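(* Let $E$ be the random Poisson cut-out set in $\mathbf S^3$ (with respect to the visual metric $d$) and $\mu$ the associated cut-out measure, as described in the context, and let $\beta=\dim_{\mathrm H}(E)$ (with respect to $d$). Then, almost surely on the event $\{\mu\neq0\}$, the following holds simultaneously for every $x\in\mathbf S^3$: \[\dim_{\mathrm H}(\pi_x(E))=\dim(\pi_x\mu)=\min\{2,\beta\},\] and, if $\beta>2$, $\pi_x\mu$ is absolutely continuous and $\pi_x(E)$ has non-empty interior.
   Context: On $\mathbb{C}^3$ let $u\cdot v=\sum_{i=0}^2u_i\bar v_i$, $\|u\|=\sqrt{u\cdot u}$, and $\langle u,v\rangle=u_0\bar v_0-u_1\bar v_1-u_2\bar v_2$. Points of the complex projective plane $\mathbb P^2_{\mathbb C}$ are identified with nonzero lifts in $\mathbb{C}^3$. Let $\|u\wedge v\|^2=\|u\|^2\|v\|^2-|u\cdot v|^2$ and $d_E(u,v)=\|u\wedge v\|/(\|u\|\|v\|)$ (a metric on $\mathbb P^2_{\mathbb C}$). Let $\mathbf S^3=\{[1:x_1:x_2]:|x_1|^2+|x_2|^2=1\}=\{u:\langle u,u\rangle=0\}$ with the visual metric $d(u,v)=\sqrt{|\langle u,v\rangle|/(\|u\|\|v\|)}$. For $w$ let $w^\perp$ be the projective line $\{u:\langle u,w\rangle=0\}$. For $x\in\mathbf S^3$ and $y\in\mathbf S^3\setminus\{x\}$, $\pi_x(y)$ is the unique intersection point of the projective lines $x^\perp$ and $y^\perp$; thus $\pi_x:\mathbf S^3\setminus\{x\}\to x^\perp\setminus\{x\}$,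 where $x^\perp$ (a complex projective line, i.e. a 2-sphere) carries the metric $d_E$ and its standard surface (Lebesgue) measure; $\pi_x(E)$ means $\pi_x(E\setminus\{x\})$. Let $\mathcal H$ be the standard surface measure on $\mathbf S^3$, rescaled so that $\mathcal H(B(x,r))/r^4\to1$ as $r\to0$ for visual balls (it depends only on $r$). Let $\gamma>0$ and let $\{(x_i,r_i)\}$ be a Poisson point process on $\mathbf S^3\times\,]0,1]$ with intensity $\gamma\,\mathcal H\otimes r^{-5}\mathrm dr$. Set $E=\mathbf S^3\setminus\bigcup_iB^\circ(x_i,r_i)$ (open visual balls), $E_n=\mathbf S^3\setminus\bigcup_{r_i\ge2^{-n}}B(x_i,r_i)$, $\mu_n=\beta_n\mathbf 1_{E_n}$ with $\beta_n=1/\mathbb P(x\in E_n)$, and $\mu$ the almost sure weak* limit of $\mu_n\mathcal H$. For a measure $\nu$, $\dim(\nu)=\inf\{\dim_{\mathrm H}A:\nu(A)>0\}$. *)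

theory Defs
  imports "HOL-Probability.Probability"
begin

type_synonym cvec = "complex \<times> complex \<times> complex"

definition hdot :: "cvec \<Rightarrow> cvec \<Rightarrow> complex" where
  "hdot u v = (case u of (u0, u1, u2) \<Rightarrow> case v of (v0, v1, v2) \<Rightarrow>
      u0 * cnj v0 + u1 * cnj v1 + u2 * cnj v2)"

definition enorm :: "cvec \<Rightarrow> real" where
  "enorm u = sqrt (Re (hdot u u))"

definition lform :: "cvec \<Rightarrow> cvec \<Rightarrow> complex" where
  "lform u v = (case u of (u0, u1, u2) \<Rightarrow> case v of (v0, v1, v2) \<Rightarrow>
      u0 * cnj v0 - u1 * cnj v1 - u2 * cnj v2)"

definition wedge_norm2 :: "cvec \<Rightarrow> cvec \<Rightarrow> real" where
  "wedge_norm2 u v = (enorm u)\<^sup>2 * (enorm v)\<^sup>2 - (cmod (hdot u v))\<^sup>2"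

definition dE :: "cvec \<Rightarrow> cvec \<Rightarrow> real" where
  "dE u v = sqrt (wedge_norm2 u v) / (enorm u * enorm v)"

definition csmult :: "complex \<Rightarrow> cvec \<Rightarrow> cvec" where
  "csmult c u = (case u of (u0, u1, u2) \<Rightarrow> (c * u0, c * u1, c * u2))"

text \<open>A point of the complex projective plane is represented by its class of
  nonzero lifts.\<close>
definition pclass :: "cvec \<Rightarrow> cvec set" where
  "pclass u = {csmult c u | c. c \<noteq> 0}"

definition P2 :: "cvec set set" where
  "P2 = {pclass u | u. u \<noteq> 0}"

definition dP :: "cvec set \<Rightarrow> cvec set \<Rightarrow> real" where
  "dP p q = dE (SOME u. u \<in> p) (SOME v. v \<in> q)"

definition perpP :: "cvec \<Rightarrow> cvec set set" where
  "perpP w = {pclass u | u. u \<noteq> 0 \<and> lform u w = 0}"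

definition lift :: "complex \<times> complex \<Rightarrow> cvec" where
  "lift x = (1, fst x, snd x)"

definition S3 :: "(complex \<times> complex) set" where
  "S3 = sphere 0 1"

definition dvis :: "complex \<times> complex \<Rightarrow> complex \<times> complex \<Rightarrow> real" where
  "dvis x y = sqrt (cmod (lform (lift x) (lift y)) / (enorm (lift x) * enorm (lift y)))"

definition vball :: "complex \<times> complex \<Rightarrow> real \<Rightarrow> (complex \<times> complex) set" where
  "vball x r = {y \<in> S3. dvis x y < r}"

definition vcball :: "complex \<times> complex \<Rightarrow> real \<Rightarrow> (complex \<times> complex) set" where
  "vcball x r = {y \<in> S3. dvis x y \<le> r}"

text \<open>The projection pi_x: the unique intersection point of x-perp and y-perp
  (for y = x we put pi_x(x) = x, which is irrelevant).\<close>
definition proj :: "complex \<times> complex \<Rightarrow> complex \<times> complex \<Rightarrow> cvec set" where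
  "proj x y = (if y = x then pclass (lift x)
               else (THE p. p \<in> perpP (lift x) \<and> p \<in> perpP (lift y)))"

definition proj_img :: "complex \<times> complex \<Rightarrow> (complex \<times> complex) set \<Rightarrow> cvec set set" where
  "proj_img x A = proj x ` (A - {x})"

text \<open>Borel sigma algebra of the projective line x-perp with the metric d_E\<close>
definition perp_space :: "complex \<times> complex \<Rightarrow> cvec set measure" where
  "perp_space x = sigma (perpP (lift x))
      {{q \<in> perpP (lift x). dP p q < r} | p r. p \<in> perpP (lift x)}"

definition proj_meas :: "complex \<times> complex \<Rightarrow> (complex \<times> complex) measure \<Rightarrow> cvec set measure" where
  "proj_meas x \<nu> = distr \<nu> (perp_space x) (proj x)"

definition hdiam :: "('a \<Rightarrow> 'a \<Rightarrow> real) \<Rightarrow> 'a set \<Rightarrow> ennreal" where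
  "hdiam \<rho> U = (SUP x\<in>U. SUP y\<in>U. ennreal (\<rho> x y))"

definition haus_content :: "('a \<Rightarrow> 'a \<Rightarrow> real) \<Rightarrow> real \<Rightarrow> real \<Rightarrow> 'a set \<Rightarrow> ennreal" where
  "haus_content \<rho> s \<delta> A =
     (INF U \<in> {U :: nat \<Rightarrow> 'a set. A \<subseteq> (\<Union>i. U i) \<and> (\<forall>i. hdiam \<rho> (U i) \<le> ennreal \<delta>)}.
        (\<Sum>i. ennreal (enn2real (hdiam \<rho> (U i)) powr s)))"

definition haus_outer :: "('a \<Rightarrow> 'a \<Rightarrow> real) \<Rightarrow> real \<Rightarrow> 'a set \<Rightarrow> ennreal" where
  "haus_outer \<rho> s A = (SUP \<delta>\<in>{0<..}. haus_content \<rho> s \<delta> A)"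

definition hdim :: "('a \<Rightarrow> 'a \<Rightarrow> real) \<Rightarrow> 'a set \<Rightarrow> ereal" where
  "hdim \<rho> A = Inf {ereal s | s. s > 0 \<and> haus_outer \<rho> s A = 0}"

definition mdim :: "('a \<Rightarrow> 'a \<Rightarrow> real) \<Rightarrow> 'a measure \<Rightarrow> ereal" where
  "mdim \<rho> \<nu> = Inf {hdim \<rho> A | A. A \<in> sets \<nu> \<and> emeasure \<nu> A > 0}"

text \<open>Standard surface measure on S^3 (unit sphere of C^2 = R^4): cone measure,
  sigma(A) = 4 * Leb{z : 0 < |z| <= 1, z/|z| in A}.\<close>
definition surf :: "(complex \<times> complex) measure" where
  "surf = scale_measure 4
     (distr (restrict_space lborel (cball 0 1 - {0})) (restrict_space borel S3) sgn)"

text \<open>Rescaled so that H(B(x,r))/r^4 tends to 1 (independent of the point x).\<close>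
definition Hnorm :: real where
  "Hnorm = Lim (at_right 0) (\<lambda>r. measure surf (vcball (1, 0) r) / r ^ 4)"

definition Hmeas :: "(complex \<times> complex) measure" where
  "Hmeas = scale_measure (ennreal (1 / Hnorm)) surf"

definition intensity :: "real \<Rightarrow> ((complex \<times> complex) \<times> real) measure" where
  "intensity \<gamma> = Hmeas \<Otimes>\<^sub>M
     density (restrict_space lborel {0<..1}) (\<lambda>r. ennreal (\<gamma> * r powr (-5)))"

definition poisson_process ::
  "'w measure \<Rightarrow> ('b measure) \<Rightarrow> ('w \<Rightarrow> 'b set) \<Rightarrow> bool" where
  "poisson_process P \<Lambda> \<Phi> \<longleftrightarrow>
     prob_space P \<and>
     (\<forall>\<omega>\<in>space P. \<Phi> \<omega> \<subseteq> space \<Lambda>) \<and>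
     (\<forall>B\<in>sets \<Lambda>. emeasure \<Lambda> B < \<infinity> \<longrightarrow>
        (AE \<omega> in P. finite (\<Phi> \<omega> \<inter> B)) \<and>
        (\<lambda>\<omega>. card (\<Phi> \<omega> \<inter> B)) \<in> measurable P (count_space UNIV) \<and>
        (\<forall>k::nat. measure P {\<omega>\<in>space P. card (\<Phi> \<omega> \<inter> B) = k} =
            measure \<Lambda> B ^ k / fact k * exp (- measure \<Lambda> B))) \<and>
     (\<forall>(n::nat) (B::nat \<Rightarrow> 'b set).
        (\<forall>i<n. B i \<in> sets \<Lambda> \<and> emeasure \<Lambda> (B i) < \<infinity>) \<and> disjoint_family_on B {..<n} \<longrightarrow>
        prob_space.indep_vars P (\<lambda>_. count_space UNIV)
           (\<lambda>i \<omega>. card (\<Phi> \<omega> \<inter> B i)) {..<n})"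

definition cutout :: "((complex \<times> complex) \<times> real) set \<Rightarrow> (complex \<times> complex) set" where
  "cutout \<Phi> = S3 - (\<Union>(x, r)\<in>\<Phi>. vball x r)"

definition cutout_n :: "((complex \<times> complex) \<times> real) set \<Rightarrow> nat \<Rightarrow> (complex \<times> complex) set" where
  "cutout_n \<Phi> n = S3 - (\<Union>(x, r)\<in>{(x, r) \<in> \<Phi>. r \<ge> 2 powr (- real n)}. vcball x r)"

definition beta_n :: "'w measure \<Rightarrow> ('w \<Rightarrow> ((complex \<times> complex) \<times> real) set)
     \<Rightarrow> nat \<Rightarrow> complex \<times> complex \<Rightarrow> real" where
  "beta_n P \<Phi> n y = 1 / measure P {\<omega> \<in> space P. y \<in> cutout_n (\<Phi> \<omega>) n}"

definition mu_n :: "'w measure \<Rightarrow> ('w \<Rightarrow> ((complex \<times> complex) \<times> real) set)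
     \<Rightarrow> 'w \<Rightarrow> nat \<Rightarrow> (complex \<times> complex) measure" where
  "mu_n P \<Phi> \<omega> n = density Hmeas
      (\<lambda>y. ennreal (beta_n P \<Phi> n y) * indicator (cutout_n (\<Phi> \<omega>) n) y)"

definition weak_star_conv :: "(nat \<Rightarrow> (complex \<times> complex) measure) \<Rightarrow> (complex \<times> complex) measure \<Rightarrow> bool" where
  "weak_star_conv \<nu>s \<nu> \<longleftrightarrow>
     (\<forall>f :: complex \<times> complex \<Rightarrow> real. continuous_on S3 f \<longrightarrow>
        (\<lambda>n. \<integral>y. f y \<partial>(\<nu>s n)) \<longlonglongrightarrow> (\<integral>y. f y \<partial>\<nu>))"

end

theory Submission imports Defs begin

text \<open>A chain through \<open>x\<close> is the fibre of the projection from \<open>x\<close>. Below exponent 2 the expected masses of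
the cut-out measures on chains form martingales whose increments decay geometrically in every moment, so on a
polynomially fine net, and then by continuity on all chains, they converge uniformly to a continuous limit. Integrating
over a pencil of chains bounds the measure of every tube of width \<open>r\<close> by a multiple of \<open>r\<^sup>2\<close>: this
is a Frostman bound for all projections at once, and a chain with nonzero limit mass meets the cut-out set by compactness.
At larger exponents a moment estimate on a net of tubes gives the bound with an arbitrarily small loss. The upper bounds
follow since the projection is locally Lipschitz and balls that meet the cut-out set are rare.\<close>

text \<open>The conclusion must hold for all x at once, so no estimate may be made for one fixed x.
  A fibre of \<open>proj x\<close> is a set \<open>hin y b = hin x b\<close> with a unit vector b;
  replacing \<open>hin x b\<close> by a free parameter gives tubes that no longer mention x, and one
  almost sure bound for this finite-dimensional family serves every x. Moments of arbitrarily high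
  order pay for the union over a fine net of the family. A chain shrinks to a point when its line
  becomes tangent to the sphere, so every constant depends on a lower bound for its radius, and the
  tangent fibre over x is treated apart. With g = \<open>gexp \<gamma>\<close>, a point survives the
  balls of radius at least r with probability r^(g + o(1)); the exponent 2 of the overview is
  compared with g. The dimension \<beta> is never computed: covering gives \<beta> \<le> max 0 (4 -
  g), the Frostman bounds give at least min 2 (4 - g) for the projections when this is positive, and
  the Lipschitz property closes the circle. The limit \<mu> enters only through the one-sided
  relation \<open>dominated\<close>, which a weak limit inherits from its approximations.\<close>

abbreviation (input) "NN == nn_integral"

type_synonym c2 = "complex \<times> complex"

section \<open>Lebesgue measure under isometries and in polar coordinates\<close>

lemma nn_integral_lborel_translate:
 fixes f :: "'a::euclidean_space => ennreal"
 assumes [measurable]: "f : borel_measurable borel"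
 shows "(NN lborel (%x. f (t + x))) = (NN lborel (%x. f x))"
 by (subst (2) lborel_affine[of 1 t]) (simp_all add: nn_integral_density nn_integral_distr)

lemma nn_integral_lborel_scale:
 fixes f :: "'a::euclidean_space => ennreal"
 assumes [measurable]: "f : borel_measurable borel" and c: "c ~= 0"
 shows "(NN lborel (%x. f x)) = ennreal (\<bar>c\<bar> ^ DIM('a)) * (NN lborel (%x. f (c *\<^sub>R x)))"
 by (subst lborel_affine[of c 0, OF c]) (simp add: nn_integral_density nn_integral_distr nn_integral_cmult)

lemma nn_integral_lborel_reflect:
 fixes f :: "'a::euclidean_space => ennreal"
 assumes [measurable]: "f : borel_measurable borel"
 shows "(NN lborel (%x. f (t - x))) = (NN lborel (%x. f x))"
 by (subst (2) lborel_affine[of "-1" t]) (simp_all add: nn_integral_density nn_integral_distr)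

text \<open>Integrating \<open>f (U x) * 1\<^sub>B (U x + y)\<close> over both variables in both orders shows that a
 translation invariant measure is determined by its value on the unit ball \<open>B\<close>.\<close>

lemma nn_integral_lborel_isometry:
 fixes U :: "'a::euclidean_space => 'a" and f :: "'a => ennreal"
 assumes U: "linear U" and iso: "!!x. norm (U x) = norm x" and f[measurable]: "f : borel_measurable borel"
 shows "(NN lborel (%x. f (U x))) = (NN lborel (%x. f x))"
proof -
 have [measurable]: "U : borel_measurable borel"
 using U by (intro borel_measurable_continuous_onI linear_continuous_on)
 (simp add: linear_conv_bounded_linear)
 have "inj U" using iso by (metis U linear_injective_0 norm_eq_zero)
 then have "surj U" using U linear_injective_imp_surjective by blast
 have inv: "EX z. U z = y" for y using \<open>surj U\<close> by (metis surjD)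
 have transl: "(NN lborel (%x. g (U x + y))) = (NN lborel (%x. g (U x)))"
 if [measurable]: "g : borel_measurable borel" for g :: "'a => ennreal" and y
 proof -
 obtain z where z: "U z = y" using inv by blast
 have "(NN lborel (%x. g (U x + y))) = (NN lborel (%x. g (U (z + x))))"
 using z by (simp add: linear_add[OF U] add.commute)
 also have "... = (NN lborel (%x. g (U x)))"
 by (rule nn_integral_lborel_translate[where f="%x. g (U x)"]) simp
 finally show ?thesis .
 qed
 define B where "B = (cball 0 1 :: 'a set)"
 have [measurable]: "B : sets borel" by (simp add: B_def)
 let ?L = "emeasure (lborel :: 'a measure) B"
 have "(NN lborel (%x. f (U x))) * ?L = (NN lborel (%x. \<integral>\<^sup>+y. f (U x) * indicator B (U x + y) \<partial>lborel))"
 proof -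
 have "(NN lborel (%y. indicator B (U x + y))) = ?L" for x
 using nn_integral_lborel_translate[of "indicator B" "U x"] by simp
 then show ?thesis by (simp add: nn_integral_cmult nn_integral_multc)
 qed
 also have "... = (NN lborel (%y. \<integral>\<^sup>+x. f (U x) * indicator B (U x + y) \<partial>lborel))"
 by (rule pair_sigma_finite.Fubini'[OF pair_sigma_finite.intro]) 
 (auto intro: sigma_finite_lborel)
 also have "... = (NN lborel (%y. \<integral>\<^sup>+x. f (U x - y) * indicator B (U x) \<partial>lborel))"
 using transl[where g="%z. f (z - y) * indicator B z" and y=y for y]
 by (simp add: add.commute)
 also have "... = (NN lborel (%x. \<integral>\<^sup>+y. f (U x - y) * indicator B (U x) \<partial>lborel))"
 by (rule pair_sigma_finite.Fubini'[OF pair_sigma_finite.intro]) 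
 (auto intro: sigma_finite_lborel)
 also have "... = (NN lborel (%x. f x)) * (NN lborel (%x. indicator B (U x)))"
 by (simp add: nn_integral_multc nn_integral_lborel_reflect nn_integral_cmult)
 also have "(NN lborel (%x. indicator B (U x))) = ?L"
 proof -
 have "indicator B (U x) = (indicator B x :: ennreal)" for x
 by (simp add: B_def iso indicator_def)
 then show ?thesis by simp
 qed
 finally have "(NN lborel (%x. f (U x))) * ?L = (NN lborel (%x. f x)) * ?L" .
 moreover have "?L ~= 0" "?L ~= \<top>"
 using emeasure_lborel_cball_finite[of "0::'a" 1] unit_ball_vol_pos[of "real DIM('a)"]
 by (auto simp: B_def emeasure_cball simp del: unit_ball_vol_pos)
 ultimately show ?thesis by (simp add: mult.commute[of _ ?L] ennreal_mult_cancel_left)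
qed

lemma nn_integral_periodic_shift:
 fixes F :: "real => ennreal"
 assumes [measurable]: "F : borel_measurable borel" and per: "!!x. F (x + 2*pi) = F x"
 and a: "0 <= a" "a < 2*pi"
 shows "(\<integral>\<^sup>+t\<in>{0..2*pi}. F (t + a) \<partial>lborel) = (\<integral>\<^sup>+t\<in>{0..2*pi}. F t \<partial>lborel)"
proof -
 have "(\<integral>\<^sup>+t\<in>{0..2*pi}. F (t + a) \<partial>lborel) = (\<integral>\<^sup>+t\<in>{a..2*pi+a}. F t \<partial>lborel)"
 proof -
 have "(\<integral>\<^sup>+t\<in>{0..2*pi}. F (t + a) \<partial>lborel) = (NN lborel (%t. F (a + t) * indicator {a..2*pi+a} (a + t)))"
 by (intro nn_integral_cong) (auto simp: indicator_def add.commute)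
 then show ?thesis using nn_integral_lborel_translate[of "%t. F t * indicator {a..2*pi+a} t" a] by simp
 qed
 also have "... = (NN lborel (%t. (F t * indicator {a..<2*pi} t + F t * indicator {2*pi..2*pi+a} t)))"
 using a by (intro nn_integral_cong) (auto simp: indicator_def)
 also have "... = (\<integral>\<^sup>+t\<in>{a..<2*pi}. F t \<partial>lborel) + (\<integral>\<^sup>+t\<in>{2*pi..2*pi+a}. F t \<partial>lborel)"
 by (rule nn_integral_add) auto
 also have "(\<integral>\<^sup>+t\<in>{2*pi..2*pi+a}. F t \<partial>lborel) = (\<integral>\<^sup>+t\<in>{0..a}. F t \<partial>lborel)"
 proof -
 have "(\<integral>\<^sup>+t\<in>{2*pi..2*pi+a}. F t \<partial>lborel)
 = (NN lborel (%t. F (2*pi+t) * indicator {2*pi..2*pi+a} (2*pi+t)))"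
 using nn_integral_lborel_translate[of "%t. F t * indicator {2*pi..2*pi+a} t" "2*pi"] by simp
 also have "... = (\<integral>\<^sup>+t\<in>{0..a}. F t \<partial>lborel)"
 by (intro nn_integral_cong) (auto simp: indicator_def per add.commute)
 finally show ?thesis .
 qed
 also have "(\<integral>\<^sup>+t\<in>{0..a}. F t \<partial>lborel) = (\<integral>\<^sup>+t\<in>{0..<a}. F t \<partial>lborel)"
 by (intro nn_integral_cong_AE eventually_mono[OF AE_lborel_singleton[of a]]) (auto simp: indicator_def)
 also have "(\<integral>\<^sup>+t\<in>{a..<2*pi}. F t \<partial>lborel) + ... = (NN lborel (%t. (F t * indicator {a..<2*pi} t + F t * indicator {0..<a} t)))"
 by (rule nn_integral_add[symmetric]) auto
 also have "... = (\<integral>\<^sup>+t\<in>{0..<2*pi}. F t \<partial>lborel)"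
 using a by (intro nn_integral_cong) (auto simp: indicator_def)
 also have "... = (\<integral>\<^sup>+t\<in>{0..2*pi}. F t \<partial>lborel)"
 by (intro nn_integral_cong_AE eventually_mono[OF AE_lborel_singleton[of "2*pi"]]) (auto simp: indicator_def)
 finally show ?thesis .
qed

text \<open>The image of planar Lebesgue measure under the squared modulus and \<pi> times Lebesgue
  measure on the half-line agree on half-lines, because a disc of radius sqrt R has area \<pi> R.
  The squared modulus rather than the modulus makes the density constant.\<close>

lemma nn_integral_radial_complex:
 fixes G :: "real => ennreal"
 assumes G[measurable]: "G : borel_measurable borel"
 shows "(NN lborel (%z. G ((cmod z)\<^sup>2))) = ennreal pi * (\<integral>\<^sup>+t\<in>{0<..}. G t \<partial>lborel)"
proof -
 define M where "M = distr (lborel :: complex measure) borel (%z. (cmod z)\<^sup>2)"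
 define N where "N = density lborel (%t::real. ennreal pi * indicator {0<..} t)"
 have em: "emeasure M {..R} = ennreal (if R < 0 then 0 else pi * R)" for R
 proof -
 have "emeasure M {..R} = emeasure (lborel::complex measure) {z. (cmod z)\<^sup>2 <= R}"
 by (simp add: M_def emeasure_distr vimage_def)
 also have "{z. (cmod z)\<^sup>2 <= R} = (if R < 0 then {} else cball 0 (sqrt R))"
 proof -
 have "(cmod z)\<^sup>2 <= R \<longleftrightarrow> cmod z <= sqrt R" if "R >= 0" for z
 using that by (metis norm_ge_zero real_sqrt_le_iff real_sqrt_unique)
 moreover have "\<not> (cmod z)\<^sup>2 <= R" if "R < 0" for z
 using that by (smt (verit) zero_le_power2)
 ultimately show ?thesis by auto
 qed
 also have "emeasure lborel ... = ennreal (if R < 0 then 0 else pi * R)"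
 by (auto simp: emeasure_cball unit_ball_vol_2)
 finally show ?thesis .
 qed
 have en: "emeasure N {..R} = ennreal (if R < 0 then 0 else pi * R)" for R
 proof -
 have "emeasure N {..R} = (NN lborel (%t. ennreal pi * indicator {0<..R} t))"
 by (auto simp: N_def emeasure_density indicator_def intro!: nn_integral_cong)
 also have "... = ennreal (if R < 0 then 0 else pi * R)"
 by (auto simp: nn_integral_cmult ennreal_mult')
 finally show ?thesis .
 qed
 have "M = N"
 proof (rule measure_eqI_generator_eq[where E="range atMost" and \<Omega>=UNIV and A="%n. {..real n}"])
 show "Int_stable (range (atMost::real => _))" by (auto simp: Int_stable_def)
 show "sets M = sigma_sets UNIV (range atMost)" "sets N = sigma_sets UNIV (range atMost)"
 by (simp_all add: M_def N_def borel_eq_atMost)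
 show "(\<Union>i::nat. {..real i}) = UNIV" using real_arch_simple by auto
 qed (auto simp: em en)
 have "(NN lborel (%z. G ((cmod z)\<^sup>2))) = (NN M (%t. G t))" by (simp add: M_def nn_integral_distr)
 also have "... = (NN lborel (%t. ennreal pi * (G t * indicator {0<..} t)))"
 by (simp add: \<open>M = N\<close> N_def nn_integral_density mult_ac)
 finally show ?thesis by (simp add: nn_integral_cmult)
qed

text \<open>By rotation invariance the integral equals its average over all rotations, and after
  exchanging the integrals the inner angular average depends on |z| only. The variable t stands for
  |z|^2, hence the factor 2.\<close>

lemma nn_integral_complex_polar:
 fixes g :: "complex => ennreal"
 assumes g[measurable]: "g : borel_measurable borel"
 shows "2 * (NN lborel (%z. g z)) = (\<integral>\<^sup>+t\<in>{0<..}. (\<integral>\<^sup>+p\<in>{0..2*pi}. g (complex_of_real (sqrt t) * cis p) \<partial>lborel) \<partial>lborel)"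
proof -
 have cism[measurable]: "cis : borel_measurable borel"
 by (intro borel_measurable_continuous_onI continuous_intros)
 define gb where "gb t = (\<integral>\<^sup>+p\<in>{0..2*pi}. g (complex_of_real (sqrt t) * cis p) \<partial>lborel)" for t :: real
 have [measurable]: "gb : borel_measurable borel" unfolding gb_def by measurable
 have "ennreal (2*pi) * (NN lborel (%z. g z)) = (\<integral>\<^sup>+p\<in>{0..2*pi}. (NN lborel (%z. g z)) \<partial>(lborel::real measure))"
 by (simp add: nn_integral_cmult mult.commute)
 also have "... = (\<integral>\<^sup>+p\<in>{0..2*pi}. (NN lborel (%z. g (cis p * z))) \<partial>(lborel::real measure))"
 by (intro nn_integral_cong arg_cong2[where f="(*)"] nn_integral_lborel_isometry[symmetric])
 (auto simp: norm_mult algebra_simps intro!: linearI)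
 also have "... = (NN (lborel::real measure) (%p. (NN lborel (%z. g (cis p * z) * indicator {0..2*pi} p))))"
 by (simp add: nn_integral_multc)
 also have "... = (NN lborel (%z. (\<integral>\<^sup>+p\<in>{0..2*pi}. g (cis p * z) \<partial>(lborel::real measure))))"
 by (rule pair_sigma_finite.Fubini'[OF pair_sigma_finite.intro]) 
 (auto intro: sigma_finite_lborel)
 also have "... = (NN lborel (%z. gb ((cmod z)\<^sup>2)))"
 proof (intro nn_integral_cong)
 fix z :: complex
 have z: "z = cmod z * cis (Arg2pi z)"
 using Arg2pi_eq[of z] by (simp add: cis_conv_exp)
 have "(\<integral>\<^sup>+p\<in>{0..2*pi}. g (cis p * z) \<partial>lborel) = (\<integral>\<^sup>+p\<in>{0..2*pi}. g (cmod z * cis (p + Arg2pi z)) \<partial>lborel)"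
 by (subst z) (simp add: cis_mult[symmetric] mult_ac)
 also have "... = (\<integral>\<^sup>+p\<in>{0..2*pi}. g (cmod z * cis p) \<partial>lborel)"
 using Arg2pi[of z]
 by (intro nn_integral_periodic_shift[where F="%p. g (cmod z * cis p)"])
 (auto simp: cis_mult[symmetric])
 finally show "(\<integral>\<^sup>+p\<in>{0..2*pi}. g (cis p * z) \<partial>lborel) = gb ((cmod z)\<^sup>2)" by (simp add: gb_def)
 qed
 also have "... = ennreal pi * (\<integral>\<^sup>+t\<in>{0<..}. gb t \<partial>lborel)" by (rule nn_integral_radial_complex) simp
 finally have "ennreal pi * (2 * (NN lborel (%z. g z))) = ennreal pi * (\<integral>\<^sup>+t\<in>{0<..}. gb t \<partial>lborel)"
 by (simp add: ennreal_mult' mult.assoc mult.left_commute)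
 then show ?thesis by (simp add: ennreal_mult_cancel_left gb_def)
qed

section \<open>The unit sphere of C^2: unitary frames and surface measure\<close>

abbreviation S3b :: "c2 measure" where "S3b \<equiv> restrict_space borel S3"

definition hin :: "c2 => c2 => complex" where
 "hin x y = fst x * cnj (fst y) + snd x * cnj (snd y)"

definition csc :: "complex => c2 => c2" where
 "csc c x = (c * fst x, c * snd x)"

definition cperp :: "c2 => c2" where
 "cperp b = (- cnj (snd b), cnj (fst b))"

text \<open>The unitary map with columns b and \<open>cperp b\<close>. It makes \<open>fst z\<close>
  the product of \<open>frame b z\<close> with b, so that statements about an arbitrary direction b
  reduce to the first coordinate.\<close>

definition frame :: "c2 => c2 => c2" where
 "frame b z = csc (fst z) b + csc (snd z) (cperp b)"

text \<open>Coordinates on the sphere in which the surface measure is the product of planar Lebesgue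
  measure in v and dt, as in the theorem of Archimedes on the sphere and the cylinder; see
  \<open>nn_integral_surf_polar\<close>.\<close>

definition polar3 :: "complex => real => c2" where
 "polar3 v t = (v, complex_of_real (sqrt (1 - (cmod v)\<^sup>2)) * cis t)"

lemma S3_closed: "closed S3" by (simp add: S3_def)
lemma S3_compact: "compact S3" by (simp add: S3_def)
lemma S3_borel[measurable]: "S3 : sets borel" by (simp add: S3_closed)
lemma in_S3: "x : S3 \<longleftrightarrow> norm x = 1" by (simp add: S3_def)
lemma space_S3b: "space S3b = S3" by (simp add: space_restrict_space)

lemma norm_prod_sq: "(norm (x :: c2))\<^sup>2 = (cmod (fst x))\<^sup>2 + (cmod (snd x))\<^sup>2"
 by (cases x) (simp add: norm_Pair)

lemma hin_self: "hin x x = complex_of_real ((norm x)\<^sup>2)"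
 by (simp add: hin_def norm_prod_sq complex_norm_square del: of_real_power)

lemma hin_cnj: "hin y x = cnj (hin x y)" by (simp add: hin_def mult.commute)
lemma hin_add_left: "hin (x + y) z = hin x z + hin y z" by (simp add: hin_def algebra_simps)
lemma hin_add_right: "hin z (x + y) = hin z x + hin z y" by (simp add: hin_def algebra_simps)
lemma hin_diff_left: "hin (x - y) z = hin x z - hin y z" by (simp add: hin_def algebra_simps)
lemma hin_diff_right: "hin z (x - y) = hin z x - hin z y" by (simp add: hin_def algebra_simps)
lemma hin_csc_left: "hin (csc c x) y = c * hin x y" by (simp add: hin_def csc_def algebra_simps)
lemma hin_csc_right: "hin x (csc c y) = cnj c * hin x y" by (simp add: hin_def csc_def algebra_simps)
lemma hin_cperp: "hin b (cperp b) = 0" "hin (cperp b) b = 0" by (simp_all add: hin_def cperp_def)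
lemma hin_cperp_cperp: "hin (cperp b) (cperp b) = hin b b" by (simp add: hin_def cperp_def)
lemma norm_cperp: "norm (cperp b) = norm b" by (simp add: norm_prod_def cperp_def add.commute)
lemma norm_csc: "norm (csc c x) = cmod c * norm x"
 by (simp add: norm_prod_def csc_def norm_mult power_mult_distrib distrib_left[symmetric] real_sqrt_mult)

lemma hin_inner: "Re (hin x y) = x \<bullet> y"
 by (cases x; cases y) (simp add: hin_def inner_complex_def)

lemma cmod_hin_le: "cmod (hin x y) <= norm x * norm y"
proof (cases "hin x y = 0")
 case False
 \<comment> \<open>A phase that turns the product into its modulus, so that the real Cauchy-Schwarz
   inequality applies.\<close>
 define c where "c = cnj (hin x y) / cmod (hin x y)"
 have c: "cmod c = 1" using False by (simp add: c_def norm_divide)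
 have "c * hin x y = complex_of_real (cmod (hin x y))"
 using False complex_norm_square[of "hin x y"] by (simp add: c_def mult.commute power2_eq_square nonzero_divide_eq_eq)
 then have "cmod (hin x y) = Re (hin (csc c x) y)" by (simp add: hin_csc_left)
 also have "... = csc c x \<bullet> y" by (rule hin_inner)
 also have "... <= norm (csc c x) * norm y" by (rule norm_cauchy_schwarz)
 finally show ?thesis by (simp add: norm_csc c)
qed simp

lemma norm_frame: assumes "norm b = 1" shows "norm (frame b z) = norm z"
proof -
 have b1: "hin b b = 1" using assms by (simp add: hin_self)
 have "hin (frame b z) (frame b z) = hin z z"
 by (simp add: frame_def hin_add_left hin_add_right hin_csc_left hin_csc_right hin_cperp
 hin_cperp_cperp b1) (simp add: hin_def)
 then have "complex_of_real ((norm (frame b z))\<^sup>2) = complex_of_real ((norm z)\<^sup>2)"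
 by (simp only: hin_self)
 then have "(norm (frame b z))\<^sup>2 = (norm z)\<^sup>2" by (simp only: of_real_eq_iff)
 then show ?thesis by simp
qed

lemma linear_frame: "linear (frame b)"
 by (rule linearI) (auto simp: frame_def csc_def prod_eq_iff algebra_simps)

lemma frame_measurable[measurable]: "frame b : borel_measurable borel"
 using linear_frame by (intro borel_measurable_continuous_onI linear_continuous_on)
 (simp add: linear_conv_bounded_linear)

lemma hin_frame: "norm b = 1 ==> hin (frame b z) b = fst z"
 by (simp add: frame_def hin_add_left hin_csc_left hin_cperp hin_self)

lemma norm_polar3: assumes "cmod v <= 1" shows "norm (polar3 v t) = 1"
proof -
 have "(cmod v)\<^sup>2 <= 1" using assms by (simp add: power_le_one)
 then have "(norm (polar3 v t))\<^sup>2 = 1" by (simp add: norm_prod_sq polar3_def norm_mult)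
 then show ?thesis by (simp add: power2_eq_1_iff) (metis norm_ge_zero not_one_le_zero neg_0_le_iff_le)
qed

lemma polar3_measurable[measurable (raw)]:
 assumes [measurable]: "f : borel_measurable M" "g : borel_measurable M"
 shows "(%x. polar3 (f x) (g x)) : borel_measurable M"
proof -
 have [measurable]: "cis : borel_measurable borel"
 by (intro borel_measurable_continuous_onI continuous_intros)
 show ?thesis unfolding polar3_def by measurable
qed

lemma sets_surf[simp, measurable_cong]: "sets surf = sets S3b" by (simp add: surf_def)
lemma space_surf[simp]: "space surf = S3" by (simp add: surf_def space_scale_measure space_S3b)

lemma sgn_to_S3: "sgn : measurable (restrict_space lborel (cball 0 1 - {0 :: c2})) S3b"
 by (rule measurable_restrict_space2) (auto simp: space_restrict_space S3_def norm_sgn intro!: measurable_restrict_space1)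

lemma punctured_cball_borel[measurable]: "cball 0 1 - {0 :: c2} : sets borel" by auto

lemma nn_integral_surf:
 assumes [measurable]: "g : borel_measurable borel"
 shows "(NN surf (%y. g y)) = 4 * (NN lborel (%z. g (sgn z) * indicator (cball 0 1 - {0}) z))"
proof -
 have [measurable]: "g : borel_measurable S3b" by (intro measurable_restrict_space1) simp
 show ?thesis unfolding surf_def
 by (subst nn_integral_scale_measure, simp)
 (simp add: nn_integral_distr[OF sgn_to_S3] nn_integral_restrict_space)
qed

lemma nn_integral_surf_frame:
 assumes [measurable]: "g : borel_measurable borel" and b: "norm b = 1"
 shows "(NN surf (%y. g (frame b y))) = (NN surf (%y. g y))"
proof -
 have sg: "sgn (frame b z) = frame b (sgn z)" for z
 using b by (simp add: sgn_div_norm norm_frame linear_scale[OF linear_frame])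
 have ind: "indicator (cball 0 1 - {0}) (frame b z) = (indicator (cball 0 1 - {0}) z :: ennreal)" for z
 proof -
 have "frame b z = 0 \<longleftrightarrow> z = 0" using norm_frame[OF b, of z] by (metis norm_eq_zero)
 then show ?thesis using norm_frame[OF b, of z] by (simp add: indicator_def)
 qed
 have "(NN lborel (%z. g (sgn z) * indicator (cball 0 1 - {0}) z))
 = (NN lborel (%z. g (sgn (frame b z)) * indicator (cball 0 1 - {0}) (frame b z)))"
 by (rule nn_integral_lborel_isometry[OF linear_frame norm_frame[OF b], symmetric]) simp
 then show ?thesis by (simp add: nn_integral_surf sg ind)
qed

text \<open>Polar coordinates in the second variable turn the cone integral into one over z1 and t;
  substituting q = |z1|^2 + t = |z|^2 and then z1 = sqrt q v separates the radial variable from the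
  direction. The factor 4 of the cone measure is used up by the 2 of the polar coordinates and by
  the radial integral of q over ]0,1], which is 1/2.\<close>

lemma nn_integral_surf_polar:
 fixes g :: "c2 => ennreal"
 assumes g[measurable]: "g : borel_measurable borel"
 shows "(NN surf (%y. g y))
 = (\<integral>\<^sup>+v\<in>ball 0 1. (\<integral>\<^sup>+p\<in>{0..2*pi}. g (polar3 v p) \<partial>lborel) \<partial>lborel)"
proof -
 have [measurable]: "cis : borel_measurable borel"
 by (intro borel_measurable_continuous_onI continuous_intros)
 define G where "G v = (\<integral>\<^sup>+p\<in>{0..2*pi}. g (polar3 v p) \<partial>lborel)" for v
 have Gm[measurable]: "G : borel_measurable borel" unfolding G_def by measurable
 define h where "h z1 z2 = g (sgn (z1, z2)) * indicator (cball 0 1 - {0}) (z1, z2)" for z1 z2 :: complex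
 have hm[measurable]: "(%x. h (fst x) (snd x)) : borel_measurable (borel \<Otimes>\<^sub>M borel)"
 unfolding h_def prod.collapse borel_prod by measurable
 have [measurable]: "h z1 : borel_measurable borel" for z1
 unfolding h_def by measurable
 have polar: "2 * (NN lborel (%z2. h z1 z2)) = (\<integral>\<^sup>+q\<in>{(cmod z1)\<^sup>2<..1}. G (complex_of_real (1 / sqrt q) * z1) \<partial>lborel)" (is "?l = ?r")
 for z1
 proof -
 have "?l = (\<integral>\<^sup>+t\<in>{0<..}. (\<integral>\<^sup>+p\<in>{0..2*pi}. h z1 (complex_of_real (sqrt t) * cis p) \<partial>lborel) \<partial>lborel)"
 by (rule nn_integral_complex_polar) simp
 also have "... = (NN lborel (%t. G (complex_of_real (1 / sqrt ((cmod z1)\<^sup>2 + t)) * z1) * indicator {(cmod z1)\<^sup>2<..1} ((cmod z1)\<^sup>2 + t)))"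
 proof (intro nn_integral_cong)
 fix t :: real
 show "(\<integral>\<^sup>+p\<in>{0..2*pi}. h z1 (complex_of_real (sqrt t) * cis p) \<partial>lborel) * indicator {0<..} t
 = G (complex_of_real (1 / sqrt ((cmod z1)\<^sup>2 + t)) * z1) * indicator {(cmod z1)\<^sup>2<..1} ((cmod z1)\<^sup>2 + t)"
 proof (cases "t > 0")
 case True
 define q where "q = (cmod z1)\<^sup>2 + t"
 have q: "q > 0" "q > (cmod z1)\<^sup>2" using True by (auto simp: q_def add_nonneg_pos)
 have n: "norm (z1, complex_of_real (sqrt t) * cis p) = sqrt q" for p
 using True by (simp add: norm_Pair norm_mult q_def)
 have p3: "polar3 (complex_of_real (1 / sqrt q) * z1) p = sgn (z1, complex_of_real (sqrt t) * cis p)" for p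
 proof -
 have "(cmod (complex_of_real (1 / sqrt q) * z1))\<^sup>2 = (cmod z1)\<^sup>2 / q"
 using q by (simp add: norm_mult power_mult_distrib norm_divide power_divide)
 then have "1 - (cmod (complex_of_real (1 / sqrt q) * z1))\<^sup>2 = t / q"
 using q by (simp add: q_def field_simps)
 then show ?thesis unfolding polar3_def sgn_div_norm n
 by (simp add: real_sqrt_divide scaleR_conv_of_real divide_inverse
 of_real_inverse mult_ac real_sqrt_mult real_sqrt_inverse)
 qed
 have "(z1, complex_of_real (sqrt t) * cis p) : cball 0 1 - {0} \<longleftrightarrow> q : {(cmod z1)\<^sup>2<..1}" for p
 using q n[of p] by (auto simp: mem_cball_0 simp del: mem_cball)
 then have "h z1 (complex_of_real (sqrt t) * cis p) = g (polar3 (complex_of_real (1 / sqrt q) * z1) p) * indicator {(cmod z1)\<^sup>2<..1} q" for p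
 unfolding h_def p3 by (simp add: indicator_def)
 then show ?thesis using True q
 by (simp add: G_def nn_integral_multc[symmetric] mult_ac flip: q_def) (auto simp: indicator_def)
 next
 case False
 then show ?thesis by (simp add: indicator_def)
 qed
 qed
 also have "... = ?r"
 by (rule nn_integral_lborel_translate[where t="(cmod z1)\<^sup>2" and f="%q. G (complex_of_real (1 / sqrt q) * z1) * indicator {(cmod z1)\<^sup>2<..1} q"])
 measurable
 finally show ?thesis .
 qed
 have "(NN surf (%y. g y)) = 4 * (NN lborel (%z. h (fst z) (snd z)))"
 by (simp add: nn_integral_surf h_def)
 also have "(NN lborel (%z. h (fst z) (snd z))) = (NN (lborel \<Otimes>\<^sub>M lborel) (%z. h (fst z) (snd z)))"
 by (simp add: lborel_prod)
 also have "... = (NN lborel (%z1. \<integral>\<^sup>+z2. h z1 z2 \<partial>lborel))"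
 by (subst sigma_finite_measure.nn_integral_fst[OF sigma_finite_lborel, symmetric]) simp_all
 also have "4 * ... = 2 * (NN lborel (%z1. 2 * (NN lborel (%z2. h z1 z2))))"
 by (subst nn_integral_cmult) (auto simp: mult.assoc[symmetric])
 also have "... = 2 * (NN lborel (%z1. (\<integral>\<^sup>+q\<in>{(cmod z1)\<^sup>2<..1}. G (complex_of_real (1 / sqrt q) * z1) \<partial>lborel)))"
 by (simp only: polar)
 also have "(NN lborel (%z1. (\<integral>\<^sup>+q\<in>{(cmod z1)\<^sup>2<..1}. G (complex_of_real (1 / sqrt q) * z1) \<partial>lborel)))
 = (NN lborel (%q. \<integral>\<^sup>+z1. G (complex_of_real (1 / sqrt q) * z1) * indicator {(cmod z1)\<^sup>2<..1} q \<partial>lborel))"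
 proof (rule pair_sigma_finite.Fubini'[OF pair_sigma_finite.intro])
 show "(%(q, z1). G (complex_of_real (1 / sqrt q) * z1) * indicator {(cmod z1)\<^sup>2<..1} q)
 : borel_measurable (lborel \<Otimes>\<^sub>M lborel)"
 unfolding indicator_def of_bool_def greaterThanAtMost_iff by measurable
 qed (auto intro: sigma_finite_lborel)
 also have "... = (\<integral>\<^sup>+q\<in>{0<..1}. ennreal q * (\<integral>\<^sup>+v\<in>ball 0 1. G v \<partial>lborel) \<partial>lborel)"
 proof (intro nn_integral_cong)
 fix q :: real
 let ?f = "%z1. G (complex_of_real (1 / sqrt q) * z1) * indicator {(cmod z1)\<^sup>2<..1} q"
 show "(NN lborel (%z1. ?f z1)) = ennreal q * (\<integral>\<^sup>+v\<in>ball 0 1. G v \<partial>lborel) * indicator {0<..1} q"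
 proof (cases "0 < q & q <= 1")
 case True
 \<comment> \<open>The scaling contributes the Jacobian q, and |z1|^2 < q becomes |v| < 1.\<close>
 have "(NN lborel (%z1. ?f z1)) = ennreal (\<bar>sqrt q\<bar> ^ DIM(complex)) * (NN lborel (%v. ?f (sqrt q *\<^sub>R v)))"
 proof (rule nn_integral_lborel_scale)
 show "?f : borel_measurable borel"
 unfolding indicator_def of_bool_def greaterThanAtMost_iff by measurable
 qed (use True in auto)
 also have "(NN lborel (%v. ?f (sqrt q *\<^sub>R v))) = (\<integral>\<^sup>+v\<in>ball 0 1. G v \<partial>lborel)"
 proof (intro nn_integral_cong)
 fix v :: complex
 have "(cmod v)\<^sup>2 * q < q \<longleftrightarrow> cmod v < 1"
 using True by (simp add: abs_square_less_1)
 then show "?f (sqrt q *\<^sub>R v) = G v * indicator (ball 0 1) v"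
 using True by (auto simp: scaleR_conv_of_real indicator_def norm_mult power_mult_distrib mult.commute
 field_simps of_real_divide)
 qed
 finally show ?thesis using True by simp
 next
 case False
 have "?f z1 = 0" for z1
 using False le_less_trans[OF zero_le_power2[of "cmod z1"]] by (auto simp: indicator_def)
 then have "(NN lborel (%z1. ?f z1)) = (NN (lborel :: complex measure) (%z1. 0))" by (intro nn_integral_cong)
 then show ?thesis using False by (auto simp: indicator_def)
 qed
 qed
 also have "... = (\<integral>\<^sup>+q\<in>{0<..1}. ennreal q \<partial>lborel) * (\<integral>\<^sup>+v\<in>ball 0 1. G v \<partial>lborel)"
 by (subst nn_integral_multc[symmetric]) (auto simp: mult_ac)
 also have "(\<integral>\<^sup>+q\<in>{0<..1}. ennreal q \<partial>lborel) = (NN lborel (%q. ennreal q * indicator {0..1} q))"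
 by (intro nn_integral_cong) (auto simp: indicator_def)
 also have "... = ennreal (1^2 / 2 - 0^2 / 2)"
 by (rule nn_integral_FTC_Icc[where F="%x. x^2/2"]) (auto intro!: derivative_eq_intros)
 finally have "(NN surf (%y. g y)) = 2 * ennreal (1/2) * (\<integral>\<^sup>+v\<in>ball 0 1. G v \<partial>lborel)" by (simp add: mult.assoc)
 also have "2 * ennreal (1/2) = 1"
 by (metis ennreal_1 ennreal_mult' ennreal_numeral mult.commute nonzero_divide_eq_eq zero_le_numeral zero_neq_numeral)
 finally show ?thesis by (simp add: G_def)
qed

lemma nn_integral_surf_frame_polar:
 fixes g :: "c2 => ennreal"
 assumes g[measurable]: "g : borel_measurable borel" and b: "norm b = 1"
 shows "(NN surf (%y. g y))
 = (\<integral>\<^sup>+v\<in>ball 0 1. (\<integral>\<^sup>+t\<in>{0..2*pi}. g (frame b (polar3 v t)) \<partial>lborel) \<partial>lborel)"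
 using nn_integral_surf_polar[of "%y. g (frame b y)"] nn_integral_surf_frame[OF g b] by simp

section \<open>The visual metric\<close>

lemma enorm_lift: "enorm (lift x) = sqrt (1 + (norm x)\<^sup>2)"
 by (cases x) (simp add: enorm_def hdot_def lift_def norm_prod_sq complex_mult_cnj cmod_power2)

lemma lform_lift: "lform (lift x) (lift y) = 1 - hin x y"
 by (cases x; cases y) (simp add: lform_def lift_def hin_def)

lemma dvis_eq: "x : S3 ==> y : S3 ==> dvis x y = sqrt (cmod (1 - hin x y) / 2)"
 by (simp add: dvis_def enorm_lift lform_lift in_S3)

lemma dvis_sq: "x : S3 ==> y : S3 ==> 2 * (dvis x y)\<^sup>2 = cmod (1 - hin x y)"
 by (simp add: dvis_eq)

lemma dvis_nonneg: "0 <= dvis x y" by (simp add: dvis_def enorm_lift)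

lemma dvis_sym: "dvis x y = dvis y x"
proof -
 have "cmod (1 - hin x y) = cmod (1 - hin y x)"
 by (metis complex_cnj_diff complex_cnj_one complex_mod_cnj hin_cnj)
 then show ?thesis by (simp add: dvis_def lform_lift mult.commute)
qed

lemma dvis_less_iff:
 assumes "x : S3" "y : S3" "0 <= r" shows "dvis x y < r \<longleftrightarrow> cmod (1 - hin x y) < 2 * r\<^sup>2"
proof -
 have "dvis x y < r \<longleftrightarrow> (dvis x y)\<^sup>2 < r\<^sup>2"
 using assms by (simp add: dvis_nonneg linorder_not_le[symmetric])
 then show ?thesis using dvis_sq[OF assms(1,2)] by linarith
qed

lemma dvis_le_iff:
 assumes "x : S3" "y : S3" "0 <= r" shows "dvis x y <= r \<longleftrightarrow> cmod (1 - hin x y) <= 2 * r\<^sup>2"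
proof -
 have "dvis x y <= r \<longleftrightarrow> (dvis x y)\<^sup>2 <= r\<^sup>2" using assms by (simp add: dvis_nonneg)
 then show ?thesis using dvis_sq[OF assms(1,2)] by linarith
qed

lemma dvis_refl: "x : S3 ==> dvis x x = 0"
 by (simp add: dvis_eq hin_self in_S3)

lemma dvis_le_1: "x : S3 ==> y : S3 ==> dvis x y <= 1"
 using cmod_hin_le[of x y] norm_triangle_ineq4[of 1 "hin x y"] by (simp add: dvis_le_iff in_S3)

lemma norm_diff_sq: "x : S3 ==> y : S3 ==> (norm (x - y))\<^sup>2 = 2 * Re (1 - hin x y)"
 using dot_norm_neg[of x y] by (simp add: hin_inner in_S3)

lemma norm_diff_sq_le: "x : S3 ==> y : S3 ==> (norm (x - y))\<^sup>2 <= 2 * cmod (1 - hin x y)"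
 using complex_Re_le_cmod[of "1 - hin x y"] norm_diff_sq[of x y] by linarith

lemma norm_diff_le_dvis:
 assumes "x : S3" "y : S3" shows "norm (x - y) <= 2 * dvis x y"
proof -
 have "(2 * dvis x y)\<^sup>2 = 4 * (dvis x y)\<^sup>2" by (simp add: power_mult_distrib)
 then have "(norm (x - y))\<^sup>2 <= (2 * dvis x y)\<^sup>2"
 using norm_diff_sq_le[OF assms] dvis_sq[OF assms] by linarith
 then show ?thesis by (rule power2_le_imp_le) (simp add: dvis_nonneg)
qed

text \<open>Splitting off the components along y, x = a y + u and z = cnj b y + v, gives 1 - <x,z> =
  (1 - a) + a (1 - b) - <u,v>. Since |u|^2 = 1 - |a|^2 is at most 2 |1 - a|, and similarly for v,
  the last term is at most 4 A B, and the three terms add up to at most 2 (A + B)^2.\<close>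

lemma dvis_triangle:
 assumes x: "x : S3" and y: "y : S3" and z: "z : S3"
 shows "dvis x z <= dvis x y + dvis y z"
proof -
 define a b where "a = hin x y" and "b = hin y z"
 define A B where "A = dvis x y" and "B = dvis y z"
 have A: "cmod (1 - a) = 2 * A\<^sup>2" and B: "cmod (1 - b) = 2 * B\<^sup>2"
 using dvis_sq x y z by (auto simp: A_def B_def a_def b_def)
 have AB: "A >= 0" "B >= 0" by (auto simp: A_def B_def dvis_nonneg)
 have yy: "hin y y = 1" "hin x x = 1" "hin z z = 1" using x y z by (auto simp: hin_self in_S3)
 have b': "hin z y = cnj b" using hin_cnj[of z y] by (simp add: b_def)
 have a': "hin y x = cnj a" using hin_cnj[of y x] by (simp add: a_def)
 define u v where "u = x - csc a y" and "v = z - csc (cnj b) y"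
 have uv: "hin u v = hin x z - a * b"
 by (simp add: u_def v_def hin_diff_left hin_diff_right hin_csc_left hin_csc_right yy a_def b_def)
 have "complex_of_real ((norm u)\<^sup>2) = 1 - a * cnj a"
 unfolding hin_self[symmetric] by (simp add: u_def hin_diff_left hin_diff_right hin_csc_left hin_csc_right yy a' a_def[symmetric])
 then have nu: "(norm u)\<^sup>2 = 1 - (cmod a)\<^sup>2"
 by (metis complex_norm_square of_real_1 of_real_diff of_real_eq_iff)
 have "complex_of_real ((norm v)\<^sup>2) = 1 - b * cnj b"
 unfolding hin_self[symmetric] by (simp add: v_def hin_diff_left hin_diff_right hin_csc_left hin_csc_right yy b' b_def[symmetric])
 then have nv: "(norm v)\<^sup>2 = 1 - (cmod b)\<^sup>2"
 by (metis complex_norm_square of_real_1 of_real_diff of_real_eq_iff)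
 have bd: "1 - (cmod a)\<^sup>2 <= 2 * cmod (1 - a)" if "cmod a <= 1" for a
 proof -
 have "1 - cmod a <= cmod (1 - a)" using norm_triangle_ineq2[of 1 a] by simp
 moreover have "1 - (cmod a)\<^sup>2 = (1 - cmod a) * (1 + cmod a)" by (simp add: power2_eq_square algebra_simps)
 moreover have "(1 - cmod a) * (1 + cmod a) <= (1 - cmod a) * 2" using that by (intro mult_left_mono) auto
 ultimately show "1 - (cmod a)\<^sup>2 <= 2 * cmod (1 - a)" by argo
 qed
 have a1: "cmod a <= 1" "cmod b <= 1" using cmod_hin_le[of x y] cmod_hin_le[of y z] x y z by (auto simp: a_def b_def in_S3)
 have "norm u <= 2 * A" using bd[OF a1(1)] nu A AB by - (rule power2_le_imp_le, auto simp: power_mult_distrib)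
 moreover have "norm v <= 2 * B" using bd[OF a1(2)] nv B AB by - (rule power2_le_imp_le, auto simp: power_mult_distrib)
 ultimately have "norm u * norm v <= (2 * A) * (2 * B)" using AB by (intro mult_mono) auto
 then have huv: "cmod (hin u v) <= 4 * A * B" using cmod_hin_le[of u v] by linarith
 have "1 - hin x z = (1 - a) + a * (1 - b) - hin u v" by (simp add: uv algebra_simps)
 then have "cmod (1 - hin x z) <= cmod (1 - a) + cmod (a * (1 - b)) + cmod (hin u v)"
 by (metis add_le_cancel_right norm_triangle_ineq norm_triangle_ineq4 order_trans)
 also have "cmod (a * (1 - b)) <= 1 * cmod (1 - b)" unfolding norm_mult using a1 by (intro mult_right_mono) auto
 finally have "cmod (1 - hin x z) <= 2 * (A + B)\<^sup>2" using huv A B by (simp add: power2_sum algebra_simps)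
 then show ?thesis using x z AB by (simp add: dvis_le_iff flip: A_def B_def)
qed

lemma continuous_hin: "continuous_on A f ==> continuous_on A g ==> continuous_on A (%x. hin (f x) (g x))"
 unfolding hin_def by (intro continuous_intros)

lemma continuous_dvis: "continuous_on A f ==> continuous_on A g ==> continuous_on A (%x. dvis (f x) (g x))"
proof -
 assume "continuous_on A f" "continuous_on A g"
 moreover have "sqrt (1 + (norm (x :: c2))\<^sup>2) ~= 0" for x
 using add_pos_nonneg[OF zero_less_one zero_le_power2, of "norm x"] by simp
 ultimately show ?thesis unfolding dvis_def enorm_lift lform_lift
 by (intro continuous_intros continuous_hin) auto
qed

lemma dvis_measurable[measurable (raw)]:
 assumes [measurable]: "f : borel_measurable M" "g : borel_measurable M"
 shows "(%x. dvis (f x) (g x)) : borel_measurable M"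
proof -
 have "(%p. dvis (fst p) (snd p)) : borel_measurable borel"
 by (intro borel_measurable_continuous_onI continuous_dvis continuous_intros)
 then have "(%x. (%p. dvis (fst p) (snd p)) (f x, g x)) : borel_measurable M"
 by (rule measurable_compose[rotated]) measurable
 then show ?thesis by simp
qed

lemma vball_borel[measurable]: "vball y r : sets borel"
proof -
 have "vball y r = S3 Int {z. dvis y z < r}" by (auto simp: vball_def)
 moreover have "{z. dvis y z < r} : sets borel" by measurable
 ultimately show ?thesis by auto
qed

lemma borel_sub_S3b: "A : sets borel ==> A <= S3 ==> A : sets S3b"
 by (auto simp: sets_restrict_space image_iff intro!: bexI[of _ A])

lemma vball_S3b[measurable]: "vball y r : sets S3b"
 by (intro borel_sub_S3b) (auto simp: vball_def)

section \<open>Surface measure of visual balls\<close>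

lemma finite_measure_surf: "finite_measure surf"
proof (rule finite_measureI)
 have "emeasure surf (space surf) = (NN surf (%y. 1))" by simp
 also have "... = (\<integral>\<^sup>+v\<in>ball 0 1. (\<integral>\<^sup>+t\<in>{0..2*pi}. 1 \<partial>(lborel :: real measure)) \<partial>(lborel :: complex measure))"
 by (rule nn_integral_surf_polar) simp
 also have "... = ennreal (2*pi) * emeasure (lborel :: complex measure) (ball 0 1)"
 by (simp add: nn_integral_cmult_indicator)
 also have "... < \<infinity>" using emeasure_lborel_ball_finite[of "0::complex" 1]
 by (simp add: ennreal_mult_less_top)
 finally show "emeasure surf (space surf) ~= \<infinity>" by simp
qed

text \<open>The rescaled intersection of the unit disc with a small disc about the boundary point 1; it
 increases to a half disc.\<close>
definition lens :: "real => complex set" where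
 "lens s = {z. cmod z < 1 & s * (cmod z)\<^sup>2 < 2 * Re z}"

definition hs :: "real => real" where "hs r = measure surf (vball (1, 0) r)"

lemma lens_borel[measurable]: "lens s : sets borel" unfolding lens_def by measurable

lemma lens_finite: "emeasure lborel (lens s) < \<infinity>"
 by (rule le_less_trans[OF emeasure_mono emeasure_lborel_ball_finite[of "0::complex" 1]]) (auto simp: lens_def)

lemma lens_antimono: "s <= s' ==> lens s' <= lens s"
proof
 fix z assume "s <= s'" "z : lens s'"
 moreover from this have "s * (cmod z)\<^sup>2 <= s' * (cmod z)\<^sup>2" by (intro mult_right_mono) auto
 ultimately show "z : lens s" by (simp add: lens_def)
qed

lemma lens_pos: assumes "s <= 2" shows "measure lborel (lens s) > 0"
proof -
 \<comment> \<open>This ball is the set |z|^2 < Re z, which contains no point with |z| \<ge>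
   1.\<close>
 have "ball (1/2) (1/2) <= lens 2"
 proof
 fix z :: complex assume "z : ball (1/2) (1/2)"
 then have "cmod (z - 1/2) < 1/2" by (simp add: dist_norm norm_minus_commute)
 then have "(cmod (z - 1/2))\<^sup>2 < (1/2)\<^sup>2" by (intro power_strict_mono) auto
 then have *: "(cmod z)\<^sup>2 < Re z" by (simp only: cmod_power2) (simp add: power2_eq_square algebra_simps)
 then have "(cmod z)\<^sup>2 < cmod z * 1" using complex_Re_le_cmod[of z] by simp
 then have "cmod z < 1" unfolding power2_eq_square using mult_less_cancel_left[of "cmod z" "cmod z" 1] by simp
 then show "z : lens 2" using * by (simp add: lens_def)
 qed
 then have "ball (1/2) (1/2) <= lens s" using lens_antimono[OF assms] by blast
 then have "measure lborel (ball (1/2::complex) (1/2)) <= measure lborel (lens s)"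
 using lens_finite[of s] by (intro measure_mono_fmeasurable) (auto simp: fmeasurable_def)
 moreover have "measure lborel (ball (1/2::complex) (1/2)) > 0"
 using content_ball_pos[of "1/2" "1/2::complex"] by simp
 ultimately show ?thesis by linarith
qed

lemma ball_Int_ball_borel[measurable]: "ball a r Int ball b s : sets borel" by auto

lemma lens_scale:
 assumes "s > 0"
 shows "emeasure lborel (ball 0 1 Int ball (1::complex) s) = ennreal (s\<^sup>2 * measure lborel (lens s))"
proof -
 have "emeasure lborel (ball 0 1 Int ball (1::complex) s) = (NN lborel (%v. indicator (ball 0 1 Int ball (1::complex) s) (1 - v)))"
 by (subst nn_integral_lborel_reflect) (auto intro!: borel_measurable_indicator)
 also have "... = ennreal (\<bar>s\<bar> ^ DIM(complex)) * (NN lborel (%v. indicator (ball 0 1 Int ball (1::complex) s) (1 - s *\<^sub>R v)))"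
 using assms by (intro nn_integral_lborel_scale) auto
 also have "(NN lborel (%v. indicator (ball 0 1 Int ball (1::complex) s) (1 - s *\<^sub>R v))) = (NN lborel (%v. indicator (lens s) v))"
 proof (intro nn_integral_cong)
 fix v :: complex
 have "cmod (1 - s *\<^sub>R v) < 1 \<longleftrightarrow> (cmod (1 - s *\<^sub>R v))\<^sup>2 < 1" by (simp add: abs_square_less_1)
 also have "(cmod (1 - s *\<^sub>R v))\<^sup>2 = 1 + s * (s * (cmod v)\<^sup>2 - 2 * Re v)"
 unfolding cmod_power2 by (simp add: power2_eq_square algebra_simps)
 also have "... < 1 \<longleftrightarrow> s * (cmod v)\<^sup>2 < 2 * Re v" using assms by (simp add: mult_less_0_iff)
 finally show "indicator (ball 0 1 Int ball (1::complex) s) (1 - s *\<^sub>R v) = (indicator (lens s) v :: ennreal)"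
 using assms norm_minus_commute[of 1 "s *\<^sub>R v"] by (auto simp add: indicator_def lens_def dist_norm)
 qed
 finally show ?thesis using assms lens_finite[of s]
 by (simp add: emeasure_eq_ennreal_measure ennreal_mult' top.not_eq_extremum)
qed

text \<open>In the coordinates \<open>frame y (polar3 v t)\<close> the visual ball is the condition
  |1 - v| < 2 r^2, without t. Its measure is therefore 2 \<pi> times the area of a disc about 1 cut
  by the unit disc, and the same for every centre.\<close>

lemma emeasure_surf_vball:
 assumes y: "y : S3" and r: "r > 0"
 shows "emeasure surf (vball y r) = ennreal (8 * pi * r ^ 4 * measure lborel (lens (2 * r\<^sup>2)))"
proof -
 have ny: "norm y = 1" using y by (simp add: in_S3)
 have "emeasure surf (vball y r) = (NN surf (%z. indicator (vball y r) z))" by simp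
 also have "... = (\<integral>\<^sup>+v\<in>ball 0 1. (\<integral>\<^sup>+t\<in>{0..2*pi}. indicator (vball y r) (frame y (polar3 v t)) \<partial>lborel) \<partial>lborel)"
 by (rule nn_integral_surf_frame_polar[OF _ ny]) simp
 also have "... = (NN (lborel :: complex measure) (%v. ennreal (2*pi) * indicator (ball 0 1 Int ball 1 (2 * r\<^sup>2)) v))"
 proof (intro nn_integral_cong)
 fix v :: complex
 show "(\<integral>\<^sup>+t\<in>{0..2*pi}. indicator (vball y r) (frame y (polar3 v t)) \<partial>lborel) * indicator (ball 0 1) v
 = ennreal (2*pi) * indicator (ball 0 1 Int ball 1 (2 * r\<^sup>2)) v"
 proof (cases "cmod v < 1")
 case True
 have "frame y (polar3 v t) : S3" for t
 using norm_frame[OF ny] norm_polar3[of v] True by (simp add: in_S3)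
 then have "indicator (vball y r) (frame y (polar3 v t)) = (indicator (ball 1 (2 * r\<^sup>2)) v :: ennreal)" for t
 using r y hin_frame[OF ny, of "polar3 v t"]
 by (simp add: vball_def indicator_def dvis_sym[of y] dvis_less_iff polar3_def dist_norm)
 then show ?thesis using True 
 by (auto simp: indicator_inter_arith mult.commute nn_integral_multc) 
 qed (simp add: indicator_def)
 qed
 also have "... = ennreal (2*pi) * ennreal ((2 * r\<^sup>2)\<^sup>2 * measure lborel (lens (2 * r\<^sup>2)))"
 using r by (subst nn_integral_cmult) (auto simp: lens_scale)
 also have "... = ennreal (2*pi * ((2 * r\<^sup>2)\<^sup>2 * measure lborel (lens (2 * r\<^sup>2))))"
 by (rule ennreal_mult'[symmetric]) simp
 also have "2*pi * ((2 * r\<^sup>2)\<^sup>2 * measure lborel (lens (2 * r\<^sup>2))) = 8 * pi * r ^ 4 * measure lborel (lens (2 * r\<^sup>2))"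
 by (simp add: power_mult_distrib flip: power_mult)
 finally show ?thesis .
qed

lemma one_zero_S3: "(1, 0) : S3" by (simp add: in_S3 norm_Pair)

lemma hs_eq: "r > 0 ==> hs r = 8 * pi * r ^ 4 * measure lborel (lens (2 * r\<^sup>2))"
 using emeasure_surf_vball[OF one_zero_S3, of r] by (simp add: hs_def measure_def)

lemma emeasure_vball_hs: "y : S3 ==> r > 0 ==> emeasure surf (vball y r) = ennreal (hs r)"
 by (simp add: hs_eq emeasure_surf_vball)

lemma hs_nonneg: "hs r >= 0" by (simp add: hs_def)

lemma hs_measurable[measurable]: "hs : borel_measurable borel"
proof (rule borel_measurable_mono)
 interpret finite_measure surf by (rule finite_measure_surf)
 have "vball (1, 0) x <= vball (1, 0) y" if "x <= y" for x y using that by (auto simp: vball_def)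
 then show "mono hs" unfolding hs_def by (intro monoI finite_measure_mono) auto
qed

text \<open>The limit of \<open>hs r / r ^ 4\<close> at 0: \<open>hs_le\<close> gives the bound from
  above and \<open>hs_asymp\<close> the one from below.\<close>

definition hsA :: real where "hsA = 8 * pi * measure lborel {z :: complex. cmod z < 1 & 0 < Re z}"

lemma half_disc_finite: "emeasure lborel {z :: complex. cmod z < 1 & 0 < Re z} < \<infinity>"
 by (rule le_less_trans[OF emeasure_mono emeasure_lborel_ball_finite[of "0::complex" 1]]) auto

lemma lens_half_disc: "s >= 0 ==> lens s <= {Z :: complex. cmod Z < 1 & 0 < Re Z}"
proof
 fix z assume s: "s >= 0" and z: "z : lens s"
 have "0 <= s * (cmod z)\<^sup>2" using s by simp
 then show "z : {Z :: complex. cmod Z < 1 & 0 < Re Z}" using z by (simp add: lens_def)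
qed

lemma hs_le: assumes "r > 0" shows "hs r <= hsA * r ^ 4"
proof -
 have "measure lborel (lens (2 * r\<^sup>2)) <= measure lborel {z :: complex. cmod z < 1 & 0 < Re z}"
 using half_disc_finite lens_half_disc[of "2 * r\<^sup>2"] by (intro measure_mono_fmeasurable) (auto simp: fmeasurable_def)
 then show ?thesis by (simp add: hs_eq[OF assms] hsA_def mult_ac mult_left_mono)
qed

lemma hsA_pos: "hsA > 0"
proof -
 have "0 < measure lborel (lens 0)" by (rule lens_pos) simp
 then show ?thesis by (simp add: hsA_def lens_def)
qed

lemma hs_ge: assumes "0 < r" "r <= 1" shows "hs r >= 8 * pi * measure lborel (lens 2) * r ^ 4"
proof -
 have "r\<^sup>2 <= 1" using assms by (simp add: power_le_one)
 then have "measure lborel (lens 2) <= measure lborel (lens (2 * r\<^sup>2))"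
 using lens_finite[of "2 * r\<^sup>2"] lens_antimono[of "2 * r\<^sup>2" 2]
 by (intro measure_mono_fmeasurable) (auto simp: fmeasurable_def)
 then show ?thesis using assms by (simp add: hs_eq mult_ac mult_left_mono)
qed

lemma hs_asymp:
 assumes "e > 0"
 shows "EX r0>0. ALL r. 0 < r --> r <= r0 --> hs r >= (1 - e) * hsA * r ^ 4"
proof -
 let ?H = "{Z :: complex. cmod Z < 1 & 0 < Re Z}"
 let ?A = "%n::nat. lens (1 / real (Suc n))"
 have U: "(\<Union>n. ?A n) = ?H"
 proof (intro equalityI subsetI)
 fix z :: complex assume z: "z : ?H"
 then obtain n where "inverse (real (Suc n)) < Re z" using reals_Archimedean by auto
 moreover have "1 / real (Suc n) * (cmod z)\<^sup>2 <= 1 / real (Suc n) * 1"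
 using z by (intro mult_left_mono) (auto simp: power_le_one)
 ultimately show "z : (\<Union>n. ?A n)" using z by (auto simp: lens_def inverse_eq_divide intro!: exI[of _ n])
 next
 fix z assume "z : (\<Union>n. ?A n)"
 then obtain n where "z : ?A n" by blast
 then show "z : ?H" using lens_half_disc[of "1 / real (Suc n)"] by auto
 qed
 have "(%n. measure lborel (?A n)) \<longlonglongrightarrow> measure lborel (\<Union>n. ?A n)"
 
 proof (rule Lim_measure_incseq)
 show "emeasure lborel (\<Union>n. ?A n) ~= \<infinity>" unfolding U using half_disc_finite by simp
 show "incseq ?A" unfolding incseq_def by (auto intro!: lens_antimono divide_left_mono)
 qed auto
 then have "(%n. measure lborel (?A n)) \<longlonglongrightarrow> measure lborel ?H" unfolding U .
 moreover have "(1 - e) * measure lborel ?H < measure lborel ?H"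
 using assms hsA_pos by (simp add: hsA_def algebra_simps zero_less_mult_iff)
 ultimately have "\<forall>\<^sub>F n in sequentially. (1 - e) * measure lborel ?H < measure lborel (?A n)"
 by (rule order_tendstoD)
 then obtain n where n: "(1 - e) * measure lborel ?H < measure lborel (?A n)"
 by (auto simp: eventually_sequentially)
 define r0 where "r0 = sqrt (1 / (2 * real (Suc n)))"
 have "hs r >= (1 - e) * hsA * r ^ 4" if "0 < r" "r <= r0" for r
 proof -
 have "r\<^sup>2 <= r0\<^sup>2" using that by (intro power_mono) auto
 then have "2 * r\<^sup>2 <= 1 / real (Suc n)" by (simp add: r0_def field_simps)
 then have "measure lborel (?A n) <= measure lborel (lens (2 * r\<^sup>2))"
 using lens_finite[of "2 * r\<^sup>2"] lens_antimono[of "2 * r\<^sup>2" "1 / real (Suc n)"]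
 by (intro measure_mono_fmeasurable) (auto simp: fmeasurable_def)
 then have "(1 - e) * measure lborel ?H <= measure lborel (lens (2 * r\<^sup>2))" using n by linarith
 then have "(8 * pi * r ^ 4) * ((1 - e) * measure lborel ?H) <= (8 * pi * r ^ 4) * measure lborel (lens (2 * r\<^sup>2))"
 using that by (intro mult_left_mono) auto
 then show ?thesis using that by (simp add: hs_eq hsA_def mult_ac)
 qed
 moreover have "r0 > 0" by (simp add: r0_def)
 ultimately show ?thesis by blast
qed

section \<open>Sublevel sets of trigonometric functions\<close>

lemma sin_ge_linear: assumes "0 <= x" "x <= pi/2" shows "2 * x / pi <= sin x"
proof -
 have "concave_on {0..pi} sin"
 by (rule f''_le0_imp_concave[where f'=cos and f''="%x. - sin x"])
 (auto intro!: derivative_eq_intros sin_ge_zero)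
 then have "convex_on {0..pi} (%x. - sin x)" by (simp add: concave_on_def)
 from convex_onD[OF this, of "2*x/pi" 0 "pi/2"] assms
 show ?thesis by (simp add: field_simps)
qed

lemma emeasure_lborel_diam_le:
 assumes "!!x y. x : S ==> y : S ==> \<bar>x - y\<bar> <= D" "D >= 0"
 shows "emeasure lborel (S :: real set) <= ennreal D"
proof (cases "S = {}")
 case False
 then obtain s where s: "s : S" by blast
 have bdd: "bdd_below S" using assms(1)[OF _ s] by (intro bdd_belowI[of _ "s - D"]) (force simp: abs_le_iff)
 have "x <= Inf S + D" if "x : S" for x
 proof -
 have "x - D <= y" if "y : S" for y using assms(1)[OF \<open>x : S\<close> that] by linarith
 then have "x - D <= Inf S" using False by (intro cInf_greatest)
 then show ?thesis by simp
 qed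
 then have "S <= {Inf S..Inf S + D}" using cInf_lower[OF _ bdd] by auto
 then have "emeasure lborel S <= emeasure lborel {Inf S..Inf S + D}" by (intro emeasure_mono) auto
 then show ?thesis using assms(2) by simp
qed simp

lemma emeasure_Un_diam_le:
 assumes "!!k x y. k < n ==> x : S k ==> y : S k ==> \<bar>x - y\<bar> <= D" "D >= 0" "!!k. k < n ==> S k : sets borel"
 "T <= (\<Union>k<n::nat. S k)" 
 shows "emeasure lborel (T :: real set) <= ennreal (real n * D)"
proof -
 have "emeasure lborel T <= emeasure lborel (\<Union>k<n. S k)" using assms(3,4) by (intro emeasure_mono) auto
 also have "... <= (\<Sum>k<n. emeasure lborel (S k))"
 using assms(3) by (intro emeasure_subadditive_finite) auto
 also have "... <= (\<Sum>k<n. ennreal D)" using assms by (intro sum_mono emeasure_lborel_diam_le) auto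
 also have "... = ennreal (real n * D)" using assms(2) by (simp add: ennreal_mult' ennreal_of_nat_eq_real_of_nat)
 finally show ?thesis .
qed

lemma cmod_cis_diff: "cmod (cis a - cis b) = 2 * \<bar>sin ((a - b) / 2)\<bar>"
proof -
 have "(cmod (cis a - cis b))\<^sup>2 = (cos a - cos b)\<^sup>2 + (sin a - sin b)\<^sup>2" by (simp add: cmod_power2)
 also have "... = 2 - 2 * cos (a - b)"
 using sin_cos_squared_add[of a] sin_cos_squared_add[of b]
 unfolding cos_diff power2_diff by algebra
 also have "cos (a - b) = 1 - 2 * (sin ((a - b) / 2))\<^sup>2"
 using cos_double_sin[of "(a - b) / 2"] by (metis field_sum_of_halves mult_2 times_divide_eq_right)
 finally have "(cmod (cis a - cis b))\<^sup>2 = (2 * \<bar>sin ((a - b) / 2)\<bar>)\<^sup>2" by (simp add: power_mult_distrib)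
 then show ?thesis by (metis abs_ge_zero norm_ge_zero power2_eq_imp_eq zero_le_mult_iff zero_le_numeral)
qed

lemma cmod_cis_diff_ge: assumes "\<bar>a - b\<bar> <= pi" shows "2 / pi * \<bar>a - b\<bar> <= cmod (cis a - cis b)"
proof -
 have "2 * (\<bar>a - b\<bar> / 2) / pi <= sin (\<bar>a - b\<bar> / 2)" using assms by (intro sin_ge_linear) auto
 also have "sin (\<bar>a - b\<bar> / 2) <= \<bar>sin ((a - b) / 2)\<bar>"
 proof (cases "a >= b")
 case False
 then have "\<bar>a - b\<bar> / 2 = - ((a - b) / 2)" by (simp add: field_simps)
 then show ?thesis by (simp only: sin_minus)
 qed simp
 finally show ?thesis by (simp add: cmod_cis_diff)
qed

lemma cis_measurable[measurable]: "cis : borel_measurable borel"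
 by (intro borel_measurable_continuous_onI continuous_intros)

text \<open>Two such parameters t, t' on the same half circle satisfy |b| |cis t - cis t'| \<le> 2
  s, and a chord is at least 2/\<pi> times its angle. The circle is cut into halves because the
  chord bound requires angles of at most \<pi>.\<close>

lemma arc_measure:
 assumes "b ~= 0" "s >= 0"
 shows "emeasure lborel {t\<in>{0..2*pi}. cmod (a + b * cis t) <= s} <= ennreal (2 * pi * s / cmod b)"
proof -
 let ?S = "%k::nat. {t\<in>{k * pi..(k+1) * pi}. cmod (a + b * cis t) <= s}"
 have "emeasure lborel {t\<in>{0..2*pi}. cmod (a + b * cis t) <= s} <= ennreal (real 2 * (pi * s / cmod b))"
 proof (rule emeasure_Un_diam_le[where S="?S"])
 fix k x y assume x: "x : ?S k" and y: "y : ?S k"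
 have "\<bar>x - y\<bar> <= pi" using x y by (auto simp: abs_le_iff algebra_simps)
 then have "2 / pi * \<bar>x - y\<bar> <= cmod (cis x - cis y)" by (rule cmod_cis_diff_ge)
 moreover have "cmod b * cmod (cis x - cis y) = cmod ((a + b * cis x) - (a + b * cis y))"
 by (simp add: norm_mult[symmetric] algebra_simps)
 moreover have "... <= s + s" using x y norm_triangle_ineq4[of "a + b * cis x" "a + b * cis y"] by auto
 ultimately have "cmod b * (2 / pi * \<bar>x - y\<bar>) <= 2 * s"
 by (smt (verit) mult_left_mono norm_ge_zero)
 then show "\<bar>x - y\<bar> <= pi * s / cmod b" using assms by (simp add: field_simps)
 next
 show "{t\<in>{0..2*pi}. cmod (a + b * cis t) <= s} <= (\<Union>k<2. ?S k)"
 proof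
 fix t assume "t : {t\<in>{0..2*pi}. cmod (a + b * cis t) <= s}"
 then have "t : ?S 0 \<or> t : ?S 1" by auto
 moreover have "(0::nat) < 2" "(1::nat) < 2" by auto
 ultimately show "t : (\<Union>k<2. ?S k)" by blast
 qed
 qed (use assms in auto)
 also have "real 2 * (pi * s / cmod b) = 2 * pi * s / cmod b" by simp
 finally show ?thesis .
qed

text \<open>Half the difference d and the midpoint u, taken modulo \<pi>, satisfy d \<le> u \<le>
  \<pi> - d on a monotone branch, so sin u \<ge> sin d, and the product formula for cos x - cos y
  gives a square. Near the extrema of the cosine a quadratic bound is the best possible.\<close>

lemma cos_diff_ge:
 assumes "k * pi <= x" "x <= (real k + 1) * pi" "k * pi <= y" "y <= (real k + 1) * pi"
 shows "2 * ((x - y) / pi)\<^sup>2 <= \<bar>cos x - cos y\<bar>"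
proof -
 have main: "2 * ((y - x) / pi)\<^sup>2 <= \<bar>cos x - cos y\<bar>" if "x <= y" "k * pi <= x" "y <= (real k + 1) * pi" for x y
 proof -
 define d u where "d = (y - x) / 2" and "u = (x + y) / 2 - k * pi"
 have d: "0 <= d" "d <= pi/2" and u: "d <= u" "u <= pi - d"
 using that by (auto simp: d_def u_def field_simps)
 have lin: "2 * d / pi <= sin d" using d by (intro sin_ge_linear)
 have sd: "sin d >= 0" using d by (intro sin_ge_zero) auto
 have "sin d <= sin u"
 proof (cases "u <= pi/2")
 case True then show ?thesis using d u by (intro sin_monotone_2pi_le) auto
 next
 case False
 then have "sin d <= sin (pi - u)" using d u by (intro sin_monotone_2pi_le) auto
 then show ?thesis by simp
 qed
 moreover have "\<bar>sin ((x + y) / 2)\<bar> = \<bar>sin u\<bar>"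
 proof -
 have "(x + y) / 2 = u + k * pi" by (simp add: u_def)
 then have "sin ((x + y) / 2) = sin u * cos (k * pi)" by (simp only: sin_add sin_npi)
 moreover have "\<bar>cos (k * pi)\<bar> = 1" by (simp add: cos_npi2 mult.commute power_abs)
 ultimately show ?thesis by (simp add: abs_mult)
 qed
 ultimately have "sin d * sin d <= \<bar>sin ((x + y) / 2)\<bar> * \<bar>sin ((y - x) / 2)\<bar>"
 using sd by (intro mult_mono) (auto simp: d_def)
 moreover have "(2 * d / pi) * (2 * d / pi) <= sin d * sin d" using lin d sd by (intro mult_mono) auto
 moreover have "2 * d = y - x" by (simp add: d_def)
 moreover have "\<bar>cos x - cos y\<bar> = 2 * (\<bar>sin ((x + y) / 2)\<bar> * \<bar>sin ((y - x) / 2)\<bar>)"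
 by (simp add: cos_diff_cos abs_mult)
 ultimately show ?thesis unfolding power2_eq_square by simp
 qed
 show ?thesis
 proof (cases "x <= y")
 case True then show ?thesis using main[of x y] assms by (simp add: power2_commute power_divide)
 next
 case False then show ?thesis using main[of y x] assms by (simp add: abs_minus_commute)
 qed
qed

text \<open>The square root is the price of the extrema of the cosine, where a chain touches a
  sphere of the visual metric. The shifted argument runs through [0, 4 \<pi>], hence four monotone
  branches.\<close>

lemma cos_sublevel_measure:
 assumes R: "R > 0" and h: "h >= 0" and t: "0 <= t" "t <= 2*pi"
 shows "emeasure lborel {f\<in>{0..2*pi}. \<bar>A + R * cos (f + t)\<bar> <= h} <= ennreal (4 * pi * sqrt (h / R))"
proof -
 let ?S = "%k::nat. {f\<in>{k * pi - t..(k+1) * pi - t}. \<bar>A + R * cos (f + t)\<bar> <= h}"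
 have "emeasure lborel {f\<in>{0..2*pi}. \<bar>A + R * cos (f + t)\<bar> <= h} <= ennreal (real 4 * (pi * sqrt (h / R)))"
 proof (rule emeasure_Un_diam_le[where S="?S"])
 fix k x y assume x: "x : ?S k" and y: "y : ?S k"
 have "2 * (((x + t) - (y + t)) / pi)\<^sup>2 <= \<bar>cos (x + t) - cos (y + t)\<bar>"
 by (rule cos_diff_ge[of k]) (use x y in \<open>auto simp: algebra_simps\<close>)
 then have "R * (2 * ((x - y) / pi)\<^sup>2) <= R * \<bar>cos (x + t) - cos (y + t)\<bar>" using R by simp
 also have "... = \<bar>R * cos (x + t) - R * cos (y + t)\<bar>"
 using R by (simp add: right_diff_distrib[symmetric] abs_mult)
 also have "... <= 2 * h" using x y by (simp add: abs_le_iff)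
 finally have "((x - y) / pi)\<^sup>2 <= h / R" using R by (simp add: field_simps)
 then have "\<bar>(x - y) / pi\<bar> <= sqrt (h / R)" by (rule real_le_rsqrt[where x="\<bar>_\<bar>", simplified])
 then show "\<bar>x - y\<bar> <= pi * sqrt (h / R)" by (simp add: abs_divide field_simps)
 next
 show "{f\<in>{0..2*pi}. \<bar>A + R * cos (f + t)\<bar> <= h} <= (\<Union>k<4. ?S k)"
 proof
 fix f assume a: "f : {f\<in>{0..2*pi}. \<bar>A + R * cos (f + t)\<bar> <= h}"
 have 1: "0 <= f + t" "f + t <= 4 * pi" using a t by auto
 then consider "f + t <= pi" | "pi <= f + t & f + t <= 2 * pi" | "2*pi <= f + t & f + t <= 3 * pi" | "3*pi <= f + t"
 by linarith
 then have "f : ?S 0 \<or> f : ?S 1 \<or> f : ?S 2 \<or> f : ?S 3" using a 1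
 by cases (auto simp: algebra_simps)
 moreover have "(0::nat) < 4" "(1::nat) < 4" "(2::nat) < 4" "(3::nat) < 4" by auto
 ultimately show "f : (\<Union>k<4. ?S k)" by blast
 qed
 qed (use R h in auto)
 then show ?thesis by (simp add: mult.assoc)
qed

section \<open>Chains, pencils and tubes\<close>

definition chn :: "c2 => c2 => real => c2" where
 "chn a w t = a + csc (cis t) w"

text \<open>A chain is the trace on the sphere of the affine complex line a + C w; a is the point of
  the line nearest to the origin and \<open>norm w\<close> the radius of the circle. The bound w0
  keeps away from lines tangent to the sphere, where the circle degenerates.\<close>

definition chains :: "real => (c2 \<times> (c2)) set" where
 "chains w0 = {(a, w). hin a w = 0 & (norm a)\<^sup>2 + (norm w)\<^sup>2 = 1 & norm w >= w0}"

lemma chn_measurable[measurable]: "chn a w : borel_measurable borel"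
 unfolding chn_def csc_def by measurable

lemma chn_S3: assumes "(a, w) : chains w0" shows "chn a w t : S3"
proof -
 have h: "hin a w = 0" "hin w a = 0" using assms hin_cnj[of w a] by (auto simp: chains_def)
 have "complex_of_real ((norm (chn a w t))\<^sup>2) = hin a a + (cis t * cnj (cis t)) * hin w w"
 unfolding hin_self[symmetric]
 by (simp add: chn_def hin_add_left hin_add_right hin_csc_left hin_csc_right h)
 also have "cis t * cnj (cis t) = 1" by (simp add: complex_norm_square[symmetric] flip: complex_norm_square)
 finally have "complex_of_real ((norm (chn a w t))\<^sup>2) = complex_of_real ((norm a)\<^sup>2 + (norm w)\<^sup>2)"
 by (simp add: hin_self)
 then have "(norm (chn a w t))\<^sup>2 = 1" using assms unfolding of_real_eq_iff by (simp add: chains_def)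
 then show ?thesis by (simp add: in_S3 power2_eq_1_iff) (smt (verit) norm_ge_zero)
qed

lemma one_minus_hin_chn: "1 - hin (chn a w t) x = (1 - hin a x) + (- hin w x) * cis t"
 by (simp add: chn_def hin_add_left hin_csc_left)

text \<open>Antipodal points of a chain are \<open>2 * norm w\<close> apart, so one of them is far from x.\<close>
lemma chn_far:
 assumes c: "(a, w) : chains w0" and x: "x : S3" and w0: "w0 >= 0"
 shows "w0\<^sup>2 / 2 <= cmod (1 - hin a x) + cmod (hin w x)"
proof -
 have "chn a w 0 - chn a w pi = 2 *\<^sub>R w"
 by (simp add: chn_def csc_def prod_eq_iff scaleR_prod_def scaleR_conv_of_real)
 then have "2 * norm w = norm ((chn a w 0 - x) - (chn a w pi - x))" by simp
 also have "... <= norm (chn a w 0 - x) + norm (chn a w pi - x)" by (rule norm_triangle_ineq4)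
 finally obtain t where "norm w <= norm (chn a w t - x)" by (metis add_mono linorder_not_le add_strict_mono mult_2)
 then have "w0 <= norm (chn a w t - x)" using c by (auto simp: chains_def)
 then have "w0\<^sup>2 <= (norm (chn a w t - x))\<^sup>2" using w0 by (intro power_mono)
 also have "... <= 2 * cmod (1 - hin (chn a w t) x)" by (intro norm_diff_sq_le chn_S3[OF c] x)
 also have "cmod (1 - hin (chn a w t) x) <= cmod (1 - hin a x) + cmod (hin w x)"
 unfolding one_minus_hin_chn using norm_triangle_ineq[of "1 - hin a x" "- hin w x * cis t"]
 by (simp add: norm_mult)
 finally show ?thesis by simp
qed

text \<open>Along a chain \<open>1 - hin\<close> has the form A + b cis t, so the ball is an arc of
  length of order s^2 / |b|. If the arc is nonempty and s is small against w0, then |A| is at most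
  |b| + 2 s^2, and \<open>chn_far\<close> bounds |b| from below; for larger s the claimed bound
  exceeds the length 2 \<pi>.\<close>

lemma chain_ball_measure:
 assumes c: "(a, w) : chains w0" and x: "x : S3" and w0: "w0 > 0" and s: "s >= 0"
 shows "emeasure lborel {t\<in>{0..2*pi}. dvis x (chn a w t) <= s} <= ennreal (32 * pi / w0\<^sup>2 * s\<^sup>2)"
proof -
 define A b where "A = 1 - hin a x" and "b = - hin w x"
 have eq: "{t\<in>{0..2*pi}. dvis x (chn a w t) <= s} = {t\<in>{0..2*pi}. cmod (A + b * cis t) <= 2 * s\<^sup>2}" (is "?S = ?T")
 using chn_S3[OF c] x s by (auto simp: dvis_sym[of x] dvis_le_iff one_minus_hin_chn A_def b_def)
 show ?thesis
 proof (cases "?T = {} \<or> s\<^sup>2 > w0\<^sup>2 / 8")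
 case True
 then show ?thesis
 proof
 assume "s\<^sup>2 > w0\<^sup>2 / 8"
 then have "2 * pi <= 32 * pi / w0\<^sup>2 * s\<^sup>2" 
 proof -
 have "w0\<^sup>2 <= 16 * s\<^sup>2" using \<open>s\<^sup>2 > w0\<^sup>2 / 8\<close> zero_le_power2[of s] by linarith
 then show ?thesis using w0 by (simp add: field_simps)
 qed
 have "emeasure lborel ?S <= emeasure lborel {0..2*pi}" by (intro emeasure_mono) auto
 also have "... = ennreal (2 * pi)" by simp
 also have "... <= ennreal (32 * pi / w0\<^sup>2 * s\<^sup>2)" by (rule ennreal_leI) fact
 finally show ?thesis .
 next
 assume "?T = {}"
 then show ?thesis unfolding eq by (simp only: emeasure_empty) simp
 qed
 next
 case False
 then obtain t where t: "cmod (A + b * cis t) <= 2 * s\<^sup>2" by blast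
 have "cmod A <= 2 * s\<^sup>2 + cmod b"
 using norm_triangle_ineq4[of "A + b * cis t" "b * cis t"] t by (simp add: norm_mult)
 moreover have "w0\<^sup>2 / 2 <= cmod A + cmod b" using chn_far[OF c x] w0 by (simp add: A_def b_def)
 moreover have "s\<^sup>2 <= w0\<^sup>2 / 8" using False by simp
 ultimately have b: "w0\<^sup>2 / 8 <= cmod b" by linarith
 have "w0\<^sup>2 > 0" using w0 by simp
 then have "cmod b > 0" using b by linarith
 then have "emeasure lborel ?T <= ennreal (2 * pi * (2 * s\<^sup>2) / cmod b)" by (intro arc_measure) auto
 also have "... <= ennreal (2 * pi * (2 * s\<^sup>2) / (w0\<^sup>2 / 8))"
 using b w0 \<open>cmod b > 0\<close> by (intro ennreal_leI divide_left_mono mult_pos_pos) auto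
 also have "2 * pi * (2 * s\<^sup>2) / (w0\<^sup>2 / 8) = 32 * pi / w0\<^sup>2 * s\<^sup>2" by simp
 finally show ?thesis unfolding eq .
 qed
qed

text \<open>Needed for continuity in the chain: a small move of the chain changes the status of a
  point only if the point is near the boundary of some ball. The squared modulus along the chain is
  |A|^2 + |b|^2 + R cos (t + T), so a lower bound for R = 2 |A| |b| reduces the claim to
  \<open>cos_sublevel_measure\<close>.\<close>

lemma chain_annulus_measure:
 assumes c: "(a, w) : chains w0" and x: "x : S3" and w0: "w0 > 0" and r: "0 <= r" "r <= w0 / 4" "r <= 1"
 and d: "0 <= d" "d <= w0 ^ 4 / 80" "d <= 1"
 shows "emeasure lborel {t\<in>{0..2*pi}. \<bar>cmod (1 - hin (chn a w t) x) - 2 * r\<^sup>2\<bar> <= d} <= ennreal (36 * pi / w0\<^sup>2 * sqrt d)"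
 (is "emeasure lborel ?S <= _")
proof (cases "?S = {}")
 case False
 define A b where "A = 1 - hin a x" and "b = - hin w x"
 define R where "R = 2 * cmod (cnj A * b)"
 define T where "T = Arg2pi (cnj A * b)"
 have hh: "(cmod (1 - hin (chn a w t) x))\<^sup>2 = (cmod A)\<^sup>2 + (cmod b)\<^sup>2 + R * cos (t + T)" for t
 proof -
 have "cnj A * b = complex_of_real (cmod (cnj A * b)) * cis T"
 unfolding T_def using Arg2pi_eq[of "cnj A * b"] by (simp add: cis_conv_exp)
 then have "(cnj A * b) * cis t = complex_of_real (cmod (cnj A * b)) * (cis T * cis t)"
 by (metis mult.assoc)
 then have "cnj A * (b * cis t) = complex_of_real (cmod (cnj A * b)) * cis (t + T)"
 by (simp only: cis_mult mult.assoc add.commute)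
 then have "2 * Re (cnj A * (b * cis t)) = R * cos (t + T)" by (simp add: R_def)
 moreover have "(cmod (A + z))\<^sup>2 = (cmod A)\<^sup>2 + (cmod z)\<^sup>2 + 2 * Re (cnj A * z)" for z
 unfolding cmod_power2 by (simp add: power2_eq_square algebra_simps)
 ultimately show ?thesis unfolding one_minus_hin_chn A_def[symmetric] b_def[symmetric]
 by (simp add: norm_mult)
 qed
 have sub: "\<bar>(cmod A)\<^sup>2 + (cmod b)\<^sup>2 - 4 * r ^ 4 + R * cos (t + T)\<bar> <= 5 * d" if "t : ?S" for t
 proof -
 define h where "h = cmod (1 - hin (chn a w t) x)"
 have h: "\<bar>h - 2 * r\<^sup>2\<bar> <= d" "h >= 0" using that by (auto simp: h_def)
 have r1: "r\<^sup>2 <= 1" using r by (simp add: power_le_one)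
 have "\<bar>h\<^sup>2 - 4 * r ^ 4\<bar> = \<bar>h - 2 * r\<^sup>2\<bar> * (h + 2 * r\<^sup>2)"
 proof -
 have "h\<^sup>2 - 4 * r ^ 4 = (h - 2 * r\<^sup>2) * (h + 2 * r\<^sup>2)"
 by (simp add: algebra_simps power2_eq_square power4_eq_xxxx)
 then show ?thesis using h by (simp add: abs_mult)
 qed
 also have "... <= d * 5" using h r1 d by (intro mult_mono) (auto simp: abs_le_iff)
 finally show ?thesis using hh[of t] unfolding h_def[symmetric] by (simp add: algebra_simps)
 qed
 obtain t where t: "t : ?S" using False by blast
 have rr: "r ^ 4 <= (w0 / 4) ^ 4" using r by (intro power_mono) auto
 have wp: "w0 ^ 4 > 0" using w0 by simp
 have "w0\<^sup>2 / 2 <= cmod A + cmod b" using chn_far[OF c x] w0 by (simp add: A_def b_def)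
 then have "(w0\<^sup>2 / 2)\<^sup>2 <= (cmod A + cmod b)\<^sup>2" by (intro power_mono) auto
 moreover have "(w0\<^sup>2 / 2)\<^sup>2 = w0 ^ 4 / 4" by (simp add: power_divide flip: power_mult)
 moreover have "(cmod A + cmod b)\<^sup>2 = (cmod A)\<^sup>2 + (cmod b)\<^sup>2 + R" by (simp add: R_def power2_sum norm_mult)
 moreover have "- R <= R * cos (t + T)"
 proof -
 have "0 <= R" by (simp add: R_def)
 from mult_left_mono[OF cos_ge_minus_one[of "t + T"] this] show ?thesis by simp
 qed
 moreover have "(w0 / 4) ^ 4 = w0 ^ 4 / 256" by (simp add: power_divide)
 moreover note sub[OF t] rr d wp
 \<comment> \<open>At t the squared modulus is at most 4 r^4 + 5 d, while (|A| + |b|)^2 \<ge> w0^4 /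
   4. With r \<le> w0 / 4 and 5 d \<le> w0^4 / 16 the difference, which is at most 2 R, stays
   bounded below.\<close>
 ultimately have R: "w0 ^ 4 / 16 <= R" unfolding abs_le_iff by linarith
 then have Rp: "R > 0" using wp by linarith
 have "emeasure lborel ?S <= emeasure lborel {t\<in>{0..2*pi}. \<bar>(cmod A)\<^sup>2 + (cmod b)\<^sup>2 - 4 * r ^ 4 + R * cos (t + T)\<bar> <= 5 * d}"
 using sub by (intro emeasure_mono) auto
 also have "... <= ennreal (4 * pi * sqrt (5 * d / R))"
 using Rp d Arg2pi[of "cnj A * b"] by (intro cos_sublevel_measure) (auto simp: T_def)
 also have "... <= ennreal (36 * pi / w0\<^sup>2 * sqrt d)"
 proof (rule ennreal_leI)
 have "5 * d / R <= 5 * d / (w0 ^ 4 / 16)" using R d wp by (intro divide_left_mono mult_pos_pos Rp) auto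
 \<comment> \<open>80 is rounded up to 81 to have an exact square root.\<close>
 also have "... <= 81 * d / w0 ^ 4" using d wp by (simp add: field_simps)
 finally have "sqrt (5 * d / R) <= sqrt (81 * d / w0 ^ 4)" by simp
 also have "... = 9 * sqrt d / w0\<^sup>2"
 proof -
 have "sqrt (w0 ^ 4) = w0\<^sup>2" using real_sqrt_abs[of "w0\<^sup>2"] by (simp flip: power_mult)
 moreover have "sqrt 81 = 9" by (simp add: real_sqrt_unique)
 ultimately show ?thesis by (simp add: real_sqrt_divide real_sqrt_mult)
 qed
 finally have "4 * pi * sqrt (5 * d / R) <= 4 * pi * (9 * sqrt d / w0\<^sup>2)" by (intro mult_left_mono) auto
 then show "4 * pi * sqrt (5 * d / R) <= 36 * pi / w0\<^sup>2 * sqrt d" by simp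
 qed
 finally show ?thesis .
next
 case True
 show ?thesis unfolding True by simp
qed

text \<open>The chains \<open>{y. hin y b = v}\<close> for fixed b form a pencil of parallel complex lines.\<close>
definition pencil :: "c2 => complex => c2 \<times> (c2)" where
 "pencil b v = (csc v b, csc (complex_of_real (sqrt (1 - (cmod v)\<^sup>2))) (cperp b))"

text \<open>\<open>hin y b\<close> is the disc coordinate v of y in the frame of b. A tube is thus
  the union of the chains of the pencil with v in a disc of radius r, and it surrounds a fibre of
  the projection from any x with \<open>hin x b = a\<close>.\<close>

definition tube :: "c2 => complex => real => c2 set" where
 "tube b a r = {y : S3. cmod (hin y b - a) <= r}"

lemma tube_borel[measurable]: "tube b a r : sets borel"
proof -
 have "tube b a r = S3 Int {y. cmod (hin y b - a) <= r}" by (auto simp: tube_def)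
 moreover have "{y. cmod (hin y b - a) <= r} : sets borel" 
 by (intro borel_closed closed_Collect_le continuous_on_norm continuous_on_diff continuous_hin continuous_intros)
 ultimately show ?thesis by auto
qed

lemma frame_polar3: "frame b (polar3 v t) = chn (fst (pencil b v)) (snd (pencil b v)) t"
 by (simp add: frame_def polar3_def chn_def pencil_def csc_def prod_eq_iff mult_ac)

lemma pencil_chains:
 assumes b: "norm b = 1" and v: "(cmod v)\<^sup>2 <= 1 - w0\<^sup>2" and w0: "w0 >= 0"
 shows "pencil b v : chains w0"
proof -
 have v1: "(cmod v)\<^sup>2 <= 1" using v by (smt (verit) zero_le_power2)
 have "w0 <= sqrt (1 - (cmod v)\<^sup>2)" using v by (intro real_le_rsqrt) auto
 then show ?thesis using v1 b
 by (simp add: chains_def pencil_def hin_csc_left hin_csc_right hin_cperp norm_csc norm_cperp)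
qed

text \<open>Fubini in the coordinates of \<open>nn_integral_surf_polar\<close>: the surface measure
  integrates over the chains of a pencil against Lebesgue measure in v, so a bound along each chain
  is multiplied by the area of the disc of radius r.\<close>

lemma nn_integral_tube_le:
 assumes b: "norm b = 1" and g[measurable]: "g : borel_measurable borel" and r: "r >= 0"
 and M: "!!v. cmod (v - a) <= r ==> cmod v < 1 ==> 
 (\<integral>\<^sup>+t\<in>{0..2*pi}. g (chn (fst (pencil b v)) (snd (pencil b v)) t) \<partial>lborel) <= M"
 shows "(NN surf (%y. g y * indicator (tube b a r) y)) <= ennreal (pi * r\<^sup>2) * M"
proof -
 have "(NN surf (%y. g y * indicator (tube b a r) y)) =
 (\<integral>\<^sup>+v\<in>ball 0 1. (\<integral>\<^sup>+t\<in>{0..2*pi}. g (frame b (polar3 v t)) * indicator (tube b a r) (frame b (polar3 v t)) \<partial>lborel) \<partial>lborel)"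
 by (rule nn_integral_surf_frame_polar[OF _ b]) simp
 also have "... <= (NN lborel (%v. M * indicator (cball a r) v))"
 proof (intro nn_integral_mono)
 fix v :: complex
 show "(\<integral>\<^sup>+t\<in>{0..2*pi}. g (frame b (polar3 v t)) * indicator (tube b a r) (frame b (polar3 v t)) \<partial>lborel)
 * indicator (ball 0 1) v <= M * indicator (cball a r) v"
 proof (cases "cmod v < 1")
 case True
 have "indicator (tube b a r) (frame b (polar3 v t)) = (indicator (cball a r) v :: ennreal)" for t
 using norm_frame[OF b] norm_polar3[of v] True hin_frame[OF b, of "polar3 v t"]
 by (auto simp: tube_def indicator_def in_S3 polar3_def dist_norm norm_minus_commute)
 moreover have "cmod (v - a) <= r ==> (\<integral>\<^sup>+t\<in>{0..2*pi}. g (frame b (polar3 v t)) \<partial>lborel) <= M"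
 using M[of v] True by (simp add: frame_polar3)
 ultimately show ?thesis using True
 by (cases "v : cball a r") (auto simp: dist_norm norm_minus_commute)
 qed (simp add: indicator_def)
 qed
 also have "... = M * ennreal (pi * r\<^sup>2)"
 using r by (subst nn_integral_cmult) (auto simp: emeasure_cball unit_ball_vol_2 intro!: borel_measurable_indicator)
 finally show ?thesis by (simp add: mult.commute)
qed

text \<open>A ball inside a tube has measure of order r^2 s^2, which for r < s improves on s^4. The
  two bounds are combined in \<open>min_powr_le\<close>.\<close>

lemma surf_tube_ball_le:
 assumes b: "norm b = 1" and r: "r >= 0" and w0: "w0 > 0" and s: "s >= 0" and x: "x : S3"
 and v: "!!v. cmod (v - a) <= r ==> (cmod v)\<^sup>2 <= 1 - w0\<^sup>2"
 shows "emeasure surf (tube b a r Int {y : S3. dvis x y <= s}) <= ennreal (32 * pi\<^sup>2 / w0\<^sup>2 * r\<^sup>2 * s\<^sup>2)"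
proof -
 have [measurable]: "{y. dvis x y <= s} : sets borel" by measurable
 have "tube b a r Int {y : S3. dvis x y <= s} : sets surf"
 by (simp, rule borel_sub_S3b) (auto simp: tube_def[of b a r] intro: sets.Int[OF tube_borel[of b a r], unfolded tube_def])
 then have "emeasure surf (tube b a r Int {y : S3. dvis x y <= s}) = (NN surf (%y. indicator (tube b a r Int {y : S3. dvis x y <= s}) y))"
 by simp
 also have "... = (NN surf (%y. indicator {y. dvis x y <= s} y * indicator (tube b a r) y))"
 by (intro nn_integral_cong) (auto simp: indicator_def)
 also have "... <= ennreal (pi * r\<^sup>2) * ennreal (32 * pi / w0\<^sup>2 * s\<^sup>2)"
 proof (rule nn_integral_tube_le[OF b _ r])
 fix v assume "cmod (v - a) <= r"
 then have p: "(fst (pencil b v), snd (pencil b v)) : chains w0" using pencil_chains[OF b v] w0 by simp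
 have "(\<integral>\<^sup>+t\<in>{0..2*pi}. indicator {y. dvis x y <= s} (chn (fst (pencil b v)) (snd (pencil b v)) t) \<partial>lborel)
 = (NN lborel (%t. indicator {t\<in>{0..2*pi}. dvis x (chn (fst (pencil b v)) (snd (pencil b v)) t) <= s} t))"
 by (intro nn_integral_cong) (auto simp: indicator_def)
 also have "... = emeasure lborel {t\<in>{0..2*pi}. dvis x (chn (fst (pencil b v)) (snd (pencil b v)) t) <= s}"
 by (rule nn_integral_indicator) simp
 also have "... <= ennreal (32 * pi / w0\<^sup>2 * s\<^sup>2)" by (rule chain_ball_measure[OF p x w0 s])
 finally show "(\<integral>\<^sup>+t\<in>{0..2*pi}. indicator {y. dvis x y <= s} (chn (fst (pencil b v)) (snd (pencil b v)) t) \<partial>lborel)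
 <= ennreal (32 * pi / w0\<^sup>2 * s\<^sup>2)" .
 qed simp
 also have "... = ennreal (pi * r\<^sup>2 * (32 * pi / w0\<^sup>2 * s\<^sup>2))" by (rule ennreal_mult'[symmetric]) simp
 finally show ?thesis by (simp add: power2_eq_square mult_ac)
qed

section \<open>The intensity measure and survival probabilities\<close>

definition kap :: real where "kap = 1 / Hnorm"

text \<open>The pairs whose ball covers y, with radius in [a, b[. The point y survives these scales
  iff the process has no point in this set; the half-open range makes adjacent ranges of scales
  disjoint.\<close>

definition conR :: "real => real => c2 => (c2 \<times> real) set" where
 "conR a b y = {p. fst p : S3 & a <= snd p & snd p < b & dvis (fst p) y < snd p}"

text \<open>The slice of \<open>conR\<close> at radius r has measure about
  \<open>kap * hsA * r ^ 4\<close>; against the intensity \<gamma> r^(-5) this leaves the present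
  constant times dr / r. It plays the role of the codimension of the cut-out set in the
  4-dimensional visual metric.\<close>

definition gexp :: "real => real" where "gexp \<gamma> = \<gamma> * kap * hsA"

lemma sets_Hmeas[simp, measurable_cong]: "sets Hmeas = sets S3b" by (simp add: Hmeas_def)
lemma space_Hmeas[simp]: "space Hmeas = S3" by (simp add: Hmeas_def space_scale_measure)

lemma emeasure_Hmeas: "emeasure Hmeas A = ennreal kap * emeasure surf A"
 by (simp add: Hmeas_def kap_def)

lemma nn_integral_Hmeas: "f : borel_measurable S3b ==> (NN Hmeas (%y. f y)) = ennreal kap * (NN surf (%y. f y))"
 by (simp add: Hmeas_def kap_def nn_integral_scale_measure)

lemma finite_measure_Hmeas: "finite_measure Hmeas"
proof (rule finite_measureI)
 interpret finite_measure surf by (rule finite_measure_surf)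
 show "emeasure Hmeas (space Hmeas) ~= \<infinity>"
 by (simp add: emeasure_Hmeas ennreal_mult_eq_top_iff emeasure_eq_measure)
qed

lemma emeasure_Hmeas_vball:
 assumes "kap >= 0" "y : S3" "r > 0" shows "emeasure Hmeas (vball y r) = ennreal (kap * hs r)"
 using assms by (simp add: emeasure_Hmeas emeasure_vball_hs ennreal_mult')

definition rad :: "real => real measure" where
 "rad \<gamma> = density (restrict_space lborel {0<..1}) (%r. ennreal (\<gamma> * r powr (-5)))"

lemma intensity_rad: "intensity \<gamma> = Hmeas \<Otimes>\<^sub>M rad \<gamma>" by (simp add: intensity_def rad_def)

lemma space_intensity: "space (intensity \<gamma>) = S3 \<times> {0<..1}"
 by (simp add: intensity_rad space_pair_measure rad_def space_restrict_space)

lemma sigma_finite_rad: "sigma_finite_measure (rad \<gamma>)"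
proof -
 interpret sigma_finite_measure "restrict_space lborel {0<..1::real}"
 by (rule sigma_finite_measure_restrict_space[OF sigma_finite_lborel]) simp
 show ?thesis unfolding rad_def
 proof (subst sigma_finite_iff_density_finite)
 show "(%r. ennreal (\<gamma> * r powr - 5)) : borel_measurable (restrict_space lborel {0<..1})"
 by (intro measurable_restrict_space1) measurable
 qed auto
qed

lemma borel_sub_intensity:
 assumes A: "A : sets borel" and sub: "A <= S3 \<times> {0<..1}"
 shows "A : sets (intensity \<gamma>)"
proof -
 have "(%x. x) : borel_measurable Hmeas"
 by (subst measurable_cong_sets[OF sets_Hmeas refl]) (intro measurable_restrict_space1, simp)
 moreover have "fst : measurable (intensity \<gamma>) Hmeas" unfolding intensity_rad by (rule measurable_fst)
 ultimately have 1: "fst : borel_measurable (intensity \<gamma>)"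
 by (rule measurable_compose[rotated])
 have "snd : measurable (intensity \<gamma>) (rad \<gamma>)" unfolding intensity_rad by (rule measurable_snd)
 moreover have "(%x. x) : measurable (rad \<gamma>) borel"
 unfolding rad_def by (simp, intro measurable_restrict_space1) simp
 ultimately have 2: "snd : borel_measurable (intensity \<gamma>)" by (rule measurable_compose)
 have "(%p. (fst p, snd p)) : measurable (intensity \<gamma>) (borel \<Otimes>\<^sub>M borel)"
 using 1 2 by (rule measurable_Pair)
 then have "(%p. p) : borel_measurable (intensity \<gamma>)" by (simp add: borel_prod)
 from measurable_sets[OF this A] show ?thesis
 using sub by (simp add: space_intensity Int_absorb2)
qed

lemma emeasure_intensity:
 assumes A: "A : sets (intensity \<gamma>)"
 shows "emeasure (intensity \<gamma>) A
 = (\<integral>\<^sup>+r\<in>{0<..1}. ennreal (\<gamma> * r powr (-5)) * emeasure Hmeas {x. (x, r) : A} \<partial>lborel)"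
proof -
 interpret H: finite_measure Hmeas by (rule finite_measure_Hmeas)
 interpret R: sigma_finite_measure "rad \<gamma>" by (rule sigma_finite_rad)
 interpret pair_sigma_finite Hmeas "rad \<gamma>" ..
 let ?f = "%r. emeasure Hmeas {x. (x, r) : A}"
 have A': "A : sets (Hmeas \<Otimes>\<^sub>M rad \<gamma>)" using A unfolding intensity_rad .
 have m: "?f : borel_measurable (restrict_space lborel {0<..1})"
 proof -
 have sr: "sets (rad \<gamma>) = sets (restrict_space lborel {0<..1})" by (simp add: rad_def)
 show ?thesis using measurable_emeasure_Pair2[OF A'] by (simp only: vimage_def measurable_cong_sets[OF sr refl])
 qed
 have m2: "(%r. ennreal (\<gamma> * r powr (-5))) : borel_measurable (restrict_space lborel {0<..1})"
 by (intro measurable_restrict_space1) measurable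
 have "emeasure (intensity \<gamma>) A = (\<integral>\<^sup>+r. ?f r \<partial>rad \<gamma>)"
 unfolding intensity_rad using emeasure_pair_measure_alt2[OF A'] by (simp add: vimage_def)
 also have "... = (\<integral>\<^sup>+r. ennreal (\<gamma> * r powr (-5)) * ?f r \<partial>restrict_space lborel {0<..1})"
 unfolding rad_def by (rule nn_integral_density[OF m2 m])
 also have "... = (\<integral>\<^sup>+r\<in>{0<..1}. ennreal (\<gamma> * r powr (-5)) * ?f r \<partial>lborel)"
 by (subst nn_integral_restrict_space) auto
 finally show ?thesis .
qed

lemma emeasure_intensity_le:
 assumes B: "B : sets (intensity \<gamma>)" and a: "a > 0" "ALL p:B. a <= snd p" and \<gamma>: "\<gamma> >= 0"
 shows "emeasure (intensity \<gamma>) B <= ennreal (\<gamma> * a powr (-5)) * emeasure Hmeas S3"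
proof -
 have "emeasure (intensity \<gamma>) B = (\<integral>\<^sup>+r\<in>{0<..1}. ennreal (\<gamma> * r powr (-5)) * emeasure Hmeas {x. (x, r) : B} \<partial>lborel)"
 by (rule emeasure_intensity[OF B])
 also have "... <= (NN (lborel :: real measure) (%r. (ennreal (\<gamma> * a powr (-5)) * emeasure Hmeas S3) * indicator {0<..1} r))"
 proof (rule nn_integral_mono)
 fix r :: real
 show "ennreal (\<gamma> * r powr (-5)) * emeasure Hmeas {x. (x, r) : B} * indicator {0<..1} r
 <= ennreal (\<gamma> * a powr (-5)) * emeasure Hmeas S3 * indicator {0<..1} r"
 proof (cases "a <= r")
 case True
 have "r powr (-5) <= a powr (-5)" using a True by (intro powr_mono2') auto
 then have "ennreal (\<gamma> * r powr (-5)) <= ennreal (\<gamma> * a powr (-5))" using \<gamma> by (intro ennreal_leI mult_left_mono)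
 moreover have "emeasure Hmeas {x. (x, r) : B} <= emeasure Hmeas S3" using emeasure_space[of Hmeas] by simp
 ultimately show ?thesis by (intro mult_right_mono mult_mono) auto
 next
 case False
 then have e: "{x. (x, r) : B} = {}" using a(2) by force
 show ?thesis unfolding e by simp
 qed
 qed
 also have "... = ennreal (\<gamma> * a powr (-5)) * emeasure Hmeas S3" by (subst nn_integral_cmult_indicator) auto
 finally show ?thesis .
qed

lemma conR_borel[measurable]: "conR a b y : sets borel"
proof -
 have "conR a b y = (S3 \<times> UNIV) Int ({p. a <= snd p} Int {p. snd p < b} Int {p. dvis (fst p) y < snd p})"
 by (auto simp: conR_def)
 moreover have "{p :: c2 \<times> real. a <= snd p} : sets borel"
 "{p :: c2 \<times> real. snd p < b} : sets borel"
 by (intro borel_closed closed_Collect_le borel_open open_Collect_less continuous_intros)+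
 moreover have "{p :: c2 \<times> real. dvis (fst p) y < snd p} : sets borel"
 by (intro borel_open open_Collect_less continuous_dvis continuous_intros)
 moreover have "S3 \<times> (UNIV :: real set) : sets borel" by (intro borel_closed closed_Times S3_closed closed_UNIV)
 ultimately show ?thesis by simp
qed

lemma conR_sets: "0 < a ==> b <= 1 ==> conR a b y : sets (intensity \<gamma>)"
 by (rule borel_sub_intensity[OF conR_borel]) (auto simp: conR_def)

lemma emeasure_conR_eq:
 assumes "kap >= 0" "\<gamma> >= 0" "0 < a" "b <= 1" "y : S3"
 shows "emeasure (intensity \<gamma>) (conR a b y) = (\<integral>\<^sup>+r\<in>{a..<b}. ennreal (\<gamma> * kap * (hs r / r ^ 5)) \<partial>lborel)"
proof -
 have "emeasure (intensity \<gamma>) (conR a b y)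
 = (\<integral>\<^sup>+r\<in>{0<..1}. ennreal (\<gamma> * r powr (-5)) * emeasure Hmeas {x. (x, r) : conR a b y} \<partial>lborel)"
 by (rule emeasure_intensity[OF conR_sets[OF assms(3,4)]])
 also have "... = (\<integral>\<^sup>+r\<in>{a..<b}. ennreal (\<gamma> * kap * (hs r / r ^ 5)) \<partial>lborel)"
 proof (intro nn_integral_cong)
 fix r :: real
 show "ennreal (\<gamma> * r powr (-5)) * emeasure Hmeas {x. (x, r) : conR a b y} * indicator {0<..1} r
 = ennreal (\<gamma> * kap * (hs r / r ^ 5)) * indicator {a..<b} r"
 proof (cases "a <= r & r < b")
 case True
 then have r: "0 < r" "r <= 1" using assms by auto
 have "{x. (x, r) : conR a b y} = vball y r"
 using True by (auto simp: conR_def vball_def dvis_sym[of y])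
 moreover have "r powr (-5) = 1 / r ^ 5" using r by (simp add: powr_minus_divide)
 ultimately show ?thesis using True r assms
 by (simp add: emeasure_Hmeas_vball indicator_def hs_nonneg mult_ac flip: ennreal_mult')
 next
 case False
 then have "{x. (x, r) : conR a b y} = {}" by (auto simp: conR_def)
 then have "emeasure Hmeas {x. (x, r) : conR a b y} = 0" by (simp only: emeasure_empty)
 then show ?thesis using False by (auto simp: indicator_def)
 qed
 qed
 finally show ?thesis .
qed

lemma nn_integral_inverse:
 assumes "0 < a" "a <= b" "c >= 0"
 shows "(\<integral>\<^sup>+r\<in>{a..<b}. ennreal (c / r) \<partial>lborel) = ennreal (c * ln (b / a))"
proof -
 have "(\<integral>\<^sup>+r\<in>{a..<b}. ennreal (c / r) \<partial>lborel) = (NN lborel (%r. ennreal (c / r) * indicator {a..b} r))"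
 by (intro nn_integral_cong_AE eventually_mono[OF AE_lborel_singleton[of b]]) (auto simp: indicator_def)
 also have "... = ennreal (c * ln b - c * ln a)"
 by (rule nn_integral_FTC_Icc[where F="%r. c * ln r"])
 (use assms in \<open>auto intro!: derivative_eq_intros\<close>)
 finally show ?thesis using assms by (simp add: ln_div right_diff_distrib)
qed

lemma emeasure_conR_le:
 assumes "kap >= 0" "\<gamma> >= 0" "0 < a" "a <= b" "b <= 1" "y : S3"
 shows "emeasure (intensity \<gamma>) (conR a b y) <= ennreal (gexp \<gamma> * ln (b / a))"
proof -
 have g: "gexp \<gamma> >= 0" using assms hsA_pos by (simp add: gexp_def)
 have "emeasure (intensity \<gamma>) (conR a b y) = (\<integral>\<^sup>+r\<in>{a..<b}. ennreal (\<gamma> * kap * (hs r / r ^ 5)) \<partial>lborel)"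
 using assms by (intro emeasure_conR_eq) auto
 also have "... <= (\<integral>\<^sup>+r\<in>{a..<b}. ennreal (gexp \<gamma> / r) \<partial>lborel)"
 proof (intro nn_integral_mono)
 fix r :: real
 show "ennreal (\<gamma> * kap * (hs r / r ^ 5)) * indicator {a..<b} r <= ennreal (gexp \<gamma> / r) * indicator {a..<b} r"
 proof (cases "r : {a..<b}")
 case True
 then have r: "r > 0" using assms by auto
 have "hs r / r ^ 5 <= hsA * r ^ 4 / r ^ 5" using hs_le[OF r] r by (intro divide_right_mono) auto
 also have "... = hsA / r" using r by (simp add: field_simps power_eq_if)
 finally have "\<gamma> * kap * (hs r / r ^ 5) <= \<gamma> * kap * (hsA / r)" using assms by (intro mult_left_mono) auto
 then show ?thesis by (intro mult_right_mono ennreal_leI) (auto simp: gexp_def)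
 qed simp
 qed
 also have "... = ennreal (gexp \<gamma> * ln (b / a))" using assms g by (intro nn_integral_inverse) auto
 finally show ?thesis .
qed

lemma dvis_le_sqrt: "q : S3 ==> y : S3 ==> dvis q y <= sqrt (norm (q - y) / 2)"
proof -
 assume q: "q : S3" and y: "y : S3"
 have "1 - hin q y = hin (y - q) y" using y by (simp add: hin_diff_left hin_self in_S3)
 then have "cmod (1 - hin q y) <= norm (q - y)" using cmod_hin_le[of "y - q" y] y by (simp add: in_S3 norm_minus_commute)
 then show ?thesis using q y by (simp add: dvis_eq)
qed

lemma S3_dense:
 obtains D where "countable D" "D <= S3" "!!y e. y : S3 ==> e > 0 ==> EX q:D. dvis q y < e"
proof -
 obtain D where D: "countable D" "D <= S3" "S3 <= closure D" using separable[of S3] by blast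
 have "EX q:D. dvis q y < e" if "y : S3" "e > 0" for y e
 proof -
 have "e\<^sup>2 > 0" using that by simp
 moreover have "y : closure D" using D(3) that by blast
 ultimately have "EX q:D. dist q y < e\<^sup>2" unfolding closure_approachable by blast
 then obtain q where q: "q : D" "dist q y < e\<^sup>2" by blast
 have "dvis q y <= sqrt (norm (q - y) / 2)" using D q that by (intro dvis_le_sqrt) auto
 also have "... < sqrt (e\<^sup>2)" 
 proof (rule real_sqrt_less_mono)
 show "norm (q - y) / 2 < e\<^sup>2" using q(2) norm_ge_zero[of "q - y"] unfolding dist_norm by linarith
 qed
 finally show ?thesis using q that by auto
 qed
 then show ?thesis using that D by blast
qed

text \<open>The process enters only through its void probabilities.\<close>
locale cutout_process = prob_space P for P :: "'w measure" +
 fixes \<Phi> :: "'w => (c2 \<times> real) set" and \<gamma> :: real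
 assumes gam_pos: "\<gamma> > 0" and kap_pos: "kap > 0"
 and pts: "!!\<omega>. \<omega> : space P ==> \<Phi> \<omega> <= S3 \<times> {0<..<1}"
 and pts_finite: "!!\<omega> a. \<omega> : space P ==> a > 0 ==> finite {p : \<Phi> \<omega>. a <= snd p}"
 and void_sets: "!!B a. B : sets (intensity \<gamma>) ==> a > 0 ==> (ALL p:B. a <= snd p) ==>
 {\<omega> : space P. \<Phi> \<omega> Int B = {}} : sets P"
 and void_prob: "!!B a. B : sets (intensity \<gamma>) ==> a > 0 ==> (ALL p:B. a <= snd p) ==>
 prob {\<omega> : space P. \<Phi> \<omega> Int B = {}} = exp (- measure (intensity \<gamma>) B)"
 and pts_count: "AE \<omega> in P. \<forall>\<^sub>F n in sequentially. card {p : \<Phi> \<omega>. (1/2) ^ n <= snd p} <= 2 ^ (6 * n)"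
begin

abbreviation "g \<equiv> gexp \<gamma>"

definition ell :: "real => real => real" where "ell a b = measure (intensity \<gamma>) (conR a b (1, 0))"
text \<open>The reciprocal of the probability that a point survives the radii in [a, b[, so
  \<open>cc a b * av a b w y\<close> has expectation 1. This is the random density with which
  \<open>mu_n\<close> will be compared.\<close>

definition cc :: "real => real => real" where "cc a b = exp (ell a b)"
definition av :: "real => real => 'w => c2 => real" where
 "av a b w y = (if \<Phi> w Int conR a b y = {} then 1 else 0)"
text \<open>For positive a the intensity of such sets is finite, which is what void probabilities
  require.\<close>

definition bdd_sets :: "real => (c2 \<times> real) set set" where
 "bdd_sets a = {B : sets (intensity \<gamma>). ALL p:B. a <= snd p}"
definition vd :: "(c2 \<times> real) set => 'w set" where
 "vd B = {w : space P. \<Phi> w Int B = {}}"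

lemma g_pos: "g > 0" using gam_pos kap_pos hsA_pos by (simp add: gexp_def)

lemma av_le_1: "av a b w y <= 1" and av_nonneg: "av a b w y >= 0" by (auto simp: av_def)

lemma emeasure_conR_indep:
 assumes "0 < a" "b <= 1" "y : S3"
 shows "emeasure (intensity \<gamma>) (conR a b y) = ennreal (ell a b)"
proof (cases "a <= b")
 case True
 have "emeasure (intensity \<gamma>) (conR a b y) = emeasure (intensity \<gamma>) (conR a b (1, 0))"
 using emeasure_conR_eq[of \<gamma> a b] assms gam_pos kap_pos one_zero_S3 by simp
 moreover have "emeasure (intensity \<gamma>) (conR a b (1, 0)) < \<infinity>"
 by (rule le_less_trans[OF emeasure_conR_le]) (use assms gam_pos kap_pos True one_zero_S3 in auto)
 ultimately show ?thesis by (simp add: ell_def emeasure_eq_ennreal_measure top.not_eq_extremum)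
next
 case False
 then have "conR a b y = {}" for y by (auto simp: conR_def)
 then show ?thesis by (simp add: ell_def)
qed

lemma measure_conR: "0 < a ==> b <= 1 ==> y : S3 ==> measure (intensity \<gamma>) (conR a b y) = ell a b"
 using emeasure_conR_indep[of a b y] by (simp add: measure_def ell_def)

lemma ell_nonneg: "ell a b >= 0" by (simp add: ell_def)
lemma cc_ge_1: "cc a b >= 1" by (simp add: cc_def ell_nonneg)
lemma cc_pos: "cc a b > 0" by (simp add: cc_def)

lemma ell_le: assumes "0 < a" "a <= b" "b <= 1" shows "ell a b <= g * ln (b / a)"
proof -
 have "ennreal (ell a b) <= ennreal (g * ln (b / a))"
 using emeasure_conR_le[of \<gamma> a b "(1,0)"] emeasure_conR_indep[of a b "(1,0)"] assms gam_pos kap_pos one_zero_S3 by simp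
 moreover have "g * ln (b / a) >= 0" using g_pos assms by simp
 ultimately show ?thesis by (simp add: ell_nonneg)
qed

lemma cc_le: assumes "0 < a" "a <= b" "b <= 1" shows "cc a b <= (b / a) powr g"
 using ell_le[OF assms] assms by (simp add: cc_def powr_def mult.commute)

lemma conR_bdd: "0 < a ==> b <= 1 ==> conR a b y : bdd_sets a"
 by (simp add: bdd_sets_def conR_sets) (auto simp: conR_def)

lemma bdd_sets_mono: "B : bdd_sets a ==> a' <= a ==> B : bdd_sets a'"
 by (auto simp: bdd_sets_def)
lemma bdd_sets_Un: "B : bdd_sets a ==> B' : bdd_sets a ==> B Un B' : bdd_sets a"
 by (auto simp: bdd_sets_def)
lemma bdd_sets_empty: "{} : bdd_sets a" by (simp add: bdd_sets_def)
lemma bdd_sets_UN: "finite Y ==> (!!y. y : Y ==> F y : bdd_sets a) ==> (\<Union>y\<in>Y. F y) : bdd_sets a"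
 by (auto simp: bdd_sets_def)

lemma bdd_sets_finite: assumes "B : bdd_sets a" "a > 0" shows "emeasure (intensity \<gamma>) B < \<infinity>"
proof -
 have B: "B : sets (intensity \<gamma>)" "ALL p:B. a <= snd p" using assms by (auto simp: bdd_sets_def)
 have "emeasure (intensity \<gamma>) B <= ennreal (\<gamma> * a powr (-5)) * emeasure Hmeas S3"
 using emeasure_intensity_le[OF B(1) assms(2) B(2)] gam_pos by simp
 also have "... < \<infinity>" using finite_measure.emeasure_finite[OF finite_measure_Hmeas, of S3]
 by (simp add: ennreal_mult_less_top less_top)
 finally show ?thesis .
qed

lemma vd_sets: "B : bdd_sets a ==> a > 0 ==> vd B : sets P"
 unfolding vd_def bdd_sets_def by (auto intro: void_sets)

lemma vd_prob: "B : bdd_sets a ==> a > 0 ==> prob (vd B) = exp (- measure (intensity \<gamma>) B)"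
 unfolding vd_def bdd_sets_def by (auto intro: void_prob)

lemma vd_Un: "vd (B Un B') = vd B Int vd B'" by (auto simp: vd_def)

lemma measure_bdd_Un:
 assumes "B : bdd_sets a" "B' : bdd_sets a" "a > 0" "B Int B' = {}"
 shows "measure (intensity \<gamma>) (B Un B') = measure (intensity \<gamma>) B + measure (intensity \<gamma>) B'"
 using assms bdd_sets_finite[OF assms(1,3)] bdd_sets_finite[OF assms(2,3)]
 by (intro measure_Union) (auto simp: bdd_sets_def)

lemma measure_bdd_mono:
 assumes "B : bdd_sets a" "B' : bdd_sets a" "a > 0" "B <= B'"
 shows "measure (intensity \<gamma>) B <= measure (intensity \<gamma>) B'"
 using assms bdd_sets_finite[OF assms(2,3)]
 by (intro measure_mono_fmeasurable) (auto simp: bdd_sets_def fmeasurable_def)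

lemma av_indicator: "w : space P ==> av a b w y = indicator (vd (conR a b y)) w"
 by (simp add: av_def vd_def indicator_def)

text \<open>A point y is covered iff some point q of a countable dense set and some rational e satisfy
 \<open>dvis q y < e\<close> and \<open>q\<close> is covered with a margin e; this gives joint measurability.\<close>
lemma av_measurable[measurable]:
 assumes a: "0 < a" and b: "b <= 1"
 shows "(%p. av a b (fst p) (snd p)) : borel_measurable (P \<Otimes>\<^sub>M S3b)"
proof -
 obtain D where D: "countable D" "D <= S3" "!!y e. y : S3 ==> e > 0 ==> EX q:D. dvis q y < e"
 by (rule S3_dense) blast
 define K where "K q e = {p. fst p : S3 & a <= snd p & snd p < b & dvis (fst p) q + real_of_rat e < snd p}" for q and e :: rat
 have Kb: "K q e : bdd_sets a" for q e
 proof -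
 have "K q e = (S3 \<times> UNIV) Int ({p. a <= snd p} Int {p. snd p < b} Int {p. dvis (fst p) q + real_of_rat e < snd p})"
 by (auto simp: K_def)
 moreover have "{p :: c2 \<times> real. a <= snd p} : sets borel"
 "{p :: c2 \<times> real. snd p < b} : sets borel"
 by (intro borel_closed closed_Collect_le borel_open open_Collect_less continuous_intros)+
 moreover have "{p :: c2 \<times> real. dvis (fst p) q + real_of_rat e < snd p} : sets borel"
 by (intro borel_open open_Collect_less continuous_dvis continuous_intros)
 moreover have "S3 \<times> (UNIV :: real set) : sets borel" by (intro borel_closed closed_Times S3_closed closed_UNIV)
 ultimately have "K q e : sets borel" by simp
 then have "K q e : sets (intensity \<gamma>)" using a b by (intro borel_sub_intensity) (auto simp: K_def)
 then show ?thesis by (auto simp: bdd_sets_def K_def)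
 qed
 let ?U = "\<Union>q\<in>D. \<Union>e\<in>(UNIV :: rat set). (space P - vd (K q e)) \<times> (S3 Int {y. dvis q y < real_of_rat e})"
 have "?U : sets (P \<Otimes>\<^sub>M S3b)"
 proof (intro sets.countable_UN'' D(1) pair_measureI)
 show "space P - vd (K q e) : sets P" for q e using vd_sets[OF Kb a] by auto
 show "S3 Int {y. dvis q y < real_of_rat e} : sets S3b" for q and e :: rat
 by (intro borel_sub_S3b sets.Int S3_borel borel_open open_Collect_less continuous_dvis continuous_intros) auto
 qed auto
 moreover have "av a b (fst p) (snd p) = 1 - indicator ?U p" if p: "p : space (P \<Otimes>\<^sub>M S3b)" for p
 proof -
 obtain w y where p: "p = (w, y)" "w : space P" "y : S3" using p by (auto simp: space_pair_measure space_S3b)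
 have "\<Phi> w Int conR a b y ~= {} \<longleftrightarrow> p : ?U"
 proof
 assume "\<Phi> w Int conR a b y ~= {}"
 then obtain x r where xr: "(x, r) : \<Phi> w" "x : S3" "a <= r" "r < b" "dvis x y < r" by (auto simp: conR_def)
 then obtain e :: rat where e: "0 < real_of_rat e" "real_of_rat e < (r - dvis x y) / 2"
 using of_rat_dense[of 0 "(r - dvis x y) / 2"] by auto
 obtain q where q: "q : D" "dvis q y < real_of_rat e" using D(3)[OF p(3) e(1)] by blast
 have "dvis x q <= dvis x y + dvis y q" using xr p q D by (intro dvis_triangle) auto
 then have "dvis x q + real_of_rat e < r" using q e by (simp add: dvis_sym[of y])
 then have "(x, r) : \<Phi> w Int K q e" using xr by (simp add: K_def)
 then show "p : ?U" using q p by (auto simp: vd_def)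
 next
 assume "p : ?U"
 then obtain q e where q: "q : D" "dvis q y < real_of_rat e" "w \<notin> vd (K q e)" using p by auto
 then obtain x r where xr: "(x, r) : \<Phi> w" "(x, r) : K q e" using p by (auto simp: vd_def)
 have "dvis x y <= dvis x q + dvis q y" using xr q p D by (intro dvis_triangle) (auto simp: K_def)
 then show "\<Phi> w Int conR a b y ~= {}" using xr q by (auto simp: K_def conR_def)
 qed
 then show ?thesis using p by (auto simp: av_def indicator_def)
 qed
 ultimately show ?thesis by (subst measurable_cong[where g="%p. 1 - indicator ?U p"]) auto
qed

end

section \<open>Correlations and moments of all orders\<close>

definition kern :: "real => nat => c2 => c2 => real" where
 "kern g N y y' = (\<Sum>j\<le>N. 2 powr (g * (real j + 2)) * indicator {z. dvis y' z <= (1/2) ^ j} y)"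

lemma kern_nonneg: "kern g N y y' >= 0"
 unfolding kern_def by (intro sum_nonneg) auto

lemma kern_measurable[measurable]: "(%y. kern g N y y') : borel_measurable borel"
 unfolding kern_def by measurable

text \<open>\<open>kern\<close> is a dyadic majorant of the pair correlation, which is of order
  dvis^(-g), cut off at distance 2^(-N). Its integral is bounded uniformly in N as soon as m gives a
  ball of radius s a mass of order at most s^\<beta> with \<beta> > g; the last factor is the sum of
  the resulting geometric series.\<close>

lemma nn_integral_kern_le:
 assumes sm: "sets m = sets S3b" and bg: "\<beta> > g" and K: "K >= 0"
 and mK: "!!j. j <= N ==> emeasure m {z : S3. dvis y' z <= (1/2) ^ j} <= ennreal (K * 2 powr (- \<beta> * real j))"
 shows "(NN m (%y. ennreal (kern g N y y'))) <= ennreal (K * (2 powr (2 * g) / (1 - 2 powr (g - \<beta>))))"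
proof -
 let ?A = "%j. {z : S3. dvis y' z <= (1/2) ^ j}"
 have spm: "space m = S3" using sets_eq_imp_space_eq[OF sm] by (simp add: space_S3b)
 have A: "?A j : sets m" for j
 proof -
 have "?A j = S3 Int {z. dvis y' z <= (1/2) ^ j}" by auto
 moreover have "{z. dvis y' z <= (1/2) ^ j} : sets borel" by measurable
 ultimately show ?thesis unfolding sm by (intro borel_sub_S3b) auto
 qed
 have "(NN m (%y. ennreal (kern g N y y'))) = (NN m (%y. (\<Sum>j\<le>N. ennreal (2 powr (g * (real j + 2))) * indicator (?A j) y)))"
 proof (intro nn_integral_cong)
 fix y assume "y : space m"
 then have "indicator (?A j) y = (indicator {z. dvis y' z <= (1/2) ^ j} y :: ennreal)" for j
 by (simp add: spm indicator_def)
 moreover have "ennreal (kern g N y y') = (\<Sum>j\<le>N. ennreal (2 powr (g * (real j + 2)) * indicator {z. dvis y' z <= (1/2) ^ j} y))"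
 unfolding kern_def by (rule sum_ennreal[symmetric]) auto
 ultimately show "ennreal (kern g N y y') = (\<Sum>j\<le>N. ennreal (2 powr (g * (real j + 2))) * indicator (?A j) y)"
 by (simp add: ennreal_mult' ennreal_indicator)
 qed
 also have "... = (\<Sum>j\<le>N. ennreal (2 powr (g * (real j + 2))) * emeasure m (?A j))"
 using A by (subst nn_integral_sum) (auto simp: nn_integral_cmult_indicator)
 also have "... <= (\<Sum>j\<le>N. ennreal (2 powr (g * (real j + 2))) * ennreal (K * 2 powr (- \<beta> * real j)))"
 using mK by (intro sum_mono mult_left_mono) auto
 also have "... = ennreal (\<Sum>j\<le>N. K * 2 powr (2 * g) * (2 powr (g - \<beta>)) ^ j)"
 proof -
 have "ennreal (2 powr (g * (real j + 2))) * ennreal (K * 2 powr (- \<beta> * real j))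
 = ennreal (K * 2 powr (2 * g) * (2 powr (g - \<beta>)) ^ j)" for j
 proof -
 have "2 powr (g * (real j + 2)) * (2 powr (- \<beta> * real j)) = 2 powr (2 * g) * (2 powr (g - \<beta>)) ^ j"
 by (simp add: powr_add[symmetric] powr_power algebra_simps)
 then show ?thesis using K by (simp add: ennreal_mult'[symmetric] mult.left_commute mult.assoc)
 qed
 then show ?thesis using K by (simp add: sum_ennreal)
 qed
 also have "... <= ennreal (K * (2 powr (2 * g) / (1 - 2 powr (g - \<beta>))))"
 proof (rule ennreal_leI)
 have q: "0 < 2 powr (g - \<beta>)" "2 powr (g - \<beta>) < 1" using bg by (auto simp: powr_less_one)
 have "(\<Sum>j\<le>N. (2 powr (g - \<beta>)) ^ j) <= (\<Sum>j. (2 powr (g - \<beta>)) ^ j)"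
 using q by (intro sum_le_suminf summable_geometric) auto
 also have "... = 1 / (1 - 2 powr (g - \<beta>))" using q by (intro suminf_geometric) auto
 finally have "K * 2 powr (2 * g) * (\<Sum>j\<le>N. (2 powr (g - \<beta>)) ^ j) <= K * 2 powr (2 * g) * (1 / (1 - 2 powr (g - \<beta>)))"
 using K by (intro mult_left_mono) auto
 then show "(\<Sum>j\<le>N. K * 2 powr (2 * g) * (2 powr (g - \<beta>)) ^ j) <= K * (2 powr (2 * g) / (1 - 2 powr (g - \<beta>)))"
 by (simp add: sum_distrib_left mult.assoc)
 qed
 finally show ?thesis .
qed

lemma dyadic_bracket:
 assumes "0 <= d" "d <= 1"
 obtains j where "j <= N" "d <= (1/2::real) ^ j" "j = N \<or> (1/2) ^ (j+1) < d"
proof -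
 define j where "j = Max {j. j <= N & d <= (1/2::real) ^ j}"
 have fin: "finite {j. j <= N & d <= (1/2::real) ^ j}" by simp
 moreover have "0 : {j. j <= N & d <= (1/2::real) ^ j}" using assms by simp
 ultimately have j: "j : {j. j <= N & d <= (1/2::real) ^ j}" unfolding j_def by (metis Max_in empty_iff)
 have "j + 1 \<notin> {j. j <= N & d <= (1/2::real) ^ j}"
 using Max_ge[OF fin, of "j+1"] by (auto simp: j_def[symmetric])
 then show ?thesis using that[of j] j by auto
qed

context cutout_process
begin

text \<open>The centre of a ball covering both points joins them by two steps shorter than the
  radius. Hence radii below half the distance act on the two points through disjoint parts of the
  process.\<close>

lemma conR_overlap:
 assumes p: "p : conR a b y" "p : conR a b y'" and y: "y : S3" "y' : S3"
 shows "dvis y y' < 2 * snd p"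
proof -
 have "dvis y y' <= dvis y (fst p) + dvis (fst p) y'" using p y by (intro dvis_triangle) (auto simp: conR_def)
 then show ?thesis using p by (auto simp: conR_def dvis_sym[of y])
qed

text \<open>The void probability of B together with C = \<open>conR a b y\<close> exceeds the
  product of the two by the exponential of the mass of C \<inter> B, and \<open>cc a b\<close>
  cancels the factor belonging to C. Only radii larger than half the distance from y to the nearest
  point of Y occur in the overlap, so the exponential is of order distance^(-g).\<close>

lemma vd_insert_le:
 assumes a: "0 < a" "(1/2) ^ N <= a" and ab: "a <= b" and b: "b <= 1"
 and Y: "finite Y" "Y ~= {}" "Y <= S3" and y: "y : S3"
 shows "cc a b * prob (vd (\<Union>z\<in>insert y Y. conR a b z)) <= prob (vd (\<Union>z\<in>Y. conR a b z)) * (\<Sum>z\<in>Y. kern g N y z)"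
proof -
 define B C where "B = (\<Union>z\<in>Y. conR a b z)" and "C = conR a b y"
 have B: "B : bdd_sets a" unfolding B_def using conR_bdd a b Y by (intro bdd_sets_UN) auto
 have C: "C : bdd_sets a" unfolding C_def using conR_bdd a b by auto
 have CB: "C - B : bdd_sets a" "C Int B : bdd_sets a" using B C by (auto simp: bdd_sets_def)
 let ?M = "measure (intensity \<gamma>)"
 have 1: "?M (B Un C) = ?M B + ?M (C - B)"
 using measure_bdd_Un[OF B CB(1) a(1)] by (simp add: Un_Diff_cancel Int_Diff) 
 have 2: "ell a b = ?M (C - B) + ?M (C Int B)"
 proof -
 have "ell a b = ?M C" using measure_conR[of a b y] a b y by (simp add: C_def)
 also have "C = (C - B) Un (C Int B)" by auto
 also have "?M ... = ?M (C - B) + ?M (C Int B)" by (rule measure_bdd_Un[OF CB a(1)]) auto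
 finally show ?thesis .
 qed
 define d where "d = Min ((%z. dvis y z) ` Y)"
 have "d : (%z. dvis y z) ` Y" unfolding d_def using Y by (intro Min_in) auto
 then obtain y0 where y0: "y0 : Y" "d = dvis y y0" by auto
 have dmin: "d <= dvis y z" if "z : Y" for z unfolding d_def using that Y by (intro Min_le) auto
 have d01: "0 <= d" "d <= 1" using y0(2) dvis_nonneg[of y y0] dvis_le_1[of y y0] y0(1) Y(3) y by auto
 obtain j where j: "j <= N" "d <= (1/2) ^ j" "j = N \<or> (1/2) ^ (j+1) < d"
 using dyadic_bracket[OF d01] by blast
 \<comment> \<open>Radii in the overlap exceed d / 2 and are at least a; the maximum also covers the
   case d = 0.\<close>
 define a' where "a' = max a (d / 2)"
 have a'p: "a' > 0" using a by (simp add: a'_def)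
 have a'2: "(1/2) ^ (j + 2) <= a'"
 proof (cases "j = N")
 case True
 have "(1/2) ^ (j + 2) <= (1/2::real) ^ N" unfolding True by (rule power_decreasing) auto
 then show ?thesis using a by (simp add: a'_def)
 next
 case False
 then show ?thesis using j(3) by (simp add: a'_def)
 qed
 have sub: "C Int B <= conR a' b y"
 proof
 fix p assume p: "p : C Int B"
 then obtain z where z: "z : Y" "p : conR a b z" by (auto simp: B_def)
 have "dvis y z < 2 * snd p" using conR_overlap[of p a b y z] p z Y y by (auto simp: C_def)
 then show "p : conR a' b y" using dmin[OF z(1)] p by (auto simp: C_def conR_def a'_def)
 qed
 have ex: "exp (?M (C Int B)) <= 2 powr (g * (real j + 2))"
 proof (cases "a' <= b")
 case True
 have "?M (C Int B) <= ?M (conR a' b y)"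
 using sub CB(2) conR_bdd[of a' b y] a'p b a by (intro measure_bdd_mono[of _ a]) (auto intro: bdd_sets_mono simp: a'_def)
 also have "... = ell a' b" using a'p b y by (intro measure_conR) auto
 finally have "exp (?M (C Int B)) <= cc a' b" by (simp add: cc_def)
 also have "... <= (b / a') powr g" using a'p True b by (intro cc_le) auto
 also have "... <= (2 ^ (j + 2)) powr g"
 proof (rule powr_mono2)
 have "b / a' <= 1 / (1/2) ^ (j + 2)" using a'2 b a'p True by (intro frac_le) auto
 then show "b / a' <= 2 ^ (j + 2)" by (simp add: power_divide)
 qed (use g_pos a'p True in auto)
 also have "... = 2 powr (g * (real j + 2))"
 by (simp add: powr_realpow[symmetric] powr_powr mult.commute del: power_Suc power_add powr_realpow add_2_eq_Suc')
 finally show ?thesis .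
 next
 case False
 then have "conR a' b y = {}" by (auto simp: conR_def)
 then have "?M (C Int B) = 0" using sub by simp
 then show ?thesis using g_pos by (simp add: ge_one_powr_ge_zero)
 qed
 also have "... <= kern g N y y0"
 proof -
 have "2 powr (g * (real j + 2)) * indicator {z. dvis y0 z <= (1/2) ^ j} y <= kern g N y y0"
 unfolding kern_def by (rule member_le_sum[of j]) (use j in auto)
 then show ?thesis using j y0 by (simp add: dvis_sym[of y0])
 qed
 \<comment> \<open>The kernel at the nearest point, which depends on y, is replaced by the sum over
   Y, so that integration in y can be done term by term.\<close>
 also have "... <= (\<Sum>z\<in>Y. kern g N y z)"
 using y0 Y kern_nonneg by (intro member_le_sum) auto
 finally have e: "exp (?M (C Int B)) <= (\<Sum>z\<in>Y. kern g N y z)" .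
 have pU: "prob (vd (B Un C)) = exp (- ?M (B Un C))" by (rule vd_prob[OF bdd_sets_Un[OF B C] a(1)])
 have "cc a b * prob (vd (B Un C)) = exp (- ?M B) * exp (?M (C Int B))"
 unfolding pU cc_def 1 using 2 by (simp add: exp_add[symmetric])
 also have "... <= exp (- ?M B) * (\<Sum>z\<in>Y. kern g N y z)" using e by (intro mult_left_mono) auto
 also have "exp (- ?M B) = prob (vd B)" by (rule vd_prob[OF B a(1), symmetric])
 finally show ?thesis by (simp add: B_def C_def Un_commute)
qed

definition XX :: "c2 measure => real => real => 'w => ennreal" where
 "XX m a b w = (NN m (%y. ennreal (cc a b * av a b w y)))"

lemma av_measurable_m[measurable]:
 assumes "sets m = sets S3b" "0 < a" "b <= 1"
 shows "(%p. av a b (fst p) (snd p)) : borel_measurable (P \<Otimes>\<^sub>M m)"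
 using av_measurable[OF assms(2,3)] assms(1)
 by (subst measurable_cong_sets[OF sets_pair_measure_cong refl]) auto

lemma XX_measurable:
 assumes m: "finite_measure m" "sets m = sets S3b" and ab: "0 < a" "b <= 1"
 shows "XX m a b : borel_measurable P"
proof -
 interpret m: finite_measure m by fact
 have [measurable]: "(%p. av a b (fst p) (snd p)) : borel_measurable (P \<Otimes>\<^sub>M m)"
 by (rule av_measurable_m) fact+
 have "(%(w, y). ennreal (cc a b * av a b w y)) : borel_measurable (P \<Otimes>\<^sub>M m)"
 unfolding case_prod_beta by measurable
 then show ?thesis unfolding XX_def[abs_def] by (rule m.borel_measurable_nn_integral)
qed

text \<open>Induction on the power, with the survival of a finite set Y carried along. One factor is
  written as an integral over a new point y, which joins Y at the cost of the sum of the kernels and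
  is then integrated out, giving card Y times J; the next factor meets a set with at most one point
  more.\<close>

lemma moment_void:
 assumes m: "finite_measure m" "sets m = sets S3b"
 and a: "0 < a" "(1/2) ^ N <= a" and ab: "a <= b" and b: "b <= 1"
 and J: "J >= 0" "!!y'. y' : S3 ==> (NN m (%y. ennreal (kern g N y y'))) <= ennreal J"
 and Y: "finite Y" "Y ~= {}" "Y <= S3"
 shows "(NN P (%u. indicator (vd (\<Union>z\<in>Y. conR a b z)) u * XX m a b u ^ k))
 <= ennreal (prob (vd (\<Union>z\<in>Y. conR a b z)) * (\<Prod>i<k. (real (card Y) + real i) * J))"
 using Y
proof (induction k arbitrary: Y)
 case 0
 have "vd (\<Union>z\<in>Y. conR a b z) : sets P"
 using conR_bdd a b 0 by (intro vd_sets[of _ a] bdd_sets_UN) auto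
 then show ?case by (simp add: emeasure_eq_measure)
next
 case (Suc k)
 interpret m: finite_measure m by fact
 interpret pair_sigma_finite P m by unfold_locales
 have spm: "space m = S3" using sets_eq_imp_space_eq[OF m(2)] by (simp add: space_S3b)
 let ?V = "%Y. vd (\<Union>z\<in>Y. conR a b z)"
 have VY: "?V Y : sets P" if "finite Y" for Y
 using conR_bdd a b that by (intro vd_sets[of _ a] bdd_sets_UN) auto
 have [measurable]: "(%p. av a b (fst p) (snd p)) : borel_measurable (P \<Otimes>\<^sub>M m)"
 by (rule av_measurable_m) fact+
 have [measurable]: "XX m a b : borel_measurable P" by (rule XX_measurable[OF m a(1) b])
 have [measurable]: "(indicator (?V Y) :: 'w => ennreal) : borel_measurable P" using VY[OF Suc.prems(1)] by simp
 let ?F = "%u y. indicator (?V Y) u * XX m a b u ^ k * ennreal (cc a b * av a b u y)"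
 let ?Pk = "\<Prod>i<k. (real (card Y) + 1 + real i) * J"
 have Pk: "?Pk >= 0" using J by (intro prod_nonneg) auto
 have "(NN P (%u. indicator (?V Y) u * XX m a b u ^ Suc k)) = (NN P (%u. \<integral>\<^sup>+y. ?F u y \<partial>m))"
 proof (intro nn_integral_cong)
 fix u assume w: "u : space P"
 have "(%y. av a b u y) : borel_measurable m"
 using measurable_Pair2[OF \<open>(%p. av a b (fst p) (snd p)) : borel_measurable (P \<Otimes>\<^sub>M m)\<close> w] by simp
 then have "(NN m (%y. ?F u y)) = indicator (?V Y) u * XX m a b u ^ k * XX m a b u"
 unfolding XX_def by (subst nn_integral_cmult) auto
 then show "indicator (?V Y) u * XX m a b u ^ Suc k = (NN m (%y. ?F u y))" by (simp add: mult_ac)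
 qed
 also have "... = (NN m (%y. \<integral>\<^sup>+u. ?F u y \<partial>P))"
 by (rule Fubini'[symmetric]) (unfold case_prod_beta, measurable)
 also have "... <= (NN m (%y. (\<Sum>z\<in>Y. ennreal (kern g N y z)) * ennreal (prob (?V Y) * ?Pk)))"
 proof (intro nn_integral_mono)
 fix y assume "y : space m"
 then have y: "y : S3" by (simp add: spm)
 have fi: "finite (insert y Y)" using Suc.prems by simp
 have "(NN P (%u. ?F u y)) = (NN P (%u. ennreal (cc a b) * (indicator (?V (insert y Y)) u * XX m a b u ^ k)))"
 proof (intro nn_integral_cong)
 fix u assume w: "u : space P"
 have "vd (\<Union>z\<in>insert y Y. conR a b z) = vd (conR a b y) Int ?V Y" by (simp add: vd_Un)
 then show "?F u y = ennreal (cc a b) * (indicator (?V (insert y Y)) u * XX m a b u ^ k)"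
 using w by (simp add: av_indicator ennreal_mult' cc_pos[THEN less_imp_le] indicator_inter_arith ennreal_indicator mult_ac)
 qed
 also have "... = ennreal (cc a b) * (NN P (%u. indicator (?V (insert y Y)) u * XX m a b u ^ k))"
 using VY[OF fi] by (intro nn_integral_cmult) auto
 also have "... <= ennreal (cc a b) * ennreal (prob (?V (insert y Y)) * (\<Prod>i<k. (real (card (insert y Y)) + real i) * J))"
 using Suc.prems y by (intro mult_left_mono Suc.IH) auto
 also have "... <= ennreal (cc a b) * ennreal (prob (?V (insert y Y)) * ?Pk)"
 proof (intro mult_left_mono ennreal_leI prod_mono)
 \<comment> \<open>If y already lies in Y the cardinality does not grow, hence an
   inequality.\<close>
 fix i show "0 <= (real (card (insert y Y)) + real i) * J & (real (card (insert y Y)) + real i) * J <= (real (card Y) + 1 + real i) * J"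
 using J card_insert_le_m1[of "Suc (card Y)" Y y] by (auto intro!: mult_right_mono)
 qed auto
 also have "... = ennreal ((cc a b * prob (?V (insert y Y))) * ?Pk)"
 using cc_pos[THEN less_imp_le] Pk by (simp add: ennreal_mult'[symmetric] mult.assoc)
 also have "... <= ennreal ((prob (?V Y) * (\<Sum>z\<in>Y. kern g N y z)) * ?Pk)"
 using Suc.prems y by (intro ennreal_leI mult_right_mono vd_insert_le[OF a ab b] Pk) auto
 also have "... = (\<Sum>z\<in>Y. ennreal (kern g N y z)) * ennreal (prob (?V Y) * ?Pk)"
 by (simp add: sum_ennreal kern_nonneg ennreal_mult'[symmetric] sum_nonneg mult_ac Pk)
 finally show "(NN P (%u. ?F u y)) <= (\<Sum>z\<in>Y. ennreal (kern g N y z)) * ennreal (prob (?V Y) * ?Pk)" .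
 qed
 also have "... = (\<Sum>z\<in>Y. \<integral>\<^sup>+y. ennreal (kern g N y z) \<partial>m) * ennreal (prob (?V Y) * ?Pk)"
 proof -
 have [measurable]: "(%y. kern g N y z) : borel_measurable m" for z
 by (subst measurable_cong_sets[OF m(2) refl]) (intro measurable_restrict_space1 kern_measurable)
 show ?thesis by (simp add: nn_integral_multc nn_integral_sum)
 qed
 also have "... <= (\<Sum>z\<in>Y. ennreal J) * ennreal (prob (?V Y) * ?Pk)"
 using J Suc.prems by (intro mult_right_mono sum_mono) auto
 also have "... = ennreal (prob (?V Y) * ((real (card Y) * J) * ?Pk))"
 using J Pk by (simp add: ennreal_of_nat_eq_real_of_nat ennreal_mult'[symmetric] mult_ac)
 also have "(real (card Y) * J) * ?Pk = (\<Prod>i<Suc k. (real (card Y) + real i) * J)"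
 by (subst prod.lessThan_Suc_shift) (simp add: add_ac)
 finally show ?case .
qed

text \<open>\<open>moment_void\<close> requires a nonempty Y, so the first point is taken out by
  hand; the density there has expectation 1. Starting from one point the factors 1, ..., k produce
  the factorial.\<close>

lemma moment_bound:
 assumes m: "finite_measure m" "sets m = sets S3b"
 and a: "0 < a" "(1/2) ^ N <= a" and ab: "a <= b" and b: "b <= 1"
 and J: "J >= 0" "!!y'. y' : S3 ==> (NN m (%y. ennreal (kern g N y y'))) <= ennreal J"
 shows "(NN P (%u. XX m a b u ^ Suc k)) <= ennreal (measure m S3 * (fact k * J ^ k))"
proof -
 interpret m: finite_measure m by fact
 interpret pair_sigma_finite P m by unfold_locales
 have spm: "space m = S3" using sets_eq_imp_space_eq[OF m(2)] by (simp add: space_S3b)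
 have avm[measurable]: "(%p. av a b (fst p) (snd p)) : borel_measurable (P \<Otimes>\<^sub>M m)"
 by (rule av_measurable_m) fact+
 have [measurable]: "XX m a b : borel_measurable P" by (rule XX_measurable[OF m a(1) b])
 let ?F = "%u y. XX m a b u ^ k * ennreal (cc a b * av a b u y)"
 have "(NN P (%u. XX m a b u ^ Suc k)) = (NN P (%u. \<integral>\<^sup>+y. ?F u y \<partial>m))"
 proof (intro nn_integral_cong)
 fix u assume w: "u : space P"
 have "(%y. av a b u y) : borel_measurable m" using measurable_Pair2[OF avm w] by simp
 then have "(NN m (%y. ?F u y)) = XX m a b u ^ k * XX m a b u"
 unfolding XX_def by (subst nn_integral_cmult) auto
 then show "XX m a b u ^ Suc k = (NN m (%y. ?F u y))" by (simp add: mult_ac)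
 qed
 also have "... = (NN m (%y. \<integral>\<^sup>+u. ?F u y \<partial>P))"
 by (rule Fubini'[symmetric]) (unfold case_prod_beta, measurable)
 also have "... <= (NN m (%y. ennreal (\<Prod>i<k. (1 + real i) * J)))"
 proof (intro nn_integral_mono)
 fix y assume "y : space m"
 then have y: "y : S3" by (simp add: spm)
 have vy: "vd (conR a b y) : sets P" using conR_bdd a b by (intro vd_sets[of _ a]) auto
 have "(NN P (%u. ?F u y)) = (NN P (%u. ennreal (cc a b) * (indicator (vd (\<Union>z\<in>{y}. conR a b z)) u * XX m a b u ^ k)))"
 by (intro nn_integral_cong) (simp add: av_indicator ennreal_mult' cc_pos[THEN less_imp_le] ennreal_indicator mult_ac)
 also have "... = ennreal (cc a b) * (NN P (%u. indicator (vd (\<Union>z\<in>{y}. conR a b z)) u * XX m a b u ^ k))"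
 using vy by (intro nn_integral_cmult) auto
 also have "... <= ennreal (cc a b) * ennreal (prob (vd (\<Union>z\<in>{y}. conR a b z)) * (\<Prod>i<k. (real (card {y}) + real i) * J))"
 using y by (intro mult_left_mono moment_void[OF m a ab b J]) auto
 also have "... = ennreal (cc a b * prob (vd (conR a b y)) * (\<Prod>i<k. (1 + real i) * J))"
 using cc_pos[THEN less_imp_le] by (simp add: ennreal_mult'[symmetric] mult.assoc)
 also have "cc a b * prob (vd (conR a b y)) = 1"
 using vd_prob[OF conR_bdd[OF a(1) b] a(1)] measure_conR[OF a(1) b y] by (simp add: cc_def exp_minus)
 finally show "(NN P (%u. ?F u y)) <= ennreal (\<Prod>i<k. (1 + real i) * J)" by simp
 qed
 also have "... = ennreal (measure m S3 * (\<Prod>i<k. (1 + real i) * J))"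
 using J by (simp add: spm m.emeasure_eq_measure ennreal_mult'[symmetric] prod_nonneg mult.commute)
 also have "(\<Prod>i<k. (1 + real i) * J) = fact k * J ^ k"
 by (induction k) (auto simp: algebra_simps)
 finally show ?thesis .
qed

end

section \<open>Moments of the martingale increments\<close>

lemma power_diff_le:
 fixes x y :: real
 shows "\<bar>x ^ Suc n - y ^ Suc n\<bar> <= real (Suc n) * \<bar>x - y\<bar> * (\<bar>x\<bar> + \<bar>x - y\<bar>) ^ n"
proof -
 have "\<bar>\<Sum>p<Suc n. x ^ p * y ^ (n - p)\<bar> <= (\<Sum>p<Suc n. (\<bar>x\<bar> + \<bar>x - y\<bar>) ^ n)"
 proof (rule order_trans[OF sum_abs sum_mono])
 fix p assume "p : {..<Suc n}"
 then have p: "p + (n - p) = n" by simp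
 have "\<bar>x ^ p * y ^ (n - p)\<bar> = \<bar>x\<bar> ^ p * \<bar>y\<bar> ^ (n - p)" by (simp add: abs_mult power_abs)
 also have "... <= (\<bar>x\<bar> + \<bar>x - y\<bar>) ^ p * (\<bar>x\<bar> + \<bar>x - y\<bar>) ^ (n - p)"
 by (intro mult_mono power_mono) auto
 also have "... = (\<bar>x\<bar> + \<bar>x - y\<bar>) ^ n" by (simp add: power_add[symmetric] p)
 finally show "\<bar>x ^ p * y ^ (n - p)\<bar> <= (\<bar>x\<bar> + \<bar>x - y\<bar>) ^ n" .
 qed
 also have "... = real (Suc n) * (\<bar>x\<bar> + \<bar>x - y\<bar>) ^ n" by simp
 finally have "\<bar>x - y\<bar> * \<bar>\<Sum>p<Suc n. x ^ p * y ^ (n - p)\<bar> <= \<bar>x - y\<bar> * (real (Suc n) * (\<bar>x\<bar> + \<bar>x - y\<bar>) ^ n)"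
 by (intro mult_left_mono) auto
 then show ?thesis unfolding diff_power_eq_sum abs_mult by (simp add: mult_ac)
qed

lemma power_sum_le:
 fixes x y :: real assumes "x >= 0" "y >= 0"
 shows "(x + y) ^ n <= 2 ^ n * (x ^ n + y ^ n)"
proof -
 have "(x + y) ^ n <= (2 * max x y) ^ n" using assms by (intro power_mono) auto
 also have "... = 2 ^ n * (max x y) ^ n" by (simp add: power_mult_distrib)
 also have "(max x y) ^ n <= x ^ n + y ^ n" using assms by (auto simp: max_def)
 finally show ?thesis by simp
qed

text \<open>With s = (t + k)^2, either s dominates a large multiple Q of q, and then q s^n is a
  small part of s^(n+1), or q s^n is at most Q^(n+1). The weight 1/2 lets
  \<open>increment_moment\<close> absorb the moment on its own left-hand side.\<close>

lemma young_split:
 fixes t k q :: real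
 assumes "t >= 0" "k >= 0" "q >= 0"
 shows "q * (t + k) ^ (2 * n) <= (t ^ (2 * Suc n) + k ^ (2 * Suc n)) / 2 + (2 * 4 ^ Suc n * q) ^ Suc n"
proof -
 define s where "s = (t + k)\<^sup>2"
 define Q where "Q = 2 * 4 ^ Suc n * q"
 have s: "s >= 0" and Q: "Q >= 0" using assms by (auto simp: s_def Q_def)
 have sn: "(t + k) ^ (2 * n) = s ^ n" by (simp add: s_def power_mult)
 have "s ^ Suc n = (t + k) ^ (2 * Suc n)" by (simp only: s_def power_mult)
 also have "... <= 2 ^ (2 * Suc n) * (t ^ (2 * Suc n) + k ^ (2 * Suc n))" using assms by (intro power_sum_le)
 also have "2 ^ (2 * Suc n) = (4::real) ^ Suc n" by (simp only: power_mult) simp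
 finally have s1: "s ^ Suc n <= 4 ^ Suc n * (t ^ (2 * Suc n) + k ^ (2 * Suc n))" .
 have tk: "0 <= t ^ (2 * Suc n) + k ^ (2 * Suc n)" using assms by simp
 show ?thesis
 proof (cases "Q <= s")
 case True
 have "Q * s ^ n <= s * s ^ n" using True s by (intro mult_right_mono) auto
 also have "... <= 4 ^ Suc n * (t ^ (2 * Suc n) + k ^ (2 * Suc n))" using s1 by simp
 finally have "4 ^ Suc n * (2 * (q * s ^ n)) <= 4 ^ Suc n * (t ^ (2 * Suc n) + k ^ (2 * Suc n))"
 by (simp add: Q_def mult_ac)
 then have "2 * (q * s ^ n) <= t ^ (2 * Suc n) + k ^ (2 * Suc n)"
 by (subst (asm) mult_le_cancel_left_pos) auto
 moreover have "0 <= Q ^ Suc n" using Q by simp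
 moreover have "x <= y / 2 + z" if "2 * x <= y" "0 <= z" for x y z :: real using that by simp
 ultimately show ?thesis unfolding sn Q_def[symmetric] by blast
 next
 case False
 have "(1::real) <= 2 * 4 ^ Suc n" using one_le_power[of "4::real" "Suc n"] by linarith
 then have "1 * q <= Q" unfolding Q_def using assms by (intro mult_right_mono) auto
 then have "q * s ^ n <= Q * Q ^ n" using False s assms Q by (intro mult_mono power_mono) auto
 then have "q * s ^ n <= Q ^ Suc n" by simp
 moreover have "x <= y / 2 + z" if "x <= z" "0 <= y" for x y z :: real using that by simp
 ultimately show ?thesis unfolding sn Q_def[symmetric] using tk by blast
 qed
qed

context cutout_process
begin

text \<open>The change of the normalised density at y when the radii in [a', a[ are added, a
  martingale difference.\<close>

definition xi :: "real => real => real => 'w => c2 => real" where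
 "xi a' a b w y = cc a' b * av a' b w y - cc a b * av a b w y"

definition DD :: "c2 measure => real => real => real => 'w => real" where
 "DD m a' a b w = (\<integral>y. xi a' a b w y \<partial>m)"

definition XR :: "c2 measure => real => real => 'w => real" where
 "XR m a b w = (\<integral>y. cc a b * av a b w y \<partial>m)"

lemma conR_split: "a' <= a ==> a <= b ==> conR a' b y = conR a b y Un conR a' a y"
 by (auto simp: conR_def)

lemma conR_split_disjoint: "conR a b y Int conR a' a z = {}"
 by (auto simp: conR_def)

lemma cc_split:
 assumes "0 < a'" "a' <= a" "a <= b" "b <= 1" shows "cc a' b = cc a b * cc a' a"
proof -
 have "ell a' b = ell a b + ell a' a"
 unfolding ell_def conR_split[OF assms(2,3)]
 using assms by (intro measure_bdd_Un[of _ a'] conR_bdd bdd_sets_mono[OF conR_bdd, of a b a'])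
 (auto simp: conR_split_disjoint)
 then show ?thesis by (simp add: cc_def exp_add)
qed

lemma cc_mono: "0 < a' ==> a' <= a ==> a <= b ==> b <= 1 ==> cc a b <= cc a' b"
 using cc_split[of a' a b] cc_ge_1[of a' a] cc_pos[of a b] by simp

lemma abs_xi_le:
 assumes "0 < a'" "a' <= a" "a <= b" "b <= 1" shows "\<bar>xi a' a b w y\<bar> <= cc a' b"
proof -
 have "0 <= cc a' b * av a' b w y" "cc a' b * av a' b w y <= cc a' b"
 using cc_pos[of a' b] av_nonneg[of a' b w y] av_le_1[of a' b w y] by (auto intro: mult_left_le)
 moreover have "0 <= cc a b * av a b w y" "cc a b * av a b w y <= cc a b"
 using cc_pos[of a b] av_nonneg[of a b w y] av_le_1[of a b w y] by (auto intro: mult_left_le)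
 ultimately show ?thesis using cc_mono[OF assms] by (simp add: xi_def abs_le_iff)
qed

lemma xi_measurable:
 assumes "sets m = sets S3b" "0 < a'" "0 < a" "b <= 1"
 shows "(%p. xi a' a b (fst p) (snd p)) : borel_measurable (P \<Otimes>\<^sub>M m)"
proof -
 note [measurable] = av_measurable_m[OF assms(1,2,4)] av_measurable_m[OF assms(1,3,4)]
 show ?thesis unfolding xi_def by measurable
qed

lemma near_sets: "{z : S3. dvis y z < r} : sets S3b"
 using vball_S3b[of y r] by (simp add: vball_def)

lemma far_sets: "{z : S3. r <= dvis y z} : sets S3b"
proof -
 have "{z : S3. r <= dvis y z} = S3 - vball y r" by (auto simp: vball_def)
 then show ?thesis by (auto intro: borel_sub_S3b)
qed

text \<open>Conditionally on everything that happens away from y, the increment at y has mean zero.\<close>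
lemma xi_orthogonal:
 assumes m: "finite_measure m" "sets m = sets S3b"
 and a: "0 < a'" "a' <= a" "a <= b" "b <= 1" and y: "y : S3"
 and B: "B : bdd_sets a'" "B Int conR a' a y = {}"
 shows "(\<integral>w. indicator (vd B) w * xi a' a b w y *
 (\<integral>z. indicator {z : S3. 2 * a <= dvis y z} z * xi a' a b w z \<partial>m) ^ j \<partial>P) = 0"
 using B
proof (induction j arbitrary: B)
 case 0
 have C: "conR a b y : bdd_sets a'" "conR a' b y : bdd_sets a'" "conR a' a y : bdd_sets a'"
 using a by (auto intro: conR_bdd bdd_sets_mono[OF conR_bdd, of a b a'])
 have s1: "vd (B Un conR a' b y) : sets P" "vd (B Un conR a b y) : sets P"
 using 0 C a by (auto intro!: vd_sets[of _ a'] bdd_sets_Un)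
 have "(\<integral>w. indicator (vd B) w * xi a' a b w y \<partial>P)
 = (\<integral>w. cc a' b * indicator (vd (B Un conR a' b y)) w - cc a b * indicator (vd (B Un conR a b y)) w \<partial>P)"
 by (intro Bochner_Integration.integral_cong)
 (auto simp: xi_def av_indicator vd_Un indicator_inter_arith algebra_simps)
 also have "... = cc a' b * prob (vd (B Un conR a' b y)) - cc a b * prob (vd (B Un conR a b y))"
 using s1 by (subst Bochner_Integration.integral_diff) (auto intro!: integrable_real_indicator integrable_mult_right simp: emeasure_eq_measure)
 \<comment> \<open>B does not meet \<open>conR a' a y\<close>, so the new radii contribute an
   independent factor, which the ratio of the normalisations cancels.\<close>
 also have "prob (vd (B Un conR a' b y)) = prob (vd (B Un conR a b y)) * exp (- ell a' a)"
 proof -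
 have "measure (intensity \<gamma>) ((B Un conR a b y) Un conR a' a y) = measure (intensity \<gamma>) (B Un conR a b y) + ell a' a"
 using 0 C a y conR_split_disjoint[of a b y a' y] measure_conR[of a' a y]
 by (subst measure_bdd_Un[of _ a']) (auto intro: bdd_sets_Un)
 moreover have "(B Un conR a b y) Un conR a' a y = B Un conR a' b y" using conR_split[of a' a b y] a by auto
 ultimately show ?thesis
 using 0 C a by (simp add: vd_prob[of _ a'] bdd_sets_Un exp_add[symmetric])
 qed
 also have "cc a' b * (prob (vd (B Un conR a b y)) * exp (- ell a' a)) - cc a b * prob (vd (B Un conR a b y)) = 0"
 unfolding cc_split[OF a] by (simp add: cc_def exp_minus)
 finally show ?case by simp
next
 case (Suc j)
 interpret m: finite_measure m by fact
 interpret pair_sigma_finite P m by unfold_locales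
 interpret Pm: finite_measure "P \<Otimes>\<^sub>M m" by (rule finite_measure_pair_measure) unfold_locales
 have spm: "space m = S3" using sets_eq_imp_space_eq[OF m(2)] by (simp add: space_S3b)
 let ?far = "{z : S3. 2 * a <= dvis y z}"
 let ?c = "cc a' b"
 have far[measurable]: "?far : sets m" unfolding m(2) by (rule far_sets)
 have xm[measurable]: "(%p. xi a' a b (fst p) (snd p)) : borel_measurable (P \<Otimes>\<^sub>M m)"
 using a by (intro xi_measurable m) auto
 have [measurable]: "(%w. xi a' a b w y) : borel_measurable P"
 using measurable_Pair1[OF xm, of y] y by (simp add: spm)
 have [measurable]: "vd B : sets P" using Suc.prems a by (intro vd_sets[of _ a']) auto
 define F where "F w = (\<integral>z. indicator ?far z * xi a' a b w z \<partial>m)" for w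
 have "(%(w, z). indicator ?far z * xi a' a b w z) : borel_measurable (P \<Otimes>\<^sub>M m)"
 unfolding case_prod_beta by measurable
 then have Fm[measurable]: "F : borel_measurable P" unfolding F_def[abs_def]
 by (rule m.borel_measurable_lebesgue_integral)
 have xb: "\<bar>xi a' a b w z\<bar> <= ?c" for w z by (rule abs_xi_le[OF a])
 have Fb: "\<bar>F w\<bar> <= ?c * measure m S3" for w
 proof -
 have "\<bar>F w\<bar> <= (\<integral>z. ?c \<partial>m)"
 unfolding F_def
 proof (rule order_trans[OF integral_abs_bound integral_mono'])
 show "\<bar>indicator ?far z * xi a' a b w z\<bar> <= ?c" for z
 using xb[of w z] cc_pos[of a' b] by (auto simp: indicator_def)
 qed (use cc_pos[of a' b] in auto)
 then show ?thesis by (simp add: spm mult.commute)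
 qed
 define H where "H w z = indicator (vd B) w * xi a' a b w y * F w ^ j * (indicator ?far z * xi a' a b w z)" for w z
 have Hm[measurable]: "(%p. H (fst p) (snd p)) : borel_measurable (P \<Otimes>\<^sub>M m)" unfolding H_def by measurable
 have Hb: "\<bar>H w z\<bar> <= ?c * (?c * measure m S3) ^ j * ?c" for w z
 proof -
 have "\<bar>indicator (vd B) w * xi a' a b w y\<bar> <= ?c" using xb[of w y] cc_pos[of a' b] by (auto simp: indicator_def)
 moreover have "\<bar>F w ^ j\<bar> <= (?c * measure m S3) ^ j" unfolding power_abs using Fb by (intro power_mono) auto
 moreover have "\<bar>indicator ?far z * xi a' a b w z\<bar> <= ?c" using xb[of w z] cc_pos[of a' b] by (auto simp: indicator_def)
 ultimately show ?thesis unfolding H_def abs_mult[of "_ * _ ^ _"] abs_mult[of _ "_ ^ _"] 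
 using cc_pos[of a' b] by (intro mult_mono) auto
 qed
 have "(\<integral>w. indicator (vd B) w * xi a' a b w y * F w ^ Suc j \<partial>P) = (\<integral>w. \<integral>z. H w z \<partial>m \<partial>P)"
 unfolding H_def integral_mult_right_zero F_def[symmetric] power_Suc2 mult.assoc ..
 also have "... = (\<integral>z. \<integral>w. H w z \<partial>P \<partial>m)"
 proof (rule Fubini_integral[symmetric])
 show "integrable (P \<Otimes>\<^sub>M m) (case_prod H)"
 by (rule Pm.integrable_const_bound[of _ "?c * (?c * measure m S3) ^ j * ?c"])
 (use Hb Hm in \<open>auto simp: case_prod_beta\<close>)
 qed
 also have "... = (\<integral>z. 0 \<partial>m)"
 proof (intro Bochner_Integration.integral_cong refl)
 fix z assume "z : space m"
 then have z: "z : S3" by (simp add: spm)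
 show "(\<integral>w. H w z \<partial>P) = 0"
 proof (cases "z : ?far")
 case False then show ?thesis by (simp add: H_def)
 next
 case True
 \<comment> \<open>The factor at z is a combination of two survival indicators, which are absorbed
   into the event \<open>vd B\<close>. The induction hypothesis still applies because a ball of
   radius below a cannot cover both y and a point z at distance at least 2 a.\<close>
 have C: "conR a b z : bdd_sets a'" "conR a' b z : bdd_sets a'"
 using a by (auto intro: conR_bdd bdd_sets_mono[OF conR_bdd, of a b a'])
 have dis: "conR a b z Int conR a' a y = {}" by (rule conR_split_disjoint)
 have dis': "conR a' b z Int conR a' a y = {}"
 proof (rule ccontr)
 assume "conR a' b z Int conR a' a y ~= {}"
 then obtain p where p: "p : conR a' b z" "p : conR a' a y" by blast
 have "dvis y z <= dvis y (fst p) + dvis (fst p) z" using p y z by (intro dvis_triangle) (auto simp: conR_def)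
 then have "dvis y z < 2 * a" using p by (auto simp: conR_def dvis_sym[of y])
 then show False using True by simp
 qed
 define G where "G B w = indicator (vd B) w * xi a' a b w y * F w ^ j" for B w
 have Gi: "integrable P (G B')" if "B' : bdd_sets a'" for B'
 proof (rule integrable_const_bound[of _ "?c * (?c * measure m S3) ^ j"])
 have [measurable]: "vd B' : sets P" using that a by (intro vd_sets[of _ a']) auto
 show "G B' : borel_measurable P" unfolding G_def[abs_def] by measurable
 have "\<bar>indicator (vd B') w * xi a' a b w y\<bar> <= ?c" for w using xb[of w y] cc_pos[of a' b] by (auto simp: indicator_def)
 moreover have "\<bar>F w ^ j\<bar> <= (?c * measure m S3) ^ j" for w unfolding power_abs using Fb by (intro power_mono) auto
 ultimately show "AE w in P. norm (G B' w) <= ?c * (?c * measure m S3) ^ j"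
 unfolding G_def real_norm_def abs_mult[of _ "_ ^ _"] using cc_pos[of a' b] by (intro AE_I2 mult_mono) auto
 qed
 have "(\<integral>w. H w z \<partial>P) = (\<integral>w. cc a' b * G (B Un conR a' b z) w - cc a b * G (B Un conR a b z) w \<partial>P)"
 using True by (intro Bochner_Integration.integral_cong)
 (auto simp: H_def G_def xi_def[of _ _ _ _ z] av_indicator vd_Un indicator_inter_arith algebra_simps)
 also have "... = cc a' b * (\<integral>w. G (B Un conR a' b z) w \<partial>P) - cc a b * (\<integral>w. G (B Un conR a b z) w \<partial>P)"
 using Suc.prems C by (subst Bochner_Integration.integral_diff) (auto intro!: integrable_mult_right Gi bdd_sets_Un)
 also have "... = 0"
 using Suc.IH[of "B Un conR a' b z"] Suc.IH[of "B Un conR a b z"] Suc.prems C dis dis'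
 by (simp add: G_def F_def bdd_sets_Un Int_Un_distrib2)
 finally show ?thesis .
 qed
 qed
 finally show ?case by (simp add: F_def)
qed

lemma XR_XX:
 assumes m: "finite_measure m" "sets m = sets S3b" and a: "0 < a" "b <= 1" and w: "u : space P"
 shows "ennreal (XR m a b u) = XX m a b u" "XR m a b u >= 0"
proof -
 interpret m: finite_measure m by fact
 have [measurable]: "(%y. av a b u y) : borel_measurable m"
 using measurable_Pair2[OF av_measurable_m[OF m(2) a] w] by simp
 have "integrable m (%y. cc a b * av a b u y)"
 using cc_pos[of a b] av_le_1 av_nonneg
 by (intro m.integrable_const_bound[of _ "cc a b"]) (auto simp: abs_mult intro!: mult_left_le)
 then show "ennreal (XR m a b u) = XX m a b u"
 unfolding XX_def XR_def using cc_pos[of a b] av_nonneg by (intro nn_integral_eq_integral[symmetric]) auto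
 show "XR m a b u >= 0" unfolding XR_def using cc_pos[of a b] av_nonneg by (intro integral_nonneg_AE) auto
qed

lemma DD_eq_XR_diff:
 assumes m: "finite_measure m" "sets m = sets S3b" and a: "0 < a'" "a' <= a" "a <= b" "b <= 1" and w: "u : space P"
 shows "DD m a' a b u = XR m a' b u - XR m a b u"
proof -
 interpret m: finite_measure m by fact
 have "integrable m (%y. cc a b * av a b u y)" if "0 < a" for a
 proof -
 have [measurable]: "(%y. av a b u y) : borel_measurable m"
 using measurable_Pair2[OF av_measurable_m[OF m(2) that a(4)] w] by simp
 show ?thesis using cc_pos[of a b] av_le_1 av_nonneg
 by (intro m.integrable_const_bound[of _ "cc a b"]) (auto simp: abs_mult intro!: mult_left_le)
 qed
 then show ?thesis using a unfolding DD_def XR_def xi_def by (intro Bochner_Integration.integral_diff) auto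
qed

text \<open>In D^(2n+2) one factor is written as an integral over y, and in the others D is replaced
  by F, the part of D coming from points at distance at least 2 a from y. By
  \<open>xi_orthogonal\<close> the main term vanishes; the error is controlled by |D - F| \<le> d, a
  bound for the normalised mass near y. \<open>young_split\<close> moves half of the moment of D to
  the left, and what remains are moments of total masses, known from
  \<open>moment_bound\<close>.\<close>

lemma increment_moment:
 assumes m: "finite_measure m" "sets m = sets S3b"
 and a: "0 < a'" "a' <= a" "a <= b" "b <= 1" and N: "(1/2) ^ N <= a'"
 and J: "J >= 0" "!!y'. y' : S3 ==> (NN m (%y. ennreal (kern g N y y'))) <= ennreal J" "measure m S3 <= J"
 and d: "d >= 0" "!!y. y : S3 ==> cc a' b * measure m {z : S3. dvis y z < 2 * a} <= d"
 shows "(\<integral>u. DD m a' a b u ^ (2 * Suc n) \<partial>P)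
 <= d ^ (2 * Suc n) + 4 * (2 * 4 ^ Suc n * real (2 * n + 1) * d) ^ Suc n * (2 ^ Suc n * (fact n * J ^ Suc n))"
proof -
 interpret m: finite_measure m by fact
 interpret pair_sigma_finite P m by unfold_locales
 interpret Pm: finite_measure "P \<Otimes>\<^sub>M m" by (rule finite_measure_pair_measure) unfold_locales
 have spm: "space m = S3" using sets_eq_imp_space_eq[OF m(2)] by (simp add: space_S3b)
 let ?c = "cc a' b" and ?D = "DD m a' a b" and ?p = "real (2 * n + 1)"
 let ?xi = "xi a' a b"
 have c: "?c > 0" by (rule cc_pos)
 have xm[measurable]: "(%p. ?xi (fst p) (snd p)) : borel_measurable (P \<Otimes>\<^sub>M m)"
 using a by (intro xi_measurable m) auto
 have xb: "\<bar>?xi u z\<bar> <= ?c" for u z by (rule abs_xi_le[OF a])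
 have xm2: "?xi u : borel_measurable m" if "u : space P" for u using measurable_Pair2[OF xm that] by simp
 have xi: "integrable m (?xi u)" if "u : space P" for u
 using xm2[OF that] xb by (intro m.integrable_const_bound[of _ ?c]) auto
 have Dm[measurable]: "?D : borel_measurable P" unfolding DD_def[abs_def]
 by (rule m.borel_measurable_lebesgue_integral) (use xm in \<open>simp add: case_prod_beta\<close>)
 define X' where "X' u = (\<integral>z. \<bar>?xi u z\<bar> \<partial>m)" for u
 have X'm[measurable]: "X' : borel_measurable P" unfolding X'_def[abs_def]
 by (rule m.borel_measurable_lebesgue_integral) (unfold case_prod_beta, measurable)
 have X'0: "X' u >= 0" for u unfolding X'_def by (intro integral_nonneg_AE) auto
 have X'b: "X' u <= ?c * measure m S3" if "u : space P" for u
 proof -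
 have "X' u <= (\<integral>z. ?c \<partial>m)" unfolding X'_def using xi[OF that] xb by (intro integral_mono integrable_abs) auto
 then show ?thesis by (simp add: spm mult.commute)
 qed
 have DX: "\<bar>?D u\<bar> <= X' u" for u unfolding DD_def X'_def by (rule integral_abs_bound)
 have Db: "\<bar>?D u\<bar> <= ?c * measure m S3" if "u : space P" for u using DX[of u] X'b[OF that] by linarith
 let ?M = "?c * measure m S3"
 have M0: "?M >= 0" using c by simp
 have bndint: "integrable P f" if "f : borel_measurable P" "!!u. u : space P ==> \<bar>f u\<bar> <= K" for f :: "'w => real" and K
 using that by (intro integrable_const_bound[of _ K]) auto
 have Dint: "integrable P (%u. ?D u ^ k)" for k
 proof (rule bndint[of _ "?M ^ k"])
 show "\<bar>?D u ^ k\<bar> <= ?M ^ k" if "u : space P" for u unfolding power_abs using Db[OF that] by (intro power_mono) auto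
 qed measurable
 \<comment> \<open>The bound of \<open>power_diff_le\<close> for the error D^(2n+1) - F^(2n+1);
   unlike F it does not depend on y.\<close>
 define S where "S u = ?p * d * (\<bar>?D u\<bar> + d) ^ (2 * n)" for u
 have S0: "S u >= 0" for u using d by (simp add: S_def)
 have Sm[measurable]: "S : borel_measurable P" unfolding S_def[abs_def] by measurable
 have Sb: "S u <= ?p * d * (?M + d) ^ (2 * n)" if "u : space P" for u
 unfolding S_def using d Db[OF that] by (intro mult_left_mono power_mono) auto
 have "(\<integral>u. ?D u ^ (2 * Suc n) \<partial>P) = (\<integral>u. \<integral>z. ?xi u z * ?D u ^ (2*n+1) \<partial>m \<partial>P)"
 by (simp add: DD_def)
 also have "... = (\<integral>z. \<integral>u. ?xi u z * ?D u ^ (2*n+1) \<partial>P \<partial>m)"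
 proof (rule Fubini_integral[symmetric])
 have "\<bar>?xi u z * ?D u ^ (2*n+1)\<bar> <= ?c * ?M ^ (2*n+1)" if "u : space P" for u z
 unfolding abs_mult power_abs using xb Db[OF that] c by (intro mult_mono power_mono) auto
 then show "integrable (P \<Otimes>\<^sub>M m) (%(u, z). ?xi u z * ?D u ^ (2*n+1))"
 by (intro Pm.integrable_const_bound[of _ "?c * ?M ^ (2*n+1)"])
 (auto simp: case_prod_beta space_pair_measure intro!: AE_I2)
 qed
 also have "... <= (\<integral>z. \<integral>u. \<bar>?xi u z\<bar> * S u \<partial>P \<partial>m)"
 proof (rule integral_mono)
 have i1: "integrable (P \<Otimes>\<^sub>M m) (%(u, z). ?xi u z * ?D u ^ (2*n+1))"
 proof -
 have "\<bar>?xi u z * ?D u ^ (2*n+1)\<bar> <= ?c * ?M ^ (2*n+1)" if "u : space P" for u z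
 unfolding abs_mult power_abs using xb Db[OF that] c by (intro mult_mono power_mono) auto
 then show ?thesis
 by (intro Pm.integrable_const_bound[of _ "?c * ?M ^ (2*n+1)"])
 (auto simp: case_prod_beta space_pair_measure intro!: AE_I2)
 qed
 show "integrable m (%z. \<integral>u. ?xi u z * ?D u ^ (2*n+1) \<partial>P)"
 using integrable_snd[OF i1] by simp
 have i2: "integrable (P \<Otimes>\<^sub>M m) (%(u, z). \<bar>?xi u z\<bar> * S u)"
 proof -
 have "\<bar>\<bar>?xi u z\<bar> * S u\<bar> <= ?c * (?p * d * (?M + d) ^ (2 * n))" if "u : space P" for u z
 unfolding abs_mult using xb Sb[OF that] S0 c by (intro mult_mono) (auto simp: abs_of_nonneg)
 then show ?thesis
 by (intro Pm.integrable_const_bound[of _ "?c * (?p * d * (?M + d) ^ (2 * n))"])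
 (auto simp: case_prod_beta space_pair_measure intro!: AE_I2)
 qed
 show "integrable m (%z. \<integral>u. \<bar>?xi u z\<bar> * S u \<partial>P)" using integrable_snd[OF i2] by simp
 fix y assume "y : space m"
 then have y: "y : S3" by (simp add: spm)
 let ?far = "{z : S3. 2 * a <= dvis y z}"
 have far[measurable]: "?far : sets m" unfolding m(2) by (rule far_sets)
 have near: "{z : S3. dvis y z < 2 * a} : sets m" unfolding m(2) by (rule near_sets)
 define F where "F u = (\<integral>z. indicator ?far z * ?xi u z \<partial>m)" for u
 have [measurable]: "(%u. ?xi u y) : borel_measurable P"
 using measurable_Pair1[OF xm, of y] y by (simp add: spm)
 have [measurable]: "F : borel_measurable P" unfolding F_def[abs_def]
 by (rule m.borel_measurable_lebesgue_integral) (unfold case_prod_beta, measurable)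
 have DF: "\<bar>?D u - F u\<bar> <= d" if w: "u : space P" for u
 proof -
 have i: "integrable m (%z. indicator ?far z * ?xi u z)"
 using integrable_real_mult_indicator[OF far xi[OF w]] by (simp add: mult.commute)
 have "?D u - F u = (\<integral>z. ?xi u z - indicator ?far z * ?xi u z \<partial>m)"
 unfolding DD_def F_def using xi[OF w] i by simp
 also have "\<bar>...\<bar> <= (\<integral>z. ?c * indicator {z : S3. dvis y z < 2 * a} z \<partial>m)"
 proof (rule order_trans[OF integral_abs_bound integral_mono])
 show "integrable m (%z. \<bar>?xi u z - indicator ?far z * ?xi u z\<bar>)" using xi[OF w] i by (intro integrable_abs) simp
 show "integrable m (%z. ?c * indicator {z : S3. dvis y z < 2 * a} z)"
 using near by (intro integrable_mult_right integrable_real_indicator) (auto simp: m.emeasure_eq_measure)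
 show "\<bar>?xi u z - indicator ?far z * ?xi u z\<bar> <= ?c * indicator {z : S3. dvis y z < 2 * a} z" if "z : space m" for z
 using that xb[of u z] by (auto simp: spm indicator_def)
 qed
 also have "... = ?c * measure m {z : S3. dvis y z < 2 * a}" using near by simp
 also have "... <= d" by (rule d(2)[OF y])
 finally show ?thesis .
 qed
 have Fb: "\<bar>F u\<bar> <= ?M + d" if "u : space P" for u using DF[OF that] Db[OF that] by linarith
 \<comment> \<open>The empty set in place of B, so that no event is imposed.\<close>
 have z0: "(\<integral>u. ?xi u y * F u ^ (2*n+1) \<partial>P) = 0"
 using xi_orthogonal[OF m a y bdd_sets_empty, of "2*n+1"] 
 by (simp add: vd_def F_def cong: Bochner_Integration.integral_cong)
 have i3: "integrable P (%u. ?xi u y * F u ^ (2*n+1))"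
 proof (rule bndint[of _ "?c * (?M + d) ^ (2*n+1)"])
 show "\<bar>?xi u y * F u ^ (2*n+1)\<bar> <= ?c * (?M + d) ^ (2*n+1)" if "u : space P" for u
 unfolding abs_mult power_abs using xb Fb[OF that] c by (intro mult_mono power_mono) auto
 qed measurable
 have i4: "integrable P (%u. ?xi u y * ?D u ^ (2*n+1))"
 proof (rule bndint[of _ "?c * ?M ^ (2*n+1)"])
 show "\<bar>?xi u y * ?D u ^ (2*n+1)\<bar> <= ?c * ?M ^ (2*n+1)" if "u : space P" for u
 unfolding abs_mult power_abs using xb Db[OF that] c by (intro mult_mono power_mono) auto
 qed measurable
 have "(\<integral>u. ?xi u y * ?D u ^ (2*n+1) \<partial>P) = (\<integral>u. ?xi u y * ?D u ^ (2*n+1) - ?xi u y * F u ^ (2*n+1) \<partial>P)"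
 using i3 i4 z0 by simp
 also have "... <= (\<integral>u. \<bar>?xi u y\<bar> * S u \<partial>P)"
 proof (rule integral_mono)
 show "integrable P (%u. ?xi u y * ?D u ^ (2*n+1) - ?xi u y * F u ^ (2*n+1))" using i3 i4 by simp
 show "integrable P (%u. \<bar>?xi u y\<bar> * S u)"
 proof (rule bndint[of _ "?c * (?p * d * (?M + d) ^ (2 * n))"])
 show "\<bar>\<bar>?xi u y\<bar> * S u\<bar> <= ?c * (?p * d * (?M + d) ^ (2 * n))" if "u : space P" for u
 unfolding abs_mult using xb Sb[OF that] S0 c by (intro mult_mono) (auto simp: abs_of_nonneg)
 qed measurable
 fix u assume w: "u : space P"
 have "\<bar>?D u ^ Suc (2*n) - F u ^ Suc (2*n)\<bar> <= real (Suc (2*n)) * \<bar>?D u - F u\<bar> * (\<bar>?D u\<bar> + \<bar>?D u - F u\<bar>) ^ (2*n)"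
 by (rule power_diff_le)
 also have "... <= real (Suc (2*n)) * d * (\<bar>?D u\<bar> + d) ^ (2*n)"
 using DF[OF w] d by (intro mult_mono power_mono) auto
 also have "... = S u" by (simp add: S_def)
 finally have dS: "\<bar>?D u ^ (2*n+1) - F u ^ (2*n+1)\<bar> <= S u" by simp
 have "?xi u y * (?D u ^ (2*n+1) - F u ^ (2*n+1)) <= \<bar>?xi u y * (?D u ^ (2*n+1) - F u ^ (2*n+1))\<bar>"
 by (rule abs_ge_self)
 also have "... = \<bar>?xi u y\<bar> * \<bar>?D u ^ (2*n+1) - F u ^ (2*n+1)\<bar>" by (rule abs_mult)
 also have "... <= \<bar>?xi u y\<bar> * S u" using dS by (rule mult_left_mono) simp
 finally have "?xi u y * (?D u ^ (2*n+1) - F u ^ (2*n+1)) <= \<bar>?xi u y\<bar> * S u" .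
 then show "?xi u y * ?D u ^ (2*n+1) - ?xi u y * F u ^ (2*n+1) <= \<bar>?xi u y\<bar> * S u"
 by (simp add: right_diff_distrib)
 qed
 finally show "(\<integral>u. ?xi u y * ?D u ^ (2*n+1) \<partial>P) <= (\<integral>u. \<bar>?xi u y\<bar> * S u \<partial>P)" .
 qed
 also have "... = (\<integral>u. \<integral>z. \<bar>?xi u z\<bar> * S u \<partial>m \<partial>P)"
 proof (rule Fubini_integral)
 have "\<bar>\<bar>?xi u z\<bar> * S u\<bar> <= ?c * (?p * d * (?M + d) ^ (2 * n))" if "u : space P" for u z
 unfolding abs_mult using xb Sb[OF that] S0 c by (intro mult_mono) (auto simp: abs_of_nonneg)
 then show "integrable (P \<Otimes>\<^sub>M m) (%(u, z). \<bar>?xi u z\<bar> * S u)"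
 by (intro Pm.integrable_const_bound[of _ "?c * (?p * d * (?M + d) ^ (2 * n))"])
 (auto simp: case_prod_beta space_pair_measure intro!: AE_I2)
 qed
 also have "... = (\<integral>u. X' u * S u \<partial>P)" by (simp add: X'_def)
 also have "... <= (\<integral>u. (?D u ^ (2 * Suc n) + d ^ (2 * Suc n)) / 2 + (2 * 4 ^ Suc n * ?p * d) ^ Suc n * X' u ^ Suc n \<partial>P)"
 proof (rule integral_mono)
 show "integrable P (%u. X' u * S u)"
 proof (rule bndint[of _ "?M * (?p * d * (?M + d) ^ (2 * n))"])
 show "\<bar>X' u * S u\<bar> <= ?M * (?p * d * (?M + d) ^ (2 * n))" if "u : space P" for u
 unfolding abs_mult using X'b[OF that] X'0 Sb[OF that] S0 M0 by (intro mult_mono) (auto simp: abs_of_nonneg)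
 qed measurable
 have "integrable P (%u. X' u ^ Suc n)"
 proof (rule bndint[of _ "?M ^ Suc n"])
 show "\<bar>X' u ^ Suc n\<bar> <= ?M ^ Suc n" if "u : space P" for u
 unfolding power_abs using X'b[OF that] X'0[of u] by (intro power_mono) auto
 qed measurable
 then show "integrable P (%u. (?D u ^ (2 * Suc n) + d ^ (2 * Suc n)) / 2 + (2 * 4 ^ Suc n * ?p * d) ^ Suc n * X' u ^ Suc n)"
 by (intro Bochner_Integration.integrable_add integrable_divide integrable_mult_right Dint integrable_const)
 fix u
 have "X' u * S u = (?p * d * X' u) * (\<bar>?D u\<bar> + d) ^ (2 * n)" by (simp add: S_def)
 also have "... <= (\<bar>?D u\<bar> ^ (2 * Suc n) + d ^ (2 * Suc n)) / 2 + (2 * 4 ^ Suc n * (?p * d * X' u)) ^ Suc n"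
 using d X'0 by (intro young_split) auto
 also have "\<bar>?D u\<bar> ^ (2 * Suc n) = ?D u ^ (2 * Suc n)" by (rule power_even_abs) simp
 also have "(2 * 4 ^ Suc n * (?p * d * X' u)) ^ Suc n = (2 * 4 ^ Suc n * ?p * d) ^ Suc n * X' u ^ Suc n"
 by (simp only: mult.assoc[symmetric] power_mult_distrib)
 finally show "X' u * S u <= (?D u ^ (2 * Suc n) + d ^ (2 * Suc n)) / 2 + (2 * 4 ^ Suc n * ?p * d) ^ Suc n * X' u ^ Suc n" .
 qed
 also have "... = ((\<integral>u. ?D u ^ (2 * Suc n) \<partial>P) + d ^ (2 * Suc n)) / 2 + (2 * 4 ^ Suc n * ?p * d) ^ Suc n * (\<integral>u. X' u ^ Suc n \<partial>P)"
 proof -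
 have "integrable P (%u. X' u ^ Suc n)"
 proof (rule bndint[of _ "?M ^ Suc n"])
 show "\<bar>X' u ^ Suc n\<bar> <= ?M ^ Suc n" if "u : space P" for u
 unfolding power_abs using X'b[OF that] X'0[of u] by (intro power_mono) auto
 qed measurable
 then show ?thesis using Dint[of "2 * Suc n"] by (simp add: prob_space del: power_Suc mult_Suc_right)
 qed
 \<comment> \<open>Half of the moment on the right is subtracted, which is legitimate because D is
   bounded and the moment therefore finite.\<close>
 finally have main: "(\<integral>u. ?D u ^ (2 * Suc n) \<partial>P) <= d ^ (2 * Suc n) + 2 * ((2 * 4 ^ Suc n * ?p * d) ^ Suc n * (\<integral>u. X' u ^ Suc n \<partial>P))"
 by (simp only: add_divide_distrib)
 have "ennreal (\<integral>u. X' u ^ Suc n \<partial>P) <= ennreal (2 * (2 ^ Suc n * (fact n * J ^ Suc n)))"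
 proof -
 have XXm[measurable]: "XX m a b : borel_measurable P" "XX m a' b : borel_measurable P"
 using a by (auto intro!: XX_measurable m)
 have "ennreal (\<integral>u. X' u ^ Suc n \<partial>P) = (NN P (%u. ennreal (X' u ^ Suc n)))"
 proof (rule nn_integral_eq_integral[symmetric])
 show "integrable P (%u. X' u ^ Suc n)"
 proof (rule bndint[of _ "?M ^ Suc n"])
 show "\<bar>X' u ^ Suc n\<bar> <= ?M ^ Suc n" if "u : space P" for u
 unfolding power_abs using X'b[OF that] X'0[of u] by (intro power_mono) auto
 qed measurable
 qed (use X'0 in auto)
 also have "... <= (NN P (%u. ennreal (2 ^ Suc n) * (XX m a' b u ^ Suc n + XX m a b u ^ Suc n)))"
 proof (intro nn_integral_mono)
 fix u assume w: "u : space P"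
 have r: "XR m a' b u >= 0" "XR m a b u >= 0" using a by (auto intro!: XR_XX(2) m w)
 have "X' u <= (\<integral>z. cc a' b * av a' b u z + cc a b * av a b u z \<partial>m)"
 unfolding X'_def
 proof (rule integral_mono)
 show "integrable m (%z. \<bar>?xi u z\<bar>)" using xi[OF w] by (rule integrable_abs)
 have "integrable m (%y. cc a b * av a b u y)" if "0 < a" for a
 proof -
 have [measurable]: "(%y. av a b u y) : borel_measurable m"
 using measurable_Pair2[OF av_measurable_m[OF m(2) that a(4)] w] by simp
 show ?thesis using cc_pos[of a b] av_le_1 av_nonneg
 by (intro m.integrable_const_bound[of _ "cc a b"]) (auto simp: abs_mult intro!: mult_left_le)
 qed
 then show ii: "integrable m (%z. cc a' b * av a' b u z + cc a b * av a b u z)" using a by simp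
 show "\<bar>?xi u z\<bar> <= cc a' b * av a' b u z + cc a b * av a b u z" for z
 using cc_pos[of a' b] cc_pos[of a b] av_nonneg[of a' b u z] av_nonneg[of a b u z]
 unfolding xi_def abs_le_iff by (auto intro: order_trans[of _ 0])
 qed
 also have "... = XR m a' b u + XR m a b u"
 unfolding XR_def
 proof (rule Bochner_Integration.integral_add)
 have *: "integrable m (%y. cc a b * av a b u y)" if "0 < a" for a
 proof -
 have [measurable]: "(%y. av a b u y) : borel_measurable m"
 using measurable_Pair2[OF av_measurable_m[OF m(2) that a(4)] w] by simp
 show ?thesis using cc_pos[of a b] av_le_1 av_nonneg
 by (intro m.integrable_const_bound[of _ "cc a b"]) (auto simp: abs_mult intro!: mult_left_le)
 qed
 show "integrable m (%y. cc a' b * av a' b u y)" "integrable m (%y. cc a b * av a b u y)" using * a by auto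
 qed
 finally have "X' u ^ Suc n <= (XR m a' b u + XR m a b u) ^ Suc n" using X'0[of u] by (rule power_mono)
 also have "... <= 2 ^ Suc n * (XR m a' b u ^ Suc n + XR m a b u ^ Suc n)" using r by (rule power_sum_le)
 finally have "ennreal (X' u ^ Suc n) <= ennreal (2 ^ Suc n * (XR m a' b u ^ Suc n + XR m a b u ^ Suc n))" by (rule ennreal_leI)
 also have "... = ennreal (2 ^ Suc n) * (XX m a' b u ^ Suc n + XX m a b u ^ Suc n)"
 using r a XR_XX(1)[OF m _ a(4) w] 
 by (simp only: ennreal_mult' ennreal_plus zero_le_power zero_le_numeral ennreal_power[symmetric])
 finally show "ennreal (X' u ^ Suc n) <= ennreal (2 ^ Suc n) * (XX m a' b u ^ Suc n + XX m a b u ^ Suc n)" .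
 qed
 also have "... = ennreal (2 ^ Suc n) * ((NN P (%u. XX m a' b u ^ Suc n)) + (NN P (%u. XX m a b u ^ Suc n)))"
 by (simp add: nn_integral_cmult nn_integral_add del: power_Suc)
 also have "... <= ennreal (2 ^ Suc n) * (ennreal (fact n * J ^ Suc n) + ennreal (fact n * J ^ Suc n))"
 proof (intro mult_left_mono add_mono)
 have le: "measure m S3 * (fact n * J ^ n) <= fact n * J ^ Suc n"
 using mult_right_mono[OF J(3), of "fact n * J ^ n"] J(1) by (simp add: mult_ac)
 show "(NN P (%u. XX m a' b u ^ Suc n)) <= ennreal (fact n * J ^ Suc n)"
 by (rule order_trans[OF moment_bound[OF m a(1) N _ a(4) J(1,2)] ennreal_leI[OF le]]) (use a in auto)
 show "(NN P (%u. XX m a b u ^ Suc n)) <= ennreal (fact n * J ^ Suc n)"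
 by (rule order_trans[OF moment_bound[where N=N and a=a, OF m _ _ a(3,4) J(1,2)] ennreal_leI[OF le]]) (use a N in auto)
 qed auto
 also have "... = ennreal (2 * (2 ^ Suc n * (fact n * J ^ Suc n)))"
 using J(1) by (simp add: ennreal_plus[symmetric] ennreal_mult'[symmetric] del: ennreal_plus power_Suc)
 finally show ?thesis .
 qed
 then have X'k: "(\<integral>u. X' u ^ Suc n \<partial>P) <= 2 * (2 ^ Suc n * (fact n * J ^ Suc n))"
 using J(1) by (subst (asm) ennreal_le_iff) auto
 have "(2 * 4 ^ Suc n * ?p * d) ^ Suc n * (\<integral>u. X' u ^ Suc n \<partial>P)
 <= (2 * 4 ^ Suc n * ?p * d) ^ Suc n * (2 * (2 ^ Suc n * (fact n * J ^ Suc n)))"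
 using X'k d by (intro mult_left_mono) auto
 then show ?thesis using main by linarith
qed

end

section \<open>Finite nets and measures on chains\<close>

lemma finite_net:
 fixes A :: "'a::euclidean_space set" and R :: real
 assumes A: "A <= cball 0 R" and R: "R > 0" and n: "n > 0"
 obtains N where "finite N" "N <= A" "card N <= (2 * n + 1) ^ DIM('a)"
 "!!x. x : A ==> EX y:N. norm (x - y) <= DIM('a) * R / n"
proof -
 define F where "F x = (\<lambda>i\<in>(Basis :: 'a set). \<lfloor>real n * (x \<bullet> i) / R\<rfloor>)" for x :: 'a
 let ?T = "PiE (Basis :: 'a set) (%_. {- int n..int n})"
 have FT: "F ` A <= ?T"
 proof
 fix t assume "t : F ` A"
 then obtain x where x: "x : A" "t = F x" by blast
 have "\<lfloor>real n * (x \<bullet> i) / R\<rfloor> : {- int n..int n}" if "i : Basis" for i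
 proof -
 have "\<bar>x \<bullet> i\<bar> <= R" using Basis_le_norm[OF that, of x] A x by auto
 then have "\<bar>real n * (x \<bullet> i) / R\<bar> <= real n"
 using R mult_left_mono[of "\<bar>x \<bullet> i\<bar>" R "real n"] by (simp add: abs_mult field_simps)
 moreover have "\<lfloor>v\<rfloor> : {- int n..int n}" if "\<bar>v\<bar> <= real n" for v :: real
 using that by (auto simp: le_floor_iff floor_le_iff)
 ultimately show ?thesis by blast
 qed
 then show "t : ?T" unfolding x(2) F_def by auto
 qed
 have finT: "finite ?T" by (intro finite_PiE) auto
 \<comment> \<open>One point of A for each occupied grid cell: the net must lie in A itself, since
   the estimates hold only for members of sets such as \<open>chains w0\<close>.\<close>
 define r where "r t = (SOME x. x : A & F x = t)" for t
 have r: "r t : A & F (r t) = t" if "t : F ` A" for t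
 proof -
 from that have "EX x. x : A & F x = t" by auto
 then show ?thesis unfolding r_def by (rule someI_ex)
 qed
 show ?thesis
 proof (rule that[of "r ` F ` A"])
 have finF: "finite (F ` A)" using FT finT by (rule finite_subset)
 then show "finite (r ` F ` A)" by simp
 show "r ` F ` A <= A" using r by blast
 have "card (r ` F ` A) <= card (F ` A)" using finF by (rule card_image_le)
 also have "... <= card ?T" using finT FT by (rule card_mono)
 also have "... = (2 * n + 1) ^ DIM('a)" by (simp add: card_PiE nat_add_distrib nat_mult_distrib)
 finally show "card (r ` F ` A) <= (2 * n + 1) ^ DIM('a)" .
 fix x assume x: "x : A"
 define y where "y = r (F x)"
 have Fy: "F y = F x" using r[of "F x"] x by (simp add: y_def)
 have "\<bar>(x - y) \<bullet> i\<bar> <= R / n" if i: "i : Basis" for i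
 proof -
 have "\<lfloor>real n * (x \<bullet> i) / R\<rfloor> = \<lfloor>real n * (y \<bullet> i) / R\<rfloor>"
 using fun_cong[OF Fy, of i] i by (simp add: F_def)
 moreover have "\<bar>u - v\<bar> <= 1" if "\<lfloor>u\<rfloor> = \<lfloor>v\<rfloor>" for u v :: real using that by linarith
 ultimately have "\<bar>real n * (x \<bullet> i) / R - real n * (y \<bullet> i) / R\<bar> <= 1" by blast
 moreover have "real n * (x \<bullet> i) / R - real n * (y \<bullet> i) / R = (n / R) * ((x - y) \<bullet> i)"
 by (simp add: inner_diff_left algebra_simps diff_divide_distrib)
 ultimately have "(n / R) * \<bar>(x - y) \<bullet> i\<bar> <= 1" using R n by (simp add: abs_mult)
 then show ?thesis using R n by (simp add: field_simps)
 qed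
 then have "(\<Sum>i\<in>Basis. \<bar>(x - y) \<bullet> i\<bar>) <= (\<Sum>i\<in>(Basis :: 'a set). R / n)" by (intro sum_mono) auto
 then have "norm (x - y) <= DIM('a) * R / n" using norm_le_l1[of "x - y"] by simp
 then show "EX y:r ` F ` A. norm (x - y) <= DIM('a) * R / n" using x by (auto simp: y_def)
 qed
qed

definition circ :: "real measure" where "circ = restrict_space lborel {0..2*pi}"

text \<open>The density f is taken with respect to the parameter t, not to arc length.\<close>

definition cm :: "(c2 => real) => c2 \<times> (c2) => c2 measure" where
 "cm f q = distr (density circ (%t. ennreal (f (chn (fst q) (snd q) t)))) S3b (chn (fst q) (snd q))"

text \<open>The constant 1 serves for the Frostman bound, bump functions serve to localise when
  interior points are sought. The Lipschitz constant enters the continuity in the chain.\<close>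

definition weight :: "real => (c2 => real) => bool" where
 "weight L f \<longleftrightarrow> L >= 0 & (ALL x. 0 <= f x & f x <= 1) & (ALL x y. \<bar>f x - f y\<bar> <= L * norm (x - y))"

lemma weightD:
 assumes "weight L f" shows "0 <= f x" "f x <= 1" "\<bar>f x - f y\<bar> <= L * norm (x - y)" "L >= 0"
 using assms unfolding weight_def by blast+

lemma weight_measurable: "weight L f ==> f : borel_measurable borel"
proof (intro borel_measurable_continuous_onI lipschitz_on_continuous_on[of L])
 assume "weight L f" then show "L-lipschitz_on UNIV f" by (auto simp: weight_def lipschitz_on_def dist_norm)
qed

lemma space_circ: "space circ = {0..2*pi}" by (simp add: circ_def space_restrict_space)
lemma circ_meas: "f : borel_measurable borel ==> f : borel_measurable circ"
 unfolding circ_def by (rule measurable_restrict_space1) simp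
lemma finite_circ: "finite_measure circ"
 by (rule finite_measureI) (simp add: space_circ circ_def emeasure_restrict_space)
lemma emeasure_circ: "A : sets borel ==> emeasure circ ({0..2*pi} Int A) = emeasure lborel ({0..2*pi} Int A)"
 by (simp add: circ_def emeasure_restrict_space)

lemma sets_cm[simp]: "sets (cm f q) = sets S3b" by (simp add: cm_def)
lemma space_cm[simp]: "space (cm f q) = S3" by (simp add: cm_def space_S3b)

lemma chn_to_S3b:
 assumes q: "q : chains w0" shows "chn (fst q) (snd q) : measurable circ S3b"
proof (rule measurable_restrict_space2)
 show "chn (fst q) (snd q) : space circ \<rightarrow> S3"
 using chn_S3[of "fst q" "snd q" w0] q by simp
 show "chn (fst q) (snd q) : borel_measurable circ" by (intro circ_meas) simp
qed

lemma emeasure_cm_le: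
 assumes q: "q : chains w0" and f: "weight L f" and A: "A : sets borel" "A <= S3"
 shows "emeasure (cm f q) A <= emeasure lborel {t\<in>{0..2*pi}. chn (fst q) (snd q) t : A}"
proof -
 let ?y = "chn (fst q) (snd q)"
 note [measurable] = weight_measurable[OF f] chn_to_S3b[OF q]
 have fm: "(%t. ennreal (f (?y t))) : borel_measurable circ"
 by (intro circ_meas) measurable
 have pre: "?y -` A Int {0..2*pi} : sets circ"
 using measurable_sets[OF chn_to_S3b[OF q] borel_sub_S3b[OF A]] by (simp add: space_circ)
 have "emeasure (cm f q) A = emeasure (density circ (%t. ennreal (f (?y t)))) (?y -` A Int {0..2*pi})"
 unfolding cm_def using borel_sub_S3b[OF A] chn_to_S3b[OF q] by (subst emeasure_distr) (auto simp: space_circ)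
 also have "... = (NN circ (%t. ennreal (f (?y t)) * indicator (?y -` A Int {0..2*pi}) t))"
 by (rule emeasure_density[OF fm pre])
 also have "... <= (NN circ (%t. indicator (?y -` A Int {0..2*pi}) t))"
 using weightD(2)[OF f] by (intro nn_integral_mono) (simp add: indicator_def)
 also have "... = emeasure circ (?y -` A Int {0..2*pi})" using pre by simp
 also have "... = emeasure lborel {t\<in>{0..2*pi}. ?y t : A}"
 proof -
 have "?y -` A : sets borel" using measurable_sets[OF chn_measurable A(1)] by simp
 from emeasure_circ[OF this] show ?thesis by (simp add: vimage_def Int_def conj_commute)
 qed
 finally show ?thesis .
qed

lemma finite_cm: assumes "q : chains w0" "weight L f" shows "finite_measure (cm f q)" "measure (cm f q) S3 <= 2 * pi"
proof -
 have "emeasure (cm f q) S3 <= emeasure lborel {t\<in>{0..2*pi}. chn (fst q) (snd q) t : S3}"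
 by (rule emeasure_cm_le[OF assms]) auto
 also have "... <= emeasure lborel {0..2*pi}" by (intro emeasure_mono) auto
 finally have *: "emeasure (cm f q) S3 <= ennreal (2 * pi)" by simp
 show "finite_measure (cm f q)"
 by (rule finite_measureI) (use * in \<open>auto simp: top_unique\<close>)
 show "measure (cm f q) S3 <= 2 * pi" unfolding measure_def using * by (intro enn2real_leI) auto
qed

lemma cm_ball:
 assumes q: "q : chains w0" and f: "weight L f" and w0: "w0 > 0" and s: "s >= 0" and x: "x : S3"
 shows "emeasure (cm f q) {z : S3. dvis x z <= s} <= ennreal (32 * pi / w0\<^sup>2 * s\<^sup>2)"
proof -
 have m: "{z : S3. dvis x z <= s} : sets borel"
 proof -
 have "{z : S3. dvis x z <= s} = S3 Int {z. dvis x z <= s}" by auto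
 moreover have "{z. dvis x z <= s} : sets borel" by measurable
 ultimately show ?thesis by auto
 qed
 have "emeasure (cm f q) {z : S3. dvis x z <= s} <= emeasure lborel {t\<in>{0..2*pi}. chn (fst q) (snd q) t : {z : S3. dvis x z <= s}}"
 by (rule emeasure_cm_le[OF q f m]) auto
 also have "{t\<in>{0..2*pi}. chn (fst q) (snd q) t : {z : S3. dvis x z <= s}} = {t\<in>{0..2*pi}. dvis x (chn (fst q) (snd q) t) <= s}"
 using chn_S3[of "fst q" "snd q" w0] q by auto
 also have "emeasure lborel ... <= ennreal (32 * pi / w0\<^sup>2 * s\<^sup>2)"
 using q by (intro chain_ball_measure[OF _ x w0 s]) simp
 finally show ?thesis .
qed

lemma chains_norm: assumes "q : chains w0" shows "norm q <= 1"
proof -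
 obtain a w where q: "q = (a, w)" by (cases q)
 have "(norm q)\<^sup>2 = 1" using assms by (simp add: q chains_def norm_Pair)
 then show ?thesis by (simp add: power2_eq_1_iff) linarith
qed

lemma chains_compact: "compact (chains w0)"
proof (rule compact_eq_bounded_closed[THEN iffD2], intro conjI)
 show "bounded (chains w0)" unfolding bounded_iff using chains_norm[of _ w0] by blast
 have "chains w0 = {q. hin (fst q) (snd q) = 0} Int {q. (norm (fst q))\<^sup>2 + (norm (snd q))\<^sup>2 = 1} Int {q. w0 <= norm (snd q)}"
 by (auto simp: chains_def)
 then show "closed (chains w0)"
 by (simp, intro closed_Int closed_Collect_eq closed_Collect_le continuous_hin continuous_intros)
qed

lemma chn_diff_le: "norm (chn a w t - chn a' w' t) <= norm (a - a') + norm (w - w')"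
proof -
 have "chn a w t - chn a' w' t = (a - a') + csc (cis t) (w - w')"
 by (simp add: chn_def csc_def prod_eq_iff algebra_simps)
 then show ?thesis using norm_triangle_ineq[of "a - a'" "csc (cis t) (w - w')"] by (simp add: norm_csc)
qed

lemma norm_fst_snd_le: "norm (fst q) + norm (snd q) <= 2 * norm (q :: 'a::real_normed_vector \<times> 'b::real_normed_vector)"
 using norm_fst_le[of "fst q" "snd q"] norm_snd_le[of "snd q" "fst q"] by simp

context cutout_process
begin

abbreviation hp :: "nat => real" where "hp n \<equiv> (1/2) ^ n"

lemma hp_pos: "hp n > 0" and hp_le_1: "hp n <= 1" by (auto simp: power_le_one)

lemma cc_hp_le: assumes "m <= n" shows "cc (hp n) (hp m) <= 2 powr (g * real n)"
proof -
 have "cc (hp n) (hp m) <= (hp m / hp n) powr g"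
 using assms by (intro cc_le hp_pos hp_le_1 power_decreasing) auto
 also have "... <= (1 / hp n) powr g"
 using g_pos by (intro powr_mono2 divide_right_mono) (auto simp: power_le_one)
 also have "1 / hp n = 2 powr real n" by (simp add: powr_realpow power_divide)
 also have "(2 powr real n) powr g = 2 powr (g * real n)" by (simp add: powr_powr mult.commute)
 finally show ?thesis .
qed

lemma XR_cm:
 assumes q: "q : chains w0" and f: "weight L f" and a: "0 < a" "b <= 1" and w: "u : space P"
 shows "XR (cm f q) a b u = (\<integral>t. f (chn (fst q) (snd q) t) * (cc a b * av a b u (chn (fst q) (snd q) t)) \<partial>circ)"
 "(%t. av a b u (chn (fst q) (snd q) t)) : borel_measurable circ"
proof -
 let ?y = "chn (fst q) (snd q)"
 note fm = weight_measurable[OF f]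
 have [measurable]: "(%t. f (?y t)) : borel_measurable circ"
 by (intro circ_meas measurable_compose[OF chn_measurable fm])
 have avm: "(%y. av a b u y) : borel_measurable S3b"
 using measurable_Pair2[OF av_measurable[OF a] w] by simp
 then show av2[measurable]: "(%t. av a b u (?y t)) : borel_measurable circ"
 using measurable_compose[OF chn_to_S3b[OF q]] by blast
 have "XR (cm f q) a b u = (\<integral>t. cc a b * av a b u (?y t) \<partial>density circ (%t. ennreal (f (?y t))))"
 unfolding XR_def cm_def
 by (rule integral_distr) (use chn_to_S3b[OF q] avm in \<open>auto\<close>)
 also have "... = (\<integral>t. f (?y t) *\<^sub>R (cc a b * av a b u (?y t)) \<partial>circ)"
 by (rule integral_density) (use weightD(1)[OF f] in auto)
 finally show "XR (cm f q) a b u = (\<integral>t. f (?y t) * (cc a b * av a b u (?y t)) \<partial>circ)" by simp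
qed

text \<open>At equal parameters the chains are at most 2 d apart, so besides the Lipschitz change of
  f a contribution arises only where the point is within 2 d of the boundary of some ball, measured
  by \<open>cmod (1 - hin)\<close>; each ball accounts for one square root from
  \<open>chain_annulus_measure\<close>. The condition b \<le> w0 / 4 makes that lemma applicable to
  all radii, which is why masses on chains are formed with radii below \<open>hp n0\<close>
  only.\<close>

lemma XR_cm_continuity:
 assumes q: "q : chains w0" "q' : chains w0" and f: "weight L f" and a: "0 < a" and w0: "w0 > 0" "b <= w0 / 4" "b <= 1"
 and w: "u : space P" and d: "norm (q - q') <= d" "2 * d <= w0 ^ 4 / 80" "2 * d <= 1"
 shows "\<bar>XR (cm f q) a b u - XR (cm f q') a b u\<bar>
 <= cc a b * (4 * pi * L * d + real (card {p : \<Phi> u. a <= snd p}) * (36 * pi / w0\<^sup>2 * sqrt (2 * d)))"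
proof -
 interpret finite_measure circ by (rule finite_circ)
 let ?y = "chn (fst q) (snd q)" and ?y' = "chn (fst q') (snd q')"
 define S where "S = {p : \<Phi> u. a <= snd p & snd p < b}"
 have finS0: "finite {p : \<Phi> u. a <= snd p}" using pts_finite[OF w a] .
 have finS: "finite S" unfolding S_def by (rule finite_subset[OF _ finS0]) auto
 have cardS: "card S <= card {p : \<Phi> u. a <= snd p}" unfolding S_def by (intro card_mono finS0) auto
 have d0: "d >= 0" using d(1) norm_ge_zero order_trans by blast
 have yy: "norm (?y t - ?y' t) <= 2 * d" for t
 using chn_diff_le[of "fst q" "snd q" t "fst q'" "snd q'"] norm_fst_snd_le[of "q - q'"] d(1) by simp
 have S3y: "?y t : S3" "?y' t : S3" for t using chn_S3[of "fst q" "snd q" w0] chn_S3[of "fst q'" "snd q'" w0] q by auto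
 define An where "An p = {t\<in>{0..2*pi}. \<bar>cmod (1 - hin (?y t) (fst p)) - 2 * (snd p)\<^sup>2\<bar> <= 2 * d}" for p
 have Anb: "An p : sets borel" for p
 proof -
 have "An p = {0..2*pi} Int {t. \<bar>cmod (1 - hin (?y t) (fst p)) - 2 * (snd p)\<^sup>2\<bar> <= 2 * d}" by (auto simp: An_def)
 moreover have "{t. \<bar>cmod (1 - hin (?y t) (fst p)) - 2 * (snd p)\<^sup>2\<bar> <= 2 * d} : sets borel"
 unfolding hin_def chn_def csc_def
 by (intro borel_closed closed_Collect_le continuous_intros)
 ultimately show ?thesis by auto
 qed
 let ?h = "%t. f (?y t) * (cc a b * av a b u (?y t))" and ?h' = "%t. f (?y' t) * (cc a b * av a b u (?y' t))"
 note fm = weight_measurable[OF f]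
 have [measurable]: "(%t. f (?y t)) : borel_measurable circ" "(%t. f (?y' t)) : borel_measurable circ"
 by (intro circ_meas measurable_compose[OF chn_measurable fm])+
 note [measurable] = XR_cm(2)[OF q(1) f a w0(3) w] XR_cm(2)[OF q(2) f a w0(3) w]
 have f01: "0 <= f x" "f x <= 1" for x using weightD[OF f] by auto
 have fa: "\<bar>f x * (cc a b * av a b u x)\<bar> <= cc a b" for x
 proof -
 have "f x * (cc a b * av a b u x) <= 1 * (cc a b * 1)"
 using f01[of x] cc_pos[of a b] av_le_1[of a b u x] av_nonneg[of a b u x] by (intro mult_mono) auto
 moreover have "0 <= f x * (cc a b * av a b u x)" using f01[of x] cc_pos[of a b] av_nonneg[of a b u x] by simp
 ultimately show ?thesis by simp
 qed
 have ih: "integrable circ ?h" "integrable circ ?h'"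
 proof -
 have hm: "?h : borel_measurable circ" "?h' : borel_measurable circ" by measurable
 show "integrable circ ?h" by (rule integrable_const_bound[where B="cc a b", OF AE_I2 hm(1)]) (simp only: real_norm_def fa)
 show "integrable circ ?h'" by (rule integrable_const_bound[where B="cc a b", OF AE_I2 hm(2)]) (simp only: real_norm_def fa)
 qed
 have AnS: "An p : sets circ" for p
 proof -
 have "An p <= {0..2*pi}" unfolding An_def by blast
 then show ?thesis using Anb[of p] by (simp add: circ_def sets_restrict_space_iff)
 qed
 have diff: "\<bar>?h t - ?h' t\<bar> <= cc a b * (L * (2 * d) + (\<Sum>p\<in>S. indicator (An p) t))" if t: "t : space circ" for t
 proof -
 have t': "t : {0..2*pi}" using t by (simp add: space_circ)
 have "\<bar>av a b u (?y t) - av a b u (?y' t)\<bar> <= (\<Sum>p\<in>S. indicator (An p) t)"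
 proof (cases "EX p:S. t : An p")
 case True
 then obtain p where p: "p : S" "t : An p" by blast
 have "1 = (indicator (An p) t :: real)" using p by simp
 also have "... <= (\<Sum>p\<in>S. indicator (An p) t)" using p finS by (intro member_le_sum) auto
 finally show ?thesis using av_le_1[of a b u] av_nonneg[of a b u] by (smt (verit))
 next
 case False
 have "p : conR a b (?y t) \<longleftrightarrow> p : conR a b (?y' t)" if p: "p : \<Phi> u" for p
 proof (cases "p : S")
 case True
 have p3: "fst p : S3" "snd p > 0" using pts[OF w] p by auto
 have "cmod (hin (?y t) (fst p) - hin (?y' t) (fst p)) <= 2 * d"
 using cmod_hin_le[of "?y t - ?y' t" "fst p"] p3 yy[of t] by (simp add: hin_diff_left in_S3)
 then have "\<bar>cmod (1 - hin (?y t) (fst p)) - cmod (1 - hin (?y' t) (fst p))\<bar> <= 2 * d"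
 using norm_triangle_ineq3[of "1 - hin (?y t) (fst p)" "1 - hin (?y' t) (fst p)"] by (simp add: norm_minus_commute)
 moreover have "\<bar>cmod (1 - hin (?y t) (fst p)) - 2 * (snd p)\<^sup>2\<bar> > 2 * d"
 using False True t' by (auto simp: An_def not_le)
 ultimately have "cmod (1 - hin (?y t) (fst p)) < 2 * (snd p)\<^sup>2 \<longleftrightarrow> cmod (1 - hin (?y' t) (fst p)) < 2 * (snd p)\<^sup>2"
 by linarith
 then show ?thesis using p3 S3y[of t]
 by (simp add: conR_def dvis_sym[of "fst p"] dvis_less_iff)
 next
 case False
 then show ?thesis using p by (auto simp: S_def conR_def)
 qed
 then have "\<Phi> u Int conR a b (?y t) = \<Phi> u Int conR a b (?y' t)" by blast
 then have "av a b u (?y t) = av a b u (?y' t)" by (simp add: av_def)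
 then show ?thesis by (simp add: sum_nonneg)
 qed
 moreover have "\<bar>f (?y t) - f (?y' t)\<bar> <= L * (2 * d)"
 proof -
 have "\<bar>f (?y t) - f (?y' t)\<bar> <= L * norm (?y t - ?y' t)" by (rule weightD(3)[OF f])
 also have "... <= L * (2 * d)" using yy weightD(4)[OF f] by (intro mult_left_mono) auto
 finally show ?thesis .
 qed
 moreover have "?h t - ?h' t = cc a b * ((f (?y t) - f (?y' t)) * av a b u (?y t) + f (?y' t) * (av a b u (?y t) - av a b u (?y' t)))"
 by (simp add: algebra_simps)
 moreover have "\<bar>(f (?y t) - f (?y' t)) * av a b u (?y t) + f (?y' t) * (av a b u (?y t) - av a b u (?y' t))\<bar>
 <= \<bar>f (?y t) - f (?y' t)\<bar> * 1 + 1 * \<bar>av a b u (?y t) - av a b u (?y' t)\<bar>"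
 using av_le_1[of a b u "?y t"] av_nonneg[of a b u "?y t"] f01[of "?y' t"]
 by (intro order_trans[OF abs_triangle_ineq] add_mono) (auto simp: abs_mult intro!: mult_mono mult_left_le_one_le mult_left_le)
 ultimately show ?thesis using cc_pos[of a b] by (simp add: abs_mult)
 qed
 have ind: "integrable circ (indicator (An p) :: real => real)" for p
 using AnS by (intro integrable_real_indicator) (auto simp: emeasure_eq_measure)
 have isum: "integrable circ (%t. \<Sum>p\<in>S. indicator (An p) t :: real)"
 by (rule Bochner_Integration.integrable_sum) (rule ind)
 have "\<bar>XR (cm f q) a b u - XR (cm f q') a b u\<bar> = \<bar>\<integral>t. ?h t - ?h' t \<partial>circ\<bar>"
 using ih by (simp add: XR_cm(1)[OF q(1) f a w0(3) w] XR_cm(1)[OF q(2) f a w0(3) w])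
 also have "... <= (\<integral>t. \<bar>?h t - ?h' t\<bar> \<partial>circ)" by (rule integral_abs_bound)
 also have "... <= (\<integral>t. cc a b * (L * (2 * d) + (\<Sum>p\<in>S. indicator (An p) t)) \<partial>circ)"
 by (rule integral_mono[OF _ _ diff])
 (intro integrable_abs Bochner_Integration.integrable_diff ih, intro integrable_mult_right isum Bochner_Integration.integrable_add integrable_const)
 also have "... = cc a b * (L * (2 * d) * measure circ (space circ) + (\<Sum>p\<in>S. measure circ (An p)))"
 proof -
 have "(\<integral>t. (\<Sum>p\<in>S. indicator (An p) t) \<partial>circ) = (\<Sum>p\<in>S. measure circ (An p))"
 using ind AnS by (subst Bochner_Integration.integral_sum) auto
 then have "(\<integral>t. L * (2 * d) + (\<Sum>p\<in>S. indicator (An p) t) \<partial>circ) = L * (2 * d) * measure circ (space circ) + (\<Sum>p\<in>S. measure circ (An p))"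
 using isum by (subst Bochner_Integration.integral_add) (auto simp: mult.commute)
 then show ?thesis by simp
 qed
 also have "... <= cc a b * (L * (2 * d) * (2 * pi) + real (card S) * (36 * pi / w0\<^sup>2 * sqrt (2 * d)))"
 proof (intro mult_left_mono add_mono)
 show "measure circ (space circ) <= 2 * pi" by (simp add: circ_def measure_restrict_space space_restrict_space)
 have "measure circ (An p) <= 36 * pi / w0\<^sup>2 * sqrt (2 * d)" if p: "p : S" for p
 proof -
 have "p : S3 \<times> {0<..<1}" "snd p < b" using pts[OF w] p unfolding S_def by blast+
 then have p3: "fst p : S3" "snd p > 0" "snd p < b" by (simp_all add: mem_Times_iff)
 have "{0..2*pi} Int An p = An p" unfolding An_def by blast
 then have "emeasure circ (An p) = emeasure lborel (An p)" using emeasure_circ[OF Anb[of p]] by simp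
 also have "... <= ennreal (36 * pi / w0\<^sup>2 * sqrt (2 * d))"
 unfolding An_def using q(1) p3 w0 d d0 by (intro chain_annulus_measure) auto
 finally show ?thesis unfolding measure_def using d0 by (intro enn2real_leI) auto
 qed
 then have "(\<Sum>p\<in>S. measure circ (An p)) <= (\<Sum>p\<in>S. 36 * pi / w0\<^sup>2 * sqrt (2 * d))" by (rule sum_mono)
 then show "(\<Sum>p\<in>S. measure circ (An p)) <= real (card S) * (36 * pi / w0\<^sup>2 * sqrt (2 * d))" by simp
 qed (use weightD(4)[OF f] d0 cc_pos[of a b] in auto)
 also have "... <= cc a b * (4 * pi * L * d + real (card {p : \<Phi> u. a <= snd p}) * (36 * pi / w0\<^sup>2 * sqrt (2 * d)))"
 using cc_pos[of a b] cardS d0 by (intro mult_left_mono add_mono mult_right_mono) (auto simp: mult_ac)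
 finally show ?thesis .
qed

end

section \<open>Uniform convergence of the masses of all chains\<close>

lemma (in prob_space) markov_even:
 fixes D :: "'a => real"
 assumes [measurable]: "D : borel_measurable M" and i: "integrable M (%w. D w ^ (2 * k))" and t: "t > 0"
 shows "prob {w : space M. t < \<bar>D w\<bar>} <= (\<integral>w. D w ^ (2 * k) \<partial>M) / t ^ (2 * k)"
proof -
 have "prob {w : space M. t < \<bar>D w\<bar>} <= prob {w : space M. t ^ (2 * k) <= D w ^ (2 * k)}"
 proof (rule finite_measure_mono)
 show "{w : space M. t < \<bar>D w\<bar>} <= {w : space M. t ^ (2 * k) <= D w ^ (2 * k)}"
 proof
 fix w assume "w : {w : space M. t < \<bar>D w\<bar>}"
 then have "t ^ (2 * k) <= \<bar>D w\<bar> ^ (2 * k)" "w : space M" using t by (auto intro!: power_mono)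
 then show "w : {w : space M. t ^ (2 * k) <= D w ^ (2 * k)}" by (simp add: power_even_abs)
 qed
 qed measurable
 also have "... <= (\<integral>w. D w ^ (2 * k) \<partial>M) / t ^ (2 * k)"
 using i t by (intro integral_Markov_inequality_measure[where A="{}"]) (auto simp: power_mult)
 finally show ?thesis .
qed

context cutout_process
begin

lemma hp_powr: "hp n = 2 powr (- real n)"
 by (simp add: powr_minus powr_realpow power_one_over inverse_eq_divide)

lemma hp_sq: "(hp n)\<^sup>2 = 2 powr (- 2 * real n)"
 unfolding hp_powr power2_eq_square powr_add[symmetric] by simp

text \<open>The normalisation grows like 2^(g n), while a ball of radius 2^(-n) has mass of order
  2^(-2 n) on a chain; this is the product of the two rates per generation.\<close>

definition theta :: real where "theta = 2 powr (g - 2)"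

lemma theta_pos: "theta > 0" by (simp add: theta_def)
lemma theta_less_1: "g < 2 ==> theta < 1" by (simp add: theta_def powr_less_one)

lemma DD_bounded:
 assumes m: "finite_measure m" "sets m = sets S3b" and a: "0 < a'" "a' <= a" "a <= b" "b <= 1"
 shows "DD m a' a b : borel_measurable P" "integrable P (%w. DD m a' a b w ^ k)"
proof -
 interpret m: finite_measure m by fact
 have xm: "(%p. xi a' a b (fst p) (snd p)) : borel_measurable (P \<Otimes>\<^sub>M m)"
 using a by (intro xi_measurable m) auto
 show Dm[measurable]: "DD m a' a b : borel_measurable P" unfolding DD_def[abs_def]
 by (rule m.borel_measurable_lebesgue_integral) (use xm in \<open>simp add: case_prod_beta\<close>)
 have b: "\<bar>DD m a' a b w\<bar> <= cc a' b * measure m (space m)" for w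
 proof -
 have "\<bar>DD m a' a b w\<bar> <= (\<integral>z. cc a' b \<partial>m)" unfolding DD_def
 by (rule order_trans[OF integral_abs_bound integral_mono'])
 (use abs_xi_le[OF a] cc_pos[of a' b] in auto)
 then show ?thesis by (simp add: mult.commute)
 qed
 have "\<bar>DD m a' a b w ^ k\<bar> <= (cc a' b * measure m (space m)) ^ k" for w
 unfolding power_abs using b by (intro power_mono) auto
 then show "integrable P (%w. DD m a' a b w ^ k)"
 by (intro integrable_const_bound[OF AE_I2]) (auto simp del: power_abs)
qed

text \<open>In \<open>increment_moment\<close> the quantity d is here of order
  \<open>theta ^ n\<close>. The term d^(2j+2) decays twice as fast as the other one and is absorbed
  since theta < 1; the constant is the same for all n and all chains.\<close>

lemma chain_increment_moment:
 assumes g2: "g < 2" and f: "weight L f" and w0: "w0 = 4 * hp n0"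
 shows "EX C>=0. ALL n>=n0. ALL q:chains w0.
 (\<integral>w. DD (cm f q) (hp (Suc n)) (hp n) (hp n0) w ^ (2 * Suc j) \<partial>P) <= C * (theta ^ n) ^ Suc j"
proof -
 define K where "K = 32 * pi / w0\<^sup>2"
 have w0p: "w0 > 0" by (simp add: w0)
 have K0: "K >= 0" by (simp add: K_def)
 define J where "J = max (2 * pi) (K * (2 powr (2 * g) / (1 - 2 powr (g - 2))))"
 have J: "J >= 2 * pi" "J >= K * (2 powr (2 * g) / (1 - 2 powr (g - 2)))"
 by (auto simp: J_def)
 have J0: "J >= 0" using J(1) pi_gt_zero by linarith
 define k0 where "k0 = 4 * K * 2 powr g"
 have k0: "k0 >= 0" using K0 by (simp add: k0_def)
 define C where "C = k0 ^ (2 * Suc j) + 4 * (2 * 4 ^ Suc j * real (2 * j + 1) * k0) ^ Suc j * (2 ^ Suc j * (fact j * J ^ Suc j))"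
 have C0: "C >= 0" unfolding C_def using k0 J0 by (intro add_nonneg_nonneg mult_nonneg_nonneg zero_le_power) auto
 have "(\<integral>w. DD (cm f q) (hp (Suc n)) (hp n) (hp n0) w ^ (2 * Suc j) \<partial>P) <= C * (theta ^ n) ^ Suc j"
 if n: "n >= n0" and q: "q : chains w0" for n q
 proof -
 let ?k = "k0 * theta ^ n"
 have th: "0 <= theta ^ n" "theta ^ n <= 1" using theta_pos theta_less_1[OF g2] by (auto simp: power_le_one)
 have hpn: "hp n <= hp n0" using n by (intro power_decreasing) auto
 have m: "finite_measure (cm f q)" by (rule finite_cm[OF q f])
 interpret m: finite_measure "cm f q" by (rule m)
 have "(\<integral>w. DD (cm f q) (hp (Suc n)) (hp n) (hp n0) w ^ (2 * Suc j) \<partial>P)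
 <= ?k ^ (2 * Suc j) + 4 * (2 * 4 ^ Suc j * real (2 * j + 1) * ?k) ^ Suc j * (2 ^ Suc j * (fact j * J ^ Suc j))"
 proof (rule increment_moment[where N="Suc n", OF m])
 show "(NN (cm f q) (%y. ennreal (kern g (Suc n) y y'))) <= ennreal J" if "y' : S3" for y'
 proof (rule order_trans[OF nn_integral_kern_le[where \<beta>=2 and K=K] ennreal_leI])
 fix i assume "i <= Suc n"
 have "emeasure (cm f q) {z : S3. dvis y' z <= hp i} <= ennreal (K * (hp i)\<^sup>2)"
 unfolding K_def by (rule cm_ball[OF q f w0p _ that]) simp
 also have "(hp i)\<^sup>2 = 2 powr (- 2 * real i)" by (rule hp_sq)
 finally show "emeasure (cm f q) {z : S3. dvis y' z <= (1/2) ^ i} <= ennreal (K * 2 powr (- 2 * real i))" .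
 qed (use g2 K0 J in auto)
 show "measure (cm f q) S3 <= J" using finite_cm(2)[OF q f] J by simp
 show "cc (hp (Suc n)) (hp n0) * measure (cm f q) {z : S3. dvis y z < 2 * hp n} <= ?k" if y: "y : S3" for y
 proof -
 have "{z : S3. dvis y z <= 2 * hp n} : sets (cm f q)"
 proof -
 have "{z : S3. dvis y z <= 2 * hp n} = S3 Int {z. dvis y z <= 2 * hp n}" by auto
 moreover have "{z. dvis y z <= 2 * hp n} : sets borel" by measurable
 ultimately show ?thesis by (auto intro: borel_sub_S3b)
 qed
 then have "measure (cm f q) {z : S3. dvis y z < 2 * hp n} <= measure (cm f q) {z : S3. dvis y z <= 2 * hp n}"
 by (intro m.finite_measure_mono) auto
 also have "... <= K * (2 * hp n)\<^sup>2"
 unfolding measure_def K_def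
 using cm_ball[OF q f w0p _ y, of "2 * hp n"] by (intro enn2real_leI) auto
 finally have "cc (hp (Suc n)) (hp n0) * measure (cm f q) {z : S3. dvis y z < 2 * hp n}
 <= 2 powr (g * real (Suc n)) * (K * (2 * hp n)\<^sup>2)"
 using n K0 by (intro mult_mono cc_hp_le) auto
 also have "... = ?k"
 proof -
 have "2 powr (g * real (Suc n)) * (hp n)\<^sup>2 = 2 powr g * theta ^ n"
 proof -
 note hp_sq[of n]
 moreover have "theta ^ n = 2 powr ((g - 2) * real n)" by (simp add: theta_def powr_power mult.commute)
 ultimately show ?thesis by (simp add: powr_add[symmetric] algebra_simps)
 qed
 then show ?thesis by (simp add: k0_def power_mult_distrib mult_ac)
 qed
 finally show ?thesis .
 qed
 qed (use hpn J0 k0 th in \<open>auto simp: power_le_one hp_pos\<close>)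
 also have "... <= C * (theta ^ n) ^ Suc j"
 proof -
 have "?k ^ (2 * Suc j) = k0 ^ (2 * Suc j) * ((theta ^ n) ^ Suc j * (theta ^ n) ^ Suc j)"
 by (simp only: power_mult_distrib power_add[symmetric] mult_2)
 also have "... <= k0 ^ (2 * Suc j) * ((theta ^ n) ^ Suc j * 1)"
 using th k0 theta_pos theta_less_1[OF g2] by (intro mult_left_mono power_le_one) auto
 finally have 1: "?k ^ (2 * Suc j) <= k0 ^ (2 * Suc j) * (theta ^ n) ^ Suc j" by simp
 have "(2 * 4 ^ Suc j * real (2 * j + 1) * ?k) ^ Suc j = (2 * 4 ^ Suc j * real (2 * j + 1) * k0) ^ Suc j * (theta ^ n) ^ Suc j"
 by (simp only: mult.assoc[symmetric] power_mult_distrib)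
 then show ?thesis using 1 unfolding C_def by (simp add: algebra_simps)
 qed
 finally show ?thesis .
 qed
 then show ?thesis using C0 by blast
qed

text \<open>Borel-Cantelli over a net of \<open>2 ^ (160 * n)\<close> chains: the decay of the moments of high order
 beats the cardinality of the net.\<close>
lemma chain_net_increments:
 assumes g2: "g < 2" and f: "weight L f" and w0: "w0 = 4 * hp n0"
 obtains t N where "0 < t" "t < 1"
 "!!n. N n <= chains w0" "!!n q. q : chains w0 ==> EX q':N n. norm (q - q') <= 8 * (1/2) ^ (20 * n)"
 "AE w in P. \<forall>\<^sub>F n in sequentially. ALL q:N n. \<bar>DD (cm f q) (hp (Suc n)) (hp n) (hp n0) w\<bar> <= t ^ n"
proof -
 \<comment> \<open>With the fourth root the threshold t^n is still summable, while Markov's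
   inequality at order 2j+2 keeps the factor (t^2)^(n (j+1)).\<close>
 define t where "t = theta powr (1/4)"
 have t: "0 < t" "t < 1"
 using theta_pos powr_less_mono2[of "1/4" theta 1] theta_less_1[OF g2] by (auto simp: t_def)
 have t4: "t ^ 4 = theta" using theta_pos by (simp add: t_def powr_power)
 have "EX N. finite N & N <= chains w0 & card N <= (3 * 2 ^ (20 * n)) ^ 8 &
 (ALL q:chains w0. EX q':N. norm (q - q') <= 8 * (1/2) ^ (20 * n))" for n
 proof -
 have "chains w0 <= cball 0 1" 
 proof
 fix q assume "q : chains w0" from chains_norm[OF this] show "q : cball 0 1" by (simp only: mem_cball_0)
 qed
 from finite_net[OF this, of "2 ^ (20 * n)"] obtain N where N: "finite N" "N <= chains w0"
 "card N <= (2 * 2 ^ (20 * n) + 1) ^ 8" "!!q. q : chains w0 ==> EX q':N. norm (q - q') <= 8 * 1 / 2 ^ (20 * n)"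
 by (auto simp del: power_mult)
 have "card N <= (3 * 2 ^ (20 * n)) ^ 8"
 by (rule order_trans[OF N(3)], rule power_mono) (use one_le_power[of "2::nat" "20 * n"] in auto)
 then show ?thesis using N by (intro exI[of _ N]) (auto simp: power_divide)
 qed
 then obtain N where N: "!!n. finite (N n)" "!!n. N n <= chains w0" "!!n. card (N n) <= (3 * 2 ^ (20 * n)) ^ 8"
 "!!n q. q : chains w0 ==> EX q':N n. norm (q - q') <= 8 * (1/2) ^ (20 * n)"
 by metis
 \<comment> \<open>The net lies in a space of real dimension 8 and has mesh of order 2^(-20 n),
   hence 160 = 8 * 20; one more power of 1/2 makes the probabilities summable.\<close>
 obtain j where j: "(t\<^sup>2) ^ j < (1/2) ^ 161"
 using real_arch_pow_inv[of "(1/2) ^ 161" "t\<^sup>2"] t by (auto simp: power_less_one_iff abs_square_less_1)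
 obtain C where C: "C >= 0" "!!n q. n >= n0 ==> q : chains w0 ==>
 (\<integral>w. DD (cm f q) (hp (Suc n)) (hp n) (hp n0) w ^ (2 * Suc j) \<partial>P) <= C * (theta ^ n) ^ Suc j"
 using chain_increment_moment[OF g2 f w0, of j] by blast
 define A where "A n = (\<Union>q\<in>N n. {w : space P. t ^ n < \<bar>DD (cm f q) (hp (Suc n)) (hp n) (hp n0) w\<bar>})" for n
 have Dm: "DD (cm f q) (hp (Suc n)) (hp n) (hp n0) : borel_measurable P"
 "integrable P (%w. DD (cm f q) (hp (Suc n)) (hp n) (hp n0) w ^ k)" if "n >= n0" "q : chains w0" for n q k
 using that by (auto intro!: DD_bounded finite_cm[OF _ f] power_decreasing simp: hp_pos power_le_one)
 have As: "{w : space P. t ^ n < \<bar>DD (cm f q) (hp (Suc n)) (hp n) (hp n0) w\<bar>} : sets P" if "n >= n0" "q : chains w0" for n q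
 proof -
 note [measurable] = Dm(1)[OF that]
 show ?thesis by measurable
 qed
 have PA: "prob (A n) <= 3 ^ 8 * C * (1/2) ^ n" if n: "n >= n0" for n
 proof -
 have "prob (A n) <= (\<Sum>q\<in>N n. prob {w : space P. t ^ n < \<bar>DD (cm f q) (hp (Suc n)) (hp n) (hp n0) w\<bar>})"
 unfolding A_def
 proof (rule finite_measure_subadditive_finite[OF N(1)], rule image_subsetI)
 fix q assume "q : N n"
 then have "q : chains w0" using N(2) by blast
 then show "{w : space P. t ^ n < \<bar>DD (cm f q) (hp (Suc n)) (hp n) (hp n0) w\<bar>} : sets P" by (rule As[OF n])
 qed
 also have "... <= (\<Sum>q\<in>N n. C * ((1/2) ^ 161) ^ n)"
 proof (rule sum_mono)
 fix q assume "q : N n"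
 then have q: "q : chains w0" using N by blast
 have "prob {w : space P. t ^ n < \<bar>DD (cm f q) (hp (Suc n)) (hp n) (hp n0) w\<bar>}
 <= (\<integral>w. DD (cm f q) (hp (Suc n)) (hp n) (hp n0) w ^ (2 * Suc j) \<partial>P) / (t ^ n) ^ (2 * Suc j)"
 using t by (intro markov_even Dm[OF n q]) auto
 also have "... <= C * (theta ^ n) ^ Suc j / (t ^ n) ^ (2 * Suc j)"
 using C(2)[OF n q] t by (intro divide_right_mono) auto
 also have "(theta ^ n) ^ Suc j = (t ^ n) ^ (2 * Suc j) * ((t\<^sup>2) ^ Suc j) ^ n"
 unfolding t4[symmetric] by (simp only: power_mult[symmetric] power_add[symmetric]) (rule arg_cong[where f="%k. t ^ k"], simp)
 also have "C * ((t ^ n) ^ (2 * Suc j) * ((t\<^sup>2) ^ Suc j) ^ n) / (t ^ n) ^ (2 * Suc j) = C * ((t\<^sup>2) ^ Suc j) ^ n"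
 using t by simp
 also have "... <= C * ((1/2) ^ 161) ^ n"
 proof (intro mult_left_mono power_mono)
 have "(t\<^sup>2) ^ Suc j <= (t\<^sup>2) ^ j" using t by (intro power_decreasing) (auto simp: power_le_one)
 then show "(t\<^sup>2) ^ Suc j <= (1/2) ^ 161" using j by linarith
 qed (use C in auto)
 finally show "prob {w : space P. t ^ n < \<bar>DD (cm f q) (hp (Suc n)) (hp n) (hp n0) w\<bar>} <= C * ((1/2) ^ 161) ^ n" .
 qed
 also have "... = real (card (N n)) * (C * ((1/2) ^ 161) ^ n)" by simp
 also have "... <= real ((3 * 2 ^ (20 * n)) ^ 8) * (C * ((1/2) ^ 161) ^ n)"
 using C N(3)[of n] by (intro mult_right_mono) (auto simp only: of_nat_le_iff mult_nonneg_nonneg zero_le_power zero_le_divide_1_iff zero_le_numeral)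
 also have "... = 3 ^ 8 * C * (1/2) ^ n"
 proof -
 have "(2 ^ (20 * n)) ^ 8 * ((1/2) ^ 161) ^ n = (1/2 :: real) ^ n"
 proof -
 have "(2::real) ^ (20 * n) ^ 8 = 2 ^ (20 * n) ^ 8" ..
 have "((1/2::real) ^ 161) ^ n = (1/2) ^ (160 * n) * (1/2) ^ n"
 by (simp only: power_mult[symmetric] power_add[symmetric]) simp
 moreover have "((2::real) ^ (20 * n)) ^ 8 = 2 ^ (160 * n)" by (simp only: power_mult[symmetric]) (simp add: mult.commute)
 ultimately show ?thesis by (simp add: power_mult_distrib[symmetric] mult.assoc[symmetric] del: power_divide)
 qed
 then show ?thesis by (simp add: power_mult_distrib mult_ac)
 qed
 finally show ?thesis .
 qed
 have "AE w in P. \<forall>\<^sub>F n in sequentially. w : space P - A (n + n0)"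
 proof (rule borel_cantelli_AE1)
 show "A (n + n0) : sets P" for n unfolding A_def
 proof (rule sets.finite_UN[OF N(1)])
 fix q assume "q : N (n + n0)"
 then have "q : chains w0" using N(2) by blast
 then show "{w : space P. t ^ (n + n0) < \<bar>DD (cm f q) (hp (Suc (n + n0))) (hp (n + n0)) (hp n0) w\<bar>} : sets P"
 by (intro As) auto
 qed
 show "emeasure P (A (n + n0)) < \<infinity>" for n by (simp add: emeasure_eq_measure)
 show "summable (%n. measure P (A (n + n0)))"
 proof (rule summable_comparison_test'[of "%n. 3 ^ 8 * C * (1/2) ^ (n + n0)"])
 have "summable (%n. 3 ^ 8 * C * (1/2) ^ n0 * (1/2::real) ^ n)" by (intro summable_mult summable_geometric) simp
 then show "summable (%n. 3 ^ 8 * C * (1/2::real) ^ (n + n0))" by (simp add: power_add mult_ac)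
 show "norm (measure P (A (n + n0))) <= 3 ^ 8 * C * (1/2) ^ (n + n0)" for n using PA[of "n + n0"] by simp
 qed
 qed
 then have ae: "AE w in P. \<forall>\<^sub>F n in sequentially. ALL q:N n. \<bar>DD (cm f q) (hp (Suc n)) (hp n) (hp n0) w\<bar> <= t ^ n"
 proof (rule AE_mp, intro AE_I2 impI)
 fix w assume "w : space P" "\<forall>\<^sub>F n in sequentially. w : space P - A (n + n0)"
 then have "\<forall>\<^sub>F n in sequentially. w : space P - A n"
 using eventually_sequentially_seg[of "%n. w : space P - A n" n0] by simp
 then show "\<forall>\<^sub>F n in sequentially. ALL q:N n. \<bar>DD (cm f q) (hp (Suc n)) (hp n) (hp n0) w\<bar> <= t ^ n"
 proof (rule eventually_mono)
 fix n assume "w : space P - A n"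
 then show "ALL q:N n. \<bar>DD (cm f q) (hp (Suc n)) (hp n) (hp n0) w\<bar> <= t ^ n"
 unfolding A_def using not_less by blast
 qed
 qed
 show ?thesis by (rule that[of t N, OF t N(2) N(4) ae])
qed

text \<open>On the net the increments are at most t^n, and an arbitrary chain is compared with its
  net point by \<open>XR_cm_continuity\<close> in both generations. The resulting bounds are
  summable, so the telescoping series converges uniformly by the M-test, and the limit inherits
  continuity from the terms.\<close>

lemma chain_limit:
 assumes g2: "g < 2" and f: "weight L f" and w0: "w0 = 4 * hp n0"
 shows "AE u in P. EX X. uniform_limit (chains w0) (%n q. XR (cm f q) (hp n) (hp n0) u) X sequentially &
 continuous_on (chains w0) X"
proof (rule chain_net_increments[OF assms])
 fix t N assume t: "0 < t" "t < 1"
 and N: "!!n. N n <= chains w0" "!!n q. q : chains w0 ==> EX q':N n. norm (q - q') <= 8 * (1/2) ^ (20 * n)"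
 and ae: "AE u in P. \<forall>\<^sub>F n in sequentially. ALL q:N n. \<bar>DD (cm f q) (hp (Suc n)) (hp n) (hp n0) u\<bar> <= t ^ n"
 have w0p: "w0 > 0" and w04: "hp n0 <= w0 / 4" by (auto simp: w0)
 have L0: "L >= 0" by (rule weightD(4)[OF f])
 define K where "K = 36 * pi / w0\<^sup>2"
 have K0: "K >= 0" by (simp add: K_def)
 define C where "C = 4 * (32 * pi * L + 2 ^ 6 * (K * 4))"
 define Mb where "Mb n = t ^ n + 2 * C * (1/4) ^ n" for n
 from ae pts_count show ?thesis
 proof (rule AE_mp[OF _ AE_mp], intro AE_I2 impI)
 fix u assume w: "u : space P"
 and e1: "\<forall>\<^sub>F n in sequentially. ALL q:N n. \<bar>DD (cm f q) (hp (Suc n)) (hp n) (hp n0) u\<bar> <= t ^ n"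
 and e2: "\<forall>\<^sub>F n in sequentially. card {p : \<Phi> u. (1/2) ^ n <= snd p} <= 2 ^ (6 * n)"
 let ?X = "%n q. XR (cm f q) (hp n) (hp n0) u"
 have small: "\<forall>\<^sub>F n in sequentially. 16 * (1/2::real) ^ (20 * n) < min (w0 ^ 4 / 80) 1"
 proof (rule order_tendstoD)
 have "(%n. 16 * ((1/2::real) ^ 20) ^ n) \<longlonglongrightarrow> 16 * 0"
 by (intro tendsto_mult tendsto_const LIMSEQ_power_zero) (simp add: power_divide)
 then show "(%n. 16 * (1/2::real) ^ (20 * n)) \<longlonglongrightarrow> 0" by (simp only: power_mult mult_zero_right)
 qed (use w0p in auto)
 have e2': "\<forall>\<^sub>F n in sequentially. card {p : \<Phi> u. (1/2) ^ Suc n <= snd p} <= 2 ^ (6 * Suc n)"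
 using e2 by (subst eventually_sequentially_Suc)
 have ev: "\<forall>\<^sub>F n in sequentially. ALL q:chains w0. norm (?X (Suc n) q - ?X n q) <= Mb n"
 using e1 e2 e2' small eventually_ge_at_top[of n0]
 proof eventually_elim
 case (elim n)
 show ?case
 proof
 fix q assume q: "q : chains w0"
 define a where "a = 8 * (1/2::real) ^ (20 * n)"
 obtain q' where q': "q' : N n" "norm (q - q') <= a" using N(2)[OF q, of n] by (auto simp: a_def)
 have q'c: "q' : chains w0" using q' N by blast
 have a: "2 * a <= w0 ^ 4 / 80" "2 * a <= 1" "a >= 0" using elim(4) by (auto simp: a_def)
 have bnd: "\<bar>?X k q - ?X k q'\<bar> <= C * (1/4) ^ n"
 if k: "k = n \<or> k = Suc n" and card: "card {p : \<Phi> u. hp k <= snd p} <= 2 ^ (6 * k)" for k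
 proof -
 have kn: "k <= Suc n" "n0 <= k" using k elim(5) by auto
 have "\<bar>?X k q - ?X k q'\<bar> <= cc (hp k) (hp n0) * (4 * pi * L * a + real (card {p : \<Phi> u. hp k <= snd p}) * (K * sqrt (2 * a)))"
 unfolding K_def by (rule XR_cm_continuity[OF q q'c f hp_pos w0p w04 hp_le_1 w q'(2) a(1,2)])
 also have "... <= 4 * 4 ^ n * (4 * pi * L * a + (2 ^ 6 * 2 ^ (6 * n)) * (K * sqrt (2 * a)))"
 proof (intro mult_mono add_mono order_refl)
 have "cc (hp k) (hp n0) <= 2 powr (g * real k)" by (rule cc_hp_le[OF kn(2)])
 also have "... <= 2 powr (2 * real (Suc n))" using g2 g_pos kn by (intro powr_mono mult_mono) auto
 also have "2 powr (2 * real (Suc n)) = (2 powr 2) powr real (Suc n)" by (simp only: powr_powr)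
 also have "... = 4 ^ Suc n" by (subst powr_realpow) auto
 also have "... = 4 * 4 ^ n" by simp
 finally show "cc (hp k) (hp n0) <= 4 * 4 ^ n" .
 have "real (card {p : \<Phi> u. hp k <= snd p}) <= real (2 ^ (6 * k))" using card by (simp only: of_nat_le_iff)
 also have "... <= 2 ^ (6 * Suc n)" using kn by (simp del: mult_Suc_right)
 also have "... = 2 ^ 6 * 2 ^ (6 * n)" by (simp only: mult_Suc_right power_add)
 finally show "real (card {p : \<Phi> u. hp k <= snd p}) <= 2 ^ 6 * 2 ^ (6 * n)" .
 qed (use L0 K0 a cc_pos[of "hp k" "hp n0"] in auto)
 \<comment> \<open>Per generation the normalisation grows by at most 2^2 and the bound for the
   number of balls by 2^6, while the square root of the mesh shrinks by 2^(-10). The mesh exponent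
   20 is large enough for 2 + 6 - 10 < 0.\<close>
 also have "... <= 4 * 4 ^ n * ((32 * pi * L + 2 ^ 6 * (K * 4)) * (1/16) ^ n)"
 proof (intro mult_left_mono)
 have p1: "(1/2::real) ^ (20 * n) <= (1/16) ^ n"
 proof -
 have "(1/2::real) ^ (20 * n) <= (1/2) ^ (4 * n)" by (intro power_decreasing) auto
 moreover have "(1/2::real) ^ 4 = 1/16" by (simp add: power_divide)
 ultimately show ?thesis by (simp only: power_mult)
 qed
 have s: "sqrt (2 * a) = 4 * (1/2) ^ (10 * n)"
 proof (rule real_sqrt_unique)
 have "((1/2::real) ^ (10 * n))\<^sup>2 = (1/2) ^ (20 * n)"
 unfolding power_mult[symmetric] by (rule arg_cong[where f="power (1/2)"]) simp
 then show "(4 * (1/2::real) ^ (10 * n))\<^sup>2 = 2 * a"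
 unfolding power_mult_distrib a_def by simp
 qed simp
 have p2: "2 ^ (6 * n) * (1/2::real) ^ (10 * n) = (1/16) ^ n"
 proof -
 have "2 ^ (6 * n) * (1/2::real) ^ (10 * n) = (2 ^ 6 * (1/2) ^ 10) ^ n"
 by (simp only: power_mult power_mult_distrib)
 moreover have "2 ^ 6 * (1/2::real) ^ 10 = 1/16" by (simp add: power_divide)
 ultimately show ?thesis by (simp only:)
 qed
 have "4 * pi * L * a <= 32 * pi * L * (1/16) ^ n"
 using mult_left_mono[OF p1, of "32 * pi * L"] L0 by (simp add: a_def mult_ac)
 moreover have "2 ^ 6 * 2 ^ (6 * n) * (K * sqrt (2 * a)) = 2 ^ 6 * (K * 4) * (2 ^ (6 * n) * (1/2) ^ (10 * n))"
 unfolding s by (simp only: mult_ac)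
 ultimately show "4 * pi * L * a + 2 ^ 6 * 2 ^ (6 * n) * (K * sqrt (2 * a)) <= (32 * pi * L + 2 ^ 6 * (K * 4)) * (1/16) ^ n"
 unfolding p2 distrib_right by linarith
 qed simp
 also have "... = C * (1/4) ^ n"
 proof -
 have "4 ^ n * (1/16::real) ^ n = (1/4) ^ n" by (simp add: power_mult_distrib[symmetric])
 moreover have "4 * 4 ^ n * (D * (1/16) ^ n) = 4 * D * (4 ^ n * (1/16) ^ n)" for D :: real by simp
 ultimately show ?thesis unfolding C_def by (simp only:)
 qed
 finally show ?thesis .
 qed
 have "DD (cm f q') (hp (Suc n)) (hp n) (hp n0) u = ?X (Suc n) q' - ?X n q'"
 using elim(5) by (intro DD_eq_XR_diff finite_cm[OF q'c f] w) (auto intro!: power_decreasing simp: power_le_one hp_pos)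
 then have "\<bar>?X (Suc n) q' - ?X n q'\<bar> <= t ^ n" using elim(1) q'(1) by force
 moreover have "\<bar>?X (Suc n) q - ?X (Suc n) q'\<bar> <= C * (1/4) ^ n" using elim(3) by (intro bnd) auto
 moreover have "\<bar>?X n q - ?X n q'\<bar> <= C * (1/4) ^ n" using elim(2) by (intro bnd) auto
 ultimately show "norm (?X (Suc n) q - ?X n q) <= Mb n" unfolding Mb_def real_norm_def by linarith
 qed
 qed
 have sM: "summable Mb" unfolding Mb_def using t
 by (intro summable_add summable_mult summable_geometric) auto
 have "uniform_limit (chains w0) (%n q. \<Sum>i<n. ?X (Suc i) q - ?X i q) (%q. \<Sum>i. ?X (Suc i) q - ?X i q) sequentially"
 by (rule Weierstrass_m_test_ev[OF ev sM])
 then have "uniform_limit (chains w0) (%n q. ?X n q - ?X 0 q) (%q. \<Sum>i. ?X (Suc i) q - ?X i q) sequentially"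
 proof -
 have "(\<Sum>i<n. ?X (Suc i) q - ?X i q) = ?X n q - ?X 0 q" for n q
 by (rule sum_lessThan_telescope)
 then show "uniform_limit (chains w0) (%n q. \<Sum>i<n. ?X (Suc i) q - ?X i q) (%q. \<Sum>i. ?X (Suc i) q - ?X i q) sequentially ==> ?thesis"
 by (simp only:)
 qed
 then have "uniform_limit (chains w0) (%n q. (?X n q - ?X 0 q) + ?X 0 q) (%q. (\<Sum>i. ?X (Suc i) q - ?X i q) + ?X 0 q) sequentially"
 by (intro uniform_limit_add uniform_limit_const)
 then have ul: "uniform_limit (chains w0) ?X (%q. (\<Sum>i. ?X (Suc i) q - ?X i q) + ?X 0 q) sequentially" by simp
 have cont: "continuous_on (chains w0) (?X n)" for n
 unfolding continuous_on_iff
 proof (intro ballI allI impI)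
 fix q and e :: real assume q: "q : chains w0" and e: "e > 0"
 \<comment> \<open>The continuity bound as a function of the distance: for fixed n its constants are
   fixed, and it vanishes at 0.\<close>
 define h where "h a = cc (hp n) (hp n0) * (4 * pi * L * a + real (card {p : \<Phi> u. hp n <= snd p}) * (K * sqrt (2 * a)))" for a
 have "isCont h 0" unfolding h_def by (intro continuous_intros)
 then have "h \<midarrow>0\<rightarrow> 0" by (simp add: isCont_def h_def)
 from LIM_D[OF this e] obtain s where s: "s > 0" "!!x. x ~= 0 ==> \<bar>x\<bar> < s ==> \<bar>h x\<bar> < e" by auto
 define d where "d = min (s / 2) (min (w0 ^ 4 / 160) (1/2))"
 have d: "d > 0" "d < s" "2 * d <= w0 ^ 4 / 80" "2 * d <= 1" using s w0p by (auto simp: d_def)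
 show "EX d>0. ALL q':chains w0. dist q' q < d --> dist (?X n q') (?X n q) < e"
 proof (intro exI[of _ d] conjI ballI impI d)
 fix q' assume q': "q' : chains w0" "dist q' q < d"
 have "\<bar>?X n q' - ?X n q\<bar> <= h d"
 unfolding h_def K_def
 by (rule XR_cm_continuity[OF q'(1) q f hp_pos w0p w04 hp_le_1 w _ d(3,4)])
 (use q'(2) in \<open>simp add: dist_norm\<close>)
 also have "... < e" using s(2)[of d] d by auto
 finally show "dist (?X n q') (?X n q) < e" by (simp add: dist_real_def)
 qed
 qed
 have "continuous_on (chains w0) (%q. (\<Sum>i. ?X (Suc i) q - ?X i q) + ?X 0 q)"
 by (rule uniform_limit_theorem[OF _ ul]) (use cont in auto)
 with ul show "EX X. uniform_limit (chains w0) ?X X sequentially & continuous_on (chains w0) X" by blast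
 qed
qed

end

section \<open>Masses of tubes\<close>

definition pens :: "real => (c2 \<times> complex) set" where
 "pens c = {(b, a). norm b = 1 & cmod a <= 1 - c}"

definition tm :: "c2 => complex => real => c2 measure" where
 "tm b a r = density surf (indicator (tube b a r))"

lemma sets_tm[simp]: "sets (tm b a r) = sets S3b" by (simp add: tm_def)

lemma tube_S3b: "tube b a r : sets S3b" by (intro borel_sub_S3b) (auto simp: tube_def[of b a r] intro: tube_borel[unfolded tube_def])

lemma tube_sets_surf[measurable]: "tube b a r : sets surf" using tube_S3b by simp

lemma emeasure_tm: "A : sets S3b ==> emeasure (tm b a r) A = emeasure surf (tube b a r Int A)"
proof -
 assume A: "A : sets S3b"
 then have "emeasure (tm b a r) A = (NN surf (%y. indicator (tube b a r) y * indicator A y))"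
 unfolding tm_def by (intro emeasure_density borel_measurable_indicator tube_sets_surf) simp
 also have "... = (NN surf (%y. indicator (tube b a r Int A) y))"
 by (simp add: indicator_inter_arith)
 also have "... = emeasure surf (tube b a r Int A)"
 using A tube_sets_surf by (intro nn_integral_indicator sets.Int) auto
 finally show ?thesis .
qed

lemma finite_tm: "finite_measure (tm b a r)"
proof (rule finite_measureI)
 interpret finite_measure surf by (rule finite_measure_surf)
 have "space (tm b a r) = S3" by (simp add: tm_def)
 then show "emeasure (tm b a r) (space (tm b a r)) ~= \<infinity>"
 using emeasure_tm[of S3 b a r] by (simp add: borel_sub_S3b emeasure_eq_measure)
qed

lemma nn_integral_tm:
 assumes "f : borel_measurable S3b"
 shows "(NN (tm b a r) (%y. f y)) = (NN surf (%y. f y * indicator (tube b a r) y))"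
 unfolding tm_def using assms
 by (subst nn_integral_density) (auto simp: mult.commute intro!: borel_measurable_indicator)

lemma vcball_S3b: "{z : S3. dvis x z <= s} : sets S3b"
proof -
 have "{z : S3. dvis x z <= s} = S3 Int {z. dvis x z <= s}" by auto
 moreover have "{z. dvis x z <= s} : sets borel" by measurable
 ultimately show ?thesis by (auto intro: borel_sub_S3b)
qed

lemma surf_vcball_le:
 assumes "x : S3" "s > 0" shows "emeasure surf {z : S3. dvis x z <= s} <= ennreal (16 * hsA * s ^ 4)"
proof -
 have "emeasure surf {z : S3. dvis x z <= s} <= emeasure surf (vball x (2 * s))"
 proof (rule emeasure_mono)
 show "{z : S3. dvis x z <= s} <= vball x (2 * s)" using assms by (auto simp: vball_def)
 qed simp
 also have "... = ennreal (hs (2 * s))" using assms by (intro emeasure_vball_hs) auto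
 also have "... <= ennreal (16 * hsA * s ^ 4)"
 using hs_le[of "2 * s"] assms by (intro ennreal_leI) (simp add: power_mult_distrib mult_ac)
 finally show ?thesis .
qed

text \<open>Geometric interpolation between the two ball bounds: the exponent t goes to the width of
  the tube and 4 - t to the ball. As long as 4 - t > g the kernel remains integrable while a factor
  r^t is gained.\<close>

lemma min_powr_le:
 fixes s r t :: real assumes "s > 0" "r > 0" "0 <= t" "t <= 2"
 shows "min (s ^ 4) (r\<^sup>2 * s\<^sup>2) <= r powr t * s powr (4 - t)"
proof (cases "s <= r")
 case True
 have "s powr t * s powr (4 - t) = s powr 4" by (simp only: powr_add[symmetric]) simp
 also have "... = s ^ 4" using assms by (simp add: powr_numeral)
 finally have "s ^ 4 = s powr t * s powr (4 - t)" by simp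
 also have "... <= r powr t * s powr (4 - t)" using assms True by (intro mult_right_mono powr_mono2) auto
 finally show ?thesis by simp
next
 case False
 have "r powr t * r powr (2 - t) = r powr 2" by (simp only: powr_add[symmetric]) simp
 then have "r\<^sup>2 * s\<^sup>2 = (r powr t * r powr (2 - t)) * s powr 2"
 using assms by (simp add: powr_numeral)
 also have "... <= (r powr t * s powr (2 - t)) * s powr 2"
 using assms False by (intro mult_right_mono mult_left_mono powr_mono2) auto
 also have "... = r powr t * s powr (4 - t)" by (simp only: mult.assoc powr_add[symmetric]) simp
 finally show ?thesis by simp
qed

lemma tm_ball_le:
 assumes b: "norm b = 1" and r: "r > 0" and w0: "w0 > 0" and t: "0 <= t" "t <= 2"
 and v: "!!v. cmod (v - a) <= r ==> (cmod v)\<^sup>2 <= 1 - w0\<^sup>2" and s: "s > 0" and x: "x : S3"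
 shows "emeasure (tm b a r) {z : S3. dvis x z <= s} <= ennreal ((16 * hsA + 32 * pi\<^sup>2 / w0\<^sup>2) * r powr t * s powr (4 - t))"
proof -
 let ?K = "16 * hsA + 32 * pi\<^sup>2 / w0\<^sup>2"
 have K: "16 * hsA <= ?K" "32 * pi\<^sup>2 / w0\<^sup>2 <= ?K" "?K >= 0" using hsA_pos by auto
 have "emeasure (tm b a r) {z : S3. dvis x z <= s} = emeasure surf (tube b a r Int {z : S3. dvis x z <= s})"
 by (rule emeasure_tm[OF vcball_S3b])
 also have "... <= ennreal (?K * min (s ^ 4) (r\<^sup>2 * s\<^sup>2))"
 proof (cases "s ^ 4 <= r\<^sup>2 * s\<^sup>2")
 case True
 have "emeasure surf (tube b a r Int {z : S3. dvis x z <= s}) <= emeasure surf {z : S3. dvis x z <= s}"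
 using vcball_S3b by (intro emeasure_mono) auto
 also have "... <= ennreal (16 * hsA * s ^ 4)" by (rule surf_vcball_le[OF x s])
 also have "... <= ennreal (?K * s ^ 4)" using K s by (intro ennreal_leI mult_right_mono) auto
 finally show ?thesis using True by (simp add: min_def)
 next
 case False
 have "emeasure surf (tube b a r Int {z : S3. dvis x z <= s}) <= ennreal (32 * pi\<^sup>2 / w0\<^sup>2 * r\<^sup>2 * s\<^sup>2)"
 using surf_tube_ball_le[OF b _ w0 _ x v] r s by simp
 also have "... <= ennreal (?K * (r\<^sup>2 * s\<^sup>2))"
 unfolding mult.assoc[of _ "r\<^sup>2"] using K by (intro ennreal_leI mult_right_mono) auto
 finally show ?thesis using False by (simp add: min_def)
 qed
 also have "... <= ennreal (?K * (r powr t * s powr (4 - t)))"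
 using K by (intro ennreal_leI mult_left_mono min_powr_le s r t)
 finally show ?thesis by (simp add: mult.assoc)
qed

text \<open>Fatou's lemma transfers the uniform moment bound to the lower limit, so one exceptional
  event serves for all n. A bound for the lower limit suits \<open>dominated\<close>, which asks for
  infinitely many n only.\<close>

lemma (in prob_space) liminf_markov:
 fixes x :: "nat => 'a => ennreal"
 assumes [measurable]: "!!n. x n : borel_measurable M"
 and E: "!!n. (NN M (%u. x n u ^ k)) <= ennreal B" and B: "B >= 0" and s: "s > 0"
 shows "EX A:sets M. prob A <= B / s ^ k & (ALL u:space M - A. liminf (%n. x n u) <= ennreal s)"
proof -
 define A where "A = {u : space M. ennreal (s ^ k) <= liminf (%n. x n u ^ k)}"
 have Am: "A : sets M" unfolding A_def by measurable
 have "ennreal (s ^ k) * emeasure M A = (NN M (%u. ennreal (s ^ k) * indicator A u))"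
 using Am by (simp add: nn_integral_cmult_indicator)
 also have "... <= (NN M (%u. liminf (%n. x n u ^ k)))"
 by (intro nn_integral_mono) (auto simp: A_def indicator_def)
 also have "... <= liminf (%n. \<integral>\<^sup>+u. x n u ^ k \<partial>M)" by (rule nn_integral_liminf) measurable
 also have "... <= ennreal B" using Liminf_le[of sequentially] E by (intro Liminf_le) auto
 finally have "ennreal (s ^ k * prob A) <= ennreal B" using s by (simp add: emeasure_eq_measure ennreal_mult')
 then have "s ^ k * prob A <= B" using B by simp
 then have 1: "prob A <= B / s ^ k" using s by (simp add: field_simps)
 have 2: "liminf (%n. x n u) <= ennreal s" if w: "u : space M - A" for u
 proof (rule ccontr)
 assume "\<not> liminf (%n. x n u) <= ennreal s"
 then have "ennreal s < liminf (%n. x n u)" by simp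
 then have "\<forall>\<^sub>F n in sequentially. ennreal s < x n u" by (rule less_LiminfD)
 then have "\<forall>\<^sub>F n in sequentially. ennreal (s ^ k) <= x n u ^ k"
 using s by (auto elim!: eventually_mono simp: ennreal_power[symmetric] intro!: power_mono)
 then have "ennreal (s ^ k) <= liminf (%n. x n u ^ k)" by (rule Liminf_bounded)
 then show False using w by (simp add: A_def)
 qed
 show ?thesis using Am 1 2 by blast
qed

lemma tube_subset:
 assumes "norm (b - b') + cmod (a - a') <= r" shows "tube b a r <= tube b' a' (2 * r)"
proof
 fix y assume y: "y : tube b a r"
 then have ny: "norm y = 1" by (simp add: tube_def in_S3)
 have "hin y b' - a' = (hin y b - a) - hin y (b - b') + (a - a')" by (simp add: hin_diff_right)
 then have "cmod (hin y b' - a') = cmod ((hin y b - a) - hin y (b - b') + (a - a'))" by (simp only:)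
 then have "cmod (hin y b' - a') <= cmod (hin y b - a) + cmod (hin y (b - b')) + cmod (a - a')"
 using norm_triangle_ineq[of "(hin y b - a) - hin y (b - b')" "a - a'"]
 norm_triangle_ineq4[of "hin y b - a" "hin y (b - b')"] by linarith
 moreover have "cmod (hin y (b - b')) <= norm (b - b')" using cmod_hin_le[of y "b - b'"] ny by simp
 ultimately show "y : tube b' a' (2 * r)" using y assms by (simp add: tube_def)
qed

text \<open>The centre of the tube keeps the distance c from the unit circle. Half of it absorbs the
  width of the tube, the other half bounds the radii of all its chains from below.\<close>

lemma pens_nondegenerate:
 assumes "cmod a <= 1 - c" "0 < c" "c < 1" "r <= c / 2" "cmod (v - a) <= r"
 shows "(cmod v)\<^sup>2 <= 1 - (sqrt (c / 2))\<^sup>2"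
proof -
 have "cmod v <= cmod a + cmod (v - a)" using norm_triangle_ineq[of a "v - a"] by simp
 then have v: "cmod v <= 1 - c / 2" using assms by simp
 then have "(cmod v)\<^sup>2 <= (1 - c / 2)\<^sup>2" by (intro power_mono) auto
 also have "... <= 1 - c / 2" unfolding power2_eq_square using assms by (intro mult_left_le) auto
 finally show ?thesis using assms by simp
qed

lemma pens_net:
 assumes c: "0 < c" "c < 1"
 obtains N where "finite N" "N <= pens c" "card N <= 49 ^ 6 * 2 ^ (6 * i)"
 "!!b a. (b, a) : pens c ==> \<exists>(b', a')\<in>N. norm (b - b') + cmod (a - a') <= (1/2) ^ i"
proof -
 have sub: "pens c <= cball 0 2"
 proof
 fix p assume "p : pens c"
 then obtain b a where p: "p = (b, a)" "norm b = 1" "cmod a <= 1 - c" by (auto simp: pens_def)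
 have "norm p <= norm b + norm a" unfolding p(1) by (rule norm_Pair_le)
 then show "p : cball 0 2" using p c by (simp add: mem_cball_0 del: mem_cball)
 qed
 obtain N where N: "finite N" "N <= pens c" "card N <= (2 * (24 * 2 ^ i) + 1) ^ 6"
 "!!p. p : pens c ==> EX p':N. norm (p - p') <= 6 * 2 / real (24 * 2 ^ i)"
 using finite_net[OF sub, of "24 * 2 ^ i"] by auto
 show ?thesis
 proof (rule that[OF N(1,2)])
 have "(2 * (24 * 2 ^ i) + 1) ^ 6 <= ((49 * 2 ^ i) ^ 6 :: nat)"
 using one_le_power[of "2::nat" i] by (intro power_mono) auto
 also have "... = 49 ^ 6 * 2 ^ (6 * i)" by (simp only: power_mult_distrib power_mult[symmetric] mult.commute)
 finally show "card N <= 49 ^ 6 * 2 ^ (6 * i)" using N(3) by linarith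
 fix b a assume "(b, a) : pens c"
 from N(4)[OF this] obtain b' a' where p: "(b', a') : N" "norm ((b, a) - (b', a')) <= 6 * 2 / real (24 * 2 ^ i)" by auto
 have "norm (b - b') + cmod (a - a') <= 2 * norm ((b, a) - (b', a'))"
 using norm_fst_snd_le[of "(b, a) - (b', a')"] by simp
 also have "... <= (1/2) ^ i" using p(2) by (simp add: power_divide)
 finally show "\<exists>(b', a')\<in>N. norm (b - b') + cmod (a - a') <= (1/2) ^ i" using p(1) by blast
 qed
qed

context cutout_process
begin

lemma XX_mono: assumes "A <= B" "A = tube b p r" "B = tube b' p' r'" "0 < a" "a' <= 1" "w : space P"
 shows "XX (tm b p r) a a' w <= XX (tm b' p' r') a a' w"
proof -
 have "(%y. av a a' w y) : borel_measurable S3b"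
 using measurable_Pair2[OF av_measurable[OF assms(4,5)] assms(6)] by simp
 then have m: "(%y. ennreal (cc a a' * av a a' w y)) : borel_measurable S3b" by measurable
 show ?thesis unfolding XX_def nn_integral_tm[OF m]
 using assms(1-3) by (intro nn_integral_mono mult_left_mono) (auto simp: indicator_def)
qed

text \<open>The ball bound with exponent 4 - t > g has a constant proportional to r^t, and in
  \<open>moment_bound\<close> this constant enters once for every factor.\<close>

lemma tube_moment:
 assumes t: "0 < t" "t <= 2" "t < 4 - g" and b: "norm b = 1" and r: "r > 0" and w0: "w0 > 0"
 and v: "!!v. cmod (v - a) <= r ==> (cmod v)\<^sup>2 <= 1 - w0\<^sup>2"
 shows "(NN P (%w. XX (tm b a r) (hp n) 1 w ^ Suc k))
 <= ennreal (fact k * ((16 * hsA + 32 * pi\<^sup>2 / w0\<^sup>2) * (2 powr (2 * g) / (1 - 2 powr (g - (4 - t)))) * r powr t) ^ Suc k)"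
proof -
 define K where "K = (16 * hsA + 32 * pi\<^sup>2 / w0\<^sup>2) * r powr t"
 define Cb where "Cb = 2 powr (2 * g) / (1 - 2 powr (g - (4 - t)))"
 interpret m: finite_measure "tm b a r" by (rule finite_tm)
 have K0: "K >= 0" using hsA_pos by (simp add: K_def)
 have q: "2 powr (g - (4 - t)) < 1" using t by (intro powr_less_one) auto
 have Cb1: "Cb >= 1"
 proof -
 have "1 - 2 powr (g - (4 - t)) <= 1" by simp
 also have "1 <= 2 powr (2 * g)" using g_pos by (intro ge_one_powr_ge_zero) auto
 finally show ?thesis unfolding Cb_def using q by (simp add: le_divide_eq)
 qed
 have "(NN P (%w. XX (tm b a r) (hp n) 1 w ^ Suc k)) <= ennreal (measure (tm b a r) S3 * (fact k * (K * Cb) ^ k))"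
 proof (rule moment_bound[where N=n, OF finite_tm])
 show "(NN (tm b a r) (%y. ennreal (kern g n y y'))) <= ennreal (K * Cb)" if y': "y' : S3" for y'
 unfolding Cb_def
 proof (rule nn_integral_kern_le[where \<beta>="4 - t" and K=K])
 fix j
 have "emeasure (tm b a r) {z : S3. dvis y' z <= (1/2) ^ j} <= ennreal (K * ((1/2) ^ j) powr (4 - t))"
 unfolding K_def using t by (intro tm_ball_le b r w0 v y') auto
 also have "((1/2::real) ^ j) powr (4 - t) = 2 powr (- (4 - t) * real j)"
 unfolding hp_powr powr_powr by (simp add: algebra_simps)
 finally show "emeasure (tm b a r) {z : S3. dvis y' z <= (1/2) ^ j} <= ennreal (K * 2 powr (- (4 - t) * real j))" .
 qed (use t K0 in auto)
 qed (use K0 Cb1 in \<open>auto simp: power_le_one\<close>)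
 also have "... <= ennreal (K * Cb * (fact k * (K * Cb) ^ k))"
 proof (intro ennreal_leI mult_right_mono)
 have "emeasure (tm b a r) {z : S3. dvis (1, 0) z <= 1} <= ennreal (K * 1 powr (4 - t))"
 unfolding K_def using t by (intro tm_ball_le b r w0 v one_zero_S3) auto
 moreover have "{z : S3. dvis (1, 0) z <= 1} = S3" using dvis_le_1[OF one_zero_S3] by auto
 ultimately have "measure (tm b a r) S3 <= K" using K0 by (simp add: m.emeasure_eq_measure)
 also have "K * 1 <= K * Cb" using Cb1 K0 by (intro mult_left_mono) auto
 finally show "measure (tm b a r) S3 <= K * Cb" by simp
 qed (use K0 Cb1 in auto)
 also have "K * Cb * (fact k * (K * Cb) ^ k) = fact k * (K * Cb) ^ Suc k" by simp
 also have "K * Cb = (16 * hsA + 32 * pi\<^sup>2 / w0\<^sup>2) * Cb * r powr t" by (simp add: K_def)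
 finally show ?thesis unfolding Cb_def .
qed

text \<open>The Frostman bound for tubes, up to an arbitrarily small loss in the exponent.\<close>
lemma tube_frostman:
 assumes t: "0 < t" "t < 2" "t < 4 - g" and c: "0 < c" "c < 1"
 shows "AE u in P. \<forall>\<^sub>F i in sequentially. \<forall>(b, a)\<in>pens c.
 liminf (%n. XX (tm b a (hp i)) (hp n) 1 u) <= ennreal (hp i powr t)"
proof -
 \<comment> \<open>An exponent strictly between t and the critical one; the gap d gains a factor
   2^(-i d) for each order of the moment.\<close>
 define t1 where "t1 = (t + min 2 (4 - g)) / 2"
 have t1: "t < t1" "t1 <= 2" "t1 < 4 - g" using t by (auto simp: t1_def min_def field_simps)
 define d where "d = t1 - t"
 have d: "d > 0" using t1 by (simp add: d_def)
 \<comment> \<open>Tubes have 6 real parameters, so the net at scale 2^(-i) has of order 2^(6 i)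
   elements; an order k with k d > 7 leaves a summable 2^(-i).\<close>
 obtain k :: nat where k: "7 / d < real k" using reals_Archimedean2 by blast
 define w0 where "w0 = sqrt (c / 2)"
 have w0: "w0 > 0" using c by (simp add: w0_def)
 define C where "C = (16 * hsA + 32 * pi\<^sup>2 / w0\<^sup>2) * (2 powr (2 * g) / (1 - 2 powr (g - (4 - t1))))"
 have C0: "C >= 0" unfolding C_def using hsA_pos t1 powr_less_one[of 2 "g - (4 - t1)"] by (intro mult_nonneg_nonneg divide_nonneg_nonneg) auto
 define Q where "Q i N \<longleftrightarrow> finite N & N <= pens c & card N <= 49 ^ 6 * 2 ^ (6 * i) &
 (\<forall>(b, a)\<in>pens c. \<exists>(b', a')\<in>N. norm (b - b') + cmod (a - a') <= (1/2) ^ i)" for i N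
 have "EX N. Q i N" for i
 unfolding Q_def
 proof (rule pens_net[OF c])
 fix N assume N: "finite N" "N <= pens c" "card N <= 49 ^ 6 * 2 ^ (6 * i)"
 "!!b a. (b, a) : pens c ==> \<exists>(b', a')\<in>N. norm (b - b') + cmod (a - a') <= (1/2) ^ i"
 then show "EX N. finite N & N <= pens c & card N <= 49 ^ 6 * 2 ^ (6 * i) &
 (\<forall>(b, a)\<in>pens c. \<exists>(b', a')\<in>N. norm (b - b') + cmod (a - a') <= (1/2) ^ i)"
 by (intro exI[of _ N] conjI) blast+
 qed
 then obtain N where "!!i. Q i (N i)" by metis
 then have N: "!!i. finite (N i)" "!!i. N i <= pens c" "!!i. card (N i) <= 49 ^ 6 * 2 ^ (6 * i)"
 "!!i. \<forall>(b, a)\<in>pens c. \<exists>(b', a')\<in>N i. norm (b - b') + cmod (a - a') <= (1/2) ^ i"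
 unfolding Q_def by blast+
 obtain i0 where i0: "2 * hp i0 <= c / 2"
 proof -
 obtain i where "(1/2::real) ^ i < c / 4" using real_arch_pow_inv[of "c / 4" "1/2"] c by auto
 then show ?thesis using that[of i] by simp
 qed
 define S where "S i = fact k * (C * (2 * hp i) powr t1) ^ Suc k / (hp i powr t) ^ Suc k" for i
 define R where "R i b a A \<longleftrightarrow> prob A <= S i & (ALL u:space P - A. liminf (%n. XX (tm b a (2 * hp i)) (hp n) 1 u) <= ennreal (hp i powr t))" for i b a A
 have ex: "EX A:sets P. R i b a A"
 if i: "i >= i0" and p: "(b, a) : pens c" for i b a
 unfolding R_def S_def
 proof (rule liminf_markov[where k="Suc k"])
 show "XX (tm b a (2 * hp i)) (hp n) 1 : borel_measurable P" for n
 by (intro XX_measurable finite_tm) (auto simp: hp_pos)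
 have "hp i <= hp i0" using i by (intro power_decreasing) auto
 then have hi: "2 * hp i <= c / 2" using i0 by linarith
 show "(NN P (%u. XX (tm b a (2 * hp i)) (hp n) 1 u ^ Suc k)) <= ennreal (fact k * (C * (2 * hp i) powr t1) ^ Suc k)" for n
 unfolding C_def
 proof (rule tube_moment)
 fix v assume "cmod (v - a) <= 2 * hp i"
 then show "(cmod v)\<^sup>2 <= 1 - w0\<^sup>2" unfolding w0_def
 using p c hi by (intro pens_nondegenerate[of a c "2 * hp i"]) (auto simp: pens_def)
 qed (use t t1 p w0 in \<open>auto simp: pens_def\<close>)
 qed (use C0 in auto)
 define A where "A i b a = (SOME A. A : sets P & R i b a A)" for i b a
 have "A i b a : sets P & R i b a (A i b a)" if "i >= i0" "(b, a) : pens c" for i b a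
 unfolding A_def by (rule someI_ex) (use ex[OF that] in blast)
 then have A: "!!i b a. i >= i0 ==> (b, a) : pens c ==> A i b a : sets P"
 "!!i b a. i >= i0 ==> (b, a) : pens c ==> prob (A i b a) <= S i"
 "!!i b a u. i >= i0 ==> (b, a) : pens c ==> u : space P - A i b a ==>
 liminf (%n. XX (tm b a (2 * hp i)) (hp n) 1 u) <= ennreal (hp i powr t)"
 unfolding R_def by blast+
 define AA where "AA i = (\<Union>p\<in>N i. A i (fst p) (snd p))" for i
 have AAs: "AA i : sets P" if "i >= i0" for i
 unfolding AA_def
 proof (rule sets.finite_UN[OF N(1)])
 fix p assume "p : N i"
 then have "(fst p, snd p) : pens c" using N(2)[of i] by auto
 then show "A i (fst p) (snd p) : sets P" by (rule A(1)[OF that])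
 qed
 define B where "B = 49 ^ 6 * (fact k * (C * 2 powr t1) ^ Suc k)"
 have PA: "prob (AA i) <= B * (1/2) ^ i" if i: "i >= i0" for i
 proof -
 have "prob (AA i) <= (\<Sum>p\<in>N i. prob (A i (fst p) (snd p)))"
 unfolding AA_def
 proof (rule finite_measure_subadditive_finite[OF N(1)], rule image_subsetI)
 fix p assume "p : N i"
 then have "(fst p, snd p) : pens c" using N(2)[of i] by auto
 then show "A i (fst p) (snd p) : sets P" by (rule A(1)[OF i])
 qed
 also have "... <= (\<Sum>p\<in>N i. S i)"
 proof (rule sum_mono)
 fix p assume "p : N i"
 then have "(fst p, snd p) : pens c" using N(2)[of i] by auto
 then show "prob (A i (fst p) (snd p)) <= S i" by (rule A(2)[OF i])
 qed
 also have "... = real (card (N i)) * S i" by simp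
 also have "... <= real (49 ^ 6 * 2 ^ (6 * i)) * S i"
 proof (rule mult_right_mono)
 show "real (card (N i)) <= real (49 ^ 6 * 2 ^ (6 * i))" using N(3)[of i] by (simp only: of_nat_le_iff)
 show "0 <= S i" unfolding S_def using C0 by simp
 qed
 also have "... <= B * (1/2) ^ i"
 proof -
 have hp_t: "hp i powr t1 = hp i powr t * hp i powr d" by (simp add: d_def powr_add[symmetric])
 have "C * (2 * hp i) powr t1 = (C * 2 powr t1) * (hp i powr t * hp i powr d)"
 using hp_pos[of i] by (simp only: powr_mult hp_t mult.assoc)
 then have e1: "S i = fact k * ((C * 2 powr t1) * (hp i powr t * hp i powr d)) ^ Suc k / (hp i powr t) ^ Suc k"
 unfolding S_def by (simp only:)
 have e2: "fact k * (y * (x * z)) ^ Suc k / x ^ Suc k = fact k * (y ^ Suc k * z ^ Suc k)"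
 if "x ~= 0" for x y z :: real using that by (simp add: power_mult_distrib)
 have "hp i powr t ~= 0" by simp
 from trans[OF e1 e2[OF this]]
 have "S i = fact k * ((C * 2 powr t1) ^ Suc k * (hp i powr d) ^ Suc k)" .
 moreover have "2 ^ (6 * i) * (hp i powr d) ^ Suc k <= (1/2) ^ i"
 proof -
 have "(hp i powr d) ^ Suc k = 2 powr (- real i * d * real (Suc k))"
 unfolding hp_powr powr_powr by (simp only: powr_power) (simp add: mult_ac)
 also have "... <= 2 powr (- real i * 7)"
 proof (rule powr_mono)
 have "7 <= d * real (Suc k)" using k d by (simp add: field_simps)
 then have "real i * 7 <= real i * (d * real (Suc k))" by (intro mult_left_mono) auto
 then show "- real i * d * real (Suc k) <= - real i * 7" by (simp add: mult.assoc)
 qed simp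
 finally have pd: "(hp i powr d) ^ Suc k <= 2 powr (- real i * 7)" .
 have "2 ^ (6 * i) * (hp i powr d) ^ Suc k <= 2 powr (6 * real i) * 2 powr (- real i * 7)"
 proof (rule mult_mono)
 have "2 powr (6 * real i) = 2 powr real (6 * i)" by simp
 also have "... = 2 ^ (6 * i)" by (rule powr_realpow) simp
 finally show "2 ^ (6 * i) <= 2 powr (6 * real i)" by simp
 qed (rule pd | simp)+
 also have "... = hp i" unfolding hp_powr powr_add[symmetric] by simp
 finally show ?thesis .
 qed
 ultimately show ?thesis using C0 unfolding B_def
 by (simp del: power_Suc add: mult.assoc) (simp only: mult.left_commute[of "2 ^ (6 * i)"], intro mult_left_mono, auto)
 qed
 finally show ?thesis .
 qed
 have "AE u in P. \<forall>\<^sub>F n in sequentially. u : space P - AA (n + i0)"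
 proof (rule borel_cantelli_AE1)
 show "AA (n + i0) : sets P" for n by (rule AAs) simp
 show "emeasure P (AA (n + i0)) < \<infinity>" for n by (simp add: emeasure_eq_measure)
 show "summable (%n. measure P (AA (n + i0)))"
 proof (rule summable_comparison_test'[of "%n. B * (1/2) ^ (n + i0)"])
 have "summable (%n. B * (1/2) ^ i0 * (1/2::real) ^ n)" by (intro summable_mult summable_geometric) simp
 then show "summable (%n. B * (1/2::real) ^ (n + i0))" by (simp add: power_add mult_ac)
 show "norm (measure P (AA (n + i0))) <= B * (1/2) ^ (n + i0)" for n using PA[of "n + i0"] by simp
 qed
 qed
 then show ?thesis
 proof (rule AE_mp, intro AE_I2 impI)
 fix u assume w: "u : space P" and e: "\<forall>\<^sub>F n in sequentially. u : space P - AA (n + i0)"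
 then have "\<forall>\<^sub>F n in sequentially. u : space P - AA n"
 using eventually_sequentially_seg[of "%n. u : space P - AA n" i0] by simp
 then show "\<forall>\<^sub>F i in sequentially. \<forall>(b, a)\<in>pens c. liminf (%n. XX (tm b a (hp i)) (hp n) 1 u) <= ennreal (hp i powr t)"
 using eventually_ge_at_top[of i0]
 proof eventually_elim
 case (elim i)
 have "liminf (%n. XX (tm b a (hp i)) (hp n) 1 u) <= ennreal (hp i powr t)" if p: "(b, a) : pens c" for b a
 proof -
 obtain b' a' where p': "(b', a') : N i" "norm (b - b') + cmod (a - a') <= hp i" using N(4)[of i] p by blast
 have p'': "(b', a') : pens c" using p'(1) N(2)[of i] by blast
 \<comment> \<open>Every tube lies in a tube of the net of twice the width, which is why the
   exceptional events were formed for \<open>2 * hp i\<close>.\<close>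
 have sub: "tube b a (hp i) <= tube b' a' (2 * hp i)" by (rule tube_subset[OF p'(2)])
 have "liminf (%n. XX (tm b a (hp i)) (hp n) 1 u) <= liminf (%n. XX (tm b' a' (2 * hp i)) (hp n) 1 u)"
 by (intro Liminf_mono always_eventually allI XX_mono[OF sub] w) (auto simp: hp_pos)
 also have "... <= ennreal (hp i powr t)"
 proof (rule A(3)[OF elim(2) p''])
 show "u : space P - A i b' a'" using elim(1) p'(1) unfolding AA_def by force
 qed
 finally show ?thesis .
 qed
 then show ?case by blast
 qed
 qed
qed

text \<open>Below exponent 2 for the process the same bound holds without loss, by integrating the uniform
 bound along the parallel chains that make up a tube.\<close>
lemma tube_integral_le:
 assumes b: "norm b = 1" and f: "weight L f" and r: "r >= 0" and a: "0 < a" "a <= hp n0" and w0: "w0 > 0"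
 and w: "u : space P" and M: "M >= 0"
 and v: "!!v. cmod (v - A) <= r ==> pencil b v : chains w0 & XR (cm f (pencil b v)) a (hp n0) u <= M"
 shows "(NN surf (%y. ennreal (f y) * ennreal (cc a 1 * av a 1 u y) * indicator (tube b A r) y)) <= ennreal (pi * r\<^sup>2 * (cc (hp n0) 1 * M))"
proof -
 have avb: "(%y. av a 1 u y) : borel_measurable S3b"
 using measurable_Pair2[OF av_measurable[OF a(1)] w, of 1] by simp
 define G where "G y = ennreal (f y) * ennreal (cc a 1 * av a 1 u y) * indicator S3 y" for y
 have Gm: "G : borel_measurable borel"
 proof -
 have "(%y. ennreal (f y) * ennreal (cc a 1 * av a 1 u y)) : borel_measurable S3b"
 using avb measurable_restrict_space1[OF weight_measurable[OF f]] by measurable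
 then show ?thesis unfolding G_def by (subst (asm) borel_measurable_restrict_space_iff_ennreal) auto
 qed
 have "(NN surf (%y. ennreal (f y) * ennreal (cc a 1 * av a 1 u y) * indicator (tube b A r) y))
 = (NN surf (%y. G y * indicator (tube b A r) y))"
 by (intro nn_integral_cong) (auto simp: G_def indicator_def)
 also have "... <= ennreal (pi * r\<^sup>2) * ennreal (cc (hp n0) 1 * M)"
 proof (rule nn_integral_tube_le[OF b Gm r])
 fix v assume "cmod (v - A) <= r"
 then have q: "pencil b v : chains w0" and X: "XR (cm f (pencil b v)) a (hp n0) u <= M" using v by auto
 let ?y = "chn (fst (pencil b v)) (snd (pencil b v))"
 let ?h = "%t. f (?y t) * (cc a (hp n0) * av a (hp n0) u (?y t))"
 interpret finite_measure circ by (rule finite_circ)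
 have [measurable]: "(%t. f (?y t)) : borel_measurable circ"
 by (intro circ_meas measurable_compose[OF chn_measurable weight_measurable[OF f]])
 note [measurable] = XR_cm(2)[OF q f a(1) hp_le_1 w, of n0]
 have hm: "?h : borel_measurable circ" by measurable
 have h0: "0 <= ?h t" for t using weightD(1)[OF f] cc_pos[of a "hp n0"] av_nonneg[of a "hp n0" u] by simp
 have ih: "integrable circ ?h"
 proof (rule integrable_const_bound[where B="cc a (hp n0)", OF AE_I2 hm])
 fix t
 have "?h t <= 1 * (cc a (hp n0) * 1)"
 using weightD(1,2)[OF f] cc_pos[of a "hp n0"] av_le_1[of a "hp n0" u] av_nonneg[of a "hp n0" u] by (intro mult_mono) auto
 then show "norm (?h t) <= cc a (hp n0)" using h0[of t] by simp
 qed
 have "(\<integral>\<^sup>+t\<in>{0..2*pi}. G (?y t) \<partial>lborel) <= (NN lborel (%t. ennreal (cc (hp n0) 1) * ennreal (?h t) * indicator {0..2*pi} t))"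
 proof (intro nn_integral_mono mult_right_mono)
 fix t
 \<comment> \<open>The balls of radius at least \<open>hp n0\<close>, which the masses on chains
   ignore, can only remove mass; their share of the normalisation is the constant
   \<open>cc (hp n0) 1\<close>.\<close>
 have sub: "conR a (hp n0) (?y t) <= conR a 1 (?y t)" using hp_le_1[of n0] by (auto simp: conR_def)
 have "av a 1 u (?y t) <= av a (hp n0) u (?y t)" using sub by (auto simp: av_def)
 moreover have "cc a 1 = cc (hp n0) 1 * cc a (hp n0)" using cc_split[of a "hp n0" 1] a hp_le_1 by simp
 ultimately have "f (?y t) * (cc a 1 * av a 1 u (?y t)) <= cc (hp n0) 1 * ?h t"
 using weightD(1)[OF f] cc_pos[of a "hp n0"] cc_pos[of "hp n0" 1] by (simp add: mult_left_mono mult_ac)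
 then have "ennreal (f (?y t) * (cc a 1 * av a 1 u (?y t))) <= ennreal (cc (hp n0) 1 * ?h t)" by (rule ennreal_leI)
 then show "G (?y t) <= ennreal (cc (hp n0) 1) * ennreal (?h t)"
 using weightD(1)[OF f] cc_pos[of "hp n0" 1] h0[of t] unfolding G_def
 by (cases "?y t : S3") (simp_all add: ennreal_mult'[symmetric] del: ennreal_mult'')
 qed simp
 also have "... = (NN circ (%t. ennreal (cc (hp n0) 1) * ennreal (?h t)))"
 unfolding circ_def by (subst nn_integral_restrict_space) auto
 also have "... = ennreal (cc (hp n0) 1) * (NN circ (%t. ennreal (?h t)))"
 using hm by (intro nn_integral_cmult) measurable
 also have "(NN circ (%t. ennreal (?h t))) = ennreal (XR (cm f (pencil b v)) a (hp n0) u)"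
 using h0 by (subst nn_integral_eq_integral[OF ih]) (auto simp: XR_cm(1)[OF q f a(1) hp_le_1 w])
 also have "ennreal (cc (hp n0) 1) * ... <= ennreal (cc (hp n0) 1) * ennreal M"
 using X by (intro mult_left_mono ennreal_leI) auto
 also have "... = ennreal (cc (hp n0) 1 * M)" using cc_pos[of "hp n0" 1] M by (simp add: ennreal_mult')
 finally show "(\<integral>\<^sup>+t\<in>{0..2*pi}. G (?y t) \<partial>lborel) <= ennreal (cc (hp n0) 1 * M)" .
 qed
 also have "... = ennreal (pi * r\<^sup>2 * (cc (hp n0) 1 * M))" by (rule ennreal_mult'[symmetric]) simp
 finally show ?thesis .
qed

end

section \<open>Hausdorff measure and dimension\<close>

lemma hdiam_ge: "x : U ==> y : U ==> ennreal (r x y) <= hdiam r U"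
 unfolding hdiam_def by (meson SUP_upper2 SUP_upper order_refl)

lemma hdiam_le: "(!!x y. x : U ==> y : U ==> r x y <= d) ==> hdiam r U <= ennreal d"
 unfolding hdiam_def by (intro SUP_least ennreal_leI)

text \<open>A sum of at most d^s forces every diameter to be at most d, so covers with small sums
  automatically respect the scale.\<close>

lemma haus_zeroI:
 assumes s: "s > 0"
 and c: "!!E. E > 0 ==> EX U :: nat => 'a set. A <= (\<Union>i. U i) & (ALL i. hdiam r (U i) < \<top>) &
 (\<Sum>i. ennreal (enn2real (hdiam r (U i)) powr s)) <= ennreal E"
 shows "haus_outer r s A = 0"
proof -
 have "haus_content r s d A <= 0" if d: "d > 0" for d
 proof (rule ennreal_le_epsilon)
 fix e :: real assume e: "0 < e"
 define E where "E = min e (d powr s)"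
 have E: "E > 0" using e d by (simp add: E_def)
 from c[OF this] obtain U :: "nat => 'a set" where U: "A <= (\<Union>i. U i)" "!!i. hdiam r (U i) < \<top>"
 "(\<Sum>i. ennreal (enn2real (hdiam r (U i)) powr s)) <= ennreal E" by auto
 have "hdiam r (U i) <= ennreal d" for i
 proof -
 have "ennreal (enn2real (hdiam r (U i)) powr s) <= (\<Sum>i. ennreal (enn2real (hdiam r (U i)) powr s))"
 using ennreal_suminf_lessD not_le by blast
 also have "... <= ennreal E" by (rule U(3))
 finally have "enn2real (hdiam r (U i)) powr s <= E" using E by (subst (asm) ennreal_le_iff) auto
 then have "enn2real (hdiam r (U i)) powr s <= d powr s" by (simp add: E_def)
 then have "enn2real (hdiam r (U i)) <= d"
 using s d by (metis linorder_not_le powr_less_mono2 less_imp_le)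
 then have "ennreal (enn2real (hdiam r (U i))) <= ennreal d" by (rule ennreal_leI)
 then show ?thesis unfolding ennreal_enn2real[OF U(2)] .
 qed
 then have "haus_content r s d A <= (\<Sum>i. ennreal (enn2real (hdiam r (U i)) powr s))"
 unfolding haus_content_def using U(1) by (intro INF_lower) auto
 also have "... <= ennreal e" using U(3) by (rule order_trans) (simp add: E_def ennreal_leI)
 finally show "haus_content r s d A <= 0 + ennreal e" by simp
 qed
 then show ?thesis unfolding haus_outer_def by (intro antisym SUP_least) auto
qed

lemma haus_zeroD:
 assumes "haus_outer r s A = 0" "d > 0" "e > 0"
 shows "EX U :: nat => 'a set. A <= (\<Union>i. U i) & (ALL i. hdiam r (U i) <= ennreal d) &
 (\<Sum>i. ennreal (enn2real (hdiam r (U i)) powr s)) < ennreal e"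
proof -
 have "haus_content r s d A <= haus_outer r s A"
 unfolding haus_outer_def using assms(2) by (intro SUP_upper) auto
 then have "haus_content r s d A < ennreal e" using assms by simp
 then show ?thesis unfolding haus_content_def by (auto simp: INF_less_iff)
qed

lemma haus_zero_mono:
 assumes "haus_outer r s B = 0" "A <= B" "s > 0" shows "haus_outer r s A = 0"
proof (rule haus_zeroI[OF assms(3)])
 fix e :: real assume "e > 0"
 from haus_zeroD[OF assms(1) zero_less_one this] obtain U :: "nat => 'a set" where
 U: "B <= (\<Union>i. U i)" "!!i. hdiam r (U i) <= ennreal 1" "(\<Sum>i. ennreal (enn2real (hdiam r (U i)) powr s)) < ennreal e" by auto
 have "hdiam r (U i) < \<top>" for i using U(2)[of i] by (simp add: less_top[symmetric] top_unique) (metis ennreal_one_less_top linorder_not_le)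
 then show "EX U :: nat => 'a set. A <= (\<Union>i. U i) & (ALL i. hdiam r (U i) < \<top>) & (\<Sum>i. ennreal (enn2real (hdiam r (U i)) powr s)) <= ennreal e"
 using U assms(2) by (intro exI[of _ U]) (auto intro: less_imp_le)
qed

lemma haus_zero_UN:
 assumes s: "s > 0" and A: "!!j :: nat. haus_outer r s (A j) = 0"
 shows "haus_outer r s (\<Union>j. A j) = 0"
proof (rule haus_zeroI[OF s])
 fix E :: real assume e: "E > 0"
 have "EX U :: nat => 'a set. A j <= (\<Union>i. U i) & (ALL i. hdiam r (U i) <= ennreal 1) &
 (\<Sum>i. ennreal (enn2real (hdiam r (U i)) powr s)) < ennreal (E * (1/2) ^ Suc j)" for j
 using e by (intro haus_zeroD[OF A]) auto
 then obtain U :: "nat => nat => 'a set" where U: "!!j. A j <= (\<Union>i. U j i)" "!!j i. hdiam r (U j i) <= ennreal 1"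
 "!!j. (\<Sum>i. ennreal (enn2real (hdiam r (U j i)) powr s)) < ennreal (E * (1/2) ^ Suc j)"
 by metis
 define V where "V k = U (fst (prod_decode k)) (snd (prod_decode k))" for k
 have "(\<Union>j. A j) <= (\<Union>k. V k)"
 proof
 fix x assume "x : (\<Union>j. A j)"
 then obtain j i where "x : U j i" using U(1) by blast
 then have "x : V (prod_encode (j, i))" by (simp add: V_def)
 then show "x : (\<Union>k. V k)" by blast
 qed
 moreover have "hdiam r (V k) < \<top>" for k
 unfolding V_def by (rule le_less_trans[OF U(2)]) simp
 moreover have "(\<Sum>k. ennreal (enn2real (hdiam r (V k)) powr s)) <= ennreal E"
 proof -
 have "(\<Sum>k. ennreal (enn2real (hdiam r (V k)) powr s))
 = (\<Sum>k. (%(j, i). ennreal (enn2real (hdiam r (U j i)) powr s)) (prod_decode k))"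
 by (simp add: V_def case_prod_beta)
 also have "... = (\<Sum>j. \<Sum>i. ennreal (enn2real (hdiam r (U j i)) powr s))"
 by (rule suminf_ennreal_2dimen) simp
 also have "... <= (\<Sum>j. ennreal (E * (1/2) ^ Suc j))"
 using U(3) by (intro suminf_le) (auto intro: less_imp_le)
 also have "... = ennreal (\<Sum>j. E * (1/2) ^ Suc j)"
 using e power_half_series by (intro suminf_ennreal_eq sums_mult) (auto simp: sums_iff suminf_mult)
 also have "(\<Sum>j. E * (1/2) ^ Suc j) = E"
 using sums_mult[OF power_half_series, of E] by (simp add: sums_iff)
 finally show ?thesis .
 qed
 ultimately show "EX U :: nat => 'a set. (\<Union>j. A j) <= (\<Union>i. U i) & (ALL i. hdiam r (U i) < \<top>) &
 (\<Sum>i. ennreal (enn2real (hdiam r (U i)) powr s)) <= ennreal E" by blast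
qed

lemma haus_zero_lipschitz:
 assumes s: "s > 0" and C: "C > 0" and f: "!!x y. x : A ==> y : A ==> r' (f x) (f y) <= C * r x y"
 and nn: "!!x y. 0 <= r x y" and A: "haus_outer r s A = 0"
 shows "haus_outer r' s (f ` A) = 0"
proof (rule haus_zeroI[OF s])
 fix E :: real assume e: "E > 0"
 have "E / C powr s > 0" using e C by simp
 from haus_zeroD[OF A zero_less_one this] obtain U :: "nat => 'a set" where
 U: "A <= (\<Union>i. U i)" "!!i. hdiam r (U i) <= ennreal 1" "(\<Sum>i. ennreal (enn2real (hdiam r (U i)) powr s)) < ennreal (E / C powr s)" by auto
 let ?V = "%i. f ` (U i Int A)"
 have fin: "hdiam r (U i) < \<top>" for i by (rule le_less_trans[OF U(2)]) simp
 have V: "hdiam r' (?V i) <= ennreal (C * enn2real (hdiam r (U i)))" for i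
 proof (rule hdiam_le)
 fix x y assume "x : ?V i" "y : ?V i"
 then obtain a b where ab: "a : U i" "a : A" "b : U i" "b : A" "x = f a" "y = f b" by auto
 have "ennreal (r a b) <= ennreal (enn2real (hdiam r (U i)))"
 using hdiam_ge[OF ab(1,3)] fin[of i] by simp
 then have "r a b <= enn2real (hdiam r (U i))" by (subst (asm) ennreal_le_iff) auto
 then have "C * r a b <= C * enn2real (hdiam r (U i))" using C by simp
 then show "r' x y <= C * enn2real (hdiam r (U i))" using f[OF ab(2,4)] ab by simp
 qed
 have "f ` A <= (\<Union>i. ?V i)" using U(1) by blast
 moreover have "hdiam r' (?V i) < \<top>" for i by (rule le_less_trans[OF V]) simp
 moreover have "(\<Sum>i. ennreal (enn2real (hdiam r' (?V i)) powr s)) <= ennreal E"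
 proof -
 have "(\<Sum>i. ennreal (enn2real (hdiam r' (?V i)) powr s)) <= (\<Sum>i. ennreal (C powr s) * ennreal (enn2real (hdiam r (U i)) powr s))"
 proof (rule suminf_le)
 fix i
 have "enn2real (hdiam r' (?V i)) <= C * enn2real (hdiam r (U i))"
 using V[of i] C by (intro enn2real_leI) auto
 then have "enn2real (hdiam r' (?V i)) powr s <= (C * enn2real (hdiam r (U i))) powr s"
 using s by (intro powr_mono2) auto
 also have "... = C powr s * enn2real (hdiam r (U i)) powr s" using C by (simp add: powr_mult)
 finally show "ennreal (enn2real (hdiam r' (?V i)) powr s) <= ennreal (C powr s) * ennreal (enn2real (hdiam r (U i)) powr s)"
 by (simp add: ennreal_mult'[symmetric] ennreal_leI)
 qed auto
 also have "... = ennreal (C powr s) * (\<Sum>i. ennreal (enn2real (hdiam r (U i)) powr s))" by (rule ennreal_suminf_cmult)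
 also have "... <= ennreal (C powr s) * ennreal (E / C powr s)" using U(3) by (intro mult_left_mono) auto
 also have "... = ennreal E" using C e by (simp add: ennreal_mult'[symmetric])
 finally show ?thesis .
 qed
 ultimately show "EX U :: nat => 'b set. f ` A <= (\<Union>i. U i) & (ALL i. hdiam r' (U i) < \<top>) &
 (\<Sum>i. ennreal (enn2real (hdiam r' (U i)) powr s)) <= ennreal E" by blast
qed

lemma hdim_nonneg: "0 <= hdim r A"
 unfolding hdim_def by (intro Inf_greatest) (auto simp: zero_ereal_def)

lemma hdim_le: "s > 0 ==> haus_outer r s A = 0 ==> hdim r A <= ereal s"
 unfolding hdim_def by (intro Inf_lower) auto

lemma hdim_ge:
 assumes "!!s. 0 < s ==> s < t ==> haus_outer r s A ~= 0" shows "ereal t <= hdim r A"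
 unfolding hdim_def using assms by (intro Inf_greatest) (auto simp: not_less[symmetric])

lemma hdim_le_hdimI:
 assumes "!!s. s > 0 ==> haus_outer r s A = 0 ==> haus_outer r' s B = 0" shows "hdim r' B <= hdim r A"
 unfolding hdim_def using assms by (intro Inf_superset_mono) auto

text \<open>The mass distribution principle.\<close>
lemma mass_distribution:
 assumes s: "s > 0" and A: "A : sets n" and H: "haus_outer r s A = 0" and C: "C >= 0" and r0: "r0 > 0"
 and B: "!!p d. p : A ==> {q : space n. r p q <= d} : sets n"
 and bd: "!!p d. p : A ==> 0 < d ==> d <= r0 ==> emeasure n {q : space n. r p q <= d} <= ennreal (C * d powr s)"
 shows "emeasure n A = 0"
proof -
 \<comment> \<open>Covering sets of diameter 0 lead to balls of radius 0, whose bound is obtained by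
   shrinking the radius.\<close>
 have bd0: "emeasure n {q : space n. r p q <= d} <= ennreal (C * d powr s)" if p: "p : A" and d: "0 <= d" "d <= r0" for p d
 proof (cases "d = 0")
 case True
 have "emeasure n {q : space n. r p q <= 0} <= 0"
 proof (rule ennreal_le_epsilon)
 fix e :: real assume e: "0 < e"
 define x where "x = min r0 ((e / (C + 1)) powr (1 / s))"
 have x: "0 < x" "x <= r0" using r0 e C by (auto simp: x_def)
 have "x powr s <= ((e / (C + 1)) powr (1 / s)) powr s" using s x by (intro powr_mono2) (auto simp: x_def)
 also have "... = e / (C + 1)" using s e C by (simp add: powr_powr)
 finally have "C * x powr s <= C * (e / (C + 1))" using C by (intro mult_left_mono) auto
 also have "... <= e" using e C by (simp add: field_simps)
 finally have ce: "C * x powr s <= e" .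
 have "emeasure n {q : space n. r p q <= 0} <= emeasure n {q : space n. r p q <= x}"
 using x B[OF p] by (intro emeasure_mono) auto
 also have "... <= ennreal (C * x powr s)" by (rule bd[OF p x])
 also have "... <= ennreal e" using ce by (rule ennreal_leI)
 finally show "emeasure n {q : space n. r p q <= 0} <= 0 + ennreal e" by simp
 qed
 then show ?thesis using True by simp
 qed (use bd[OF p] d in auto)
 have "emeasure n A <= 0"
 proof (rule ennreal_le_epsilon)
 fix e :: real assume e: "0 < e"
 have "e / (C + 1) > 0" using e C by simp
 from haus_zeroD[OF H r0 this] obtain U :: "nat => 'a set" where
 U: "A <= (\<Union>i. U i)" "!!i. hdiam r (U i) <= ennreal r0" "(\<Sum>i. ennreal (enn2real (hdiam r (U i)) powr s)) < ennreal (e / (C + 1))" by auto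
 define d where "d i = enn2real (hdiam r (U i))" for i
 have d: "0 <= d i" "d i <= r0" for i
 proof -
 show "0 <= d i" by (simp add: d_def)
 show "d i <= r0" unfolding d_def using r0 by (intro enn2real_leI U(2)) simp
 qed
 \<comment> \<open>The growth bound is available only for balls centred in A, so each covering set
   is enlarged to a ball about one of its points in A.\<close>
 define W where "W i = (if U i Int A = {} then {} else {q : space n. r (SOME p. p : U i Int A) q <= d i})" for i
 have some: "(SOME p. p : U i Int A) : U i Int A" if "U i Int A ~= {}" for i
 proof -
 from that have "EX p. p : U i Int A" by blast
 then show ?thesis by (rule someI_ex)
 qed
 have Ws: "W i : sets n" for i unfolding W_def using some[of i] B by auto
 have We: "emeasure n (W i) <= ennreal C * ennreal (d i powr s)" for i
 unfolding W_def using some[of i] bd0[OF _ d, of "SOME p. p : U i Int A" i] C by (auto simp: ennreal_mult')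
 have "A <= (\<Union>i. W i)"
 proof
 fix q assume q: "q : A"
 then obtain i where i: "q : U i" using U(1) by blast
 let ?p = "SOME p. p : U i Int A"
 have ne: "U i Int A ~= {}" using q i by blast
 have "ennreal (r ?p q) <= hdiam r (U i)" using some[OF ne] i by (intro hdiam_ge) auto
 also have "... = ennreal (d i)"
 proof -
 have "hdiam r (U i) < \<top>" by (rule le_less_trans[OF U(2)]) simp
 from ennreal_enn2real[OF this] show ?thesis by (simp only: d_def)
 qed
 finally have "r ?p q <= d i" using d[of i] by (subst (asm) ennreal_le_iff) auto
 then have "q : W i" unfolding W_def using ne q sets.sets_into_space[OF A] by auto
 then show "q : (\<Union>i. W i)" by blast
 qed
 then have "emeasure n A <= emeasure n (\<Union>i. W i)" using Ws by (intro emeasure_mono) auto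
 also have "... <= (\<Sum>i. emeasure n (W i))" using Ws by (intro emeasure_subadditive_countably) auto
 also have "... <= (\<Sum>i. ennreal C * ennreal (d i powr s))" using We by (intro suminf_le) auto
 also have "... = ennreal C * (\<Sum>i. ennreal (d i powr s))" by (rule ennreal_suminf_cmult)
 also have "... <= ennreal C * ennreal (e / (C + 1))" using U(3) by (intro mult_left_mono) (auto simp: d_def)
 also have "... <= ennreal e"
 proof -
 have "C * (e / (C + 1)) <= e" using e C by (simp add: field_simps)
 then show ?thesis using C e by (simp add: ennreal_mult'[symmetric] ennreal_leI del: ennreal_mult'')
 qed
 finally show "emeasure n A <= 0 + ennreal e" by simp
 qed
 then show ?thesis by simp
qed

section \<open>Upper bound for the dimension of the cut-out set\<close>

lemma hs_lower: "EX c>0. ALL r. 0 < r --> r <= 1 --> c * r ^ 4 <= hs r"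
 using hs_ge lens_pos[of 2] by (intro exI[of _ "8 * pi * measure lborel (lens 2)"]) auto

text \<open>A maximal separated set covers. Balls of half the separation are disjoint and have
  measure at least a multiple of 2^(-4 n), which bounds the cardinality and thereby also provides a
  separated set of greatest cardinality.\<close>

lemma vball_cover:
 "EX C>0. ALL n. EX Q. finite Q & Q <= S3 & real (card Q) <= C * 2 ^ (4 * n) & S3 <= (\<Union>q\<in>Q. vball q ((1/2) ^ n))"
proof -
 obtain c where c: "c > 0" "!!r. 0 < r ==> r <= 1 ==> c * r ^ 4 <= hs r" using hs_lower by blast
 interpret finite_measure surf by (rule finite_measure_surf)
 define C where "C = measure surf S3 * 16 / c + 1"
 have C: "C > 0" unfolding C_def using c by (intro add_nonneg_pos) auto
 have "EX Q. finite Q & Q <= S3 & real (card Q) <= C * 2 ^ (4 * n) & S3 <= (\<Union>q\<in>Q. vball q ((1/2) ^ n))" for n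
 proof -
 define sep where "sep Q \<longleftrightarrow> finite Q & Q <= S3 & (ALL x:Q. ALL y:Q. x ~= y --> (1/2) ^ n <= dvis x y)" for Q
 have bound: "real (card Q) <= C * 2 ^ (4 * n)" if Q: "sep Q" for Q
 proof -
 let ?B = "%q. vball q ((1/2) ^ Suc n)"
 have dis: "disjoint_family_on ?B Q"
 proof -
 have "?B x Int ?B y = {}" if xy: "x : Q" "y : Q" "x ~= y" for x y
 proof (rule ccontr)
 assume "?B x Int ?B y ~= {}"
 then obtain z where z: "z : ?B x" "z : ?B y" by blast
 have S: "x : S3" "y : S3" "(1/2) ^ n <= dvis x y" using xy Q unfolding sep_def by blast+
 have zz: "z : S3" "dvis x z < (1/2) ^ Suc n" "dvis z y < (1/2) ^ Suc n"
 using z by (simp_all add: vball_def dvis_sym[of z])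
 have "dvis x y <= dvis x z + dvis z y" by (rule dvis_triangle) fact+
 also have "... < (1/2) ^ Suc n + (1/2) ^ Suc n" by (rule add_strict_mono) fact+
 also have "... = (1/2) ^ n" by simp
 finally show False using S(3) by simp
 qed
 then show ?thesis unfolding disjoint_family_on_def by blast
 qed
 have "(\<Sum>q\<in>Q. measure surf (?B q)) = measure surf (\<Union>q\<in>Q. ?B q)"
 using Q dis by (intro finite_measure_finite_Union[symmetric]) (auto simp: sep_def)
 also have "... <= measure surf S3"
 by (intro finite_measure_mono) (auto simp: vball_def borel_sub_S3b)
 finally have "(\<Sum>q\<in>Q. measure surf (?B q)) <= measure surf S3" .
 moreover have "(\<Sum>q\<in>Q. measure surf (?B q)) >= (\<Sum>q\<in>Q. c * ((1/2) ^ Suc n) ^ 4)"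
 proof (rule sum_mono)
 fix q assume "q : Q"
 then have "q : S3" using Q by (auto simp: sep_def)
 then have "measure surf (?B q) = hs ((1/2) ^ Suc n)"
 using emeasure_vball_hs[of q "(1/2) ^ Suc n"] hs_nonneg by (simp add: measure_def)
 moreover have "c * ((1/2) ^ Suc n) ^ 4 <= hs ((1/2) ^ Suc n)" by (rule c(2)) (auto simp: power_le_one simp del: power_Suc)
 ultimately show "c * ((1/2) ^ Suc n) ^ 4 <= measure surf (?B q)" by simp
 qed
 ultimately have "real (card Q) * (c * ((1/2) ^ Suc n) ^ 4) <= measure surf S3" by simp
 moreover have "((1/2::real) ^ Suc n) ^ 4 = 1 / (16 * 2 ^ (4 * n))"
 proof -
 have "((1/2::real) ^ Suc n) ^ 4 = 1 / (2 ^ Suc n) ^ 4" by (simp add: power_divide)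
 also have "((2::real) ^ Suc n) ^ 4 = 2 ^ (4 + 4 * n)"
 unfolding power_mult[symmetric] by (rule arg_cong[where f="power 2"]) simp
 also have "... = 16 * 2 ^ (4 * n)" by (simp add: power_add)
 finally show ?thesis .
 qed
 ultimately have "real (card Q) * c <= measure surf S3 * (16 * 2 ^ (4 * n))" by (simp add: field_simps)
 then have "real (card Q) <= measure surf S3 * 16 / c * 2 ^ (4 * n)" using c by (simp add: field_simps)
 also have "... <= C * 2 ^ (4 * n)" by (intro mult_right_mono) (auto simp: C_def)
 finally show ?thesis .
 qed
 have "EX Q. sep Q & (ALL Q'. sep Q' --> card Q' <= card Q)"
 proof (rule ex_has_greatest_nat)
 show "sep {}" by (simp add: sep_def)
 show "ALL Q. sep Q --> card Q < Suc (nat \<lceil>C * 2 ^ (4 * n)\<rceil>)"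
 proof (intro allI impI)
 fix Q :: "c2 set" assume "sep Q"
 from bound[OF this] show "card Q < Suc (nat \<lceil>C * 2 ^ (4 * n)\<rceil>)" by linarith
 qed
 qed
 then obtain Q where Q: "sep Q" "!!Q'. sep Q' ==> card Q' <= card Q" by blast
 have "S3 <= (\<Union>q\<in>Q. vball q ((1/2) ^ n))"
 proof (rule ccontr)
 assume "\<not> ?thesis"
 then obtain y where y: "y : S3" "y \<notin> (\<Union>q\<in>Q. vball q ((1/2) ^ n))" by blast
 then have far: "(1/2) ^ n <= dvis q y" if "q : Q" for q using that by (force simp: vball_def)
 have ny: "y \<notin> Q"
 proof
 assume "y : Q"
 from far[OF this] have "(1/2) ^ n <= (0::real)" unfolding dvis_refl[OF y(1)] .
 moreover have "(0::real) < (1/2) ^ n" by simp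
 ultimately show False by linarith
 qed
 have "(1/2) ^ n <= dvis u v" if "u : insert y Q" "v : insert y Q" "u ~= v" for u v
 using that Q(1) far dvis_sym[of u v] unfolding sep_def by (metis insert_iff)
 then have "sep (insert y Q)" using Q(1) y(1) unfolding sep_def by simp
 from Q(2)[OF this] show False using ny Q(1) by (simp add: sep_def)
 qed
 then show ?thesis using Q(1) bound[OF Q(1)] by (auto simp: sep_def)
 qed
 then show ?thesis using C by blast
qed

context cutout_process
begin

text \<open>The ball of such a pair contains all of \<open>vball q d\<close>. If the cut-out set
  meets \<open>vball q d\<close>, the process therefore has no point here, see
  \<open>vd_of_hit\<close>.\<close>

definition shK :: "real => real => real => c2 => (c2 \<times> real) set" where
 "shK d a b q = {p. fst p : S3 & a <= snd p & snd p < b & dvis (fst p) q + d < snd p}"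

lemma shK_bdd: assumes "0 < a" "b <= 1" shows "shK d a b q : bdd_sets a"
proof -
 have "shK d a b q = (S3 \<times> UNIV) Int ({p. a <= snd p} Int {p. snd p < b} Int {p. dvis (fst p) q + d < snd p})"
 by (auto simp: shK_def)
 moreover have "{p :: c2 \<times> real. a <= snd p} : sets borel"
 "{p :: c2 \<times> real. snd p < b} : sets borel"
 by (intro borel_closed closed_Collect_le borel_open open_Collect_less continuous_intros)+
 moreover have "{p :: c2 \<times> real. dvis (fst p) q + d < snd p} : sets borel"
 by (intro borel_open open_Collect_less continuous_dvis continuous_intros)
 moreover have "S3 \<times> (UNIV :: real set) : sets borel" by (intro borel_closed closed_Times S3_closed closed_UNIV)
 ultimately have "shK d a b q : sets borel" by simp
 then have "shK d a b q : sets (intensity \<gamma>)" using assms by (intro borel_sub_intensity) (auto simp: shK_def)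
 then show ?thesis by (auto simp: bdd_sets_def shK_def)
qed

lemma shK_measure_ge:
 assumes q: "q : S3" and d: "0 < d" and a: "d < a" "a <= b" "b <= 1" and c: "c >= 0"
 and h: "!!r. a <= r ==> r <= b ==> c * r ^ 4 <= hs (r - d)"
 shows "\<gamma> * kap * c * ln (b / a) <= measure (intensity \<gamma>) (shK d a b q)"
proof -
 have ap: "0 < a" using d a by simp
 have K: "shK d a b q : bdd_sets a" using ap a by (intro shK_bdd) auto
 then have Ks: "shK d a b q : sets (intensity \<gamma>)" by (simp add: bdd_sets_def)
 have gk: "0 <= \<gamma> * kap" using gam_pos kap_pos by simp
 have "ennreal (\<gamma> * kap * c * ln (b / a)) = (\<integral>\<^sup>+r\<in>{a..<b}. ennreal (\<gamma> * kap * c / r) \<partial>lborel)"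
 using ap a c gk by (intro nn_integral_inverse[symmetric]) auto
 also have "... <= (\<integral>\<^sup>+r\<in>{0<..1}. ennreal (\<gamma> * r powr (-5)) * emeasure Hmeas {x. (x, r) : shK d a b q} \<partial>lborel)"
 proof (intro nn_integral_mono)
 fix r :: real
 show "ennreal (\<gamma> * kap * c / r) * indicator {a..<b} r
 <= ennreal (\<gamma> * r powr (-5)) * emeasure Hmeas {x. (x, r) : shK d a b q} * indicator {0<..1} r"
 proof (cases "r : {a..<b}")
 case True
 then have r: "0 < r" "r <= 1" "a <= r" "r < b" "0 < r - d" using ap a by auto
 have "{x. (x, r) : shK d a b q} = vball q (r - d)"
 using r by (auto simp: shK_def vball_def dvis_sym[of q])
 then have "emeasure Hmeas {x. (x, r) : shK d a b q} = ennreal (kap * hs (r - d))"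
 using emeasure_Hmeas_vball[of q "r - d"] kap_pos q r by simp
 moreover have "\<gamma> * kap * c / r <= (\<gamma> * r powr (-5)) * (kap * hs (r - d))"
 proof -
 have "r powr (-5) = 1 / r ^ 5" using r by (simp add: powr_minus_divide)
 moreover have "c / r = c * r ^ 4 / r ^ 5" using r by (simp add: field_simps power_eq_if)
 moreover have "c * r ^ 4 / r ^ 5 <= hs (r - d) / r ^ 5" using h[of r] r by (intro divide_right_mono) auto
 ultimately have "\<gamma> * kap * (c / r) <= \<gamma> * kap * (hs (r - d) * r powr (-5))"
 using gk by (intro mult_left_mono) auto
 then show ?thesis by (simp add: mult_ac)
 qed
 ultimately show ?thesis using True r gam_pos kap_pos hs_nonneg
 by (simp add: ennreal_mult'[symmetric] ennreal_leI del: ennreal_mult'')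
 qed simp
 qed
 also have "... = emeasure (intensity \<gamma>) (shK d a b q)" by (rule emeasure_intensity[OF Ks, symmetric])
 also have "... = ennreal (measure (intensity \<gamma>) (shK d a b q))"
 using bdd_sets_finite[OF K ap] by (simp add: emeasure_eq_ennreal_measure top.not_eq_extremum)
 finally show ?thesis by (subst (asm) ennreal_le_iff) auto
qed

text \<open>For radii between M 2^(-n) and b the shrunken ball of radius r - 2^(-n) has almost the
  measure of the full one. So the probability that no single ball swallows
  \<open>vball q (hp n)\<close> decays with an exponent as close to g as desired.\<close>

lemma hit_probability:
 assumes e: "g' < g" "g' > 0"
 shows "EX C>=0. ALL n. ALL q:S3. EX a>0. shK (hp n) a 1 q : bdd_sets a & prob (vd (shK (hp n) a 1 q)) <= C * 2 powr (- g' * real n)"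
proof -
 \<comment> \<open>Two losses, from the asymptotics of \<open>hs\<close> and from shrinking the
   radius, each cost a factor 1 - E; together they turn g into g'.\<close>
 define E where "E = 1 - sqrt (g' / g)"
 have gg: "0 < g' / g" "g' / g < 1" using e g_pos by auto
 have E: "0 < E" "E < 1" "(1 - E)\<^sup>2 = g' / g" using gg by (auto simp: E_def)
 obtain r0 where r0: "r0 > 0" "!!r. 0 < r ==> r <= r0 ==> hs r >= (1 - E) * hsA * r ^ 4"
 using hs_asymp[OF E(1)] by blast
 obtain M where M: "M > 1" "(1 - 1 / M) ^ 4 >= 1 - E"
 proof -
 have "(1 - E / 4) ^ 4 >= 1 + real 4 * (- (E / 4))"
 using Bernoulli_inequality[of "- (E / 4)" 4] E by simp
 moreover have "4 / E > 1" using E by simp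
 ultimately show ?thesis using that[of "4 / E"] by simp
 qed
 define b where "b = min r0 1"
 have b: "0 < b" "b <= 1" "b <= r0" using r0 by (auto simp: b_def)
 \<comment> \<open>Makes the bound at least 1 for the finitely many n with M 2^(-n) > b, and is the
   constant of the estimate for the others.\<close>
 define C where "C = max 1 ((M / b) powr g')"
 have C: "C >= 0" "C >= 1" "C >= (M / b) powr g'" by (auto simp: C_def)
 have "EX a>0. shK (hp n) a 1 q : bdd_sets a & prob (vd (shK (hp n) a 1 q)) <= C * 2 powr (- g' * real n)" if q: "q : S3" for n q
 proof -
 define a where "a = M * hp n"
 have a: "a > 0" "hp n < a" using M hp_pos[of n] by (auto simp: a_def)
 have K1: "shK (hp n) a 1 q : bdd_sets a" using a by (intro shK_bdd) auto
 have Kb: "shK (hp n) a b q : bdd_sets a" using a b by (intro shK_bdd) auto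
 have p: "prob (vd (shK (hp n) a 1 q)) = exp (- measure (intensity \<gamma>) (shK (hp n) a 1 q))"
 by (rule vd_prob[OF K1 a(1)])
 have "prob (vd (shK (hp n) a 1 q)) <= C * 2 powr (- g' * real n)"
 proof (cases "a <= b")
 case True
 have "\<gamma> * kap * ((1 - E)\<^sup>2 * hsA) * ln (b / a) <= measure (intensity \<gamma>) (shK (hp n) a b q)"
 proof (rule shK_measure_ge[OF q hp_pos a(2) True b(2)])
 show "0 <= (1 - E)\<^sup>2 * hsA" using hsA_pos by simp
 fix r assume r: "a <= r" "r <= b"
 have rp: "0 < r" "0 < r - hp n" "r - hp n <= r0" using a r b hp_pos[of n] by linarith+
 have "(1 - 1 / M) * r <= r - hp n"
 proof -
 have "hp n = a / M" using M by (simp add: a_def)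
 also have "... <= r / M" using r M by (intro divide_right_mono) auto
 finally show ?thesis by (simp add: left_diff_distrib)
 qed
 then have "((1 - 1 / M) * r) ^ 4 <= (r - hp n) ^ 4" using M rp by (intro power_mono) auto
 moreover have "(1 - E) * r ^ 4 <= ((1 - 1 / M) * r) ^ 4"
 unfolding power_mult_distrib using M rp by (intro mult_right_mono) auto
 ultimately have "(1 - E) * r ^ 4 <= (r - hp n) ^ 4" by linarith
 then have "(1 - E) * hsA * ((1 - E) * r ^ 4) <= (1 - E) * hsA * (r - hp n) ^ 4"
 using E hsA_pos by (intro mult_left_mono) auto
 also have "... <= hs (r - hp n)" by (rule r0(2)[OF rp(2,3)])
 finally show "(1 - E)\<^sup>2 * hsA * r ^ 4 <= hs (r - hp n)" by (simp add: power2_eq_square mult_ac)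
 qed
 also have "... <= measure (intensity \<gamma>) (shK (hp n) a 1 q)"
 using b by (intro measure_bdd_mono[OF Kb K1 a(1)]) (auto simp: shK_def)
 finally have "g' * ln (b / a) <= measure (intensity \<gamma>) (shK (hp n) a 1 q)"
 proof -
 have "\<gamma> * kap * ((1 - E)\<^sup>2 * hsA) = g * (g' / g)" unfolding E(3) by (simp add: gexp_def)
 also have "... = g'" using g_pos by simp
 finally show "\<gamma> * kap * ((1 - E)\<^sup>2 * hsA) * ln (b / a) <= measure (intensity \<gamma>) (shK (hp n) a 1 q) ==> ?thesis" by simp
 qed
 then have "prob (vd (shK (hp n) a 1 q)) <= exp (- (g' * ln (b / a)))" unfolding p by simp
 also have "... = (a / b) powr g'" using a b by (simp add: powr_def ln_div algebra_simps)
 also have "... = (M / b) powr g' * hp n powr g'" using M b by (simp add: a_def powr_mult[symmetric])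
 also have "hp n powr g' = 2 powr (- g' * real n)" unfolding hp_powr powr_powr by (simp add: mult.commute)
 also have "(M / b) powr g' * 2 powr (- g' * real n) <= C * 2 powr (- g' * real n)"
 using C by (intro mult_right_mono) auto
 finally show ?thesis .
 next
 case False
 have "b / M <= hp n" using False M by (simp add: a_def field_simps)
 then have "(b / M) powr g' <= hp n powr g'" using b M e by (intro powr_mono2) auto
 also have "hp n powr g' = 2 powr (- g' * real n)" unfolding hp_powr powr_powr by (simp add: mult.commute)
 finally have "(M / b) powr g' * (b / M) powr g' <= C * 2 powr (- g' * real n)"
 using C by (intro mult_mono) auto
 moreover have "(M / b) powr g' * (b / M) powr g' = 1" using b M by (simp add: powr_mult[symmetric])
 ultimately show ?thesis using prob_le_1[of "vd (shK (hp n) a 1 q)"] by linarith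
 qed
 then show ?thesis using a K1 by blast
 qed
 then show ?thesis using C(1) by blast
qed

lemma vd_of_hit:
 assumes "w : space P" "y : cutout (\<Phi> w)" "y : vball q d" "q : S3"
 shows "w : vd (shK d a b q)"
proof (rule ccontr)
 assume "w \<notin> vd (shK d a b q)"
 then obtain p where p: "p : \<Phi> w" "p : shK d a b q" using assms(1) by (auto simp: vd_def)
 have y: "y : S3" using assms by (simp add: vball_def)
 have "dvis (fst p) y <= dvis (fst p) q + dvis q y"
 using p assms y by (intro dvis_triangle) (auto simp: shK_def)
 then have "dvis (fst p) y < snd p" using p(2) assms(3) by (simp add: shK_def vball_def)
 then have "y : vball (fst p) (snd p)" using y by (simp add: vball_def)
 then show False using assms(2) p(1) by (cases p) (auto simp: cutout_def)
qed

text \<open>First moment: of order 2^(4 n) balls of radius 2^(-n), each met with probability of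
  order at most 2^(-g' n), give an expected sum of s-th powers of diameters of order 2^(-h n).
  Markov's inequality at level \<open>z ^ n\<close> with z = 2^(-h/2) and Borel-Cantelli yield
  covers with arbitrarily small sums.\<close>

lemma haus_cutout_zero:
 assumes s: "s > 0" "s > 4 - g"
 shows "AE u in P. haus_outer dvis s (cutout (\<Phi> u)) = 0"
proof -
 obtain g' where g': "g' < g" "g' > 0" "s > 4 - g'"
 proof -
 have "max 0 (4 - s) < g" using s g_pos by simp
 then obtain x where "max 0 (4 - s) < x" "x < g" using dense by blast
 then show ?thesis using that[of x] by simp
 qed
 define h where "h = s - 4 + g'"
 have h: "h > 0" using g' by (simp add: h_def)
 obtain C1 where C1: "C1 > 0" "ALL n. EX Q. finite Q & Q <= S3 & real (card Q) <= C1 * 2 ^ (4 * n) & S3 <= (\<Union>q\<in>Q. vball q ((1/2) ^ n))"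
 using vball_cover by blast
 obtain Q where "ALL n. finite (Q n) & Q n <= S3 & real (card (Q n)) <= C1 * 2 ^ (4 * n) & S3 <= (\<Union>q\<in>Q n. vball q ((1/2) ^ n))"
 using choice[OF C1(2)] by blast
 then have Q: "!!n. finite (Q n)" "!!n. Q n <= S3" "!!n. real (card (Q n)) <= C1 * 2 ^ (4 * n)"
 "!!n. S3 <= (\<Union>q\<in>Q n. vball q ((1/2) ^ n))" by blast+
 obtain C2 where C2: "C2 >= 0" "!!n q. q : S3 ==> EX a>0. shK (hp n) a 1 q : bdd_sets a & prob (vd (shK (hp n) a 1 q)) <= C2 * 2 powr (- g' * real n)"
 using hit_probability[OF g'(1,2)] by blast
 define a where "a n q = (SOME a. a > 0 & shK (hp n) a 1 q : bdd_sets a & prob (vd (shK (hp n) a 1 q)) <= C2 * 2 powr (- g' * real n))" for n q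
 have a: "a n q > 0 & shK (hp n) (a n q) 1 q : bdd_sets (a n q) & prob (vd (shK (hp n) (a n q) 1 q)) <= C2 * 2 powr (- g' * real n)"
 if "q : S3" for n q unfolding a_def by (rule someI_ex) (use C2(2)[OF that, of n] in blast)
 define Ev where "Ev n q = vd (shK (hp n) (a n q) 1 q)" for n q
 have Evs: "Ev n q : sets P" if "q : S3" for n q unfolding Ev_def using a[OF that, of n] by (intro vd_sets) auto
 define W where "W n u = (\<Sum>q\<in>Q n. indicator (Ev n q) u * (2 * hp n) powr s)" for n u
 have Qi: "q : S3" if "q : Q n" for n q using Q(2) that by blast
 have iE: "integrable P (%u. indicator (Ev n q) u * (2 * hp n) powr s)" if "q : Q n" for n q
 using Evs[OF Qi[OF that]] by (intro integrable_mult_left integrable_real_indicator) (auto simp: emeasure_eq_measure)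
 define C where "C = C1 * C2 * 2 powr s"
 have EW: "(\<integral>u. W n u \<partial>P) <= C * 2 powr (- h * real n)" for n
 proof -
 have "(\<integral>u. W n u \<partial>P) = (\<Sum>q\<in>Q n. prob (Ev n q) * (2 * hp n) powr s)"
 unfolding W_def using iE Evs[OF Qi] by (subst Bochner_Integration.integral_sum) auto
 also have "... <= (\<Sum>q\<in>Q n. C2 * 2 powr (- g' * real n) * (2 * hp n) powr s)"
 unfolding Ev_def using a[OF Qi] by (intro sum_mono mult_right_mono) auto
 also have "... = real (card (Q n)) * (C2 * 2 powr (- g' * real n) * (2 * hp n) powr s)" by simp
 also have "... <= (C1 * 2 ^ (4 * n)) * (C2 * 2 powr (- g' * real n) * (2 * hp n) powr s)"
 using Q(3) C2(1) by (intro mult_right_mono) auto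
 also have "... = C * (2 powr (4 * real n) * 2 powr (- g' * real n) * 2 powr (- s * real n))"
 proof -
 have "(2 * hp n) powr s = 2 powr s * 2 powr (- s * real n)"
 unfolding powr_mult by (simp add: hp_powr powr_powr mult.commute del: power_divide)
 moreover have "(2::real) ^ (4 * n) = 2 powr (4 * real n)"
 using powr_realpow[of 2 "4 * n"] by simp
 ultimately show ?thesis unfolding C_def by (simp only: mult_ac)
 qed
 also have "2 powr (4 * real n) * 2 powr (- g' * real n) * 2 powr (- s * real n) = 2 powr (- h * real n)"
 unfolding powr_add[symmetric] h_def by (simp add: algebra_simps)
 finally show ?thesis .
 qed
 have iW: "integrable P (W n)" for n unfolding W_def[abs_def] by (intro Bochner_Integration.integrable_sum iE)
 have W0: "W n u >= 0" for n u unfolding W_def by (intro sum_nonneg) auto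
 define z where "z = 2 powr (- h / 2)"
 have z: "0 < z" "z < 1" using h by (auto simp: z_def powr_less_one)
 have zz: "2 powr (- h * real n) = z ^ n * z ^ n" for n
 proof -
 have "z ^ n = 2 powr (- h / 2 * real n)"
 unfolding powr_realpow[OF z(1), symmetric] by (simp only: z_def powr_powr)
 then show ?thesis by (simp add: powr_add[symmetric])
 qed
 define Bad where "Bad n = {u : space P. z ^ n <= W n u}" for n
 have Bad: "Bad n : sets P" for n unfolding Bad_def using iW[of n] by measurable
 have PB: "prob (Bad n) <= C * z ^ n" for n
 proof -
 have "prob (Bad n) <= (\<integral>u. W n u \<partial>P) / z ^ n"
 unfolding Bad_def using iW W0 z by (intro integral_Markov_inequality_measure[where A="{}"]) auto
 also have "... <= C * 2 powr (- h * real n) / z ^ n" using EW z by (intro divide_right_mono) auto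
 also have "... = C * z ^ n" unfolding zz using z by simp
 finally show ?thesis .
 qed
 have "AE u in P. \<forall>\<^sub>F n in sequentially. u : space P - Bad n"
 proof (rule borel_cantelli_AE1[OF Bad])
 show "emeasure P (Bad n) < \<infinity>" for n by (simp add: emeasure_eq_measure)
 show "summable (%n. measure P (Bad n))"
 by (rule summable_comparison_test'[of "%n. C * z ^ n"]) (use PB z in \<open>auto intro!: summable_mult summable_geometric\<close>)
 qed
 then show ?thesis
 proof (rule AE_mp, intro AE_I2 impI)
 fix u assume w: "u : space P" and ev: "\<forall>\<^sub>F n in sequentially. u : space P - Bad n"
 show "haus_outer dvis s (cutout (\<Phi> u)) = 0"
 proof (rule haus_zeroI[OF s(1)])
 fix E :: real assume e: "E > 0"
 have "(%n. z ^ n) \<longlonglongrightarrow> 0" using z by (intro LIMSEQ_power_zero) auto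
 then have "\<forall>\<^sub>F n in sequentially. z ^ n < E" using e by (rule order_tendstoD)
 then have "\<forall>\<^sub>F n in sequentially. z ^ n < E & u : space P - Bad n" using ev by eventually_elim auto
 then obtain n where n: "z ^ n < E" "u \<notin> Bad n" by (auto simp: eventually_sequentially)
 have Wn: "W n u <= E" using n w by (auto simp: Bad_def)
 define R where "R = {q : Q n. u : Ev n q}"
 have finR: "finite R" unfolding R_def using Q(1) by simp
 obtain f where f: "bij_betw f {..<card R} R" using ex_bij_betw_nat_finite[OF finR] by (auto simp: atLeast0LessThan)
 define U where "U i = (if i < card R then vball (f i) (hp n) else {})" for i
 have "cutout (\<Phi> u) <= (\<Union>i. U i)"
 proof
 fix y assume y: "y : cutout (\<Phi> u)"
 then have "y : S3" by (simp add: cutout_def)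
 then obtain q where q: "q : Q n" "y : vball q (hp n)" using Q(4)[of n] by blast
 have "u : Ev n q" unfolding Ev_def using w y q Qi by (intro vd_of_hit) auto
 then have "q : R" using q by (simp add: R_def)
 then have "q : f ` {..<card R}" using f by (simp add: bij_betw_def)
 then obtain i where "i < card R" "f i = q" by blast
 then have "y : U i" using q by (simp add: U_def)
 then show "y : (\<Union>i. U i)" by blast
 qed
 moreover have dU: "hdiam dvis (U i) <= ennreal (2 * hp n)" for i
 proof (rule hdiam_le)
 fix x y assume "x : U i" "y : U i"
 then have i: "i < card R" and xy: "x : vball (f i) (hp n)" "y : vball (f i) (hp n)" by (auto simp: U_def split: if_splits)
 have "f i : f ` {..<card R}" using i by blast
 then have "f i : R" using f by (simp add: bij_betw_def)
 then have "f i : Q n" by (simp add: R_def) then have "f i : S3" by (rule Qi)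
 then have "dvis x y <= dvis x (f i) + dvis (f i) y" using xy by (intro dvis_triangle) (auto simp: vball_def)
 then show "dvis x y <= 2 * hp n" using xy by (simp add: vball_def dvis_sym[of x])
 qed
 moreover have "hdiam dvis (U i) < \<top>" for i by (rule le_less_trans[OF dU]) simp
 moreover have "(\<Sum>i. ennreal (enn2real (hdiam dvis (U i)) powr s)) <= ennreal E"
 proof -
 have "(\<Sum>i. ennreal (enn2real (hdiam dvis (U i)) powr s)) = (\<Sum>i<card R. ennreal (enn2real (hdiam dvis (U i)) powr s))"
 by (rule suminf_finite) (auto simp: U_def hdiam_def)
 also have "... <= (\<Sum>i<card R. ennreal ((2 * hp n) powr s))"
 proof (intro sum_mono ennreal_leI powr_mono2)
 show "enn2real (hdiam dvis (U i)) <= 2 * hp n" for i using dU[of i] by (intro enn2real_leI) auto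
 qed (use s in auto)
 also have "... = ennreal (real (card R) * (2 * hp n) powr s)"
 by (simp add: ennreal_of_nat_eq_real_of_nat ennreal_mult')
 also have "real (card R) * (2 * hp n) powr s = W n u"
 proof -
 have "W n u = (\<Sum>q\<in>Q n. if u : Ev n q then (2 * hp n) powr s else 0)"
 unfolding W_def by (intro sum.cong) (auto simp: indicator_def)
 also have "... = (\<Sum>q\<in>R. (2 * hp n) powr s)" unfolding R_def using Q(1) by (subst sum.inter_filter) auto
 finally show ?thesis by simp
 qed
 also have "ennreal (W n u) <= ennreal E" using Wn by (rule ennreal_leI)
 finally show ?thesis .
 qed
 ultimately show "EX U :: nat => c2 set. cutout (\<Phi> u) <= (\<Union>i. U i) & (ALL i. hdiam dvis (U i) < \<top>) &
 (\<Sum>i. ennreal (enn2real (hdiam dvis (U i)) powr s)) <= ennreal E" by blast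
 qed
 qed
qed

theorem hdim_cutout_le: "AE w in P. hdim dvis (cutout (\<Phi> w)) <= ereal (max 0 (4 - g))"
proof -
 have "AE w in P. ALL k::nat. haus_outer dvis (max 0 (4 - g) + 1 / real (Suc k)) (cutout (\<Phi> w)) = 0"
 proof (subst AE_all_countable, intro allI haus_cutout_zero)
 fix k :: nat
 have k: "0 < 1 / real (Suc k)" by simp
 show "0 < max 0 (4 - g) + 1 / real (Suc k)" using k by linarith
 show "4 - g < max 0 (4 - g) + 1 / real (Suc k)" using k by linarith
 qed
 then show ?thesis
 proof (rule AE_mp, intro AE_I2 impI)
 fix w assume h: "ALL k::nat. haus_outer dvis (max 0 (4 - g) + 1 / real (Suc k)) (cutout (\<Phi> w)) = 0"
 show "hdim dvis (cutout (\<Phi> w)) <= ereal (max 0 (4 - g))"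
 proof (rule ereal_le_epsilon2)
 fix e :: real assume e: "0 < e"
 obtain k where k: "inverse (real (Suc k)) < e" using reals_Archimedean[OF e] by blast
 have "hdim dvis (cutout (\<Phi> w)) <= ereal (max 0 (4 - g) + 1 / real (Suc k))"
 using h by (intro hdim_le) (auto intro: add_nonneg_pos)
 also have "... <= ereal (max 0 (4 - g) + e)" using k unfolding ereal_less_eq inverse_eq_divide by linarith
 also have "... = ereal (max 0 (4 - g)) + ereal e" by (rule plus_ereal.simps(1)[symmetric])
 finally show "hdim dvis (cutout (\<Phi> w)) <= ereal (max 0 (4 - g)) + ereal e" .
 qed
 qed
qed

end

section \<open>The projection in coordinates of the projective line\<close>

lemma hdot_alt: "hdot u v = fst u * cnj (fst v) + hin (snd u) (snd v)"
 by (cases u; cases v) (simp add: hdot_def hin_def)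

lemma lform_alt: "lform u v = fst u * cnj (fst v) - hin (snd u) (snd v)"
 by (cases u; cases v) (simp add: lform_def hin_def)

lemma lift_alt: "lift x = (1, x)" by (simp add: lift_def)

lemma csmult_alt: "csmult c u = (c * fst u, csc c (snd u))"
 by (cases u) (simp add: csmult_def csc_def)

lemma enorm_alt: "enorm u = norm (u :: cvec)"
proof -
 have "Re (hdot u u) = (norm (fst u))\<^sup>2 + (norm (snd u))\<^sup>2"
 unfolding hdot_alt hin_self by (simp add: complex_mult_cnj cmod_power2)
 then show ?thesis by (simp add: enorm_def norm_prod_def)
qed

lemma norm_cvec_sq: "(norm (u :: cvec))\<^sup>2 = (cmod (fst u))\<^sup>2 + (norm (snd u))\<^sup>2"
 by (simp add: norm_prod_def)

lemma hdot_csmult: "hdot (csmult a u) (csmult b v) = a * cnj b * hdot u v"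
 by (simp add: hdot_alt csmult_alt hin_csc_left hin_csc_right algebra_simps)

lemma norm_csmult: "norm (csmult c u) = cmod c * norm u"
proof -
 have "(norm (csmult c u))\<^sup>2 = (cmod c * norm u)\<^sup>2"
 unfolding power_mult_distrib norm_cvec_sq by (simp add: csmult_alt norm_mult norm_csc power_mult_distrib algebra_simps)
 then show ?thesis by (metis norm_ge_zero power2_eq_imp_eq mult_nonneg_nonneg)
qed

lemma hdot_sym: "cmod (hdot u v) = cmod (hdot v u)"
proof -
 have "hdot v u = cnj (hdot u v)" unfolding hdot_alt using hin_cnj[of "snd v" "snd u"] by simp
 then show ?thesis by simp
qed

text \<open>Pythagoras for the distance of u to the multiples of v. Consequently
  \<open>dE u v * norm u\<close> is the distance of u to the complex line spanned by v, the form in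
  which \<open>dE_le\<close> and \<open>dE_attained\<close> make it available.\<close>

lemma wedge_identity:
 "(norm v)\<^sup>2 * (norm (u - csmult c v))\<^sup>2 = wedge_norm2 u v + (cmod (c * (norm v)\<^sup>2 - hdot u v))\<^sup>2"
proof -
 have n: "(norm (u - csmult c v))\<^sup>2 = (norm u)\<^sup>2 - 2 * Re (cnj c * hdot u v) + (cmod c)\<^sup>2 * (norm v)\<^sup>2"
 proof -
 have e: "complex_of_real ((norm w)\<^sup>2) = hdot w w" for w :: cvec
 unfolding norm_cvec_sq hdot_alt hin_self of_real_add complex_norm_square by simp
 have hs: "hdot v u = cnj (hdot u v)" unfolding hdot_alt using hin_cnj[of "snd v" "snd u"] by simp
 have "hdot (u - csmult c v) (u - csmult c v) = hdot u u - cnj c * hdot u v - c * hdot v u + c * cnj c * hdot v v"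
 by (simp add: hdot_alt csmult_alt hin_diff_left hin_diff_right hin_csc_left hin_csc_right algebra_simps)
 then have "Re (hdot (u - csmult c v) (u - csmult c v)) = Re (hdot u u) - Re (cnj c * hdot u v) - Re (c * hdot v u) + Re (c * cnj c * hdot v v)"
 by simp
 moreover have "Re (c * hdot v u) = Re (cnj c * hdot u v)" unfolding hs by simp
 moreover have "Re (hdot w w) = (norm w)\<^sup>2" for w using e[of w] by (metis Re_complex_of_real)
 moreover have "Re (c * cnj c * hdot v v) = (cmod c)\<^sup>2 * (norm v)\<^sup>2"
 unfolding e[symmetric] complex_norm_square[symmetric] by (simp flip: of_real_mult of_real_power)
 ultimately show ?thesis by simp
 qed
 have m: "(cmod (c * (norm v)\<^sup>2 - hdot u v))\<^sup>2 = (cmod c)\<^sup>2 * ((norm v)\<^sup>2)\<^sup>2 - 2 * (norm v)\<^sup>2 * Re (cnj c * hdot u v) + (cmod (hdot u v))\<^sup>2"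
 unfolding cmod_power2 by (simp add: power2_eq_square algebra_simps)
 show ?thesis unfolding n m wedge_norm2_def enorm_alt by (simp add: power2_eq_square algebra_simps)
qed

lemma wedge_nonneg: "wedge_norm2 u v >= 0"
proof (cases "v = 0")
 case True then show ?thesis by (simp add: wedge_norm2_def enorm_alt hdot_alt hin_def)
next
 case False
 have "(norm v)\<^sup>2 * (norm (u - csmult (hdot u v / (norm v)\<^sup>2) v))\<^sup>2 = wedge_norm2 u v"
 using wedge_identity[of v u "hdot u v / (norm v)\<^sup>2"] False by simp
 then show ?thesis by (metis mult_nonneg_nonneg zero_le_power2)
qed

lemma dE_le: assumes "u ~= 0" "v ~= 0" shows "dE u v * norm u <= norm (u - csmult c v)"
proof -
 have "wedge_norm2 u v <= (norm v * norm (u - csmult c v))\<^sup>2"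
 using wedge_identity[of v u c] by (simp add: power_mult_distrib)
 then have "sqrt (wedge_norm2 u v) <= norm v * norm (u - csmult c v)" by (intro real_le_lsqrt wedge_nonneg) auto
 then show ?thesis using assms by (simp add: dE_def enorm_alt field_simps)
qed

lemma dE_attained: assumes "u ~= 0" "v ~= 0" shows "EX c. norm (u - csmult c v) = dE u v * norm u"
proof -
 let ?c = "hdot u v / (norm v)\<^sup>2"
 have "(norm v * norm (u - csmult ?c v))\<^sup>2 = wedge_norm2 u v"
 using wedge_identity[of v u ?c] assms by (simp add: power_mult_distrib)
 then have "norm v * norm (u - csmult ?c v) = sqrt (wedge_norm2 u v)" by (metis norm_ge_zero mult_nonneg_nonneg real_sqrt_unique)
 then show ?thesis using assms by (intro exI[of _ ?c]) (simp add: dE_def enorm_alt field_simps)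
qed

lemma dE_csmult: "a ~= 0 ==> b ~= 0 ==> dE (csmult a u) (csmult b v) = dE u v"
proof -
 assume "a ~= 0" "b ~= 0"
 have "wedge_norm2 (csmult a u) (csmult b v) = (cmod a * cmod b)\<^sup>2 * wedge_norm2 u v"
 by (simp add: wedge_norm2_def enorm_alt norm_csmult hdot_csmult norm_mult power_mult_distrib algebra_simps)
 then have "sqrt (wedge_norm2 (csmult a u) (csmult b v)) = cmod a * cmod b * sqrt (wedge_norm2 u v)"
 by (simp add: real_sqrt_mult)
 then show ?thesis using \<open>a ~= 0\<close> \<open>b ~= 0\<close> by (simp add: dE_def enorm_alt norm_csmult)
qed

lemma csmult_csmult: "csmult a (csmult b u) = csmult (a * b) u"
 by (simp add: csmult_alt csc_def mult.assoc)

lemma csmult_1: "csmult 1 u = u" by (simp add: csmult_alt csc_def)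

lemma pclass_some: "EX c. c ~= 0 & (SOME w. w : pclass u) = csmult c u"
proof -
 have "u : pclass u" unfolding pclass_def using csmult_1[of u] by (auto intro!: exI[of _ 1])
 then have "(SOME w. w : pclass u) : pclass u" by (rule someI)
 then show ?thesis by (auto simp: pclass_def)
qed

lemma dP_pclass: "dP (pclass u) (pclass v) = dE u v"
proof -
 obtain a b where "a ~= 0" "(SOME w. w : pclass u) = csmult a u" "b ~= 0" "(SOME w. w : pclass v) = csmult b v"
 using pclass_some by metis
 then show ?thesis by (simp add: dP_def dE_csmult)
qed

lemma dP_nonneg: "0 <= dP p q"
 unfolding dP_def dE_def enorm_alt by (intro divide_nonneg_nonneg mult_nonneg_nonneg real_sqrt_ge_zero wedge_nonneg norm_ge_zero)

lemma dP_sym: "dP p q = dP q p"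
 unfolding dP_def dE_def wedge_norm2_def using hdot_sym by (simp add: mult.commute)

lemma pclass_csmult: "c ~= 0 ==> pclass (csmult c u) = pclass u"
proof -
 assume c: "c ~= 0"
 have *: "csmult a u = csmult (a / c) (csmult c u)" for a using c by (simp add: csmult_csmult)
 have "EX d. csmult a u = csmult d (csmult c u) & d ~= 0" if "a ~= 0" for a
 using *[of a] that c by (intro exI[of _ "a / c"]) auto
 moreover have "EX d. csmult a (csmult c u) = csmult d u & d ~= 0" if "a ~= 0" for a
 using that c by (intro exI[of _ "a * c"]) (simp add: csmult_csmult)
 ultimately show ?thesis unfolding pclass_def by blast
qed

text \<open>The equation of the line \<open>perpP (lift x)\<close> expresses the first homogeneous
  coordinate as \<open>hin b x\<close> in terms of the other two. The projective line is thereby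
  parametrised by b up to scalars.\<close>

definition pp :: "c2 => c2 => cvec set" where
 "pp x b = pclass (hin b x, b)"

lemma pp_csc: assumes "c ~= 0" shows "pp x (csc c b) = pp x b"
proof -
 have "(hin (csc c b) x, csc c b) = csmult c (hin b x, b)" by (simp add: csmult_alt hin_csc_left)
 then show ?thesis unfolding pp_def using pclass_csmult[OF assms] by simp
qed

lemma perpP_iff: "p : perpP (lift x) \<longleftrightarrow> (EX b. b ~= 0 & p = pp x b)"
proof
 assume "p : perpP (lift x)"
 then obtain u where u: "p = pclass u" "u ~= 0" "lform u (lift x) = 0" by (auto simp: perpP_def)
 then have f: "fst u = hin (snd u) x" by (simp add: lform_alt lift_alt)
 have "snd u ~= 0"
 proof
 assume "snd u = 0"
 then have "u = 0" using f by (simp add: prod_eq_iff hin_def)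
 then show False using u by simp
 qed
 moreover have "p = pp x (snd u)" unfolding pp_def u(1) f[symmetric] by simp
 ultimately show "EX b. b ~= 0 & p = pp x b" by blast
next
 assume "EX b. b ~= 0 & p = pp x b"
 then obtain b where "b ~= 0" "p = pclass (hin b x, b)" by (auto simp: pp_def)
 then show "p : perpP (lift x)" unfolding perpP_def mem_Collect_eq
 by (intro exI[of _ "(hin b x, b)"]) (simp add: lform_alt lift_alt prod_eq_iff)
qed

lemma pp_perpP: "b ~= 0 ==> pp x b : perpP (lift x)"
 unfolding perpP_iff by blast

lemma csc_unit:
 assumes "b ~= 0" obtains b' c where "norm b' = 1" "c ~= 0" "b = csc c b'"
proof -
 let ?c = "complex_of_real (norm b)"
 have "norm (csc (1 / ?c) b) = 1" using assms by (simp add: norm_csc norm_divide)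
 moreover have "b = csc ?c (csc (1 / ?c) b)" using assms by (simp add: csc_def prod_eq_iff)
 ultimately show ?thesis using that[of "csc (1 / ?c) b" ?c] assms by simp
qed

lemma perpP_unit: "p : perpP (lift x) ==> EX b. norm b = 1 & p = pp x b"
proof -
 assume "p : perpP (lift x)"
 then obtain b where b: "b ~= 0" "p = pp x b" by (auto simp: perpP_iff)
 obtain b' c where "norm b' = 1" "c ~= 0" "b = csc c b'" using csc_unit[OF b(1)] by blast
 then show ?thesis using b pp_csc[of c x b'] by (intro exI[of _ b']) simp
qed

lemma hin_zero_iff: assumes "d ~= 0" shows "hin d b = 0 \<longleftrightarrow> (EX c. b = csc c (cperp d))"
proof
 assume h: "hin d b = 0"
 obtain d1 d2 b1 b2 where d: "d = (d1, d2)" "b = (b1, b2)" by (cases d; cases b)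
 have e: "d1 * cnj b1 + d2 * cnj b2 = 0" using h by (simp add: d hin_def)
 show "EX c. b = csc c (cperp d)"
 proof (cases "d2 = 0")
 case True
 then have "d1 ~= 0" "b1 = 0" using assms e by (auto simp: d zero_prod_def)
 then show ?thesis using True by (intro exI[of _ "b2 / cnj d1"]) (simp add: d csc_def cperp_def)
 next
 case False
 have "cnj b2 = - d1 * cnj b1 / d2" using e False by (simp add: field_simps add_eq_0_iff)
 then have "b2 = cnj (- d1 * cnj b1 / d2)" by (metis complex_cnj_cnj)
 then show ?thesis using False by (intro exI[of _ "- b1 / cnj d2"]) (simp add: d csc_def cperp_def)
 qed
qed (auto simp: hin_csc_right hin_cperp)

text \<open>The point of the first line given by b lies on the second one iff
  \<open>hin b y = hin b x\<close>, i.e. iff b is orthogonal to y - x; in C^2 this determines b up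
  to a scalar.\<close>

lemma proj_eq:
 assumes "y ~= x" shows "proj x y = pp x (cperp (y - x))"
proof -
 let ?b = "cperp (y - x)"
 have b0: "?b ~= 0" using assms norm_cperp[of "y - x"] by (metis norm_eq_zero right_minus_eq)
 have hb: "hin b y = hin b x \<longleftrightarrow> hin (y - x) b = 0" for b
 proof -
 have "hin (y - x) b = cnj (hin b y - hin b x)" by (simp add: hin_cnj[of "y - x"] hin_diff_right)
 then show ?thesis by simp
 qed
 have 1: "pp x ?b : perpP (lift x)" using b0 by (rule pp_perpP)
 have "hin ?b y = hin ?b x" using hb[of ?b] by (simp add: hin_cperp)
 then have 2: "pp x ?b : perpP (lift y)" using pp_perpP[OF b0, of y] by (simp add: pp_def)
 have 3: "p = pp x ?b" if p: "p : perpP (lift x)" "p : perpP (lift y)" for p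
 proof -
 obtain b where b: "b ~= 0" "p = pp x b" using p by (auto simp: perpP_iff)
 obtain b' where b': "b' ~= 0" "p = pp y b'" using p by (auto simp: perpP_iff)
 have "(hin b x, b) : pclass (hin b' y, b')"
 proof -
 have "(hin b x, b) : pclass (hin b x, b)" unfolding pclass_def using csmult_1[of "(hin b x, b)"] by (auto intro!: exI[of _ 1])
 then show ?thesis using b(2) b'(2) by (simp add: pp_def)
 qed
 then obtain c where "b = csc c b'" "hin b x = c * hin b' y" by (auto simp: pclass_def csmult_alt)
 then have "hin b x = hin b y" by (simp add: hin_csc_left)
 then have "hin (y - x) b = 0" using hb[of b] by simp
 then obtain c where c: "b = csc c ?b" using hin_zero_iff[of "y - x" b] assms by auto
 then have "c ~= 0" using b(1) by (auto simp: csc_def zero_prod_def)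
 from pp_csc[OF this, of x ?b] show ?thesis unfolding b(2) c[symmetric] .
 qed
 have "(THE p. p : perpP (lift x) & p : perpP (lift y)) = pp x ?b"
 using 1 2 3 by (intro the_equality) blast+
 then show ?thesis unfolding proj_def using assms by simp
qed

lemma proj_perpP: "x : S3 ==> proj x y : perpP (lift x)"
proof (cases "y = x")
 case True
 assume "x : S3"
 then have "pclass (lift x) = pp x x" "x ~= 0" by (auto simp: pp_def lift_alt hin_self in_S3)
 then show ?thesis using True pp_perpP[of x x] by (simp add: proj_def)
next
 case False
 then have "cperp (y - x) ~= 0" using norm_cperp[of "y - x"] by (metis norm_eq_zero right_minus_eq)
 then show ?thesis using proj_eq[OF False] pp_perpP by simp
qed

lemma pp_diff_le:
 assumes x: "x : S3" and b: "b ~= 0" "b' ~= 0" shows "dP (pp x b) (pp x b') <= 2 * norm (b - b') / norm b"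
proof -
 let ?u = "(hin b x, b)" and ?v = "(hin b' x, b')"
 have uv: "?u ~= 0" "?v ~= 0" using b by (auto simp: zero_prod_def)
 have "?u - csmult 1 ?v = (hin (b - b') x, b - b')" unfolding csmult_1 by (simp add: hin_diff_left)
 then have "norm (?u - csmult 1 ?v) <= cmod (hin (b - b') x) + norm (b - b')" using norm_Pair_le by metis
 also have "cmod (hin (b - b') x) <= norm (b - b')" using cmod_hin_le[of "b - b'" x] x by (simp add: in_S3)
 finally have "dE ?u ?v * norm ?u <= 2 * norm (b - b')" using dE_le[OF uv, of 1] by linarith
 moreover have "dE ?u ?v * norm b <= dE ?u ?v * norm ?u"
 using dP_nonneg[of "pclass ?u" "pclass ?v"] norm_snd_le[of b "hin b x"] by (intro mult_left_mono) (auto simp: dP_pclass)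
 ultimately have "dE ?u ?v * norm b <= 2 * norm (b - b')" by linarith
 then show ?thesis using b by (simp add: pp_def dP_pclass field_simps)
qed

text \<open>The projection depends on the direction of y - x only, which is Lipschitz away from x;
  hence the constant 1 / e.\<close>

lemma proj_lipschitz:
 assumes x: "x : S3" and y: "y : S3" "y' : S3" and e: "e > 0" "e <= norm (y - x)" "e <= norm (y' - x)"
 shows "dP (proj x y) (proj x y') <= 2 / e * norm (y - y')" "dP (proj x y) (proj x y') <= 4 / e * dvis y y'"
proof -
 have ne: "y ~= x" "y' ~= x" using e by auto
 have b0: "cperp (y - x) ~= 0" "cperp (y' - x) ~= 0"
 using ne norm_cperp[of "y - x"] norm_cperp[of "y' - x"] by (metis norm_eq_zero right_minus_eq)+
 have "cperp (y - x) - cperp (y' - x) = cperp (y - y')" by (simp add: cperp_def)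
 then have "dP (proj x y) (proj x y') <= 2 * norm (y - y') / norm (y - x)"
 using pp_diff_le[OF x b0] by (simp add: proj_eq ne norm_cperp)
 also have "... <= 2 * norm (y - y') / e" using e by (intro divide_left_mono mult_pos_pos) auto
 finally show 1: "dP (proj x y) (proj x y') <= 2 / e * norm (y - y')" by simp
 also have "... <= 2 / e * (2 * dvis y y')" using norm_diff_le_dvis[OF y] e by (intro mult_left_mono) auto
 finally show "dP (proj x y) (proj x y') <= 4 / e * dvis y y'" by simp
qed

text \<open>The link between the projection and tubes. The point \<open>proj x y\<close> is
  represented by a vector orthogonal to y - x, and \<open>dE_attained\<close> finds a multiple of it
  within 2 d of b; hence \<open>hin (y - x) b\<close> is small. The point x itself lies in the tube
  trivially.\<close>

lemma dP_tube:
 assumes x: "x : S3" and y: "y : S3" and b: "norm b = 1" and d: "y ~= x ==> dP (pp x b) (proj x y) <= d" "0 <= d"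
 shows "y : tube b (hin x b) (4 * d)"
proof (cases "y = x")
 case True then show ?thesis using x d(2) by (simp add: tube_def)
next
 case False
 let ?b = "cperp (y - x)"
 let ?u = "(hin b x, b)" and ?v = "(hin ?b x, ?b)"
 have b0: "?b ~= 0" using False norm_cperp[of "y - x"] by (metis norm_eq_zero right_minus_eq)
 have uv: "?u ~= 0" "?v ~= 0" using b b0 by (auto simp: zero_prod_def)
 obtain c where c: "norm (?u - csmult c ?v) = dE ?u ?v * norm ?u" using dE_attained[OF uv] by blast
 have "norm ?u <= cmod (hin b x) + norm b" by (rule norm_Pair_le)
 also have "... <= 2" using cmod_hin_le[of b x] b x by (simp add: in_S3)
 finally have "dE ?u ?v * norm ?u <= d * 2"
 using d False by (intro mult_mono) (auto simp: proj_eq pp_def dP_pclass)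
 moreover have "norm (b - csc c ?b) <= norm (?u - csmult c ?v)"
 using norm_snd_le[of "snd (?u - csmult c ?v)" "fst (?u - csmult c ?v)"] by (simp add: csmult_alt)
 ultimately have n: "norm (b - csc c ?b) <= 2 * d" using c by linarith
 have "hin y b - hin x b = hin (y - x) (b - csc c ?b)"
 by (simp add: hin_diff_left[symmetric]) (simp add: hin_diff_right hin_csc_right hin_cperp)
 then have "cmod (hin y b - hin x b) <= norm (y - x) * norm (b - csc c ?b)" using cmod_hin_le by metis
 also have "... <= 2 * (2 * d)"
 using n norm_triangle_ineq4[of y x] x y by (intro mult_mono) (auto simp: in_S3)
 finally show ?thesis using y by (simp add: tube_def)
qed

lemma space_perp: "space (perp_space x) = perpP (lift x)"
 unfolding perp_space_def by (rule space_measure_of) auto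

lemma ball_perp: "p : perpP (lift x) ==> {q : perpP (lift x). dP p q < r} : sets (perp_space x)"
 unfolding perp_space_def by (subst sets_measure_of) (auto intro!: sigma_sets.Basic)

lemma cball_perp: assumes "p : perpP (lift x)" shows "{q : perpP (lift x). dP p q <= r} : sets (perp_space x)"
proof -
 have "{q : perpP (lift x). dP p q <= r} = (\<Inter>n::nat. {q : perpP (lift x). dP p q < r + 1 / real (Suc n)})"
 proof (intro equalityI subsetI)
 fix q assume "q : {q : perpP (lift x). dP p q <= r}"
 moreover have "0 < 1 / real (Suc n)" for n by simp
 ultimately show "q : (\<Inter>n::nat. {q : perpP (lift x). dP p q < r + 1 / real (Suc n)})" by (auto intro: add_strict_increasing2 le_less_trans simp: less_add_same_cancel1)
 next
 fix q assume q: "q : (\<Inter>n::nat. {q : perpP (lift x). dP p q < r + 1 / real (Suc n)})"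
 have "dP p q <= r"
 proof (rule field_le_epsilon)
 fix e :: real assume "0 < e"
 then obtain n where n: "inverse (real (Suc n)) < e" using reals_Archimedean by blast
 have "dP p q < r + 1 / real (Suc n)" using q by blast
 then show "dP p q <= r + e" using n by (simp add: inverse_eq_divide)
 qed
 then show "q : {q : perpP (lift x). dP p q <= r}" using q by blast
 qed
 then show ?thesis using ball_perp[OF assms] by simp
qed

lemma proj_measurable:
 assumes x: "x : S3" shows "proj x : measurable S3b (perp_space x)"
 unfolding perp_space_def
proof (rule measurable_measure_of)
 show "proj x : space S3b \<rightarrow> perpP (lift x)" using proj_perpP[OF x] by simp
 fix A assume "A : {{q : perpP (lift x). dP p q < r} |p r. p : perpP (lift x)}"
 then obtain p r where A: "A = {q : perpP (lift x). dP p q < r}" "p : perpP (lift x)" by auto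
 obtain b where b: "p = pp x b" using A(2) by (auto simp: perpP_iff)
 define F where "F y = dE (hin b x, b) (hin (cperp (y - x)) x, cperp (y - x))" for y
 have "F : borel_measurable borel"
 proof -
 have *: "(%y :: c2. Re (hin (f y) (f y))) : borel_measurable borel"
 "(%y. hin (g y) (f y)) : borel_measurable borel"
 if "f : borel_measurable borel" "g : borel_measurable borel" for f g :: "c2 => c2"
 proof -
 have c: "(%p :: c2. fst p) : borel_measurable borel" "(%p :: c2. snd p) : borel_measurable borel"
 "(%p :: c2. cnj (fst p)) : borel_measurable borel" "(%p :: c2. cnj (snd p)) : borel_measurable borel"
 by (intro borel_measurable_continuous_onI continuous_intros)+
 have "(%y. hin (g y) (f y)) : borel_measurable borel" if "f : borel_measurable borel" "g : borel_measurable borel"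
 for f g :: "c2 => c2"
 unfolding hin_def by (intro borel_measurable_add borel_measurable_times measurable_compose[OF that(1) c(3)]
 measurable_compose[OF that(1) c(4)] measurable_compose[OF that(2) c(1)] measurable_compose[OF that(2) c(2)])
 from this[OF that] this[OF that(1) that(1)] show "(%y. hin (g y) (f y)) : borel_measurable borel"
 "(%y :: c2. Re (hin (f y) (f y))) : borel_measurable borel" by simp_all
 qed
 have cm: "(%y. cperp (y - x)) : borel_measurable borel"
 unfolding cperp_def by (intro borel_measurable_continuous_onI continuous_intros)
 have h: "(%y. hin (cperp (y - x)) x) : borel_measurable borel" "(%y. hin b (cperp (y - x))) : borel_measurable borel"
 using *(2)[of "%_. x", OF _ cm] *(2)[OF cm, of "%_. b"] by auto
 have n: "(%y. norm (hin (cperp (y - x)) x, cperp (y - x))) : borel_measurable borel"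
 unfolding norm_Pair using h(1) cm by measurable
 have "cnj : borel_measurable borel" by (intro borel_measurable_continuous_onI continuous_intros)
 then have h': "(%y. cnj (hin (cperp (y - x)) x)) : borel_measurable borel" by (rule measurable_compose[OF h(1)])
 have "(%y :: c2. sqrt (A * (m y)\<^sup>2 - (cmod (e * f y + g y))\<^sup>2) / (B * m y)) : borel_measurable borel"
 if [measurable]: "m : borel_measurable borel" "f : borel_measurable borel" "g : borel_measurable borel" for m f g A e B
 by measurable
 from this[OF n h' h(2)] show ?thesis unfolding F_def dE_def wedge_norm2_def enorm_alt hdot_alt fst_conv snd_conv .
 qed
 then have 1: "{y. F y < r} : sets borel" by measurable
 \<comment> \<open>Off x the distance to p has the explicit measurable form F; the single point x is
   added by hand.\<close>
 have "proj x -` A Int S3 = (S3 Int {y. F y < r} - {x}) Un (if dP p (proj x x) < r then {x} else {})"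
 proof (intro equalityI subsetI)
 fix y assume y: "y : proj x -` A Int S3"
 then show "y : (S3 Int {y. F y < r} - {x}) Un (if dP p (proj x x) < r then {x} else {})"
 by (cases "y = x") (auto simp: A proj_eq b pp_def dP_pclass F_def)
 next
 fix y assume y: "y : (S3 Int {y. F y < r} - {x}) Un (if dP p (proj x x) < r then {x} else {})"
 show "y : proj x -` A Int S3"
 proof (cases "y = x")
 case True then show ?thesis using y x proj_perpP[OF x] by (auto simp: A split: if_splits)
 next
 case False then show ?thesis using y proj_perpP[OF x, of y] by (auto simp: A proj_eq b pp_def dP_pclass F_def split: if_splits)
 qed
 qed
 moreover have "... : sets S3b"
 using 1 x by (intro borel_sub_S3b) auto
 ultimately show "proj x -` A Int space S3b : sets S3b" by (simp add: space_S3b)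
qed auto

text \<open>The sigma algebra of the line is generated by balls, so the image is expressed through
  balls about the images of a countable dense subset. For the converse inclusion a limit of centres
  exists by compactness, and \<open>dP_tube\<close> turns the approximation into the equation
  \<open>hin l b = hin x b\<close>, which says that l is projected to q.\<close>

lemma proj_compact_image:
 assumes x: "x : S3" and K: "compact K" "K <= S3" "x \<notin> K" shows "proj x ` K : sets (perp_space x)"
proof (cases "K = {}")
 case False
 obtain e where e: "e > 0" "!!y. y : K ==> e <= norm (y - x)"
 using separate_point_closed[OF compact_imp_closed[OF K(1)] K(3)] by (auto simp: dist_norm norm_minus_commute)
 obtain D where D: "countable D" "D <= K" "K <= closure D" using separable[of K] by blast
 have "proj x ` K = (\<Inter>n::nat. \<Union>y\<in>D. {q : perpP (lift x). dP (proj x y) q < 1 / real (Suc n)})"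
 proof (intro equalityI subsetI)
 fix q assume "q : proj x ` K"
 then obtain y where y: "y : K" "q = proj x y" by blast
 show "q : (\<Inter>n::nat. \<Union>y\<in>D. {q : perpP (lift x). dP (proj x y) q < 1 / real (Suc n)})"
 proof
 fix n :: nat
 have "e / 2 * (1 / real (Suc n)) > 0" using e by simp
 moreover have "y : closure D" using D(3) y(1) by blast
 ultimately have "EX y':D. dist y' y < e / 2 * (1 / real (Suc n))" unfolding closure_approachable by blast
 then obtain y' where y': "y' : D" "norm (y' - y) < e / 2 * (1 / real (Suc n))" by (auto simp: dist_norm)
 have y'K: "y' : K" using y' D by blast
 have "dP (proj x y') q <= 2 / e * norm (y' - y)"
 unfolding y(2) using y y'K K e by (intro proj_lipschitz(1)[OF x]) auto
 also have "... < 2 / e * (e / 2 * (1 / real (Suc n)))" using y' e by (intro mult_strict_left_mono) auto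
 also have "... = 1 / real (Suc n)" using e(1) by (simp del: of_nat_Suc)
 finally show "q : (\<Union>y\<in>D. {q : perpP (lift x). dP (proj x y) q < 1 / real (Suc n)})"
 using y'(1) y(2) proj_perpP[OF x] by blast
 qed
 next
 fix q assume q: "q : (\<Inter>n::nat. \<Union>y\<in>D. {q : perpP (lift x). dP (proj x y) q < 1 / real (Suc n)})"
 then have "q : perpP (lift x)" by blast
 then obtain b where b: "norm b = 1" "q = pp x b" using perpP_unit by blast
 have "EX y. y : K & dP (proj x y) q < 1 / real (Suc n)" for n using q D(2) by blast
 then obtain s where s: "!!n. s n : K" "!!n. dP (proj x (s n)) q < 1 / real (Suc n)" by metis
 obtain l r where l: "l : K" "strict_mono r" "(s \<circ> r) \<longlonglongrightarrow> l"
 using K(1) s(1) unfolding compact_def by metis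
 have "cmod (hin (s n) b - hin x b) <= 4 * (1 / real (Suc n))" for n
 proof -
 have "dP (pp x b) (proj x (s n)) <= 1 / real (Suc n)" using s(2)[of n] dP_sym[of "pp x b"] b(2) by simp
 then have "s n : tube b (hin x b) (4 * (1 / real (Suc n)))" using s(1)[of n] K(2) by (intro dP_tube x b(1)) auto
 then show ?thesis by (simp add: tube_def)
 qed
 then have bd: "cmod (hin ((s \<circ> r) n) b - hin x b) <= 4 * (1 / real (Suc (r n)))" for n by simp
 have "(%n. cmod (hin ((s \<circ> r) n) b - hin x b)) \<longlonglongrightarrow> cmod (hin l b - hin x b)"
 unfolding hin_def by (intro tendsto_intros l(3))
 moreover have "(%n. 4 * (1 / real (Suc (r n)))) \<longlonglongrightarrow> 4 * 0"
 proof (intro tendsto_mult tendsto_const)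
 have "(%n. 1 / real (Suc n)) \<longlonglongrightarrow> 0" using LIMSEQ_inverse_real_of_nat by (simp add: inverse_eq_divide)
 from LIMSEQ_subseq_LIMSEQ[OF this l(2)] show "(%n. 1 / real (Suc (r n))) \<longlonglongrightarrow> 0" by (simp add: o_def)
 qed
 ultimately have "cmod (hin l b - hin x b) <= 4 * 0" using bd by (intro LIMSEQ_le) auto
 then have h0: "hin (l - x) b = 0" by (simp add: hin_diff_left)
 have lx: "l ~= x" using l(1) K(3) by blast
 then obtain c where c: "b = csc c (cperp (l - x))" using h0 hin_zero_iff[of "l - x" b] by auto
 have "c ~= 0" using c b(1) by (auto simp: csc_def norm_prod_def)
 then have "q = proj x l" using b(2) c pp_csc proj_eq[OF lx] by simp
 then show "q : proj x ` K" using l(1) by blast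
 qed
 moreover have "... : sets (perp_space x)"
 using D(1) ball_perp[OF proj_perpP[OF x]] by (intro sets.countable_INT sets.countable_UN'') auto
 ultimately show ?thesis by simp
qed simp

lemma proj_img_decomp:
 "A - {x} = (\<Union>k::nat. {y : A. 1 / real (Suc k) <= norm (y - x)})" for x :: "c2"
proof (intro equalityI subsetI)
 fix y assume y: "y : A - {x}"
 then have "norm (y - x) > 0" by simp
 then obtain k where "inverse (real (Suc k)) < norm (y - x)" using reals_Archimedean by blast
 then have "1 / real (Suc k) <= norm (y - x)" by (simp add: inverse_eq_divide)
 then show "y : (\<Union>k::nat. {y : A. 1 / real (Suc k) <= norm (y - x)})" using y by blast
next
 fix y assume "y : (\<Union>k::nat. {y : A. 1 / real (Suc k) <= norm (y - x)})"
 then obtain k where k: "y : A" "1 / real (Suc k) <= norm (y - x)" by blast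
 have "0 < 1 / real (Suc k)" by simp
 then show "y : A - {x}" using k by auto
qed

lemma proj_img_sets:
 assumes x: "x : S3" and E: "closed E" "E <= S3" shows "proj_img x E : sets (perp_space x)"
proof -
 have "proj x ` {y : E. 1 / real (Suc k) <= norm (y - x)} : sets (perp_space x)" for k
 proof (rule proj_compact_image[OF x])
 have "{y : E. 1 / real (Suc k) <= norm (y - x)} = E Int {y. 1 / real (Suc k) <= norm (y - x)}" by auto
 moreover have "closed ..." by (intro closed_Int E closed_Collect_le continuous_intros)
 ultimately show "compact {y : E. 1 / real (Suc k) <= norm (y - x)}"
 using S3_compact E(2) by (metis (no_types, lifting) closed_Int_compact inf.absorb_iff2 inf.assoc inf.commute inf_le1 subset_trans Int_lower1)
 qed (use E in auto)
 moreover have "proj_img x E = (\<Union>k. proj x ` {y : E. 1 / real (Suc k) <= norm (y - x)})"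
 unfolding proj_img_def proj_img_decomp by (rule image_UN)
 ultimately show ?thesis by auto
qed

lemma haus_proj_img_zero:
 assumes x: "x : S3" and s: "s > 0" and E: "E <= S3" and H: "haus_outer dvis s E = 0"
 shows "haus_outer dP s (proj_img x E) = 0"
proof -
 have "haus_outer dP s (proj x ` {y : E. 1 / real (Suc k) <= norm (y - x)}) = 0" for k
 proof (rule haus_zero_lipschitz[where C="4 / (1 / real (Suc k))", OF s])
 show "haus_outer dvis s {y : E. 1 / real (Suc k) <= norm (y - x)} = 0"
 by (rule haus_zero_mono[OF H _ s]) auto
 fix y y' assume "y : {y : E. 1 / real (Suc k) <= norm (y - x)}" "y' : {y : E. 1 / real (Suc k) <= norm (y - x)}"
 then show "dP (proj x y) (proj x y') <= 4 / (1 / real (Suc k)) * dvis y y'"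
 using E x by (intro proj_lipschitz(2)) auto
 qed (auto simp: dvis_nonneg)
 then show ?thesis unfolding proj_img_def proj_img_decomp image_UN by (rule haus_zero_UN[OF s])
qed

section \<open>Nets and dimension of the projective line\<close>

lemma complex_net: 
 assumes "M > 0" obtains N :: "complex set" where "finite N" "N <= cball 0 1" "card N <= (2 * M + 1)\<^sup>2"
 "!!z. cmod z <= 1 ==> EX z':N. cmod (z - z') <= 2 / real M"
 using finite_net[of "cball (0::complex) 1" 1 M] assms by (auto simp: dist_norm)

text \<open>A net of the projective line, given by the points \<open>(1, \<zeta>)\<close> and \<open>(\<zeta>, 1)\<close> of a grid.\<close>
lemma perp_net:
 assumes x: "x : S3" and M: "M > 0"
 shows "EX N. finite N & card N <= 2 * (2 * M + 1)\<^sup>2 & (ALL b:N. norm b >= 1) &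
 (ALL p:perpP (lift x). EX b:N. EX b'. p = pp x b' & norm b' >= 1 & norm (b - b') <= 2 / real M)"
proof -
 obtain Z where Z: "finite Z" "Z <= cball 0 1" "card Z <= (2 * M + 1)\<^sup>2"
 "!!z. cmod z <= 1 ==> EX z':Z. cmod (z - z') <= 2 / real M" using complex_net[OF M] by blast
 let ?N = "(%z. (1, z)) ` Z Un (%z. (z, 1)) ` Z"
 have "card ?N <= card Z + card Z"
 using card_Un_le card_image_le[OF Z(1)] by (meson add_mono le_trans)
 then have "card ?N <= 2 * (2 * M + 1)\<^sup>2" using Z(3) by linarith
 moreover have "norm b >= 1" if "b : ?N" for b
 using that norm_fst_le[of "1::complex"] norm_snd_le[of "1::complex"] by auto
 moreover have "EX b:?N. EX b'. p = pp x b' & norm b' >= 1 & norm (b - b') <= 2 / real M" if p: "p : perpP (lift x)" for p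
 proof -
 obtain b1 b2 where b: "(b1, b2) ~= 0" "p = pp x (b1, b2)" using p by (auto simp: perpP_iff)
 show ?thesis
 proof (cases "cmod b2 <= cmod b1")
 case True
 then have b1: "b1 ~= 0" using b by (auto simp: zero_prod_def)
 have "cmod (b2 / b1) <= 1" using True b1 by (simp add: norm_divide)
 then obtain z where z: "z : Z" "cmod (b2 / b1 - z) <= 2 / real M" using Z(4) by blast
 have "p = pp x (csc (1 / b1) (b1, b2))" using b b1 by (simp add: pp_csc)
 then have "p = pp x (1, b2 / b1)" using b1 by (simp add: csc_def)
 moreover have "norm ((1, z) - (1, b2 / b1)) <= 2 / real M" using z by (simp add: norm_Pair norm_minus_commute)
 ultimately show ?thesis using z(1) norm_fst_le[of "1::complex"]
 by (intro bexI[of _ "(1, z)"] exI[of _ "(1, b2 / b1)"]) auto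
 next
 case False
 then have b2: "b2 ~= 0" by auto
 have "cmod (b1 / b2) <= 1" using False b2 by (simp add: norm_divide)
 then obtain z where z: "z : Z" "cmod (b1 / b2 - z) <= 2 / real M" using Z(4) by blast
 have "p = pp x (csc (1 / b2) (b1, b2))" using b b2 by (simp add: pp_csc)
 then have "p = pp x (b1 / b2, 1)" using b2 by (simp add: csc_def)
 moreover have "norm ((z, 1) - (b1 / b2, 1)) <= 2 / real M" using z by (simp add: norm_Pair norm_minus_commute)
 ultimately show ?thesis using z(1) norm_snd_le[of "1::complex"]
 by (intro bexI[of _ "(z, 1)"] exI[of _ "(b1 / b2, 1)"]) auto
 qed
 qed
 ultimately show ?thesis using Z(1) by (intro exI[of _ ?N]) auto
qed

text \<open>Of order M^2 sets of diameter of order 1 / M have a sum of order M^(2 - s), which tends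
  to 0 for s > 2.\<close>

lemma hdim_perp_le: assumes x: "x : S3" and A: "A <= perpP (lift x)" shows "hdim dP A <= 2"
proof -
 have H: "haus_outer dP s A = 0" if s: "s > 2" for s
 proof (rule haus_zeroI)
 show "s > 0" using s by simp
 fix E :: real assume e: "E > 0"
 have "(%M. 18 * 8 powr s * (real M powr (2 - s))) \<longlonglongrightarrow> 18 * 8 powr s * 0"
 using s by (intro tendsto_mult tendsto_const tendsto_neg_powr filterlim_real_sequentially) auto
 then have "\<forall>\<^sub>F M in sequentially. 18 * 8 powr s * (real M powr (2 - s)) < E" using e by (intro order_tendstoD) auto
 then have "\<forall>\<^sub>F M in sequentially. 18 * 8 powr s * (real M powr (2 - s)) < E & M > 0"
 using eventually_gt_at_top[of 0] by eventually_elim auto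
 then obtain M :: nat where M: "18 * 8 powr s * (real M powr (2 - s)) < E" "M > 0" by (auto simp: eventually_sequentially)
 obtain N where N: "finite N" "card N <= 2 * (2 * M + 1)\<^sup>2" "ALL b:N. norm b >= 1"
 and N': "ALL p:perpP (lift x). EX b:N. EX b'. p = pp x b' & norm b' >= 1 & norm (b - b') <= 2 / real M"
 using perp_net[OF x M(2)] by (elim exE conjE) (rule that)
 obtain f where f: "bij_betw f {..<card N} N" using ex_bij_betw_nat_finite[OF N(1)] by (auto simp: atLeast0LessThan)
 define U where "U i = (if i < card N then {pp x b' |b'. norm b' >= 1 & norm (f i - b') <= 2 / real M} else {})" for i
 have "A <= (\<Union>i. U i)"
 proof
 fix p assume "p : A"
 then have "p : perpP (lift x)" using A by blast
 from bspec[OF N' this] obtain b b' where b: "b : N" "p = pp x b'" "norm b' >= 1" "norm (b - b') <= 2 / real M"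
 by (elim bexE exE conjE) (rule that)
 have "b : f ` {..<card N}" using f b(1) by (simp add: bij_betw_def)
 then obtain i where "i < card N" "b = f i" by blast
 then have "p : U i" using b unfolding U_def by (simp only: if_True) blast
 then show "p : (\<Union>i. U i)" by blast
 qed
 moreover have dU: "hdiam dP (U i) <= ennreal (8 / real M)" for i
 proof (rule hdiam_le)
 fix p q assume "p : U i" "q : U i"
 then obtain b b' where b: "p = pp x b" "norm b >= 1" "norm (f i - b) <= 2 / real M" "q = pp x b'" "norm b' >= 1" "norm (f i - b') <= 2 / real M"
 by (auto simp: U_def split: if_splits)
 have "norm (b - b') <= norm (f i - b') + norm (f i - b)"
 using norm_triangle_ineq4[of "f i - b'" "f i - b"] by simp
 then have nb: "norm (b - b') <= 4 / real M" using b by simp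
 have "dP p q <= 2 * norm (b - b') / norm b" unfolding b using b by (intro pp_diff_le x) auto
 also have "... <= 2 * norm (b - b') / 1" using b by (intro divide_left_mono) auto
 finally show "dP p q <= 8 / real M" using nb by simp
 qed
 moreover have "hdiam dP (U i) < \<top>" for i by (rule le_less_trans[OF dU]) simp
 moreover have "(\<Sum>i. ennreal (enn2real (hdiam dP (U i)) powr s)) <= ennreal E"
 proof -
 have "(\<Sum>i. ennreal (enn2real (hdiam dP (U i)) powr s)) = (\<Sum>i<card N. ennreal (enn2real (hdiam dP (U i)) powr s))"
 by (rule suminf_finite) (auto simp: U_def hdiam_def)
 also have "... <= (\<Sum>i<card N. ennreal ((8 / real M) powr s))"
 proof (intro sum_mono ennreal_leI powr_mono2)
 show "enn2real (hdiam dP (U i)) <= 8 / real M" for i using dU[of i] by (intro enn2real_leI) auto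
 qed (use s in auto)
 also have "... = ennreal (real (card N) * (8 / real M) powr s)"
 by (simp add: ennreal_of_nat_eq_real_of_nat ennreal_mult')
 also have "... <= ennreal E"
 proof (rule ennreal_leI)
 have "real (card N) <= 2 * (2 * real M + 1)\<^sup>2" using N(2) of_nat_mono[OF N(2), where 'a=real] by (simp add: add.commute)
 also have "... <= 2 * (3 * real M)\<^sup>2" using M(2) by (intro mult_left_mono power_mono) auto
 also have "... = 18 * real M powr 2" using M(2) by (simp add: powr_numeral power_mult_distrib)
 finally have "real (card N) * (8 / real M) powr s <= 18 * real M powr 2 * (8 / real M) powr s" by (intro mult_right_mono) auto
 also have "... = 18 * 8 powr s * (real M powr (2 - s))"
 using M(2) by (simp add: powr_divide powr_diff)
 finally show "real (card N) * (8 / real M) powr s <= E" using M(1) by linarith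
 qed
 finally show ?thesis .
 qed
 ultimately show "EX U :: nat => cvec set set. A <= (\<Union>i. U i) & (ALL i. hdiam dP (U i) < \<top>) &
 (\<Sum>i. ennreal (enn2real (hdiam dP (U i)) powr s)) <= ennreal E" by blast
 qed
 have "hdim dP A <= ereal 2"
 proof (rule ereal_le_epsilon2)
 fix e :: real assume "0 < e"
 then have "hdim dP A <= ereal (2 + e)" by (intro hdim_le H) auto
 then show "hdim dP A <= ereal 2 + ereal e" by simp
 qed
 then show ?thesis by simp
qed

section \<open>Measures with the Frostman property for tubes\<close>

abbreviation tube_bound :: "c2 measure => real => real => real => real => bool" where
 "tube_bound m c t C r0 \<equiv> ALL b a r. (b, a) : pens c --> 0 < r --> r <= r0 --> emeasure m (tube b a r) <= ennreal (C * r powr t)"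

text \<open>C and r0 may depend on c, since the estimates deteriorate towards tangent
  chains.\<close>

definition frostman :: "c2 measure => real => bool" where
 "frostman m t \<longleftrightarrow> (ALL c. 0 < c --> c < 1 --> (EX C>=0. EX r0>0. tube_bound m c t C r0))"

lemma frostmanE:
 assumes "frostman m t" "0 < c" "c < 1"
 obtains C r0 where "C >= 0" "r0 > 0" "tube_bound m c t C r0"
proof -
 have "EX C>=0. EX r0>0. tube_bound m c t C r0"
 using assms unfolding frostman_def by (elim allE[of _ c]) (simp only: simp_thms)
 then show ?thesis by (elim exE conjE) (rule that)
qed

lemma frostman_chain_null:
 assumes sm: "sets m = sets S3b" and t: "t > 0" and F: "frostman m t" and c: "0 < c" "c < 1" and b: "(b, a) : pens c"
 shows "emeasure m {y : S3. hin y b = a} = 0"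
proof -
 obtain C r0 where C: "C >= 0" "r0 > 0" "tube_bound m c t C r0" by (rule frostmanE[OF F c])
 have "emeasure m {y : S3. hin y b = a} <= 0"
 proof (rule ennreal_le_epsilon)
 fix e :: real assume e: "0 < e"
 define r where "r = min r0 ((e / (C + 1)) powr (1 / t))"
 have r: "0 < r" "r <= r0" using C e by (auto simp: r_def)
 have "r powr t <= ((e / (C + 1)) powr (1 / t)) powr t" using t r by (intro powr_mono2) (auto simp: r_def)
 also have "... = e / (C + 1)" using t e C by (simp add: powr_powr)
 finally have "C * r powr t <= C * (e / (C + 1))" using C by (intro mult_left_mono) auto
 also have "... <= e" using e C by (simp add: field_simps)
 finally have ce: "C * r powr t <= e" .
 have "{y : S3. hin y b = a} <= tube b a r" using r by (auto simp: tube_def)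
 then have "emeasure m {y : S3. hin y b = a} <= emeasure m (tube b a r)" using tube_S3b sm by (intro emeasure_mono) auto
 also have "... <= ennreal (C * r powr t)" using C(3) b r by (simp only: simp_thms)
 also have "... <= ennreal e" using ce by (rule ennreal_leI)
 finally show "emeasure m {y : S3. hin y b = a} <= 0 + ennreal e" by simp
 qed
 then show ?thesis by simp
qed

text \<open>A point x lies on the great circle \<open>hin y (cperp x) = 0\<close>, a chain as far as
  possible from tangency, so that chains being null is enough.\<close>

lemma frostman_point:
 assumes sm: "sets m = sets S3b" and t: "t > 0" and F: "frostman m t" and x: "x : S3"
 shows "emeasure m {x} = 0"
proof -
 have nx: "norm x = 1" using x by (simp add: in_S3)
 have "{y : S3. hin y (cperp x) = 0} = S3 Int {y. hin y (cperp x) = 0}" by auto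
 moreover have "closed ..." by (intro closed_Int S3_closed closed_Collect_eq continuous_intros continuous_hin)
 ultimately have "{y : S3. hin y (cperp x) = 0} : sets m" unfolding sm by (intro borel_sub_S3b borel_closed) auto
 then have "emeasure m {x} <= emeasure m {y : S3. hin y (cperp x) = 0}" using x by (intro emeasure_mono) (auto simp: hin_cperp)
 also have "... = 0" by (rule frostman_chain_null[OF sm t F, of "1/2"]) (auto simp: pens_def norm_cperp nx)
 finally show ?thesis by simp
qed

lemma proj_meas_sets: "sets (proj_meas x m) = sets (perp_space x)" by (simp add: proj_meas_def)
lemma proj_meas_space: "space (proj_meas x m) = perpP (lift x)" by (simp add: proj_meas_def space_perp)

lemma emeasure_proj_meas:
 assumes "sets m = sets S3b" "x : S3" "A : sets (perp_space x)"
 shows "emeasure (proj_meas x m) A = emeasure m {y : S3. proj x y : A}"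
proof -
 have "space m = S3" using sets_eq_imp_space_eq[OF assms(1)] by (simp add: space_S3b)
 moreover have "proj x : measurable m (perp_space x)"
 using proj_measurable[OF assms(2)] assms(1) by (simp cong: measurable_cong_sets)
 ultimately show ?thesis unfolding proj_meas_def using assms(3)
 by (simp add: emeasure_distr vimage_def Int_def conj_commute)
qed

text \<open>The point \<open>pp x x\<close> is x itself, where the line touches the sphere. At
  distance more than r from it the vector b satisfies |<x,b>| \<le> 1 - c; there
  \<open>dP_tube\<close> turns the bound for tubes into a growth bound for the projected measure,
  and the mass distribution principle applies. The fibre over \<open>pp x x\<close> consists of x
  alone, a null set.\<close>

lemma frostman_proj_null:
 assumes sm: "sets m = sets S3b" and t: "t > 0" and F: "frostman m t" and x: "x : S3"
 and A: "A : sets (perp_space x)" and H: "haus_outer dP t A = 0"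
 shows "emeasure (proj_meas x m) A = 0"
proof -
 let ?n = "proj_meas x m"
 have nx: "norm x = 1" using x by (simp add: in_S3)
 have x0: "x ~= 0" using nx by auto
 have px: "pp x x : perpP (lift x)" using x0 by (rule pp_perpP)
 define Fk where "Fk r = {q : perpP (lift x). dP (pp x x) q <= r}" for r
 have Fks: "Fk r : sets (perp_space x)" for r unfolding Fk_def by (rule cball_perp[OF px])
 have px0: "emeasure m {x} = 0" by (rule frostman_point[OF sm t F x])
 have 0: "emeasure ?n (Fk 0) = 0"
 proof -
 have "{y : S3. proj x y : Fk 0} <= {x}"
 proof
 fix y assume y: "y : {y : S3. proj x y : Fk 0}"
 then have "y : tube x (hin x x) (4 * 0)" by (intro dP_tube x nx) (auto simp: Fk_def)
 then have "hin y x = 1" by (simp add: tube_def hin_self nx)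
 then have "dvis y x = 0" using y x by (simp add: dvis_eq)
 then have "norm (y - x) <= 0" using norm_diff_le_dvis[of y x] y x by simp
 then show "y : {x}" by simp
 qed
 then have "emeasure m {y : S3. proj x y : Fk 0} <= emeasure m {x}"
 using x by (intro emeasure_mono) (auto simp: sm intro!: borel_sub_S3b)
 then show ?thesis using px0 by (simp add: emeasure_proj_meas[OF sm x Fks])
 qed
 have k: "emeasure ?n (A - Fk (1 / real (Suc k))) = 0" for k
 proof -
 define r where "r = 1 / real (Suc k)"
 have r: "0 < r" "r <= 1" by (auto simp: r_def)
 \<comment> \<open>From r / 2 < |x - <x,b> b| follows r^2 / 4 < 1 - |<x,b>|^2 \<le> 2 (1 -
   |<x,b>|).\<close>
 define c where "c = r\<^sup>2 / 8"
 have c: "0 < c" "c < 1" using r power_le_one[of r 2] by (auto simp: c_def)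
 have deg: "cmod (hin x b) <= 1 - c" if b: "norm b = 1" and q: "pp x b \<notin> Fk r" for b
 proof (cases "hin x b = 0")
 case True then show ?thesis using c by simp
 next
 case False
 have pb: "pp x b : perpP (lift x)" using b by (intro pp_perpP) auto
 have "norm (csc (hin x b) b) = cmod (hin x b)" using b by (simp add: norm_csc)
 then have ne: "csc (hin x b) b ~= 0" using False by (metis norm_eq_zero)
 have "r < dP (pp x x) (pp x (csc (hin x b) b))" using q pb False by (simp add: Fk_def pp_csc)
 also have "... <= 2 * norm (x - csc (hin x b) b) / norm x" by (rule pp_diff_le[OF x x0 ne])
 finally have "(r / 2)\<^sup>2 < (norm (x - csc (hin x b) b))\<^sup>2" using r nx by (intro power_strict_mono) auto
 also have "complex_of_real ((norm (x - csc (hin x b) b))\<^sup>2) = complex_of_real (1 - (cmod (hin x b))\<^sup>2)"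
 proof -
 have hb: "hin b b = 1" "hin x x = 1" "hin b x = cnj (hin x b)" using b nx hin_cnj[of b x] by (auto simp: hin_self)
 show ?thesis unfolding hin_self[symmetric]
 using complex_norm_square[of "hin x b"] by (simp add: hin_diff_left hin_diff_right hin_csc_left hin_csc_right hb)
 qed
 then have "(norm (x - csc (hin x b) b))\<^sup>2 = 1 - (cmod (hin x b))\<^sup>2" by (simp only: of_real_eq_iff)
 also have "... = (1 - cmod (hin x b)) * (1 + cmod (hin x b))" by (simp add: power2_eq_square algebra_simps)
 also have "... <= (1 - cmod (hin x b)) * 2"
 using cmod_hin_le[of x b] nx b by (intro mult_left_mono) auto
 finally show ?thesis by (simp add: c_def power_divide)
 qed
 obtain C R0 where C: "C >= 0" "R0 > 0" "tube_bound m c t C R0"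
 by (rule frostmanE[OF F c])
 show ?thesis unfolding r_def[symmetric]
 proof (rule mass_distribution[OF t])
 show "A - Fk r : sets ?n" using A Fks by (auto simp: proj_meas_sets)
 show "haus_outer dP t (A - Fk r) = 0" by (rule haus_zero_mono[OF H _ t]) auto
 show "0 <= C * 4 powr t" using C by simp
 show "R0 / 4 > 0" using C by simp
 fix p d assume p: "p : A - Fk r"
 have pP: "p : perpP (lift x)" using p sets.sets_into_space[OF A] by (auto simp: space_perp)
 then obtain b where b: "norm b = 1" "p = pp x b" using perpP_unit by blast
 show "{q : space ?n. dP p q <= d} : sets ?n"
 unfolding proj_meas_space proj_meas_sets by (rule cball_perp[OF pP])
 assume d: "0 < d" "d <= R0 / 4"
 have "(b, hin x b) : pens c" using deg[OF b(1)] p b by (auto simp: pens_def)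
 then have "emeasure m (tube b (hin x b) (4 * d)) <= ennreal (C * (4 * d) powr t)" using d by (intro C(3)[rule_format]) auto
 moreover have "emeasure ?n {q : space ?n. dP p q <= d} <= emeasure m (tube b (hin x b) (4 * d))"
 unfolding proj_meas_space emeasure_proj_meas[OF sm x cball_perp[OF pP]]
 proof (rule emeasure_mono)
 show "{y : S3. proj x y : {q : perpP (lift x). dP p q <= d}} <= tube b (hin x b) (4 * d)"
 using d b by (auto intro!: dP_tube[OF x])
 show "tube b (hin x b) (4 * d) : sets m" using tube_S3b by (simp add: sm)
 qed
 moreover have "C * (4 * d) powr t = C * 4 powr t * d powr t" using d by (simp add: powr_mult)
 ultimately show "emeasure ?n {q : space ?n. dP p q <= d} <= ennreal (C * 4 powr t * d powr t)" by simp
 qed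
 qed
 have "A <= Fk 0 Un (\<Union>k. A - Fk (1 / real (Suc k)))"
 proof
 fix q assume q: "q : A"
 then have qP: "q : perpP (lift x)" using sets.sets_into_space[OF A] by (auto simp: space_perp)
 show "q : Fk 0 Un (\<Union>k. A - Fk (1 / real (Suc k)))"
 proof (cases "dP (pp x x) q <= 0")
 case True then show ?thesis using qP by (simp add: Fk_def)
 next
 case False
 then have "0 < dP (pp x x) q" by simp
 then obtain k where "inverse (real (Suc k)) < dP (pp x x) q" using reals_Archimedean by blast
 then have "q \<notin> Fk (1 / real (Suc k))" by (simp add: Fk_def inverse_eq_divide)
 then show ?thesis using q by blast
 qed
 qed
 moreover have "Fk 0 : null_sets ?n" using 0 Fks by (intro null_setsI) (simp_all add: proj_meas_sets)
 moreover have "(\<Union>k. A - Fk (1 / real (Suc k))) : null_sets ?n"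
 proof (rule null_sets_UN)
 fix k
 have "A - Fk (1 / real (Suc k)) : sets ?n" using A Fks by (simp only: proj_meas_sets) (rule sets.Diff)
 then show "A - Fk (1 / real (Suc k)) : null_sets ?n" using k by (intro null_setsI)
 qed
 ultimately have "Fk 0 Un (\<Union>k. A - Fk (1 / real (Suc k))) : null_sets ?n" "A <= Fk 0 Un (\<Union>k. A - Fk (1 / real (Suc k)))"
 by (auto intro: null_sets.Un)
 then have "A : null_sets ?n" using A by (intro null_sets_subset[of _ ?n A]) (simp_all only: proj_meas_sets)
 then show ?thesis by (rule null_setsD1)
qed

lemma hin_parseval: assumes "norm z = 1" shows "(cmod (hin y z))\<^sup>2 + (cmod (hin y (cperp z)))\<^sup>2 = (norm y)\<^sup>2"
proof -
 obtain y1 y2 z1 z2 where yz: "y = (y1, y2)" "z = (z1, z2)" by (cases y; cases z)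
 have z: "(cmod z1)\<^sup>2 + (cmod z2)\<^sup>2 = 1" using assms norm_prod_sq[of z] by (simp add: yz)
 have "(cmod (hin y z))\<^sup>2 + (cmod (hin y (cperp z)))\<^sup>2 = ((cmod y1)\<^sup>2 + (cmod y2)\<^sup>2) * ((cmod z1)\<^sup>2 + (cmod z2)\<^sup>2)"
 unfolding cmod_power2 by (simp add: yz hin_def cperp_def power2_eq_square algebra_simps)
 then show ?thesis using z norm_prod_sq[of y] by (simp add: yz)
qed

lemma circle_net:
 assumes s: "s > 0" and N: "N > (0::nat)" and v: "cmod (1 - v) = s"
 shows "EX k<N. cmod (v - (1 + complex_of_real s * cis (2 * pi * real k / real N))) <= 2 * pi * s / real N"
proof -
 have "v - 1 ~= 0" using v s by (auto simp: norm_minus_commute)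
 have cv: "cmod (v - 1) = s" using v by (simp add: norm_minus_commute)
 obtain t where t: "0 <= t" "t < 2 * pi" "v - 1 = complex_of_real s * cis t"
 using cv Arg2pi[of "v - 1"] that[of "Arg2pi (v - 1)"] by (simp add: is_Arg_def cis_conv_exp)
 define k where "k = nat \<lfloor>t * real N / (2 * pi)\<rfloor>"
 have k: "real k <= t * real N / (2 * pi)" "t * real N / (2 * pi) < real k + 1"
 using t(1) by (auto simp: k_def)
 have "t * real N / (2 * pi) < real N" using t N by (simp add: field_simps)
 then have kN: "k < N" using k(1) by linarith
 have e: "t - 2 * pi * real k / real N = (t * real N / (2 * pi) - real k) * (2 * pi / real N)"
 using N by (simp add: field_simps)
 have "\<bar>t * real N / (2 * pi) - real k\<bar> * (2 * pi / real N) <= 1 * (2 * pi / real N)"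
 using k by (intro mult_right_mono) auto
 then have d: "\<bar>t - 2 * pi * real k / real N\<bar> <= 2 * pi / real N" unfolding e abs_mult by simp
 have "v - (1 + complex_of_real s * cis (2 * pi * real k / real N)) = complex_of_real s * (cis t - cis (2 * pi * real k / real N))"
 using t(3) by (simp add: algebra_simps)
 then have "cmod (v - (1 + complex_of_real s * cis (2 * pi * real k / real N))) = s * cmod (cis t - cis (2 * pi * real k / real N))"
 using s by (simp add: norm_mult)
 also have "cmod (cis t - cis (2 * pi * real k / real N)) <= \<bar>t - 2 * pi * real k / real N\<bar>"
 unfolding cmod_cis_diff using abs_sin_x_le_abs_x[of "(t - 2 * pi * real k / real N) / 2"] by simp
 finally show ?thesis using d s kN by (intro exI[of _ k]) (auto intro: order_trans mult_left_mono simp: field_simps)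
qed

text \<open>A sphere of the visual metric is a union of a circle of chains; it needs only \<open>1/\<rho>\<close> tubes.\<close>
lemma frostman_sphere_null:
 assumes sm: "sets m = sets S3b" and F: "frostman m 2" and z: "z : S3" and r: "r > 0"
 shows "emeasure m {y : S3. dvis z y = r} = 0"
proof -
 have nz: "norm z = 1" using z by (simp add: in_S3)
 define s where "s = 2 * r\<^sup>2"
 have s: "s > 0" using r by (simp add: s_def)
 have ds: "cmod (1 - hin y z) = s" if "y : S3" "dvis z y = r" for y
 using that dvis_sq[of y z] z dvis_sym[of y z] by (simp add: s_def)
 \<comment> \<open>The margin is twice the c used below: the centres of the covering tubes differ
   from the coordinates \<open>hin y z\<close> by up to c and must stay in
   \<open>pens c\<close>.\<close>
 define Sk where "Sk k = {y : S3. cmod (1 - hin y z) = s & cmod (hin y z) <= 1 - 2 / real (k + 3)}" for k :: nat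
 have cl: "closed (Sk k)" for k
 proof -
 have "Sk k = S3 Int {y. cmod (1 - hin y z) = s} Int {y. cmod (hin y z) <= 1 - 2 / real (k + 3)}" by (auto simp: Sk_def)
 then show ?thesis by (auto intro!: closed_Int S3_closed closed_Collect_eq closed_Collect_le continuous_intros continuous_hin)
 qed
 have Sks: "Sk k : sets m" for k unfolding sm using cl by (intro borel_sub_S3b borel_closed) (auto simp: Sk_def)
 have null: "emeasure m (Sk k) = 0" for k
 proof -
 define c where "c = 1 / real (k + 3)"
 have c: "0 < c" "c < 1" by (auto simp: c_def)
 obtain C R0 where C: "C >= 0" "R0 > 0" "tube_bound m c 2 C R0" by (rule frostmanE[OF F c])
 have le: "emeasure m (Sk k) <= ennreal (C * (2 * pi * s)\<^sup>2 / real N)" if N: "real N >= 2 * pi * s / min R0 c" "N > 0" for N :: nat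
 proof -
 define R where "R = 2 * pi * s / real N"
 have R: "R > 0" "R <= R0" "R <= c"
 proof -
 show "R > 0" using s N by (simp add: R_def)
 have "2 * pi * s <= real N * min R0 c" using N(1) C(2) c by (simp add: pos_divide_le_eq)
 then have "R <= min R0 c" unfolding R_def using N(2) by (subst pos_divide_le_eq) (auto simp only: mult.commute of_nat_0_less_iff)
 then show "R <= R0" "R <= c" by auto
 qed
 define vk where "vk j = 1 + complex_of_real s * cis (2 * pi * real j / real N)" for j
 define J where "J = {j. j < N & cmod (vk j) <= 1 - c}"
 have J: "finite J" "card J <= N" unfolding J_def by (auto intro: order_trans[OF card_mono[of "{..<N}"]])
 have "Sk k <= (\<Union>j\<in>J. tube z (vk j) R)"
 proof
 fix y assume y: "y : Sk k"
 obtain j where j: "j < N" "cmod (hin y z - vk j) <= R"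
 using circle_net[OF s N(2), of "hin y z"] y by (auto simp: Sk_def vk_def R_def)
 have "cmod (vk j) <= cmod (hin y z) + cmod (hin y z - vk j)" using norm_triangle_ineq4[of "hin y z" "hin y z - vk j"] by simp
 also have "... <= (1 - 2 * c) + c" using y j R by (auto simp: Sk_def c_def)
 finally have "j : J" using j by (simp add: J_def)
 then show "y : (\<Union>j\<in>J. tube z (vk j) R)" using y j by (auto simp: tube_def Sk_def)
 qed
 then have "emeasure m (Sk k) <= emeasure m (\<Union>j\<in>J. tube z (vk j) R)"
 using J(1) by (intro emeasure_mono sets.finite_UN) (simp_all add: sm tube_S3b)
 also have "... <= (\<Sum>j\<in>J. emeasure m (tube z (vk j) R))"
 using J(1) by (intro emeasure_subadditive_finite) (simp_all add: sm tube_S3b image_subset_iff)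
 also have "... <= (\<Sum>j\<in>J. ennreal (C * R powr 2))"
 proof (rule sum_mono)
 fix j assume "j : J"
 then have "(z, vk j) : pens c" using nz by (simp add: J_def pens_def)
 then show "emeasure m (tube z (vk j) R) <= ennreal (C * R powr 2)" using C(3) R by (simp only: simp_thms)
 qed
 also have "... = ennreal (real (card J) * (C * R powr 2))" using C by (simp add: ennreal_of_nat_eq_real_of_nat ennreal_mult')
 also have "... <= ennreal (real N * (C * R powr 2))" using J C by (intro ennreal_leI mult_right_mono) auto
 also have "real N * (C * R powr 2) = C * (2 * pi * s)\<^sup>2 / real N"
 using R N by (simp add: powr_numeral) (simp add: R_def power2_eq_square)
 finally show ?thesis .
 qed
 have "emeasure m (Sk k) <= 0"
 proof (rule ennreal_le_epsilon)
 fix e :: real assume e: "0 < e"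
 obtain N :: nat where N: "real N >= max (2 * pi * s / min R0 c) (C * (2 * pi * s)\<^sup>2 / e) + 1" using real_arch_simple by blast
 have N1: "real N >= 2 * pi * s / min R0 c" "real N >= C * (2 * pi * s)\<^sup>2 / e" using N by auto
 have "0 <= 2 * pi * s / min R0 c" using s C c by auto
 then have N0: "N > 0" using N by (cases N) auto
 have "C * (2 * pi * s)\<^sup>2 / real N <= e" using N1(2) N0 e by (simp add: field_simps)
 then show "emeasure m (Sk k) <= 0 + ennreal e" using le[OF N1(1) N0] by (simp add: order_trans[OF _ ennreal_leI])
 qed
 then show ?thesis by simp
 qed
 \<comment> \<open>What the sets \<open>Sk k\<close> miss are the points with |<y,z>| = 1; they lie
   on a single chain, the great circle through z.\<close>
 have ch: "emeasure m {y : S3. hin y (cperp z) = 0} = 0"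
 by (rule frostman_chain_null[OF sm _ F, of "1/2"]) (auto simp: pens_def norm_cperp nz)
 have chs: "{y : S3. hin y (cperp z) = 0} : sets m"
 proof -
 have "{y : S3. hin y (cperp z) = 0} = S3 Int {y. hin y (cperp z) = 0}" by auto
 moreover have "closed ..." by (intro closed_Int S3_closed closed_Collect_eq continuous_intros continuous_hin)
 ultimately show ?thesis unfolding sm by (intro borel_sub_S3b borel_closed) auto
 qed
 have "{y : S3. dvis z y = r} <= {y : S3. hin y (cperp z) = 0} Un (\<Union>k. Sk k)"
 proof
 fix y assume y: "y : {y : S3. dvis z y = r}"
 then have yS: "y : S3" and e: "cmod (1 - hin y z) = s" using ds by auto
 have p: "(cmod (hin y z))\<^sup>2 + (cmod (hin y (cperp z)))\<^sup>2 = 1" using hin_parseval[OF nz, of y] yS by (simp add: in_S3)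
 show "y : {y : S3. hin y (cperp z) = 0} Un (\<Union>k. Sk k)"
 proof (cases "hin y (cperp z) = 0")
 case True then show ?thesis using yS by simp
 next
 case False
 then have "0 < (cmod (hin y (cperp z)))\<^sup>2" by simp
 then have "(cmod (hin y z))\<^sup>2 < 1\<^sup>2" using p unfolding one_power2 by linarith
 then have lt: "cmod (hin y z) < 1" by (rule power2_less_imp_less) simp
 then have "0 < (1 - cmod (hin y z)) / 2" by simp
 then obtain k where "inverse (real (Suc k)) < (1 - cmod (hin y z)) / 2" using reals_Archimedean by blast
 moreover have "1 / real (k + 3) <= inverse (real (Suc k))" by (simp add: inverse_eq_divide frac_le)
 ultimately have "y : Sk k" using yS e by (simp add: Sk_def)
 then show ?thesis by blast
 qed
 qed
 moreover have "{y : S3. hin y (cperp z) = 0} Un (\<Union>k. Sk k) : null_sets m"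
 using ch chs null Sks by (intro null_sets.Un null_sets_UN) (auto intro: null_setsI)
 ultimately have "emeasure m {y : S3. dvis z y = r} <= emeasure m ({y : S3. hin y (cperp z) = 0} Un (\<Union>k. Sk k))"
 "emeasure m ({y : S3. hin y (cperp z) = 0} Un (\<Union>k. Sk k)) = 0"
 by (auto intro: emeasure_mono)
 then show ?thesis by simp
qed

section \<open>Weak limits and the Frostman property\<close>

context cutout_process
begin

abbreviation "ca n w y \<equiv> ennreal (cc (hp n) 1 * av (hp n) 1 w y)"
abbreviation "chain_lim f n0 w \<equiv> EX X. uniform_limit (chains (4 * hp n0)) (%n q. XR (cm f q) (hp n) (hp n0) w) X sequentially &
 continuous_on (chains (4 * hp n0)) X"

text \<open>This is all that is retained of a weak limit: an upper bound for the integral of a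
  nonnegative continuous function that holds in infinitely many generations passes to m. Quantifying
  over all such m inside the almost sure statements lets m depend on the sample point. The factor
  \<open>kap\<close> relates \<open>Hmeas\<close> to \<open>surf\<close>.\<close>

definition dominated :: "'w => c2 measure => bool" where
 "dominated w m \<longleftrightarrow> sets m = sets S3b & finite_measure m &
 (ALL f M. continuous_on UNIV f --> (ALL y. 0 <= f y) --> 0 <= M -->
 (\<exists>\<^sub>F n in sequentially. (NN surf (%y. ennreal (f y) * ca n w y)) <= ennreal M) -->
 (NN m (%y. ennreal (f y))) <= ennreal (kap * M))"

lemma dominatedD:
 assumes "dominated w m"
 shows "sets m = sets S3b" "finite_measure m" "space m = S3"
 using assms sets_eq_imp_space_eq[of m S3b] by (auto simp: dominated_def space_S3b)

lemma dominated_le: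
 assumes "dominated w m" "continuous_on UNIV f" "!!y. 0 <= f y" "0 <= M"
 "\<exists>\<^sub>F n in sequentially. (NN surf (%y. ennreal (f y) * ca n w y)) <= ennreal M"
 shows "(NN m (%y. ennreal (f y))) <= ennreal (kap * M)"
 using assms unfolding dominated_def by (elim conjE allE[of _ f] allE[of _ M]) (simp only: simp_thms)

text \<open>The test function is positive exactly where dvis is below r, and once
  \<open>hp n \<le> r\<close> the ball takes part in generation n, whose density vanishes
  there.\<close>

lemma dominated_vball_null:
 assumes d: "dominated u m" and w: "u : space P" and p: "(z, r) : \<Phi> u" shows "emeasure m (vball z r) = 0"
proof -
 have zr: "z : S3" "0 < r" "r < 1" using pts[OF w] p by auto
 define f where "f y = max 0 (r - dvis z y)" for y
 have fc: "continuous_on UNIV f" unfolding f_def by (intro continuous_intros continuous_dvis)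
 obtain n0 where n0: "hp n0 < r" using real_arch_pow_inv[of r "1/2"] zr by auto
 have "(NN surf (%y. ennreal (f y) * ca n u y)) <= ennreal 0" if n: "n >= n0" for n
 proof -
 have "hp n <= hp n0" using n by (intro power_decreasing) auto
 then have hn: "hp n <= r" using n0 by linarith
 have "(NN surf (%y. ennreal (f y) * ca n u y)) = (NN surf (%y. 0))"
 proof (rule nn_integral_cong)
 fix y :: "c2"
 show "ennreal (f y) * ca n u y = 0"
 proof (cases "dvis z y < r")
 case True
 then have "(z, r) : conR (hp n) 1 y" using zr hn by (simp add: conR_def)
 then have "av (hp n) 1 u y = 0" using p by (auto simp: av_def)
 then show ?thesis by simp
 qed (simp add: f_def)
 qed
 then show ?thesis by simp
 qed
 then have "\<forall>\<^sub>F n in sequentially. (NN surf (%y. ennreal (f y) * ca n u y)) <= ennreal 0"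
 unfolding eventually_sequentially by blast
 then have "(NN m (%y. ennreal (f y))) <= ennreal (kap * 0)"
 using fc by (intro dominated_le[OF d]) (auto simp: f_def intro: eventually_frequently)
 then have "(NN m (%y. ennreal (f y))) = 0" by simp
 moreover have "(%y. ennreal (f y)) : borel_measurable m"
 using borel_measurable_continuous_onI[OF fc] dominatedD(1)[OF d]
 by (simp cong: measurable_cong_sets add: measurable_restrict_space1)
 ultimately have "AE y in m. ennreal (f y) = 0" by (simp add: nn_integral_0_iff_AE)
 then have "AE y in m. \<not> dvis z y < r" by eventually_elim (auto simp: f_def)
 moreover have "vball z r = {y : space m. \<not> \<not> dvis z y < r}" using dominatedD(3)[OF d] by (auto simp: vball_def)
 moreover have "vball z r : sets m" using vball_S3b dominatedD(1)[OF d] by simp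
 ultimately show ?thesis by (subst (asm) AE_iff_measurable[of "vball z r"]) auto
qed

lemma pts_countable: assumes "w : space P" shows "countable (\<Phi> w)"
proof -
 have "\<Phi> w <= (\<Union>n. {p : \<Phi> w. hp n <= snd p})"
 proof
 fix p assume p: "p : \<Phi> w"
 then have "0 < snd p" using pts[OF assms] by auto
 then obtain n where "hp n < snd p" using real_arch_pow_inv[of "snd p" "1/2"] by auto
 then show "p : (\<Union>n. {p : \<Phi> w. hp n <= snd p})" using p by (auto intro!: exI[of _ n])
 qed
 moreover have "countable (\<Union>n. {p : \<Phi> w. hp n <= snd p})" using pts_finite[OF assms hp_pos] by (auto intro: countable_finite)
 ultimately show ?thesis using countable_subset by blast
qed

lemma cutout_closed: "closed (cutout (\<Phi> w))"
proof -
 have "S3 - vball z r = S3 Int {y. r <= dvis z y}" for z r by (auto simp: vball_def)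
 moreover have "closed (S3 Int {y. r <= dvis z y})" for z r
 by (intro closed_Int S3_closed closed_Collect_le continuous_intros continuous_dvis)
 ultimately have "closed (S3 - vball (fst p) (snd p))" for p by simp
 then have "closed (S3 Int (\<Inter>p\<in>\<Phi> w. S3 - vball (fst p) (snd p)))" by (intro closed_Int S3_closed closed_INT) auto
 moreover have "cutout (\<Phi> w) = S3 Int (\<Inter>p\<in>\<Phi> w. S3 - vball (fst p) (snd p))" by (auto simp: cutout_def)
 ultimately show ?thesis by simp
qed

lemma cutout_S3b: "cutout (\<Phi> w) : sets S3b"
 using cutout_closed by (intro borel_sub_S3b borel_closed) (auto simp: cutout_def)

lemma dominated_support:
 assumes d: "dominated u m" and w: "u : space P" shows "emeasure m (S3 - cutout (\<Phi> u)) = 0"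
proof -
 have "S3 - cutout (\<Phi> u) = (\<Union>p\<in>\<Phi> u. vball (fst p) (snd p))" by (auto simp: cutout_def vball_def)
 moreover have "... : null_sets m"
 proof (rule null_sets_UN'[OF pts_countable[OF w]])
 fix p assume "p : \<Phi> u"
 then show "vball (fst p) (snd p) : null_sets m"
 using dominated_vball_null[OF d w, of "fst p" "snd p"] vball_S3b dominatedD(1)[OF d] by (intro null_setsI) auto
 qed
 ultimately show ?thesis using null_setsD1 by simp
qed

text \<open>A continuous cutoff between the tubes of width r and 2 r replaces the indicator, which
  is not an admissible test function.\<close>

lemma dominated_tube:
 assumes d: "dominated w m" and r: "r > 0" and M: "M >= 0"
 and fr: "\<exists>\<^sub>F n in sequentially. (NN surf (%y. ca n w y * indicator (tube b a (2 * r)) y)) <= ennreal M"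
 shows "emeasure m (tube b a r) <= ennreal (kap * M)"
proof -
 define f where "f y = min 1 (max 0 (2 - cmod (hin y b - a) / r))" for y
 have f: "continuous_on UNIV f" "!!y. 0 <= f y" unfolding f_def using r by (auto intro!: continuous_intros continuous_hin)
 have le: "(NN surf (%y. ennreal (f y) * ca n w y))
 <= (NN surf (%y. ca n w y * indicator (tube b a (2 * r)) y))" for n
 proof (rule nn_integral_mono)
 fix y assume "y : space surf"
 then have y: "y : S3" by simp
 have "ennreal (f y) <= indicator (tube b a (2 * r)) y"
 proof (cases "cmod (hin y b - a) <= 2 * r")
 case True
 have "ennreal (f y) <= ennreal 1" by (intro ennreal_leI) (simp add: f_def)
 then show ?thesis using True y by (simp add: tube_def)
 next
 case False
 then have "2 - cmod (hin y b - a) / r <= 0" using r by (simp add: field_simps)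
 then show ?thesis by (simp add: f_def)
 qed
 then have "ennreal (f y) * ca n w y <= indicator (tube b a (2 * r)) y * ca n w y"
 by (rule mult_right_mono) simp
 then show "ennreal (f y) * ca n w y <= ca n w y * indicator (tube b a (2 * r)) y"
 by (simp add: mult.commute)
 qed
 have "\<exists>\<^sub>F n in sequentially. (NN surf (%y. ennreal (f y) * ca n w y)) <= ennreal M"
 using fr by (rule frequently_elim1) (rule order_trans[OF le])
 then have I: "(NN m (%y. ennreal (f y))) <= ennreal (kap * M)" using f M by (intro dominated_le[OF d]) auto
 have "emeasure m (tube b a r) = (NN m (%y. indicator (tube b a r) y))" using tube_S3b dominatedD(1)[OF d] by simp
 also have "... <= (NN m (%y. ennreal (f y)))"
 proof (rule nn_integral_mono)
 fix y show "indicator (tube b a r) y <= ennreal (f y)"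
 proof (cases "y : tube b a r")
 case True
 then have "cmod (hin y b - a) / r <= 1" using r by (simp add: tube_def)
 then have "f y = 1" by (simp add: f_def)
 then show ?thesis using True by simp
 qed simp
 qed
 finally show ?thesis using I by simp
qed

lemma hp_bracket: assumes "0 < r" "r <= 1" shows "EX j. hp (Suc j) < r & r <= hp j"
proof -
 define n where "n = (LEAST n. hp n < r)"
 have ex: "EX n. hp n < r" using real_arch_pow_inv[of r "1/2"] assms by auto
 have n: "hp n < r" unfolding n_def by (rule LeastI_ex[OF ex])
 then have "n ~= 0" using assms by (cases n) auto
 then obtain j where j: "n = Suc j" by (cases n) auto
 have "\<not> hp j < r" using not_less_Least[of j "%n. hp n < r"] j by (simp add: n_def)
 then show ?thesis using n j by (intro exI[of _ j]) auto
qed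

lemma frostman_below_2:
 assumes t: "0 < t" "t < 2" "t < 4 - g"
 shows "AE u in P. ALL m. dominated u m --> frostman m t"
proof -
 have "AE u in P. ALL k::nat. \<forall>\<^sub>F i in sequentially. \<forall>(b, a)\<in>pens (1 / real (k + 2)).
 liminf (%n. XX (tm b a (hp i)) (hp n) 1 u) <= ennreal (hp i powr t)"
 unfolding AE_all_countable by (intro allI tube_frostman t) auto
 with AE_space show ?thesis
 proof eventually_elim
 fix u assume w: "u : space P" and H: "ALL k::nat. \<forall>\<^sub>F i in sequentially. \<forall>(b, a)\<in>pens (1 / real (k + 2)).
 liminf (%n. XX (tm b a (hp i)) (hp n) 1 u) <= ennreal (hp i powr t)"
 show "ALL m. dominated u m --> frostman m t"
 unfolding frostman_def
 proof (intro allI impI)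
 fix m and c :: real assume d: "dominated u m" and c: "0 < c" "c < 1"
 obtain k where k: "inverse (real (Suc k)) < c" using reals_Archimedean c by blast
 have "1 / real (k + 2) <= inverse (real (Suc k))" by (simp add: inverse_eq_divide frac_le)
 then have kc: "1 / real (k + 2) <= c" using k by linarith
 obtain I where I: "!!i. i >= I ==> \<forall>(b, a)\<in>pens (1 / real (k + 2)).
 liminf (%n. XX (tm b a (hp i)) (hp n) 1 u) <= ennreal (hp i powr t)"
 using H unfolding eventually_sequentially by blast
 show "EX C>=0. EX r0>0. tube_bound m c t C r0"
 proof (rule exI[of _ "kap * 2 * 4 powr t"], intro conjI exI[of _ "hp (I + 1)"] allI impI)
 fix b a r assume b: "(b, a) : pens c" and r: "0 < r" "r <= hp (I + 1)"
 have "r <= 1" using r(2) hp_le_1[of "I + 1"] by linarith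
 then obtain j where j: "hp (Suc j) < r" "r <= hp j" using hp_bracket[OF r(1)] by blast
 have "hp (Suc j) < hp (I + 1)" using j(1) r(2) by linarith
 then have "I + 1 < Suc j" using power_strict_decreasing_iff[of "1/2::real" "Suc j" "I + 1"] by simp
 \<comment> \<open>One scale is lost by rounding r up to \<open>hp j\<close>, a second one because
   \<open>dominated_tube\<close> needs twice the width; altogether
   \<open>hp i <= 4 * r\<close>.\<close>
 then obtain i where i: "j = Suc i" "i >= I" by (cases j) auto
 have bk: "(b, a) : pens (1 / real (k + 2))" using b kc by (auto simp: pens_def)
 have pp: "0 < hp i powr t" by simp
 have "liminf (%n. XX (tm b a (hp i)) (hp n) 1 u) <= ennreal (hp i powr t)"
 using bspec[OF I[OF i(2)] bk] by simp
 also have "... < ennreal (2 * hp i powr t)" using pp by (intro ennreal_lessI) linarith+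
 finally have li: "liminf (%n. XX (tm b a (hp i)) (hp n) 1 u) < ennreal (2 * hp i powr t)" .
 have fr: "\<exists>\<^sub>F n in sequentially. XX (tm b a (hp i)) (hp n) 1 u <= ennreal (2 * hp i powr t)"
 proof (rule ccontr)
 assume "\<not> ?thesis"
 then have "\<forall>\<^sub>F n in sequentially. ennreal (2 * hp i powr t) <= XX (tm b a (hp i)) (hp n) 1 u"
 unfolding not_frequently by (rule eventually_mono) (simp add: not_le less_imp_le)
 then have "ennreal (2 * hp i powr t) <= liminf (%n. XX (tm b a (hp i)) (hp n) 1 u)" by (rule Liminf_bounded)
 then show False using li by simp
 qed
 have e2: "hp i = 2 * hp j" using i by simp
 have X: "XX (tm b a (hp i)) (hp n) 1 u = (NN surf (%y. ca n u y * indicator (tube b a (2 * hp j)) y))" for n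
 proof -
 have "(%y. av (hp n) 1 u y) : borel_measurable S3b"
 using measurable_Pair2[OF av_measurable[OF hp_pos] w, of 1 n] by simp
 then have "(%y. ca n u y) : borel_measurable S3b" by measurable
 then show ?thesis unfolding XX_def e2 by (rule nn_integral_tm)
 qed
 have "emeasure m (tube b a r) <= emeasure m (tube b a (hp j))"
 using j(2) tube_S3b dominatedD(1)[OF d] by (intro emeasure_mono) (auto simp: tube_def)
 also have "... <= ennreal (kap * (2 * hp i powr t))"
 using fr unfolding X by (intro dominated_tube[OF d]) auto
 also have "... <= ennreal (kap * 2 * 4 powr t * r powr t)"
 proof (rule ennreal_leI)
 have "hp i = 4 * hp (Suc j)" using i by simp
 also have "... <= 4 * r" using j(1) by linarith
 finally have "hp i powr t <= (4 * r) powr t" using t by (intro powr_mono2) auto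
 also have "... = 4 powr t * r powr t" using r by (simp add: powr_mult)
 finally show "kap * (2 * hp i powr t) <= kap * 2 * 4 powr t * r powr t" using kap_pos by simp
 qed
 finally show "emeasure m (tube b a r) <= ennreal (kap * 2 * 4 powr t * r powr t)" .
 qed (use kap_pos in auto)
 qed
 qed
qed

text \<open>The limit mass is continuous on the compact set of chains of radius at least w0, hence
  bounded; by uniform convergence one constant M bounds the masses of all these chains in all late
  generations, and \<open>tube_integral_le\<close> adds them up over a tube without loss in the
  exponent.\<close>

lemma frostman_2:
 assumes g2: "g < 2"
 shows "AE u in P. ALL m. dominated u m --> frostman m 2"
proof -
 have wt: "weight 0 (%_. 1)" by (simp add: weight_def)
 have "AE u in P. ALL n0. chain_lim (%_. 1) n0 u"
 unfolding AE_all_countable by (intro allI chain_limit[OF g2 wt refl])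
 with AE_space show ?thesis
 proof eventually_elim
 fix u assume w: "u : space P" and H: "ALL n0. chain_lim (%_. 1) n0 u"
 show "ALL m. dominated u m --> frostman m 2"
 unfolding frostman_def
 proof (intro allI impI)
 fix m and c :: real assume d: "dominated u m" and c: "0 < c" "c < 1"
 have "sqrt (c / 2) / 4 > 0" using c by simp
 then obtain n0 where n0: "hp n0 < sqrt (c / 2) / 4" using real_arch_pow_inv[of "sqrt (c / 2) / 4" "1/2"] by auto
 \<comment> \<open>Small enough that every chain in a tube of width 2 r \<le> c / 2 with parameters
   in \<open>pens c\<close> has radius at least w0.\<close>
 define w0 where "w0 = 4 * hp n0"
 have w0: "0 < w0" "w0 <= sqrt (c / 2)" using n0 by (auto simp: w0_def)
 obtain X where X: "uniform_limit (chains w0) (%n q. XR (cm (%_. 1) q) (hp n) (hp n0) u) X sequentially" "continuous_on (chains w0) X"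
 using H unfolding w0_def by blast
 obtain M0 where M0: "!!q. q : chains w0 ==> \<bar>X q\<bar> <= M0"
 using compact_imp_bounded[OF compact_continuous_image[OF X(2) chains_compact]] unfolding bounded_iff by auto
 define M where "M = max 0 M0 + 1"
 have ev: "\<forall>\<^sub>F n in sequentially. (ALL q:chains w0. XR (cm (%_. 1) q) (hp n) (hp n0) u <= M) & n0 <= n"
 using uniform_limitD[OF X(1) zero_less_one] eventually_ge_at_top[of n0]
 proof eventually_elim
 case (elim n)
 then show ?case using M0 by (auto simp: M_def dist_real_def) (smt (verit, best))
 qed
 define K where "K = cc (hp n0) 1 * M"
 have K: "K >= 0" using cc_pos[of "hp n0" 1] by (simp add: K_def M_def)
 show "EX C>=0. EX r0>0. ALL b a r. (b, a) : pens c --> 0 < r --> r <= r0 --> emeasure m (tube b a r) <= ennreal (C * r powr 2)"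
 proof (rule exI[of _ "kap * (4 * pi * K)"], intro conjI exI[of _ "c / 4"] allI impI)
 fix b a r assume b: "(b, a) : pens c" and r: "0 < r" "r <= c / 4"
 have nb: "norm b = 1" "cmod a <= 1 - c" using b by (auto simp: pens_def)
 have ch: "pencil b v : chains w0" if "cmod (v - a) <= 2 * r" for v
 proof (rule pencil_chains[OF nb(1)])
 have "(cmod v)\<^sup>2 <= 1 - (sqrt (c / 2))\<^sup>2" using that r by (intro pens_nondegenerate[OF nb(2) c, of "2 * r"]) auto
 moreover have "w0\<^sup>2 <= (sqrt (c / 2))\<^sup>2" using w0 by (intro power_mono) auto
 ultimately show "(cmod v)\<^sup>2 <= 1 - w0\<^sup>2" by linarith
 qed (use w0 in simp)
 have "\<forall>\<^sub>F n in sequentially. (NN surf (%y. ca n u y * indicator (tube b a (2 * r)) y)) <= ennreal (4 * pi * K * r\<^sup>2)"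
 using ev
 proof eventually_elim
 case (elim n)
 have "(NN surf (%y. ennreal 1 * ca n u y * indicator (tube b a (2 * r)) y)) <= ennreal (pi * (2 * r)\<^sup>2 * (cc (hp n0) 1 * M))"
 proof (rule tube_integral_le[OF nb(1) wt])
 show "hp n <= hp n0" using elim by (intro power_decreasing) auto
 show "M >= 0" by (simp add: M_def)
 fix v assume "cmod (v - a) <= 2 * r"
 then show "pencil b v : chains w0 & XR (cm (%_. 1) (pencil b v)) (hp n) (hp n0) u <= M" using ch elim by blast
 qed (use r w w0 in auto)
 then show ?case by (simp add: K_def power_mult_distrib mult_ac)
 qed
 then have "emeasure m (tube b a r) <= ennreal (kap * (4 * pi * K * r\<^sup>2))"
 using K r by (intro dominated_tube[OF d] eventually_frequently) auto
 then show "emeasure m (tube b a r) <= ennreal (kap * (4 * pi * K) * r powr 2)" using r by (simp add: powr_numeral mult_ac)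
 qed (use kap_pos K c in auto)
 qed
 qed
qed

end

section \<open>Interior points of the projections\<close>

lemma pp_near:
 assumes x: "x : S3" and b0: "norm b0 = 1" and p: "p : perpP (lift x)" and r: "dP (pp x b0) p < r" "r <= 1/4"
 shows "EX b. norm b = 1 & p = pp x b & norm (b - b0) <= 4 * r"
proof -
 obtain b' where b': "norm b' = 1" "p = pp x b'" using perpP_unit[OF p] by blast
 let ?u = "(hin b0 x, b0)" and ?v = "(hin b' x, b')"
 have uv: "?u ~= 0" "?v ~= 0" using b0 b'(1) by (auto simp: zero_prod_def)
 obtain c where c: "norm (?u - csmult c ?v) = dE ?u ?v * norm ?u" using dE_attained[OF uv] by blast
 have "norm ?u <= cmod (hin b0 x) + norm b0" by (rule norm_Pair_le)
 also have "... <= 2" using cmod_hin_le[of b0 x] b0 x by (simp add: in_S3)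
 finally have "dE ?u ?v * norm ?u <= r * 2"
 using r(1) dP_nonneg[of "pp x b0" p] unfolding b'(2) pp_def dP_pclass by (intro mult_mono) auto
 moreover have "norm (b0 - csc c b') <= norm (?u - csmult c ?v)"
 using norm_snd_le[of "snd (?u - csmult c ?v)" "fst (?u - csmult c ?v)"] by (simp add: csmult_alt)
 ultimately have n: "norm (b0 - csc c b') <= 2 * r" using c by linarith
 have "\<bar>norm b0 - norm (csc c b')\<bar> <= norm (b0 - csc c b')" by (rule norm_triangle_ineq3)
 then have m: "\<bar>1 - cmod c\<bar> <= 2 * r" using n b0 b'(1) by (simp add: norm_csc)
 then have c0: "c ~= 0" using r by auto
 \<comment> \<open>The multiple c b' close to b0 has norm close to 1; keeping only the phase of c
   gives a unit representative that is still close to b0.\<close>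
 define e where "e = c / complex_of_real (cmod c)"
 have e: "cmod e = 1" "e ~= 0" using c0 by (auto simp: e_def norm_divide)
 have "c = complex_of_real (cmod c) * e" using c0 by (simp add: e_def)
 then have "csc e b' - csc c b' = csc (complex_of_real (1 - cmod c) * e) b'" by (simp add: csc_def prod_eq_iff) (simp add: algebra_simps)
 then have "norm (csc e b' - csc c b') = \<bar>1 - cmod c\<bar>" using e b'(1) by (simp add: norm_csc norm_mult del: of_real_diff)
 moreover have "norm (csc e b' - b0) <= norm (csc e b' - csc c b') + norm (b0 - csc c b')"
 using norm_triangle_ineq4[of "csc e b' - csc c b'" "b0 - csc c b'"] by simp
 ultimately have "norm (csc e b' - b0) <= 4 * r" using m n by linarith
 moreover have "norm (csc e b') = 1" using e b'(1) by (simp add: norm_csc)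
 moreover have "p = pp x (csc e b')" using b'(2) pp_csc[OF e(2)] by simp
 ultimately show ?thesis by blast
qed

lemma proj_eq_pp:
 assumes y: "y ~= x" and b: "b ~= 0" and h: "hin y b = hin x b" shows "proj x y = pp x b"
proof -
 have "hin (y - x) b = 0" using h by (simp add: hin_diff_left)
 then obtain c where c: "b = csc c (cperp (y - x))" using hin_zero_iff[of "y - x" b] y by auto
 then have "c ~= 0" using b by (auto simp: csc_def zero_prod_def)
 from pp_csc[OF this, of x "cperp (y - x)"] show ?thesis unfolding proj_eq[OF y] c[symmetric] by simp
qed

lemma proj_tube_cover:
 assumes x: "x : S3" and M: "M > 0"
 shows "EX N. finite N & card N <= 2 * (2 * M + 1)\<^sup>2 & (ALL b:N. norm b = 1) &
 (ALL y:S3. y ~= x --> (EX b:N. y : tube b (hin x b) (16 / real M)))"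
proof -
 obtain N where N: "finite N" "card N <= 2 * (2 * M + 1)\<^sup>2" "ALL b:N. norm b >= 1"
 and N': "ALL p:perpP (lift x). EX b:N. EX b'. p = pp x b' & norm b' >= 1 & norm (b - b') <= 2 / real M"
 using perp_net[OF x M] by (elim exE conjE) (rule that)
 define s where "s b = csc (1 / complex_of_real (norm b)) b" for b
 have "card (s ` N) <= 2 * (2 * M + 1)\<^sup>2" using card_image_le[OF N(1), of s] N(2) by linarith
 moreover have ns: "norm (s b) = 1" if "b : N" for b
 proof -
 have "norm b >= 1" using bspec[OF N(3) that] .
 then have "norm b > 0" by linarith
 then show ?thesis by (simp add: s_def norm_csc norm_divide)
 qed
 moreover have "EX b:s ` N. y : tube b (hin x b) (16 / real M)" if y: "y : S3" "y ~= x" for y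
 proof -
 obtain b b' where b: "b : N" "proj x y = pp x b'" "norm b' >= 1" "norm (b - b') <= 2 / real M"
 using bspec[OF N' proj_perpP[OF x, of y]] by (elim bexE exE conjE) (rule that)
 have nb: "norm b >= 1" using bspec[OF N(3) b(1)] .
 then have b0: "b ~= 0" "b' ~= 0" "norm b > 0" using b(3) by auto
 have "1 / complex_of_real (norm b) ~= 0" using b0 by simp
 from pp_csc[OF this, of x b] have "dP (pp x (s b)) (proj x y) = dP (pp x b) (pp x b')" unfolding s_def b(2) by (rule arg_cong)
 also have "... <= 2 * norm (b - b') / norm b" by (rule pp_diff_le[OF x b0(1,2)])
 also have "... <= 2 * norm (b - b') / 1" using nb by (intro divide_left_mono) auto
 also have "... <= 4 / real M" using b(4) by simp
 finally have "y : tube (s b) (hin x (s b)) (4 * (4 / real M))" using ns[OF b(1)] by (intro dP_tube[OF x y(1)]) auto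
 then show ?thesis using b(1) by (intro bexI[of _ "s b"]) auto
 qed
 ultimately show ?thesis using N(1) by (intro exI[of _ "s ` N"]) auto
qed

lemma sq_le_add: fixes a b e :: real assumes "0 <= a" "0 <= b" "b <= a + e" "a <= 1" "0 <= e" "e <= 1" shows "b\<^sup>2 <= a\<^sup>2 + 3 * e"
proof -
 have "b\<^sup>2 <= (a + e)\<^sup>2" using assms by (intro power_mono) auto
 moreover have "a * e <= 1 * e" "e * e <= 1 * e" using assms by (intro mult_right_mono; simp)+
 ultimately show ?thesis by (simp add: power2_eq_square algebra_simps)
qed

text \<open>Since \<open>hin (y - x) b\<close> is small, almost all of |y - x| comes from the
  components of x and y along \<open>cperp b\<close>, and these have nearly equal lengths. So the
  chain through x given by b cannot be short if the tube around it reaches a point at distance d.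
  The constant 28 leaves d^2 \<le> 4 sx^2 + d^2 / 4.\<close>

lemma nondegenerate_direction:
 assumes x: "x : S3" and y: "y : S3" and b: "norm b = 1" and d: "0 < d" "d <= norm (y - x)"
 and r: "cmod (hin y b - hin x b) <= r" "r <= d\<^sup>2 / 28"
 shows "3 / 16 * d\<^sup>2 <= 1 - (cmod (hin x b))\<^sup>2"
proof -
 have n1: "norm x = 1" "norm y = 1" using x y by (auto simp: in_S3)
 have "norm (y - x) <= 2" using norm_triangle_ineq4[of y x] n1 by simp
 then have "d\<^sup>2 <= 2\<^sup>2" using d by (intro power_mono) auto
 then have "d\<^sup>2 <= 4" by simp
 then have r1: "0 <= r" "r <= 1" using r norm_ge_zero[of "hin y b - hin x b"] by linarith+
 define sx sy where "sx = cmod (hin x (cperp b))" and "sy = cmod (hin y (cperp b))"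
 have e: "(cmod (hin x b))\<^sup>2 + sx\<^sup>2 = 1" "(cmod (hin y b))\<^sup>2 + sy\<^sup>2 = 1"
 using hin_parseval[OF b, of x] hin_parseval[OF b, of y] n1 by (auto simp: sx_def sy_def)
 have "cmod (hin x b) <= cmod (hin y b) + r" using r(1) norm_triangle_ineq2[of "hin x b" "hin y b"] by (simp add: norm_minus_commute)
 then have "(cmod (hin x b))\<^sup>2 <= (cmod (hin y b))\<^sup>2 + 3 * r"
 using cmod_hin_le[of y b] n1 b r1 by (intro sq_le_add) auto
 then have sy: "sy\<^sup>2 <= sx\<^sup>2 + 3 * r" using e by linarith
 have "cmod (hin (y - x) (cperp b)) <= sy + sx" unfolding hin_diff_left sx_def sy_def by (rule norm_triangle_ineq4)
 then have "(cmod (hin (y - x) (cperp b)))\<^sup>2 <= (sy + sx)\<^sup>2" by (intro power_mono) auto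
 also have "... <= 2 * sy\<^sup>2 + 2 * sx\<^sup>2" using sum_squares_bound[of sy sx] by (simp add: power2_sum)
 finally have 1: "(cmod (hin (y - x) (cperp b)))\<^sup>2 <= 4 * sx\<^sup>2 + 6 * r" using sy by linarith
 have "(cmod (hin (y - x) b))\<^sup>2 <= r\<^sup>2" using r(1) by (intro power_mono) (auto simp: hin_diff_left)
 also have "r\<^sup>2 <= r" using r1 by (simp add: power2_eq_square mult_left_le)
 finally have "(norm (y - x))\<^sup>2 <= 4 * sx\<^sup>2 + 7 * r" using 1 hin_parseval[OF b, of "y - x"] by linarith
 moreover have "d\<^sup>2 <= (norm (y - x))\<^sup>2" using d by (intro power_mono) auto
 ultimately show ?thesis using r(2) e(1) by linarith
qed

text \<open>The radius of a chain is the square root of 1 - |v|^2, which is only Hoelder continuous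
  of order 1/2 up to the unit circle.\<close>

lemma pencil_dist:
 assumes b: "norm b = 1" and v: "cmod v <= 1" "cmod v' <= 1" "cmod (v - v') <= r"
 shows "norm (pencil b v - pencil b v') <= r + sqrt (2 * r)"
proof -
 define s where "s v = sqrt (1 - (cmod v)\<^sup>2)" for v
 have s: "s v <= s v' + sqrt (2 * r)" if v: "cmod v <= 1" "cmod v' <= 1" "cmod (v - v') <= r" for v v'
 proof -
 have r: "0 <= r" using v(3) norm_ge_zero[of "v - v'"] by linarith
 have a: "cmod v' <= cmod v + r" using v(3) norm_triangle_ineq2[of v' v] by (simp add: norm_minus_commute)
 have "(cmod v')\<^sup>2 - (cmod v)\<^sup>2 = (cmod v' - cmod v) * (cmod v' + cmod v)" by (simp add: power2_eq_square algebra_simps)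
 also have "... <= r * 2"
 proof (cases "cmod v' - cmod v <= 0")
 case True
 then have "(cmod v' - cmod v) * (cmod v' + cmod v) <= 0" by (intro mult_nonpos_nonneg) auto
 then show ?thesis using r by linarith
 next
 case False then show ?thesis using a v by (intro mult_mono) auto
 qed
 finally have "1 - (cmod v)\<^sup>2 <= (1 - (cmod v')\<^sup>2) + 2 * r" by linarith
 then have "s v <= sqrt ((1 - (cmod v')\<^sup>2) + 2 * r)" by (simp add: s_def)
 also have "... <= s v' + sqrt (2 * r)" unfolding s_def using v r by (intro sqrt_add_le_add_sqrt) (auto simp: power_le_one)
 finally show ?thesis .
 qed
 have "\<bar>s v - s v'\<bar> <= sqrt (2 * r)" using s[OF v] s[OF v(2,1)] v(3) by (simp add: norm_minus_commute abs_le_iff)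
 moreover have "pencil b v - pencil b v' = (csc (v - v') b, csc (complex_of_real (s v - s v')) (cperp b))"
 by (simp add: pencil_def s_def csc_def prod_eq_iff algebra_simps)
 then have "norm (pencil b v - pencil b v') <= norm (csc (v - v') b) + norm (csc (complex_of_real (s v - s v')) (cperp b))"
 using norm_Pair_le by simp
 then have "norm (pencil b v - pencil b v') <= cmod (v - v') + \<bar>s v - s v'\<bar>"
 using b by (simp add: norm_csc norm_cperp del: of_real_diff)
 ultimately show ?thesis using v(3) by linarith
qed

lemma continuous_pencil: "continuous_on UNIV (%b. pencil b (hin x b))"
 unfolding pencil_def csc_def cperp_def by (intro continuous_intros continuous_hin)

lemma hin_chn_pencil: "norm b = 1 ==> hin (chn (fst (pencil b v)) (snd (pencil b v)) t) b = v"
 by (simp add: chn_def pencil_def hin_add_left hin_csc_left hin_cperp hin_self)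

abbreviation "img_interior x A \<equiv> EX p:perpP (lift x). EX r>0. {q : perpP (lift x). dP p q < r} <= proj_img x A"

text \<open>With centres q in a countable dense set these weights detect mass in every open set, and
  the exceptional events remain countable in number.\<close>

definition bump :: "c2 => nat => c2 => real" where
 "bump q j y = max 0 (1 / real (Suc j) - norm (y - q))"

lemma weight_bump: "weight 1 (bump q j)"
 unfolding weight_def
proof (intro conjI allI)
 fix x y
 have "1 / real (Suc j) <= 1" by simp
 then show "bump q j x <= 1" unfolding bump_def using norm_ge_zero[of "x - q"] by linarith
 have "\<bar>norm (x - q) - norm (y - q)\<bar> <= norm (x - y)" using norm_triangle_ineq3[of "x - q" "y - q"] by simp
 moreover have "\<bar>max 0 (c - a) - max 0 (c - b)\<bar> <= \<bar>a - b\<bar>" for a b c :: real by (simp add: max_def abs_if)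
 ultimately show "\<bar>bump q j x - bump q j y\<bar> <= 1 * norm (x - y)" unfolding bump_def mult_1 by (blast intro: order_trans)
qed (auto simp: bump_def)

lemma bump_pos_iff: "bump q j y ~= 0 \<longleftrightarrow> y : ball q (1 / real (Suc j))"
 by (auto simp: bump_def dist_norm norm_minus_commute max_def)

lemma bump_continuous: "continuous_on UNIV (bump q j)"
 unfolding bump_def by (intro continuous_intros)

context cutout_process
begin

text \<open>If the limit mass of a chain is nonzero then compactness yields a point of the cut-out set on it.\<close>
lemma chain_hits_cutout:
 assumes w: "u : space P" and b: "norm b = 1" and ch: "pencil b v : chains w0" and f: "weight L f"
 and X: "(%n. XR (cm f (pencil b v)) (hp n) (hp n0) u) \<longlonglongrightarrow> X" "X ~= 0"
 and K: "closed K" "!!y. f y ~= 0 ==> y : K"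
 and big: "!!y p. y : K ==> p : \<Phi> u ==> hp n0 <= snd p ==> snd p < dvis (fst p) y"
 shows "EX y:cutout (\<Phi> u). y : K & hin y b = v"
proof -
 have "\<forall>\<^sub>F n in sequentially. XR (cm f (pencil b v)) (hp n) (hp n0) u ~= 0" by (rule tendsto_imp_eventually_ne[OF X])
 then obtain n1 where n1: "!!n. n >= n1 ==> XR (cm f (pencil b v)) (hp n) (hp n0) u ~= 0" unfolding eventually_sequentially by blast
 have "EX y. y : S3 & hin y b = v & f y ~= 0 & av (hp n) (hp n0) u y ~= 0" if n: "n >= n1" for n
 proof (rule ccontr)
 assume no: "\<not> ?thesis"
 let ?y = "chn (fst (pencil b v)) (snd (pencil b v))"
 have "f (?y t) * (cc (hp n) (hp n0) * av (hp n) (hp n0) u (?y t)) = 0" for t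
 proof -
 have "?y t : S3" "hin (?y t) b = v" using chn_S3[of "fst (pencil b v)" "snd (pencil b v)" w0] ch hin_chn_pencil[OF b] by auto
 then have "f (?y t) = 0 \<or> av (hp n) (hp n0) u (?y t) = 0" using no by blast
 then show ?thesis by auto
 qed
 then have "XR (cm f (pencil b v)) (hp n) (hp n0) u = 0" unfolding XR_cm(1)[OF ch f hp_pos hp_le_1 w] by (simp only: Bochner_Integration.integral_zero)
 then show False using n1[OF n] by simp
 qed
 then have "ALL n. EX y. y : S3 & hin y b = v & f y ~= 0 & av (hp (n + n1)) (hp n0) u y ~= 0" by simp
 from choice[OF this] obtain s where s: "ALL n. s n : S3 & hin (s n) b = v & f (s n) ~= 0 & av (hp (n + n1)) (hp n0) u (s n) ~= 0" by blast
 obtain l r where l: "l : S3" "strict_mono r" "(s \<circ> r) \<longlonglongrightarrow> l"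
 using S3_compact s unfolding compact_def by blast
 have in_closed: "l : C" if "closed C" "\<forall>\<^sub>F n in sequentially. s n : C" for C
 proof (rule Lim_in_closed_set[OF that(1) _ _ l(3)])
 show "\<forall>\<^sub>F n in sequentially. (s \<circ> r) n : C" using eventually_subseq[OF l(2) that(2)] by simp
 qed simp
 have lK: "l : K" using K s by (intro in_closed) auto
 have "l : {y. hin y b = v}" using s by (intro in_closed closed_Collect_eq continuous_hin continuous_intros) auto
 then have lb: "hin l b = v" by simp
 have "snd p <= dvis (fst p) l" if p: "p : \<Phi> u" for p
 \<comment> \<open>Masses of chains ignore balls of radius at least \<open>hp n0\<close>; these are
   kept away by the set K, the smaller ones by passing to the limit in the points
   \<open>s n\<close>.\<close>
 proof (cases "hp n0 <= snd p")
 case True then show ?thesis using big[OF lK p] by simp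
 next
 case False
 have zr: "fst p : S3" "0 < snd p" using pts[OF w] p by auto
 then obtain m where m: "hp m < snd p" using real_arch_pow_inv[of "snd p" "1/2"] by auto
 have "snd p <= dvis (fst p) (s n)" if n: "n >= m" for n
 proof (rule ccontr)
 assume "\<not> ?thesis"
 moreover have "hp (n + n1) <= hp m" using n by (intro power_decreasing) auto
 then have "hp (n + n1) <= snd p" using m by linarith
 ultimately have "p : conR (hp (n + n1)) (hp n0) (s n)" using zr False by (simp add: conR_def)
 then have "av (hp (n + n1)) (hp n0) u (s n) = 0" using p by (auto simp: av_def)
 then show False using s by blast
 qed
 then have "\<forall>\<^sub>F n in sequentially. s n : {y. snd p <= dvis (fst p) y}" unfolding eventually_sequentially by blast
 then have "l : {y. snd p <= dvis (fst p) y}" by (intro in_closed closed_Collect_le continuous_dvis continuous_intros)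
 then show ?thesis by simp
 qed
 then have "l : cutout (\<Phi> u)" using l(1) by (fastforce simp: cutout_def vball_def)
 then show ?thesis using lK lb by blast
qed

text \<open>If the limit masses of all chains through \<open>x\<close> vanish then so does \<open>\<mu>\<close>: the chains that carry the mass of
 a net of tubes around these chains are uniformly close to them.\<close>
lemma null_of_null_chains:
 assumes w: "u : space P" and d: "dominated u m" and x: "x : S3" and f: "weight L f" and d0: "0 < d0"
 and w0: "w0 = 4 * hp n0" "w0 <= d0 / 8"
 and sep: "!!y. f y ~= 0 ==> d0 <= norm (y - x)"
 and X: "uniform_limit (chains w0) (%n q. XR (cm f q) (hp n) (hp n0) u) X sequentially" "continuous_on (chains w0) X"
 and null: "!!b. norm b = 1 ==> 3 / 16 * d0\<^sup>2 <= 1 - (cmod (hin x b))\<^sup>2 ==> X (pencil b (hin x b)) = 0"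
 shows "(NN m (%y. ennreal (f y))) = 0"
proof -
 have w0p: "w0 > 0" by (simp add: w0)
 have fc: "continuous_on UNIV f" using weightD(3)[OF f] weightD(4)[OF f]
 by (intro lipschitz_on_continuous_on[of L]) (auto simp: lipschitz_on_def dist_norm)
 \<comment> \<open>The net has at most 18 M^2 tubes of width 16 / M, so the number of tubes times
   r^2 is at most 18 * 256; the other factors come from \<open>tube_integral_le\<close>.\<close>
 define K where "K = 18 * pi * 256 * (cc (hp n0) 1 * 2)"
 have K: "K > 0" using cc_pos[of "hp n0" 1] by (simp add: K_def)
 have main: "(NN m (%y. ennreal (f y))) <= ennreal (kap * (K * E))" if e: "E > 0" for E
 proof (rule dominated_le[OF d fc weightD(1)[OF f]])
 have "uniformly_continuous_on (chains w0) X" by (rule compact_uniformly_continuous[OF X(2) chains_compact])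
 then have "EX D>0. ALL q:chains w0. ALL q':chains w0. dist q' q < D --> dist (X q') (X q) < E"
 unfolding uniformly_continuous_on_def using e by (elim allE[of _ E]) (simp only: simp_thms)
 then obtain D where D: "D > 0" and Dc: "ALL q:chains w0. ALL q':chains w0. dist q' q < D --> dist (X q') (X q) < E"
 by (elim exE conjE)
 define D1 where "D1 = min 1 D"
 have D1: "0 < D1" "D1 <= 1" "D1 <= D" using D by (auto simp: D1_def)
 \<comment> \<open>Smallness for the uniform continuity of X through \<open>pencil_dist\<close>, for
   \<open>nondegenerate_direction\<close>, and for \<open>sq_le_add\<close>.\<close>
 define r0 where "r0 = min (D1\<^sup>2 / 8) (min (d0\<^sup>2 / 28) 1)"
 have r0: "0 < r0" "r0 <= D1\<^sup>2 / 8" "r0 <= d0\<^sup>2 / 28" "r0 <= 1" using D1 d0 by (auto simp: r0_def)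
 obtain M :: nat where M: "real M >= 16 / r0 + 1" using real_arch_simple by blast
 have "0 < 16 / r0" using r0 by simp
 then have "0 < real M" "real M >= 16 / r0" using M by linarith+
 then have M0: "M > 0" "real M >= 16 / r0" by auto
 define r where "r = 16 / real M"
 have r: "0 < r" "r <= r0" using M0 r0 by (auto simp: r_def field_simps)
 have small: "r + sqrt (2 * r) < D"
 proof -
 have q: "D1\<^sup>2 <= D1" using D1 by (simp add: power2_eq_square mult_left_le)
 have "sqrt (2 * r) <= sqrt ((D1 / 2)\<^sup>2)" using r r0 by (intro real_sqrt_le_mono) (simp add: power_divide)
 also have "... = D1 / 2" using D1 by simp
 finally show ?thesis using r r0 q D1 by linarith
 qed
 obtain N where N: "finite N" "card N <= 2 * (2 * M + 1)\<^sup>2" "ALL b:N. norm b = 1"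
 "ALL y:S3. y ~= x --> (EX b:N. y : tube b (hin x b) r)"
 using proj_tube_cover[OF x M0(1), folded r_def] by (elim exE conjE) (rule that)
 have "\<forall>\<^sub>F n in sequentially. (NN surf (%y. ennreal (f y) * ca n u y)) <= ennreal (K * E)"
 using uniform_limitD[OF X(1) e] eventually_ge_at_top[of n0]
 proof eventually_elim
 case (elim n)
 define G where "G y = ennreal (f y) * ca n u y" for y
 have Gm: "G : borel_measurable S3b"
 proof -
 have "(%y. av (hp n) 1 u y) : borel_measurable S3b"
 using measurable_Pair2[OF av_measurable[OF hp_pos] w, of 1 n] by simp
 then show ?thesis unfolding G_def using measurable_restrict_space1[OF weight_measurable[OF f]] by measurable
 qed
 have tube: "(NN surf (%y. G y * indicator (tube b (hin x b) r) y)) <= ennreal (pi * r\<^sup>2 * (cc (hp n0) 1 * (2 * E)))" if b: "b : N" for b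
 \<comment> \<open>Along the chains of a tube of the first kind the masses are at most 2 E, because
   X vanishes on the central one. Tubes of the second kind do not meet the set where f is nonzero,
   by \<open>nondegenerate_direction\<close>.\<close>
 proof (cases "3 / 16 * d0\<^sup>2 <= 1 - (cmod (hin x b))\<^sup>2")
 case True
 have nb: "norm b = 1" using bspec[OF N(3) b] .
 have hx: "cmod (hin x b) <= 1" using cmod_hin_le[of x b] nb x by (simp add: in_S3)
 have "w0\<^sup>2 <= (d0 / 8)\<^sup>2" using w0 w0p by (intro power_mono) auto
 then have w0d: "w0\<^sup>2 <= d0\<^sup>2 / 64" by (simp add: power_divide)
 have P: "pencil b v : chains w0" "cmod v <= 1" if v: "cmod (v - hin x b) <= r" for v
 proof -
 have "cmod v <= cmod (hin x b) + r" using v norm_triangle_ineq2[of v "hin x b"] by linarith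
 then have "(cmod v)\<^sup>2 <= (cmod (hin x b))\<^sup>2 + 3 * r" using hx r r0 by (intro sq_le_add) auto
 then have le: "(cmod v)\<^sup>2 <= 1 - w0\<^sup>2" using True w0d r(2) r0(3) zero_le_power2[of d0] by linarith
 then show "pencil b v : chains w0" using w0p by (intro pencil_chains[OF nb]) auto
 have "(cmod v)\<^sup>2 <= 1\<^sup>2" using le zero_le_power2[of w0] unfolding one_power2 by linarith
 then show "cmod v <= 1" by (rule power2_le_imp_le) simp
 qed
 show ?thesis unfolding G_def
 proof (rule tube_integral_le[OF nb f])
 show "hp n <= hp n0" using elim by (intro power_decreasing) auto
 fix v assume v: "cmod (v - hin x b) <= r"
 have q: "pencil b v : chains w0" "pencil b (hin x b) : chains w0" using P[OF v] P[of "hin x b"] r by auto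
 have "norm (pencil b v - pencil b (hin x b)) < D" using pencil_dist[OF nb P(2)[OF v] hx v] small by linarith
 then have "dist (X (pencil b v)) (X (pencil b (hin x b))) < E" 
 using bspec[OF bspec[OF Dc q(2)] q(1)] by (simp add: dist_norm)
 moreover have "dist (XR (cm f (pencil b v)) (hp n) (hp n0) u) (X (pencil b v)) < E" using elim q by blast
 ultimately show "pencil b v : chains w0 & XR (cm f (pencil b v)) (hp n) (hp n0) u <= 2 * E"
 using q null[OF nb True] by (simp add: dist_real_def)
 qed (use r e w w0p in auto)
 next
 case False
 have "G y * indicator (tube b (hin x b) r) y = 0" if y: "y : S3" for y
 proof (rule ccontr)
 assume c: "G y * indicator (tube b (hin x b) r) y ~= 0"
 then have fy: "f y ~= 0" by (auto simp: G_def)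
 have yt: "y : tube b (hin x b) r" using c by (auto simp: indicator_def split: if_splits)
 have "cmod (hin y b - hin x b) <= r" using yt by (simp add: tube_def)
 then have "3 / 16 * d0\<^sup>2 <= 1 - (cmod (hin x b))\<^sup>2"
 using r(2) r0(3) by (intro nondegenerate_direction[OF x y bspec[OF N(3) b] d0 sep[OF fy], of r]) auto
 then show False using False by simp
 qed
 then have "(NN surf (%y. G y * indicator (tube b (hin x b) r) y)) = (NN surf (%y. 0))" by (intro nn_integral_cong) simp
 then show ?thesis by simp
 qed
 have "(NN surf (%y. G y)) <= (NN surf (%y. (\<Sum>b\<in>N. G y * indicator (tube b (hin x b) r) y)))"
 proof (rule nn_integral_mono)
 fix y assume "y : space surf"
 then have y: "y : S3" by simp
 show "G y <= (\<Sum>b\<in>N. G y * indicator (tube b (hin x b) r) y)"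
 proof (cases "f y = 0")
 case True then show ?thesis by (simp add: G_def)
 next
 case False
 have "y ~= x" using sep[OF False] d0 by auto
 then obtain b where b: "b : N" "y : tube b (hin x b) r" using bspec[OF N(4) y] by blast
 have "G y = G y * indicator (tube b (hin x b) r) y" using b by simp
 also have "... <= (\<Sum>b\<in>N. G y * indicator (tube b (hin x b) r) y)" using b(1) N(1) by (intro member_le_sum) auto
 finally show ?thesis .
 qed
 qed
 also have "... = (\<Sum>b\<in>N. (NN surf (%y. G y * indicator (tube b (hin x b) r) y)))"
 using Gm by (intro nn_integral_sum borel_measurable_times_ennreal borel_measurable_indicator tube_sets_surf)
 (simp cong: measurable_cong_sets)
 also have "... <= (\<Sum>b\<in>N. ennreal (pi * r\<^sup>2 * (cc (hp n0) 1 * (2 * E))))" by (intro sum_mono tube)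
 also have "... = ennreal (real (card N) * (pi * r\<^sup>2 * (cc (hp n0) 1 * (2 * E))))"
 using cc_pos[of "hp n0" 1] e by (simp add: ennreal_of_nat_eq_real_of_nat ennreal_mult')
 also have "... <= ennreal (K * E)"
 proof (rule ennreal_leI)
 have "real (card N) <= 2 * (2 * real M + 1)\<^sup>2" using of_nat_mono[OF N(2), where 'a=real] by (simp add: add.commute)
 also have "... <= 2 * (3 * real M)\<^sup>2" using M0(1) by (intro mult_left_mono power_mono) auto
 finally have "real (card N) * r\<^sup>2 <= 2 * (3 * real M)\<^sup>2 * r\<^sup>2" by (intro mult_right_mono) auto
 also have "... = 18 * 256" using M0(1) by (simp add: r_def power2_eq_square)
 finally have "(real (card N) * r\<^sup>2) * (pi * (cc (hp n0) 1 * (2 * E))) <= 18 * 256 * (pi * (cc (hp n0) 1 * (2 * E)))"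
 using e cc_pos[of "hp n0" 1] by (intro mult_right_mono) auto
 then show "real (card N) * (pi * r\<^sup>2 * (cc (hp n0) 1 * (2 * E))) <= K * E" by (simp add: K_def mult_ac)
 qed
 finally show ?case unfolding G_def .
 qed
 then show "\<exists>\<^sub>F n in sequentially. (NN surf (%y. ennreal (f y) * ca n u y)) <= ennreal (K * E)"
 by (rule eventually_frequently[OF sequentially_bot])
 show "0 <= K * E" using K e by simp
 qed
 have "(NN m (%y. ennreal (f y))) <= 0"
 proof (rule ennreal_le_epsilon)
 fix e :: real assume e: "0 < e"
 show "(NN m (%y. ennreal (f y))) <= 0 + ennreal e" using main[of "e / (kap * K)"] e K kap_pos by simp
 qed
 then show ?thesis by simp
qed

text \<open>There is a small ball of positive mass away from x and from all closed balls of the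
  process of radius at least \<open>hp n0\<close>: discarding the latter costs no mass, as the open
  balls and their boundary spheres are null. A bump on it has positive integral, so by
  \<open>null_of_null_chains\<close> some chain through x has nonzero limit mass. Continuity keeps
  the limit mass nonzero for all nearby directions b, and each of these chains meets the cut-out
  set.\<close>

lemma proj_img_interior:
 assumes w: "v : space P" and d: "dominated v m" and F: "frostman m 2" and pos: "emeasure m S3 ~= 0" and x: "x : S3"
 and D: "countable D" "!!y e. e > 0 ==> EX q:D. norm (y - q) < e"
 and H: "!!n0 q j. q : D ==> chain_lim (bump q j) n0 v"
 shows "img_interior x (cutout (\<Phi> v))"
proof -
 have sm: "sets m = sets S3b" by (rule dominatedD(1)[OF d])
 have x1: "emeasure m {x} = 0" by (rule frostman_point[OF sm _ F x]) simp
 have osub: "S3 Int V : sets m" if "open V" for V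
 unfolding sm using that by (intro borel_sub_S3b sets.Int S3_borel borel_open) auto
 have "EX k. emeasure m (S3 Int {y. 1 / real (Suc k) < norm (y - x)}) ~= 0"
 proof (rule ccontr)
 assume "\<not> ?thesis"
 then have "S3 Int {y. 1 / real (Suc k) < norm (y - x)} : null_sets m" for k
 by (intro null_setsI osub open_Collect_less continuous_intros) auto
 then have "(\<Union>k. S3 Int {y. 1 / real (Suc k) < norm (y - x)}) : null_sets m" by (intro null_sets_UN)
 moreover have "{x} : null_sets m" using x1 x by (intro null_setsI) (auto simp: sm intro!: borel_sub_S3b)
 ultimately have nu: "{x} Un (\<Union>k. S3 Int {y. 1 / real (Suc k) < norm (y - x)}) : null_sets m" by (intro null_sets.Un)
 have "S3 <= {x} Un (\<Union>k. S3 Int {y. 1 / real (Suc k) < norm (y - x)})"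
 proof
 fix y assume y: "y : S3"
 show "y : {x} Un (\<Union>k. S3 Int {y. 1 / real (Suc k) < norm (y - x)})"
 proof (cases "y = x")
 case False
 then have "0 < norm (y - x)" by simp
 then obtain k where "inverse (real (Suc k)) < norm (y - x)" using reals_Archimedean by blast
 then have "1 / real (Suc k) < norm (y - x)" by (simp add: inverse_eq_divide)
 then show ?thesis using y by blast
 qed simp
 qed
 then have "emeasure m S3 <= emeasure m ({x} Un (\<Union>k. S3 Int {y. 1 / real (Suc k) < norm (y - x)}))"
 using nu by (intro emeasure_mono null_setsD2)
 then show False using pos null_setsD1[OF nu] by simp
 qed
 then obtain k where k: "emeasure m (S3 Int {y. 1 / real (Suc k) < norm (y - x)}) ~= 0" by blast
 define d0 where "d0 = 1 / real (Suc k)"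
 have d0: "0 < d0" by (simp add: d0_def)
 have kd: "emeasure m (S3 Int {y. d0 < norm (y - x)}) ~= 0" unfolding d0_def by (rule k)
 have "0 < d0 / 32" using d0 by simp
 then obtain n0 where n0: "hp n0 < d0 / 32" using real_arch_pow_inv[of "d0 / 32" "1/2"] by auto
 define w0 where "w0 = 4 * hp n0"
 have w0: "0 < w0" "w0 <= d0 / 8" using n0 by (auto simp: w0_def)
 define Big where "Big = {p : \<Phi> v. hp n0 <= snd p}"
 have Bf: "finite Big" unfolding Big_def by (rule pts_finite[OF w hp_pos])
 define V where "V = {y. d0 < norm (y - x)} Int (\<Inter>p\<in>Big. {y. snd p < dvis (fst p) y})"
 have Vo: "open V" unfolding V_def using Bf
 by (intro open_Int open_INT ballI open_Collect_less continuous_intros continuous_dvis)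
 have VU: "emeasure m (S3 Int V) ~= 0"
 proof
 assume z: "emeasure m (S3 Int V) = 0"
 have c: "{y : S3. dvis (fst p) y <= snd p} : null_sets m" if p: "p : Big" for p
 proof -
 have p': "(fst p, snd p) : \<Phi> v" "fst p : S3" "0 < snd p" using p pts[OF w] by (auto simp: Big_def)
 have e: "{y : S3. dvis (fst p) y <= snd p} = vball (fst p) (snd p) Un {y : S3. dvis (fst p) y = snd p}"
 by (auto simp: vball_def)
 have s: "{y : S3. dvis (fst p) y = snd p} : sets m"
 proof -
 have "{y : S3. dvis (fst p) y = snd p} = S3 Int {y. dvis (fst p) y = snd p}" by auto
 moreover have "closed ..." by (intro closed_Int S3_closed closed_Collect_eq continuous_intros continuous_dvis)
 ultimately show ?thesis unfolding sm by (intro borel_sub_S3b borel_closed) auto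
 qed
 show ?thesis unfolding e
 using dominated_vball_null[OF d w p'(1)] frostman_sphere_null[OF sm F p'(2,3)] s
 by (intro null_sets.Un null_setsI) (simp_all add: sm vball_S3b)
 qed
 have "S3 Int V : null_sets m" using z osub[OF Vo] by (intro null_setsI)
 moreover have "(\<Union>p\<in>Big. {y : S3. dvis (fst p) y <= snd p}) : null_sets m"
 using c Bf by (intro null_sets_UN' countable_finite)
 ultimately have nu: "(S3 Int V) Un (\<Union>p\<in>Big. {y : S3. dvis (fst p) y <= snd p}) : null_sets m" by (intro null_sets.Un)
 have "S3 Int {y. d0 < norm (y - x)} <= (S3 Int V) Un (\<Union>p\<in>Big. {y : S3. dvis (fst p) y <= snd p})"
 proof
 fix y assume y: "y : S3 Int {y. d0 < norm (y - x)}"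
 show "y : (S3 Int V) Un (\<Union>p\<in>Big. {y : S3. dvis (fst p) y <= snd p})"
 proof (cases "EX p:Big. dvis (fst p) y <= snd p")
 case True then show ?thesis using y by blast
 next
 case False
 have "snd p < dvis (fst p) y" if "p : Big" for p
 proof (rule ccontr)
 assume "\<not> ?thesis"
 then have "dvis (fst p) y <= snd p" by simp
 then show False using False that by blast
 qed
 then show ?thesis using y by (simp add: V_def)
 qed
 qed
 then have "emeasure m (S3 Int {y. d0 < norm (y - x)}) <= emeasure m ((S3 Int V) Un (\<Union>p\<in>Big. {y : S3. dvis (fst p) y <= snd p}))"
 using nu by (intro emeasure_mono null_setsD2)
 then show False using kd null_setsD1[OF nu] by simp
 qed
 have "EX q j. q : D & cball q (1 / real (Suc j)) <= V & emeasure m (S3 Int ball q (1 / real (Suc j))) ~= 0"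
 proof (rule ccontr)
 assume no: "\<not> ?thesis"
 define Q where "Q = {(q, j). q : D & cball q (1 / real (Suc j)) <= V}"
 have "Q <= D \<times> UNIV" by (auto simp: Q_def)
 then have Qc: "countable Q" by (rule countable_subset) (intro countable_SIGMA D(1), simp)
 have "S3 Int ball (fst a) (1 / real (Suc (snd a))) : null_sets m" if "a : Q" for a
 using that no by (intro null_setsI osub) (auto simp: Q_def)
 then have nu: "(\<Union>a\<in>Q. S3 Int ball (fst a) (1 / real (Suc (snd a)))) : null_sets m" by (intro null_sets_UN'[OF Qc])
 have "S3 Int V <= (\<Union>a\<in>Q. S3 Int ball (fst a) (1 / real (Suc (snd a))))"
 proof
 fix y assume y: "y : S3 Int V"
 then obtain e where e: "0 < e" "ball y e <= V" using Vo unfolding open_contains_ball by blast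
 have "0 < e / 2" using e by simp
 then obtain j where j: "inverse (real (Suc j)) < e / 2" using reals_Archimedean by blast
 define r where "r = 1 / real (Suc j)"
 have r: "0 < r" "r < e / 2" using j by (auto simp: r_def inverse_eq_divide)
 obtain q where q: "q : D" "norm (y - q) < r" using D(2)[OF r(1)] by blast
 have "cball q r <= V"
 proof
 fix u assume "u : cball q r"
 then have "dist y u < e" using q r dist_triangle[of y u q] by (simp add: dist_norm)
 then show "u : V" using e by auto
 qed
 then have "(q, j) : Q" using q by (simp add: Q_def r_def)
 moreover have "y : S3 Int ball q r" using y q by (simp add: dist_norm norm_minus_commute)
 ultimately show "y : (\<Union>a\<in>Q. S3 Int ball (fst a) (1 / real (Suc (snd a))))" by (auto simp: r_def intro!: bexI[of _ "(q, j)"])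
 qed
 then have "emeasure m (S3 Int V) <= emeasure m (\<Union>a\<in>Q. S3 Int ball (fst a) (1 / real (Suc (snd a))))"
 using nu by (intro emeasure_mono null_setsD2)
 then show False using VU null_setsD1[OF nu] by simp
 qed
 then obtain q j where q: "q : D" "cball q (1 / real (Suc j)) <= V" "emeasure m (S3 Int ball q (1 / real (Suc j))) ~= 0" by blast
 let ?f = "bump q j"
 have sp: "y : cball q (1 / real (Suc j))" if "?f y ~= 0" for y using that unfolding bump_pos_iff by simp
 have int: "(NN m (%y. ennreal (?f y))) ~= 0"
 proof
 assume z: "(NN m (%y. ennreal (?f y))) = 0"
 have "(%y. ennreal (?f y)) : borel_measurable m"
 using borel_measurable_continuous_onI[OF bump_continuous] sm
 by (simp cong: measurable_cong_sets add: measurable_restrict_space1)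
 then have "AE y in m. ennreal (?f y) = 0" using z by (simp add: nn_integral_0_iff_AE)
 then have "AE y in m. y \<notin> ball q (1 / real (Suc j))"
 proof eventually_elim
 case (elim y)
 then have "?f y = 0" using weightD(1)[OF weight_bump, of q j y] by (simp add: ennreal_eq_0_iff)
 then show ?case using bump_pos_iff by blast
 qed
 moreover have "S3 Int ball q (1 / real (Suc j)) = {y : space m. \<not> y \<notin> ball q (1 / real (Suc j))}"
 using dominatedD(3)[OF d] by auto
 ultimately have "emeasure m (S3 Int ball q (1 / real (Suc j))) = 0"
 by (subst AE_iff_measurable[OF osub[OF open_ball], symmetric, where P="%y. y \<notin> ball q (1 / real (Suc j))"]) simp_all
 then show False using q(3) by simp
 qed
 obtain X where X: "uniform_limit (chains w0) (%n p. XR (cm ?f p) (hp n) (hp n0) v) X sequentially" "continuous_on (chains w0) X"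
 using H[OF q(1)] unfolding w0_def by blast
 have "EX b. norm b = 1 & 3 / 16 * d0\<^sup>2 <= 1 - (cmod (hin x b))\<^sup>2 & X (pencil b (hin x b)) ~= 0"
 proof (rule ccontr)
 assume no: "\<not> ?thesis"
 have "(NN m (%y. ennreal (?f y))) = 0"
 proof (rule null_of_null_chains[OF w d x weight_bump d0 w0_def w0(2) _ X])
 show "d0 <= norm (y - x)" if "?f y ~= 0" for y using sp[OF that] q(2) by (auto simp: V_def)
 qed (use no in blast)
 then show False using int by simp
 qed
 then obtain b0 where b0: "norm b0 = 1" "3 / 16 * d0\<^sup>2 <= 1 - (cmod (hin x b0))\<^sup>2" "X (pencil b0 (hin x b0)) ~= 0" by blast
 define B where "B = {b. norm b = 1 & (cmod (hin x b))\<^sup>2 <= 1 - w0\<^sup>2}"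
 have "w0\<^sup>2 <= (d0 / 8)\<^sup>2" using w0 by (intro power_mono) auto
 then have w0d: "w0\<^sup>2 <= d0\<^sup>2 / 64" by (simp add: power_divide)
 have "(cmod (hin x b0))\<^sup>2 <= 1 - w0\<^sup>2" using b0(2) w0d zero_le_power2[of d0] by linarith
 then have b0B: "b0 : B" using b0(1) by (simp add: B_def)
 have hB: "pencil b (hin x b) : chains w0" if "b : B" for b using that w0 by (intro pencil_chains) (auto simp: B_def)
 have "continuous_on B (%b. X (pencil b (hin x b)))"
 by (rule continuous_on_compose2[OF X(2) continuous_on_subset[OF continuous_pencil]]) (auto intro: hB)
 then have "ALL e>0. EX h>0. ALL b:B. dist b b0 < h --> dist (X (pencil b (hin x b))) (X (pencil b0 (hin x b0))) < e"
 unfolding continuous_on_iff by (rule bspec[OF _ b0B])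
 moreover have "0 < \<bar>X (pencil b0 (hin x b0))\<bar>" using b0(3) by simp
 ultimately have "EX h>0. ALL b:B. dist b b0 < h --> dist (X (pencil b (hin x b))) (X (pencil b0 (hin x b0))) < \<bar>X (pencil b0 (hin x b0))\<bar>"
 by (elim allE impE)
 then obtain h where h: "h > 0" and hc: "ALL b:B. dist b b0 < h --> dist (X (pencil b (hin x b))) (X (pencil b0 (hin x b0))) < \<bar>X (pencil b0 (hin x b0))\<bar>"
 by (elim exE conjE)
 \<comment> \<open>The vector b moves by at most 4 r, which stays below h, and |<x,b>|^2 grows by at
   most 12 r, which leaves the chain a radius of at least w0.\<close>
 define r where "r = min (1/4) (min (h / 8) (d0\<^sup>2 / 112))"
 have r: "0 < r" "r <= 1/4" "r <= h / 8" "r <= d0\<^sup>2 / 112" using h d0 by (auto simp: r_def)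
 have "p : proj_img x (cutout (\<Phi> v))" if p: "p : perpP (lift x)" "dP (pp x b0) p < r" for p
 proof -
 obtain b where b: "norm b = 1" "p = pp x b" "norm (b - b0) <= 4 * r" using pp_near[OF x b0(1) p r(2)] by blast
 have "hin x b - hin x b0 = hin x (b - b0)" by (simp add: hin_diff_right)
 then have "cmod (hin x b - hin x b0) <= 4 * r" using cmod_hin_le[of x "b - b0"] b(3) x by (simp add: in_S3)
 then have "cmod (hin x b) <= cmod (hin x b0) + 4 * r" using norm_triangle_ineq2[of "hin x b" "hin x b0"] by linarith
 then have "(cmod (hin x b))\<^sup>2 <= (cmod (hin x b0))\<^sup>2 + 3 * (4 * r)"
 using cmod_hin_le[of x b0] x b0(1) r by (intro sq_le_add) (auto simp: in_S3)
 then have "(cmod (hin x b))\<^sup>2 <= 1 - w0\<^sup>2" using b0(2) w0d r(4) zero_le_power2[of d0] by linarith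
 then have bB: "b : B" using b(1) by (simp add: B_def)
 have "dist b b0 < h" using b(3) r(1,3) by (simp add: dist_norm)
 then have "dist (X (pencil b (hin x b))) (X (pencil b0 (hin x b0))) < \<bar>X (pencil b0 (hin x b0))\<bar>" using bspec[OF hc bB] by blast
 then have Xb: "X (pencil b (hin x b)) ~= 0" by (auto simp: dist_real_def)
 have "EX y:cutout (\<Phi> v). y : cball q (1 / real (Suc j)) & hin y b = hin x b"
 proof (rule chain_hits_cutout[OF w b(1) hB[OF bB] weight_bump tendsto_uniform_limitI[OF X(1) hB[OF bB]] Xb closed_cball sp])
 fix y p assume "y : cball q (1 / real (Suc j))" "p : \<Phi> v" "hp n0 <= snd p"
 then show "snd p < dvis (fst p) y" using q(2) by (auto simp: V_def Big_def)
 qed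
 then obtain y where y: "y : cutout (\<Phi> v)" "y : cball q (1 / real (Suc j))" "hin y b = hin x b" by blast
 have "d0 < norm (y - x)" using y(2) q(2) by (auto simp: V_def)
 then have yx: "y ~= x" using d0 by auto
 have "b ~= 0" using b(1) by auto
 from proj_eq_pp[OF yx this y(3)] have "p = proj x y" using b(2) by simp
 then show ?thesis using y(1) yx by (auto simp: proj_img_def)
 qed
 moreover have "pp x b0 : perpP (lift x)" using b0(1) by (intro pp_perpP) auto
 ultimately show ?thesis using r(1) by (intro bexI[of _ "pp x b0"] exI[of _ r]) auto
qed

lemma proj_img_interior_AE:
 assumes g2: "g < 2"
 shows "AE u in P. ALL m x. dominated u m --> emeasure m S3 ~= 0 --> x : S3 -->
 img_interior x (cutout (\<Phi> u))"
proof -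
 obtain D :: "c2 set" where D0: "countable D" "UNIV <= closure D"
 by (rule separable[of UNIV])
 have D: "EX q:D. norm (y - q) < e" if "e > 0" for y e
 proof -
 have "y : closure D" using D0(2) by blast
 then have "EX q:D. dist q y < e" unfolding closure_approachable using that by blast
 then show ?thesis by (simp add: dist_norm norm_minus_commute)
 qed
 have "AE u in P. ALL q:D. ALL j n0. chain_lim (bump q j) n0 u"
 unfolding AE_ball_countable[OF D0(1)] AE_all_countable by (intro ballI allI chain_limit[OF g2 weight_bump refl])
 with AE_space frostman_2[OF g2] show ?thesis
 proof eventually_elim
 fix u assume w: "u : space P" and F: "ALL m. dominated u m --> frostman m 2"
 and H: "ALL q:D. ALL j n0. chain_lim (bump q j) n0 u"
 show "ALL m x. dominated u m --> emeasure m S3 ~= 0 --> x : S3 -->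
 img_interior x (cutout (\<Phi> u))"
 proof (intro allI impI)
 fix m x assume d: "dominated u m" and p: "emeasure m S3 ~= 0" and x: "x : S3"
 show "img_interior x (cutout (\<Phi> u))"
 proof (rule proj_img_interior[OF w d _ p x D0(1) D])
 show "frostman m 2" using F d by blast
 qed (assumption | rule H[rule_format])+
 qed
 qed
qed

end

text \<open>Over each centre there is at most one radius, and the intensity has no atoms in the
  radius. This disposes of the boundary cases r = 1 and dvis = r.\<close>

lemma intensity_graph_null:
 assumes D: "D : sets (intensity \<gamma>)" and g: "!!x r r'. (x, r) : D ==> (x, r') : D ==> r = r'"
 shows "emeasure (intensity \<gamma>) D = 0"
proof -
 interpret R: sigma_finite_measure "rad \<gamma>" by (rule sigma_finite_rad)
 have D': "D : sets (Hmeas \<Otimes>\<^sub>M rad \<gamma>)" using D by (simp only: intensity_rad)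
 have "emeasure (rad \<gamma>) (Pair x -` D) = 0" for x
 proof -
 have s: "Pair x -` D : sets (rad \<gamma>)" by (rule sets_Pair1[OF D'])
 have sr: "sets (rad \<gamma>) = sets (restrict_space lborel {0<..1})" by (simp add: rad_def)
 have "Pair x -` D = {} \<or> (EX c. Pair x -` D = {c})" using g[of x] by blast
 then have n: "emeasure (restrict_space lborel {0<..1}) (Pair x -` D) = 0"
 proof
 assume "EX c. Pair x -` D = {c}"
 then obtain c where c: "Pair x -` D = {c}" by blast
 then have "{c} <= {0<..1}" using sets.sets_into_space[OF s] by (simp add: rad_def space_restrict_space)
 then show ?thesis unfolding c by (subst emeasure_restrict_space) auto
 qed simp
 have m2: "(%r. ennreal (\<gamma> * r powr (-5))) : borel_measurable (restrict_space lborel {0<..1})"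
 by (intro measurable_restrict_space1) measurable
 have "Pair x -` D : null_sets (restrict_space lborel {0<..1})" using n s by (intro null_setsI) (auto simp: sr)
 then have "AE r in restrict_space lborel {0<..1}. r \<notin> Pair x -` D" by (rule AE_not_in)
 then have "(\<integral>\<^sup>+r. ennreal (\<gamma> * r powr (-5)) * indicator (Pair x -` D) r \<partial>restrict_space lborel {0<..1}) = (\<integral>\<^sup>+r. 0 \<partial>restrict_space lborel {0<..1::real})"
 by (intro nn_integral_cong_AE) (auto elim!: eventually_mono)
 then show ?thesis unfolding rad_def using s by (subst emeasure_density[OF m2]) (auto simp: sr)
 qed
 then show ?thesis unfolding intensity_rad R.emeasure_pair_measure_alt[OF D'] by simp
qed

text \<open>If the integrals of f fail to form a measure, \<open>density\<close> falls back to the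
  zero measure, and the inequality holds in either case. It is used for \<open>mu_n\<close>.\<close>

lemma emeasure_density_le: "emeasure (density M f) A <= (NN M (%x. f x * indicator A x))"
 unfolding density_def emeasure_measure_of_conv by simp

section \<open>Dimensions of the projections and of the projected measures\<close>

lemma frostman_mono: assumes F: "frostman m t" and s: "s <= t" shows "frostman m s"
 unfolding frostman_def
proof (intro allI impI)
 fix c :: real assume c: "0 < c" "c < 1"
 obtain C r0 where C: "C >= 0" "r0 > 0" "tube_bound m c t C r0" by (rule frostmanE[OF F c])
 show "EX C>=0. EX r0>0. ALL b a r. (b, a) : pens c --> 0 < r --> r <= r0 --> emeasure m (tube b a r) <= ennreal (C * r powr s)"
 proof (rule exI[of _ C], intro conjI exI[of _ "min r0 1"] allI impI)
 fix b a r assume b: "(b, a) : pens c" and r: "0 < r" "r <= min r0 1"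
 have "r powr t <= r powr s" using r s by (intro powr_mono') auto
 then have "ennreal (C * r powr t) <= ennreal (C * r powr s)" using C by (intro ennreal_leI mult_left_mono)
 moreover have "emeasure m (tube b a r) <= ennreal (C * r powr t)" using C(3) b r by (simp only: simp_thms min.bounded_iff)
 ultimately show "emeasure m (tube b a r) <= ennreal (C * r powr s)" by (rule order_trans[rotated])
 qed (use C in auto)
qed

lemma haus_singleton_zero: assumes s: "s > 0" shows "haus_outer dP s {pp x x} = 0"
proof (rule haus_zeroI[OF s])
 fix e :: real assume "e > 0"
 have "dP (pp x x) (pp x x) = 0"
 proof (cases "(hin x x, x) = 0")
 case True then show ?thesis unfolding pp_def dP_pclass dE_def enorm_alt True by simp
 next
 case False
 have "dE (hin x x, x) (hin x x, x) * norm (hin x x, x) <= 0" using dE_le[OF False False, of 1] by (simp add: csmult_1)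
 then have "dE (hin x x, x) (hin x x, x) <= 0" using False by (simp add: mult_le_0_iff)
 then show ?thesis using dP_nonneg[of "pp x x" "pp x x"] by (simp add: pp_def dP_pclass)
 qed
 then have h: "hdiam dP {pp x x} = 0" by (simp add: hdiam_def)
 show "EX U :: nat => cvec set set. {pp x x} <= (\<Union>i. U i) & (ALL i. hdiam dP (U i) < \<top>) &
 (\<Sum>i. ennreal (enn2real (hdiam dP (U i)) powr s)) <= ennreal e"
 by (intro exI[of _ "%_. {pp x x}"]) (simp add: h)
qed

lemma singleton_perp_sets: assumes x: "x : S3" shows "{pp x x} : sets (perp_space x)"
proof -
 have x0: "x ~= 0" using x by (auto simp: in_S3)
 have "q = pp x x" if q: "q : perpP (lift x)" "dP (pp x x) q <= 0" for q
 proof -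
 obtain b where b: "b ~= 0" "q = pp x b" using q(1) by (auto simp: perpP_iff)
 have uv: "(hin x x, x) ~= 0" "(hin b x, b) ~= 0" using x0 b(1) by (auto simp: zero_prod_def)
 have "dE (hin x x, x) (hin b x, b) = 0" using q(2) dP_nonneg[of "pp x x" q] unfolding b(2) pp_def dP_pclass by simp
 then obtain c where c: "(hin x x, x) - csmult c (hin b x, b) = 0" using dE_attained[OF uv] by auto
 then have e: "(hin x x, x) = csmult c (hin b x, b)" by simp
 have "c ~= 0"
 proof
 assume "c = 0"
 moreover have "x = csc c b" using e by (simp add: csmult_alt)
 ultimately show False using x0 by (simp add: csc_def zero_prod_def)
 qed
 then show ?thesis unfolding b(2) pp_def e by (simp add: pclass_csmult)
 qed
 moreover have "dP (pp x x) (pp x x) <= 0"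
 proof -
 have u: "(hin x x, x) ~= 0" using x0 by (auto simp: zero_prod_def)
 have "dE (hin x x, x) (hin x x, x) * norm (hin x x, x) <= 0" using dE_le[OF u u, of 1] by (simp add: csmult_1)
 then show ?thesis using u by (simp add: pp_def dP_pclass mult_le_0_iff)
 qed
 ultimately have "{pp x x} = {q : perpP (lift x). dP (pp x x) q <= 0}" using pp_perpP[OF x0, of x] by auto
 then show ?thesis using cball_perp[OF pp_perpP[OF x0, of x], of 0] by simp
qed

definition projections :: "(c2 \<times> real) set => c2 measure => bool" where
 "projections \<Phi> m \<longleftrightarrow>
 (ALL x:S3. hdim dP (proj_img x (cutout \<Phi>)) = min 2 (hdim dvis (cutout \<Phi>)) &
 mdim dP (proj_meas x m) = min 2 (hdim dvis (cutout \<Phi>)) &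
 (hdim dvis (cutout \<Phi>) > 2 -->
 (ALL A:sets (proj_meas x m). haus_outer dP 2 A = 0 --> emeasure (proj_meas x m) A = 0) &
 img_interior x (cutout \<Phi>)))"

context cutout_process
begin

lemma frostman_below_2_all:
 "AE w in P. ALL m t. dominated w m --> 0 < t --> t < min 2 (4 - g) --> frostman m t"
proof -
 have "AE w in P. 0 < real_of_rat q --> real_of_rat q < min 2 (4 - g) --> (ALL m. dominated w m --> frostman m (real_of_rat q))" for q
 proof (cases "0 < real_of_rat q & real_of_rat q < min 2 (4 - g)")
 case True
 then show ?thesis using frostman_below_2[of "real_of_rat q"] by simp
 qed (auto intro!: AE_I2)
 then have "AE w in P. ALL q. 0 < real_of_rat q --> real_of_rat q < min 2 (4 - g) --> (ALL m. dominated w m --> frostman m (real_of_rat q))"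
 unfolding AE_all_countable by blast
 then show ?thesis
 proof eventually_elim
 case (elim w)
 show ?case
 proof (intro allI impI)
 fix m t assume d: "dominated w m" and t: "0 < t" "t < min 2 (4 - g)"
 obtain q where q: "t < real_of_rat q" "real_of_rat q < min 2 (4 - g)" using of_rat_dense[OF t(2)] by blast
 have "0 < real_of_rat q" using q t by linarith
 then have "frostman m (real_of_rat q)" using elim q(2) d by blast
 then show "frostman m t" by (rule frostman_mono) (use q in simp)
 qed
 qed
qed

text \<open>Upper bounds come from the Lipschitz property and from the dimension of the line. Lower
  bounds come from \<open>frostman_proj_null\<close>: for g < 4 a set of positive projected measure
  has dimension at least min 2 (4 - g), and by the covering bound the right-hand sides are not
  larger. For g \<ge> 4 the cut-out set has dimension 0 and the lower bound is trivial.\<close>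

lemma proj_dimension:
 assumes w: "u : space P" and d: "dominated u m" and pos: "emeasure m S3 ~= 0" and x: "x : S3"
 and F: "!!t. 0 < t ==> t < min 2 (4 - g) ==> frostman m t"
 and h: "hdim dvis (cutout (\<Phi> u)) <= ereal (max 0 (4 - g))"
 shows "hdim dP (proj_img x (cutout (\<Phi> u))) = min 2 (hdim dvis (cutout (\<Phi> u)))"
 "mdim dP (proj_meas x m) = min 2 (hdim dvis (cutout (\<Phi> u)))"
proof -
 define E where "E = cutout (\<Phi> u)"
 let ?n = "proj_meas x m"
 have ES: "E <= S3" "closed E" unfolding E_def by (auto simp: cutout_def) (rule cutout_closed[unfolded cutout_def])
 have sm: "sets m = sets S3b" "space m = S3" using dominatedD[OF d] by auto
 have Es: "E : sets m" using cutout_S3b sm by (simp add: E_def)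
 have S3s: "S3 : sets m" using sm(2) sets.top[of m] by simp
 have muE: "emeasure m E ~= 0"
 proof
 assume "emeasure m E = 0"
 then have "E : null_sets m" using Es by (intro null_setsI)
 moreover have "S3 - E : null_sets m" using dominated_support[OF d w] Es S3s by (intro null_setsI) (auto simp: E_def)
 ultimately have "E Un (S3 - E) : null_sets m" by (rule null_sets.Un)
 moreover have "E Un (S3 - E) = S3" using ES by blast
 ultimately show False using pos by (auto dest: null_setsD1)
 qed
 have pxx: "proj x x = pp x x" using x by (simp add: proj_def pp_def lift_alt hin_self in_S3)
 have x0: "x ~= 0" using x by (auto simp: in_S3)
 \<comment> \<open>\<open>proj x x\<close> equals \<open>pp x x\<close>; with this point added the
   preimage of A contains the whole cut-out set, also when x belongs to it.\<close>
 define A where "A = proj_img x E Un {pp x x}"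
 have PI: "proj_img x E : sets ?n" unfolding proj_meas_sets by (rule proj_img_sets[OF x ES(2,1)])
 have As: "A : sets ?n" unfolding A_def proj_meas_sets by (rule sets.Un[OF PI[unfolded proj_meas_sets] singleton_perp_sets[OF x]])
 have PIP: "proj_img x E <= perpP (lift x)" using proj_perpP[OF x] by (auto simp: proj_img_def)
 have AP: "A <= perpP (lift x)" using PIP pp_perpP[OF x0, of x] by (auto simp: A_def)
 have le: "hdim dP (proj_img x E) <= hdim dvis E" by (rule hdim_le_hdimI) (rule haus_proj_img_zero[OF x _ ES(1)])
 have leA: "hdim dP A <= hdim dvis E"
 proof (rule hdim_le_hdimI)
 fix s :: real assume s: "s > 0" "haus_outer dvis s E = 0"
 have e: "A = (\<Union>k::nat. if k = 0 then {pp x x} else proj_img x E)" by (auto simp: A_def split: if_splits)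
 show "haus_outer dP s A = 0" unfolding e
 by (rule haus_zero_UN[OF s(1)]) (use haus_singleton_zero[OF s(1)] haus_proj_img_zero[OF x s(1) ES(1) s(2)] in auto)
 qed
 have up1: "hdim dP (proj_img x E) <= min 2 (hdim dvis E)" using le hdim_perp_le[OF x PIP] by simp
 have upA: "hdim dP A <= min 2 (hdim dvis E)" using leA hdim_perp_le[OF x AP] by simp
 have nuA: "emeasure ?n A > 0"
 proof -
 have e: "emeasure ?n A = emeasure m {y : S3. proj x y : A}" using As by (intro emeasure_proj_meas[OF sm(1) x]) (simp add: proj_meas_sets)
 have "proj x y : A" if "y : E" for y using that pxx by (cases "y = x") (auto simp: A_def proj_img_def)
 then have "E <= {y : S3. proj x y : A}" using ES by blast
 moreover have "{y : S3. proj x y : A} : sets m"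
 using measurable_sets[OF proj_measurable[OF x], of A] As sm(1)
 by (simp add: proj_meas_sets space_S3b vimage_def Int_def conj_commute)
 ultimately have "emeasure m E <= emeasure ?n A" unfolding e by (intro emeasure_mono)
 then show ?thesis using muE by (metis bot.not_eq_extremum bot_ennreal le_zero_eq)
 qed
 have upm: "mdim dP ?n <= min 2 (hdim dvis E)"
 proof -
 have "mdim dP ?n <= hdim dP A" unfolding mdim_def using As nuA by (intro Inf_lower) blast
 then show ?thesis using upA by (rule order_trans)
 qed
 have low: "min 2 (hdim dvis E) <= hdim dP B" if B: "B : sets ?n" "emeasure ?n B > 0" for B
 proof (cases "g < 4")
 case False
 then have "hdim dvis E <= 0" using h by (simp add: E_def zero_ereal_def)
 then have "min 2 (hdim dvis E) <= 0" by (rule min.coboundedI2)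
 then show ?thesis using hdim_nonneg by (rule order_trans)
 next
 case True
 have "ereal (min 2 (4 - g)) <= hdim dP B"
 proof (rule hdim_ge)
 fix s assume s: "0 < s" "s < min 2 (4 - g)"
 show "haus_outer dP s B ~= 0"
 proof
 assume H: "haus_outer dP s B = 0"
 have "emeasure ?n B = 0" using frostman_proj_null[OF sm(1) s(1) F[OF s] x _ H] B(1) by (simp add: proj_meas_sets)
 then show False using B(2) by simp
 qed
 qed
 moreover have "min 2 (hdim dvis E) <= ereal (min 2 (4 - g))"
 proof -
 have "hdim dvis E <= ereal (4 - g)" using h True by (simp add: E_def max_def)
 then have "min 2 (hdim dvis E) <= min 2 (ereal (4 - g))" by (intro min.mono) auto
 also have "... = ereal (min 2 (4 - g))" by (simp add: min_def)
 finally show ?thesis .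
 qed
 ultimately show ?thesis by (rule order_trans[rotated])
 qed
 have lowm: "min 2 (hdim dvis E) <= mdim dP ?n"
 unfolding mdim_def by (rule Inf_greatest) (use low in blast)
 have low1: "min 2 (hdim dvis E) <= hdim dP (proj_img x E)"
 proof (cases "g < 4")
 case False
 then have "hdim dvis E <= 0" using h by (simp add: E_def zero_ereal_def)
 then have "min 2 (hdim dvis E) <= 0" by (rule min.coboundedI2)
 then show ?thesis using hdim_nonneg by (rule order_trans)
 next
 case True
 define t where "t = min 2 (4 - g) / 2"
 have t: "0 < t" "t < min 2 (4 - g)" using True by (auto simp: t_def min_def)
 have xz: "emeasure m {x} = 0" by (rule frostman_point[OF sm(1) t(1) F[OF t] x])
 \<comment> \<open>Without \<open>pp x x\<close> at most the point x is lost from the preimage of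
   the image, and it is null.\<close>
 have "emeasure ?n (proj_img x E) > 0"
 proof (rule ccontr)
 assume "\<not> ?thesis"
 then have z: "emeasure ?n (proj_img x E) = 0" by simp
 have e: "emeasure ?n (proj_img x E) = emeasure m {y : S3. proj x y : proj_img x E}"
 using PI by (intro emeasure_proj_meas[OF sm(1) x]) (simp add: proj_meas_sets)
 have s: "{y : S3. proj x y : proj_img x E} : sets m"
 using measurable_sets[OF proj_measurable[OF x], of "proj_img x E"] PI sm(1)
 by (simp add: proj_meas_sets space_S3b vimage_def Int_def conj_commute)
 have "{y : S3. proj x y : proj_img x E} : null_sets m" using z e s by (intro null_setsI) auto
 moreover have "{x} : null_sets m" using xz x by (intro null_setsI) (auto simp: sm intro!: borel_sub_S3b)
 ultimately have nu: "{y : S3. proj x y : proj_img x E} Un {x} : null_sets m" by (rule null_sets.Un)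
 have "E <= {y : S3. proj x y : proj_img x E} Un {x}" using ES(1) by (auto simp: proj_img_def)
 then have "emeasure m E <= emeasure m ({y : S3. proj x y : proj_img x E} Un {x})"
 using nu by (intro emeasure_mono null_setsD2)
 then show False using muE null_setsD1[OF nu] by simp
 qed
 then show ?thesis by (rule low[OF PI])
 qed
 show "hdim dP (proj_img x (cutout (\<Phi> u))) = min 2 (hdim dvis (cutout (\<Phi> u)))"
 using up1 low1 unfolding E_def by (rule antisym)
 show "mdim dP (proj_meas x m) = min 2 (hdim dvis (cutout (\<Phi> u)))"
 using upm lowm unfolding E_def by (rule antisym)
qed

theorem cutout_projections:
 "AE u in P. ALL m. dominated u m --> emeasure m S3 ~= 0 -->
 projections (\<Phi> u) m"
proof -
 have 1: "AE u in P. g < 2 --> (ALL m. dominated u m --> frostman m 2)"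
 using frostman_2 by (cases "g < 2") auto
 have 2: "AE u in P. g < 2 --> (ALL m x. dominated u m --> emeasure m S3 ~= 0 --> x : S3 -->
 img_interior x (cutout (\<Phi> u)))"
 proof (cases "g < 2")
 case True then show ?thesis using proj_img_interior_AE[OF True] by simp
 qed (auto intro!: AE_I2)
 show ?thesis using AE_space frostman_below_2_all hdim_cutout_le 1 2
 proof eventually_elim
 fix u assume w: "u : space P" and F: "ALL m t. dominated u m --> 0 < t --> t < min 2 (4 - g) --> frostman m t"
 and h: "hdim dvis (cutout (\<Phi> u)) <= ereal (max 0 (4 - g))"
 and F2: "g < 2 --> (ALL m. dominated u m --> frostman m 2)"
 and I: "g < 2 --> (ALL m x. dominated u m --> emeasure m S3 ~= 0 --> x : S3 -->
 img_interior x (cutout (\<Phi> u)))"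
 show "ALL m. dominated u m --> emeasure m S3 ~= 0 -->
 projections (\<Phi> u) m"
 unfolding projections_def
 proof (intro allI impI ballI)
 fix m x assume d: "dominated u m" and pos: "emeasure m S3 ~= 0" and x: "x : S3"
 have F': "frostman m t" if "0 < t" "t < min 2 (4 - g)" for t using F d that by blast
 have dim: "hdim dP (proj_img x (cutout (\<Phi> u))) = min 2 (hdim dvis (cutout (\<Phi> u)))"
 "mdim dP (proj_meas x m) = min 2 (hdim dvis (cutout (\<Phi> u)))"
 by (rule proj_dimension[OF w d pos x _ h]; rule F'; assumption)+
 have ac: "(ALL A:sets (proj_meas x m). haus_outer dP 2 A = 0 --> emeasure (proj_meas x m) A = 0) &
 img_interior x (cutout (\<Phi> u))"
 if h2: "hdim dvis (cutout (\<Phi> u)) > 2"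
 proof -
 \<comment> \<open>A dimension above 2 forces g < 2, the range in which the bound without loss is
   available.\<close>
 have "ereal 2 < ereal (max 0 (4 - g))" using less_le_trans[OF h2 h] by simp
 then have g2: "g < 2" by (simp add: max_def split: if_splits)
 have "frostman m 2" using F2 g2 d by blast
 then have "emeasure (proj_meas x m) A = 0" if "A : sets (proj_meas x m)" "haus_outer dP 2 A = 0" for A
 using frostman_proj_null[OF dominatedD(1)[OF d] _ _ x _ that(2)] that(1) by (simp add: proj_meas_sets)
 moreover have "img_interior x (cutout (\<Phi> u))"
 using mp[OF I g2] d pos x by (elim allE[of _ m] allE[of _ x] impE)
 ultimately show ?thesis by blast
 qed
 show "hdim dP (proj_img x (cutout (\<Phi> u))) = min 2 (hdim dvis (cutout (\<Phi> u))) &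
 mdim dP (proj_meas x m) = min 2 (hdim dvis (cutout (\<Phi> u))) &
 (hdim dvis (cutout (\<Phi> u)) > 2 -->
 (ALL A:sets (proj_meas x m). haus_outer dP 2 A = 0 --> emeasure (proj_meas x m) A = 0) &
 img_interior x (cutout (\<Phi> u)))"
 by (rule conjI[OF dim(1) conjI[OF dim(2)]], rule impI, rule ac, assumption)
 qed
 qed
qed

end

section \<open>From the Poisson process to void probabilities\<close>

lemma (in prob_space) poisson_tail:
 assumes c: "c : measurable M (count_space UNIV)" and l: "l >= 0" and m: "m > 0"
 and P: "!!k::nat. prob {w : space M. c w = k} = l ^ k / fact k * exp (- l)"
 shows "prob {w : space M. m <= c w} <= l / real m"
proof -
 define Q where "Q k = {w : space M. c w = k}" for k :: nat
 have Qs: "Q k : events" for k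
 using measurable_sets[OF c, of "{k}"] by (simp add: Q_def vimage_def Int_def conj_commute)
 have S: "(%j. prob (Q (j + i))) sums prob {w : space M. i <= c w}" for i
 proof -
 have "(%j. prob (Q (j + i))) sums prob (\<Union>j. Q (j + i))"
 by (rule finite_measure_UNION) (use Qs in \<open>auto simp: disjoint_family_on_def Q_def\<close>)
 moreover have "(\<Union>j. Q (j + i)) = {w : space M. i <= c w}"
 by (auto simp: Q_def) (metis le_add_diff_inverse2)
 ultimately show ?thesis by simp
 qed
 obtain m' where m': "m = Suc m'" using m by (cases m) auto
 have "prob {w : space M. m <= c w} <= l / real m * prob {w : space M. m' <= c w}"
 \<comment> \<open>Termwise, P(c = j + m) is at most l / m times P(c = j + m - 1) by the explicit
   weights; summing over j compares the two tails.\<close>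
 proof (rule sums_le[OF _ S sums_mult[OF S]])
 fix j
 have "prob (Q (j + m)) = l / real (Suc (j + m')) * prob (Q (j + m'))"
 unfolding Q_def P m' by (simp add: field_simps)
 also have "... <= l / real m * prob (Q (j + m'))"
 using l by (intro mult_right_mono divide_left_mono) (auto simp: m')
 finally show "prob (Q (j + m)) <= l / real m * prob (Q (j + m'))" .
 qed
 also have "... <= l / real m * 1" using l by (intro mult_left_mono) auto
 finally show ?thesis by simp
qed

text \<open>The locale asks at every sample point for properties that the Poisson process has almost
  surely, so the process is emptied on a null set. Void events and their probabilities are then read
  off from the counts.\<close>

lemma cutout_process_of_poisson:
 assumes \<gamma>: "\<gamma> > 0" and kap: "kap > 0" and pp: "poisson_process P (intensity \<gamma>) \<Phi>"
 shows "EX N:null_sets P. cutout_process P (%u. if u : N then {} else \<Phi> u) \<gamma>"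
proof -
 interpret prob_space P using pp by (simp add: poisson_process_def)
 have sp: "\<Phi> u <= S3 \<times> {0<..1}" if "u : space P" for u
 using pp that unfolding poisson_process_def space_intensity by blast
 have cm: "(%u. card (\<Phi> u Int B)) : measurable P (count_space UNIV)" (is ?cm)
 and cf: "AE u in P. finite (\<Phi> u Int B)" (is ?cf)
 and cp: "prob {u : space P. card (\<Phi> u Int B) = k} = measure (intensity \<gamma>) B ^ k / fact k * exp (- measure (intensity \<gamma>) B)" (is "?cp k")
 if B: "B : sets (intensity \<gamma>)" "emeasure (intensity \<gamma>) B < \<infinity>" for B k
 proof -
 have "?cf & ?cm & (ALL k. ?cp k)"
 using pp B unfolding poisson_process_def by (elim conjE ballE[of _ _ B]) (simp_all only: simp_thms)
 then show ?cm ?cf "?cp k" by blast+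
 qed
 have ev: "{u : space P. R (card (\<Phi> u Int B))} : events" if "B : sets (intensity \<gamma>)" "emeasure (intensity \<gamma>) B < \<infinity>" for B R
 using measurable_sets[OF cm[OF that], of "{k. R k}"] by (simp add: vimage_def Int_def conj_commute)
 interpret H: finite_measure Hmeas by (rule finite_measure_Hmeas)
 define CH where "CH = \<gamma> * measure Hmeas S3"
 have CH: "CH >= 0" using \<gamma> by (simp add: CH_def)
 have le: "emeasure (intensity \<gamma>) B <= ennreal (CH * a powr (-5))" if "B : sets (intensity \<gamma>)" "a > 0" "ALL p:B. a <= snd p" for B a
 proof -
 have "ennreal (\<gamma> * a powr (-5)) * emeasure Hmeas S3 = ennreal (CH * a powr (-5))"
 using \<gamma> by (simp add: CH_def H.emeasure_eq_measure ennreal_mult'[symmetric] mult_ac)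
 then show ?thesis using emeasure_intensity_le[OF that] \<gamma> by simp
 qed
 then have fin: "emeasure (intensity \<gamma>) B < \<infinity>" if "B : sets (intensity \<gamma>)" "a > 0" "ALL p:B. a <= snd p" for B a
 using le_less_trans[OF le[OF that] ennreal_less_top] by simp
 define Bn where "Bn n = S3 \<times> {(1/2) ^ n..1::real}" for n :: nat
 have Bns: "Bn n : sets (intensity \<gamma>)" for n
 proof (rule borel_sub_intensity)
 show "Bn n : sets borel" unfolding Bn_def by (intro borel_closed closed_Times S3_closed) simp
 have "(0::real) < (1/2) ^ n" by simp
 then have "{(1/2) ^ n..1::real} <= {0<..1}" by (auto simp only: atLeastAtMost_iff greaterThanAtMost_iff intro: less_le_trans)
 then show "Bn n <= S3 \<times> {0<..1}" unfolding Bn_def by blast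
 qed
 have Bnf: "emeasure (intensity \<gamma>) (Bn n) < \<infinity>" for n by (rule fin[OF Bns, of "(1/2) ^ n"]) (auto simp: Bn_def)
 \<comment> \<open>Points of radius exactly 1 are removed, because the sets
   \<open>conR a 1 y\<close> contain only radii below 1.\<close>
 define D1 where "D1 = S3 \<times> {1::real}"
 have D1s: "D1 : sets (intensity \<gamma>)"
 by (rule borel_sub_intensity) (auto simp: D1_def intro!: borel_closed closed_Times S3_closed)
 have D10: "emeasure (intensity \<gamma>) D1 = 0" by (rule intensity_graph_null[OF D1s]) (auto simp: D1_def)
 have D1f: "emeasure (intensity \<gamma>) D1 < \<infinity>" by (simp add: D10)
 have "prob {u : space P. card (\<Phi> u Int D1) = 0} = 1" using cp[OF D1s D1f, of 0] by (simp add: measure_def D10)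
 then have "AE u in P. card (\<Phi> u Int D1) = 0" using ev[OF D1s D1f, of "%k. k = 0"] by (simp add: prob_Collect_eq_1)
 then have "AE u in P. \<Phi> u Int D1 = {} & (ALL n. finite (\<Phi> u Int Bn n))"
 using cf[OF D1s D1f] AE_all_countable[THEN iffD2, OF allI, OF cf[OF Bns Bnf]] by eventually_elim simp
 then obtain N where N: "{u : space P. \<not> (\<Phi> u Int D1 = {} & (ALL n. finite (\<Phi> u Int Bn n)))} <= N" "N : null_sets P"
 by (rule AE_E) (auto intro: null_setsI)
 have good: "\<Phi> u Int D1 = {}" "finite (\<Phi> u Int Bn n)" if "u : space P" "u \<notin> N" for u n using N(1) that by blast+
 have Ns: "N : events" "N <= space P" using N(2) sets.sets_into_space by auto
 let ?\<Phi> = "%u. if u : N then {} else \<Phi> u"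
 have bd: "finite (\<Phi> u Int B)" if w: "u : space P" "u \<notin> N" and B: "a > 0" "ALL p:B. a <= snd p" for u B and a :: real
 proof -
 obtain n where n: "(1/2) ^ n < a" using real_arch_pow_inv[OF B(1), of "1/2"] by auto
 have "\<Phi> u Int B <= \<Phi> u Int Bn n"
 proof
 fix p assume p: "p : \<Phi> u Int B"
 then have "fst p : S3" "snd p <= 1" using sp[OF w(1)] by auto
 moreover have "(1/2) ^ n <= snd p" using p B(2) n by (meson IntD2 less_le_trans less_imp_le)
 ultimately show "p : \<Phi> u Int Bn n" using p by (auto simp: Bn_def mem_Times_iff)
 qed
 then show ?thesis using good(2)[OF w] finite_subset by blast
 qed
 \<comment> \<open>\<open>card\<close> is 0 for infinite sets too, so a vanishing count means
   emptiness only off N, where finiteness is known.\<close>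
 have void: "{u : space P. ?\<Phi> u Int B = {}} = ({u : space P. card (\<Phi> u Int B) = 0} - N) Un N"
 if B: "a > 0" "ALL p:B. a <= snd p" for B and a :: real
 using bd[OF _ _ B] Ns(2) by (auto simp: card_eq_0_iff)
 have "cutout_process P ?\<Phi> \<gamma>"
 proof (intro cutout_process.intro cutout_process_axioms.intro)
 show "prob_space P" by unfold_locales
 show "\<gamma> > 0" "kap > 0" by (fact \<gamma>, fact kap)
 show "?\<Phi> u <= S3 \<times> {0<..<1}" if w: "u : space P" for u
 proof (cases "u : N")
 case False
 show ?thesis
 proof
 fix p assume p: "p : ?\<Phi> u"
 then have "p : \<Phi> u" using False by simp
 then have "p : S3 \<times> {0<..1}" "p \<notin> D1" using sp[OF w] good(1)[OF w False] by blast+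
 then show "p : S3 \<times> {0<..<1}" by (auto simp: D1_def)
 qed
 qed simp
 show "finite {p : ?\<Phi> u. a <= snd p}" if w: "u : space P" and a: "a > 0" for u a
 proof (cases "u : N")
 case False
 have "{p : \<Phi> u. a <= snd p} = \<Phi> u Int {p. a <= snd p}" by blast
 then show ?thesis using bd[OF w False a, of "{p. a <= snd p}"] False by simp
 qed simp
 fix B and a :: real assume B: "B : sets (intensity \<gamma>)" "a > 0" "ALL p:B. a <= snd p"
 have f: "emeasure (intensity \<gamma>) B < \<infinity>" by (rule fin[OF B])
 have e: "{u : space P. card (\<Phi> u Int B) = 0} : events" by (rule ev[OF B(1) f])
 show "{u : space P. ?\<Phi> u Int B = {}} : events" unfolding void[OF B(2,3)] using e Ns by auto
 show "prob {u : space P. ?\<Phi> u Int B = {}} = exp (- measure (intensity \<gamma>) B)"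
 unfolding void[OF B(2,3)] using e Ns N(2) cp[OF B(1) f, of 0]
 by (subst measure_Un_null_set) (auto simp: measure_Diff_null_set)
 next
 \<comment> \<open>The intensity of the radii above 2^(-n) is of order at most 2^(5 n); the
   threshold 2^(6 n) leaves a summable tail.\<close>
 define A where "A n = {u : space P. 2 ^ (6 * n) <= card (\<Phi> u Int Bn n)}" for n
 have As: "A n : events" for n unfolding A_def by (rule ev[OF Bns Bnf])
 have Ap: "prob (A n) <= CH * (1/2) ^ n" for n
 proof -
 have "prob (A n) <= measure (intensity \<gamma>) (Bn n) / real (2 ^ (6 * n))"
 unfolding A_def by (rule poisson_tail[OF cm[OF Bns Bnf] _ _ cp[OF Bns Bnf]]) auto
 also have "measure (intensity \<gamma>) (Bn n) <= CH * ((1/2) ^ n) powr (-5)"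
 unfolding measure_def using CH by (intro enn2real_leI le[OF Bns]) (auto simp: Bn_def)
 also have "((1/2::real) ^ n) powr (-5) = 2 ^ (5 * n)"
 proof -
 have "((1/2::real) ^ n) powr (-5) = inverse (((1/2) ^ n) ^ 5)"
 by (simp add: powr_minus flip: powr_numeral)
 then show ?thesis by (simp add: power_one_over power_mult[symmetric] mult.commute inverse_eq_divide)
 qed
 also have "CH * 2 ^ (5 * n) / real (2 ^ (6 * n)) = CH * (1/2) ^ n"
 proof -
 have "(2::real) ^ (6 * n) = 2 ^ (5 * n) * 2 ^ n" by (simp add: power_add[symmetric])
 then show ?thesis by (simp add: power_one_over)
 qed
 finally show ?thesis by (simp add: divide_right_mono)
 qed
 have "summable (%n. prob (A n))"
 by (rule summable_comparison_test'[of "%n. CH * (1/2) ^ n" 0]) (auto simp: Ap intro!: summable_mult summable_geometric)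
 then have "AE u in P. \<forall>\<^sub>F n in sequentially. u : space P - A n"
 by (intro borel_cantelli_AE1 As) (auto simp: emeasure_eq_measure)
 with AE_space show "AE u in P. \<forall>\<^sub>F n in sequentially. card {p : ?\<Phi> u. (1 / 2) ^ n <= snd p} <= 2 ^ (6 * n)"
 proof eventually_elim
 fix u assume w: "u : space P" and h: "\<forall>\<^sub>F n in sequentially. u : space P - A n"
 show "\<forall>\<^sub>F n in sequentially. card {p : ?\<Phi> u. (1 / 2) ^ n <= snd p} <= 2 ^ (6 * n)"
 using h
 proof eventually_elim
 fix n assume n: "u : space P - A n"
 show "card {p : ?\<Phi> u. (1 / 2) ^ n <= snd p} <= 2 ^ (6 * n)"
 proof (cases "u : N")
 case False
 have "{p : \<Phi> u. (1 / 2) ^ n <= snd p} = \<Phi> u Int Bn n" using sp[OF w] by (auto simp: Bn_def)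
 then show ?thesis using n False by (auto simp: A_def not_le)
 qed simp
 qed
 qed
 qed
 then show ?thesis using N(2) by blast
qed

section \<open>Domination of the given limit measure and conclusion\<close>

locale cutout_version = cutout_process P \<Phi> \<gamma> for P :: "'w measure" and \<Phi> \<gamma> +
 fixes \<Psi> :: "'w => (c2 \<times> real) set" and N :: "'w set"
 assumes N_null: "N : null_sets P" and version: "!!\<omega>. \<omega> : space P ==> \<omega> \<notin> N ==> \<Psi> \<omega> = \<Phi> \<omega>"
begin

text \<open>If the event on the left were not measurable, its measure would be 0 and so would be \<open>beta_n\<close>.\<close>
lemma beta_n_le: assumes y: "y : S3" shows "beta_n P \<Psi> n y <= cc (hp n) 1"
proof -
 let ?S = "{u : space P. y : cutout_n (\<Psi> u) n}"
 \<comment> \<open>C is \<open>conR\<close> with closed conditions, matching the closed balls and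
   the full range of radii in \<open>cutout_n\<close>; D1 and D2 are the boundary cases by which the
   two may differ, both null.\<close>
 define C where "C = {p. fst p : S3 & hp n <= snd p & snd p <= 1 & dvis (fst p) y <= snd p}"
 define D1 where "D1 = {p. fst p : S3 & hp n <= snd p & snd p = 1}"
 define D2 where "D2 = {p. fst p : S3 & hp n <= snd p & snd p <= 1 & dvis (fst p) y = snd p}"
 have hp0: "0 < hp n" by (rule hp_pos)
 have cl: "closed {p :: c2 \<times> real. fst p : S3}"
 proof -
 have "{p :: c2 \<times> real. fst p : S3} = S3 \<times> UNIV" by auto
 then show ?thesis by (simp add: closed_Times S3_closed)
 qed
 have sets: "C : sets (intensity \<gamma>)" "D1 : sets (intensity \<gamma>)" "D2 : sets (intensity \<gamma>)"
 proof -
 have sub: "S <= S3 \<times> {0<..1}" if "!!p. p : S ==> fst p : S3 & hp n <= snd p & snd p <= 1" for S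
 proof
 fix p assume "p : S"
 then have h: "fst p : S3" "hp n <= snd p" "snd p <= 1" using that by blast+
 have "0 < snd p" using h(2) hp0 by linarith
 then show "p : S3 \<times> {0<..1}" using h by (simp add: mem_Times_iff)
 qed
 show "C : sets (intensity \<gamma>)" "D1 : sets (intensity \<gamma>)" "D2 : sets (intensity \<gamma>)"
 by (rule borel_sub_intensity[OF borel_closed sub];
 auto simp only: C_def D1_def D2_def mem_Collect_eq
 intro!: closed_Collect_conj cl closed_Collect_le closed_Collect_eq continuous_intros continuous_dvis)+
 qed
 have Cb: "C : bdd_sets (hp n)" using sets(1) by (simp add: bdd_sets_def C_def)
 have cs: "conR (hp n) 1 y : sets (intensity \<gamma>)" using conR_bdd[OF hp0, of 1 y] by (simp add: bdd_sets_def)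
 have "C <= conR (hp n) 1 y Un (D1 Un D2)" by (auto simp: C_def D1_def D2_def conR_def)
 then have "emeasure (intensity \<gamma>) C <= emeasure (intensity \<gamma>) (conR (hp n) 1 y Un (D1 Un D2))"
 using sets cs by (intro emeasure_mono) auto
 also have "... <= emeasure (intensity \<gamma>) (conR (hp n) 1 y) + emeasure (intensity \<gamma>) (D1 Un D2)"
 using sets cs by (intro emeasure_subadditive) auto
 also have "emeasure (intensity \<gamma>) (D1 Un D2) <= emeasure (intensity \<gamma>) D1 + emeasure (intensity \<gamma>) D2"
 using sets by (intro emeasure_subadditive) auto
 also have "emeasure (intensity \<gamma>) D1 = 0" by (rule intensity_graph_null[OF sets(2)]) (auto simp: D1_def)
 also have "emeasure (intensity \<gamma>) D2 = 0" by (rule intensity_graph_null[OF sets(3)]) (auto simp: D2_def)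
 finally have "emeasure (intensity \<gamma>) C <= ennreal (ell (hp n) 1)"
 using emeasure_conR_indep[OF hp0 order_refl y] by (simp add: add_left_mono)
 then have mC: "measure (intensity \<gamma>) C <= ell (hp n) 1"
 unfolding measure_def using ell_nonneg by (intro enn2real_leI)
 show ?thesis
 proof (cases "?S : events")
 case True
 have "prob ?S = prob (vd C)"
 proof (rule finite_measure_eq_AE[OF _ True vd_sets[OF Cb hp0]])
 show "AE u in P. u : ?S \<longleftrightarrow> u : vd C"
 using AE_space AE_not_in[OF N_null]
 proof eventually_elim
 fix u assume w: "u : space P" "u \<notin> N"
 have "y : cutout_n (\<Phi> u) n \<longleftrightarrow> \<Phi> u Int C = {}"
 using pts[OF w(1)] y unfolding cutout_n_def C_def vcball_def hp_powr by fastforce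
 then show "u : ?S \<longleftrightarrow> u : vd C" using version[OF w] w by (simp add: vd_def)
 qed
 qed
 also have "... = exp (- measure (intensity \<gamma>) C)" by (rule vd_prob[OF Cb hp0])
 finally have "exp (- ell (hp n) 1) <= prob ?S" using mC by simp
 moreover from this have "0 < prob ?S" by (rule less_le_trans[OF exp_gt_zero])
 ultimately have "1 / prob ?S <= 1 / exp (- ell (hp n) 1)" by (intro divide_left_mono) auto
 then show ?thesis by (simp add: beta_n_def cc_def exp_minus inverse_eq_divide)
 next
 case False
 then have "prob ?S = 0" by (rule measure_notin_sets)
 then show ?thesis using cc_pos[of "hp n" 1] by (simp add: beta_n_def)
 qed
qed

text \<open>A point outside the closed balls of \<open>cutout_n\<close> lies in no open ball of the
  same radii, and \<open>beta_n\<close> is at most \<open>cc (hp n) 1\<close>; so off N the density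
  of \<open>mu_n\<close> is pointwise below the normalised one.\<close>

lemma nn_integral_mu_n_le:
 assumes w: "u : space P" "u \<notin> N" and f: "f : borel_measurable S3b"
 shows "(\<integral>\<^sup>+y. f y \<partial>mu_n P \<Psi> u n) <= ennreal kap * (NN surf (%y. f y * ca n u y))"
proof -
 let ?a = "%y. ca n u y"
 have "(%y. av (hp n) 1 u y) : borel_measurable S3b"
 using measurable_Pair2[OF av_measurable[OF hp_pos] w(1), of 1 n] by simp
 then have am: "?a : borel_measurable S3b" by measurable
 then have amH: "?a : borel_measurable Hmeas" by (simp cong: measurable_cong_sets)
 have fH: "f : borel_measurable Hmeas" using f by (simp cong: measurable_cong_sets)
 have hle: "ennreal (beta_n P \<Psi> n y) * indicator (cutout_n (\<Psi> u) n) y <= ?a y" if y: "y : S3" for y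
 proof (cases "y : cutout_n (\<Phi> u) n")
 case True
 have "\<Phi> u Int conR (hp n) 1 y = {}"
 proof (rule ccontr)
 assume "\<Phi> u Int conR (hp n) 1 y ~= {}"
 then obtain p where p: "p : \<Phi> u" "p : conR (hp n) 1 y" by blast
 obtain x r where xr: "p = (x, r)" by (cases p)
 have v: "y : vcball x r" "2 powr (- real n) <= r" using p(2) y by (auto simp: xr conR_def vcball_def hp_powr)
 have "(x, r) : {(x, r) : \<Phi> u. 2 powr (- real n) <= r}" using p(1) v(2) by (simp add: xr)
 then show False using True v(1) unfolding cutout_n_def by blast
 qed
 then have "av (hp n) 1 u y = 1" by (simp add: av_def)
 then show ?thesis using beta_n_le[OF y] True version[OF w] by (simp add: ennreal_leI)
 next
 case False then show ?thesis using version[OF w] by simp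
 qed
 have "mu_n P \<Psi> u n <= density Hmeas ?a"
 proof -
 have "emeasure (mu_n P \<Psi> u n) A <= emeasure (density Hmeas ?a) A" for A
 proof (cases "A : sets Hmeas")
 case True
 have "emeasure (mu_n P \<Psi> u n) A <= (NN Hmeas (%y. (ennreal (beta_n P \<Psi> n y) * indicator (cutout_n (\<Psi> u) n) y) * indicator A y))"
 unfolding mu_n_def by (rule emeasure_density_le)
 also have "... <= (NN Hmeas (%y. ?a y * indicator A y))" by (intro nn_integral_mono mult_right_mono hle) auto
 also have "... = emeasure (density Hmeas ?a) A" by (rule emeasure_density[OF amH True, symmetric])
 finally show ?thesis .
 next
 case False then show ?thesis by (simp add: emeasure_notin_sets mu_n_def)
 qed
 then show ?thesis by (simp add: le_measure_iff le_fun_def mu_n_def)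
 qed
 then have "(\<integral>\<^sup>+y. f y \<partial>mu_n P \<Psi> u n) <= (NN (density Hmeas ?a) (%y. f y))"
 by (intro nn_integral_mono_measure) (simp_all add: mu_n_def)
 also have "... = (NN Hmeas (%y. ?a y * f y))" by (rule nn_integral_density[OF amH fH])
 also have "... = ennreal kap * (NN surf (%y. ?a y * f y))" using am f by (intro nn_integral_Hmeas borel_measurable_times_ennreal)
 finally show ?thesis by (simp add: mult.commute)
qed

text \<open>A convergent sequence of integrals that is infinitely often below a bound has its limit
  below it; this is why \<open>dominated\<close> is phrased with a frequency quantifier.\<close>

lemma dominated_weak_star:
 assumes w: "u : space P" "u \<notin> N" and sm: "sets m = sets Hmeas" and fm: "finite_measure m" and ws: "weak_star_conv (mu_n P \<Psi> u) m"
 shows "dominated u m"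
 unfolding dominated_def
proof (intro conjI allI impI)
 show s3: "sets m = sets S3b" using sm by simp
 fix f :: "c2 => real" and M :: real
 assume f: "continuous_on UNIV f" "ALL y. 0 <= f y" and M: "0 <= M"
 and fr: "\<exists>\<^sub>F n in sequentially. (NN surf (%y. ennreal (f y) * ca n u y)) <= ennreal M"
 interpret mu: finite_measure m by (rule fm)
 have sp: "space m = S3" using sets_eq_imp_space_eq[OF s3] by (simp add: space_S3b)
 have fb: "f : borel_measurable S3b" by (intro measurable_restrict_space1 borel_measurable_continuous_onI f)
 have fmu: "f : borel_measurable m" using fb s3 by (simp cong: measurable_cong_sets)
 have cS: "continuous_on S3 f" using f(1) by (rule continuous_on_subset) simp
 have tend: "(%n. \<integral>y. f y \<partial>(mu_n P \<Psi> u n)) \<longlonglongrightarrow> (\<integral>y. f y \<partial>m)" using ws cS unfolding weak_star_conv_def by blast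
 have bnd: "(\<integral>y. f y \<partial>(mu_n P \<Psi> u n)) <= kap * M"
 if n: "(NN surf (%y. ennreal (f y) * ca n u y)) <= ennreal M" for n
 proof -
 have fn: "f : borel_measurable (mu_n P \<Psi> u n)" using fb by (simp add: mu_n_def cong: measurable_cong_sets)
 have "(\<integral>\<^sup>+y. ennreal (f y) \<partial>mu_n P \<Psi> u n) <= ennreal kap * (NN surf (%y. ennreal (f y) * ca n u y))"
 by (rule nn_integral_mu_n_le[OF w]) (use fb in measurable)
 also have "... <= ennreal kap * ennreal M" using n by (intro mult_left_mono) auto
 also have "... = ennreal (kap * M)" using kap_pos by (simp add: ennreal_mult')
 finally have "(\<integral>\<^sup>+y. ennreal (f y) \<partial>mu_n P \<Psi> u n) <= ennreal (kap * M)" .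
 then show ?thesis using f(2) fn kap_pos M
 by (subst integral_eq_nn_integral) (auto intro!: enn2real_leI)
 qed
 have "(\<integral>y. f y \<partial>m) <= kap * M"
 proof (rule ccontr)
 assume "\<not> ?thesis"
 then have "\<forall>\<^sub>F n in sequentially. kap * M < (\<integral>y. f y \<partial>(mu_n P \<Psi> u n))" using order_tendstoD(1)[OF tend] by simp
 moreover have "\<exists>\<^sub>F n in sequentially. (\<integral>y. f y \<partial>(mu_n P \<Psi> u n)) <= kap * M"
 using fr by (rule frequently_elim1) (rule bnd)
 ultimately show False unfolding frequently_def by (auto simp: not_le)
 qed
 moreover have "integrable m f"
 proof -
 obtain B where "ALL y:S3. norm (f y) <= B"
 using compact_imp_bounded[OF compact_continuous_image[OF cS S3_compact]] unfolding bounded_iff by auto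
 then show ?thesis using fmu by (intro mu.integrable_const_bound[of _ B]) (auto simp: sp)
 qed
 ultimately show "(NN m (%y. ennreal (f y))) <= ennreal (kap * M)"
 using f(2) by (subst nn_integral_eq_integral) (auto intro: ennreal_leI)
qed (rule fm)

end

text \<open>A nonpositive factor becomes 0 under \<open>ennreal\<close>, so \<open>Hmeas\<close> and
  with it every \<open>mu_n\<close> vanishes; the test function 1 carries this over to the
  limit.\<close>

lemma weak_limit_null_if_kap_nonpos:
 assumes kap: "kap <= 0" and sm: "sets m = sets Hmeas" and fm: "finite_measure m" and ws: "weak_star_conv (mu_n P \<Phi> w) m"
 shows "emeasure m (space m) = 0"
proof -
 interpret finite_measure m by (rule fm)
 have H0: "emeasure Hmeas (space Hmeas) = 0" using kap by (simp add: emeasure_Hmeas ennreal_neg)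
 have n0: "emeasure (mu_n P \<Phi> w n) A = 0" for n A
 proof -
 have "space Hmeas : null_sets Hmeas" using H0 by (intro null_setsI sets.top)
 then have "AE y in Hmeas. y \<notin> space Hmeas" by (rule AE_not_in)
 with AE_space have ae: "AE y in Hmeas. False" by eventually_elim simp
 have "emeasure (mu_n P \<Phi> w n) A <= (NN Hmeas (%y. (ennreal (beta_n P \<Phi> n y) * indicator (cutout_n (\<Phi> w) n) y) * indicator A y))"
 unfolding mu_n_def by (rule emeasure_density_le)
 also have "... = (NN Hmeas (%y. 0))" by (rule nn_integral_cong_AE) (use ae in eventually_elim, simp)
 finally show ?thesis by simp
 qed
 have "continuous_on S3 (%_. 1 :: real)" by simp
 then have "(%n. \<integral>y. 1 \<partial>(mu_n P \<Phi> w n)) \<longlonglongrightarrow> (\<integral>y. (1::real) \<partial>m)" using ws unfolding weak_star_conv_def by blast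
 then have "(%n. 0) \<longlonglongrightarrow> measure m (space m)" by (simp add: measure_def n0)
 then have "measure m (space m) = 0" by (simp add: LIMSEQ_const_iff)
 then show ?thesis by (simp add: emeasure_eq_measure)
qed

theorem theorem5p13:
  fixes P :: "'w measure"
    and \<Phi> :: "'w \<Rightarrow> ((complex \<times> complex) \<times> real) set"
    and \<gamma> :: real
    and \<mu> :: "'w \<Rightarrow> (complex \<times> complex) measure"
  assumes "\<gamma> > 0"
    and "poisson_process P (intensity \<gamma>) \<Phi>"
    and "AE \<omega> in P. sets (\<mu> \<omega>) = sets Hmeas \<and> finite_measure (\<mu> \<omega>) \<and>
           weak_star_conv (mu_n P \<Phi> \<omega>) (\<mu> \<omega>)"
  shows "AE \<omega> in P. emeasure (\<mu> \<omega>) (space (\<mu> \<omega>)) \<noteq> 0 \<longrightarrow>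
          (\<forall>x\<in>S3.
             hdim dP (proj_img x (cutout (\<Phi> \<omega>))) = min 2 (hdim dvis (cutout (\<Phi> \<omega>))) \<and>
             mdim dP (proj_meas x (\<mu> \<omega>)) = min 2 (hdim dvis (cutout (\<Phi> \<omega>))) \<and>
             (hdim dvis (cutout (\<Phi> \<omega>)) > 2 \<longrightarrow>
                (\<forall>A\<in>sets (proj_meas x (\<mu> \<omega>)). haus_outer dP 2 A = 0 \<longrightarrow>
                    emeasure (proj_meas x (\<mu> \<omega>)) A = 0) \<and>
                (\<exists>p\<in>perpP (lift x). \<exists>r>0.
                    {q \<in> perpP (lift x). dP p q < r} \<subseteq> proj_img x (cutout (\<Phi> \<omega>)))))"
\<comment> \<open>\<open>Hnorm\<close> is given by a \<open>Lim\<close> and enters only through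
  \<open>kap\<close>. If \<open>kap\<close> is not positive, the reference measure is zero and the
  limit measure is almost surely zero.\<close>
proof (cases "kap > 0")
 case False
 show ?thesis using assms(3)
 proof eventually_elim
 case (elim \<omega>)
 then have "emeasure (\<mu> \<omega>) (space (\<mu> \<omega>)) = 0"
 using False by (intro weak_limit_null_if_kap_nonpos[of "\<mu> \<omega>" P \<Phi> \<omega>]) auto
 then show ?case by simp
 qed
next
 case True
 obtain N where N: "N : null_sets P" "cutout_process P (%\<omega>. if \<omega> : N then {} else \<Phi> \<omega>) \<gamma>"
 using cutout_process_of_poisson[OF assms(1) True assms(2)] by blast
 \<comment> \<open>The estimates concern the process emptied on N, while \<open>mu_n\<close> and
   \<mu> refer to the given one; the two processes agree off N.\<close>
 interpret cutout_version P "%\<omega>. if \<omega> : N then {} else \<Phi> \<omega>" \<gamma> \<Phi> N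
 by (intro cutout_version.intro N(2) cutout_version_axioms.intro N(1)) simp
 show ?thesis using AE_space AE_not_in[OF N(1)] assms(3) cutout_projections
 proof eventually_elim
 case (elim \<omega>)
 have d: "dominated \<omega> (\<mu> \<omega>)" using elim by (intro dominated_weak_star) auto
 have e: "(if \<omega> : N then {} else \<Phi> \<omega>) = \<Phi> \<omega>" using elim(2) by simp
 show ?case unfolding dominatedD(3)[OF d] projections_def[symmetric]
 by (rule mp[OF spec[OF elim(4)[unfolded e], of "\<mu> \<omega>"] d])
 qed
qed

end
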